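(* Let $E\in\{[0,1],[0,\infty),\mathbb R\}$, let $\mathcal C$ be a constraint admissible for $E$, let $V_1,\dots,V_{i_k+2}$ be generic, and for each large enough $n$ let $(m_1^{(n)},\dots,m_n^{(n)})$ have distribution $\mathbb P^{\mathcal C}_{n,E,V}$. Let $l\ge i_k$, $l\ge1$, let $a_n\to\infty$ be a sequence with $a_n=o(\sqrt n)$, and put $$\mathbf m_l^*:=\operatorname*{arg\,min}_{\mathbf m^*\in\{\mathbf m_l^{*,1},\dots,\mathbf m_l^{*,p}\}}\big\|(m_1^{(n)},\dots,m_l^{(n)})-\mathbf m^*\big\|,\qquad Z_n:=a_n\,\Sigma_l(\mathbf m_l^* )\big((m_1^{(n)},\dots,m_l^{(n)})-\mathbf m_l^*\big),$$ where $\|\cdot\|$ is the Euclidean norm and $$\Sigma_l(\mathbf m_l):=T^{\mathcal C}\bigg[\Big(\operatorname{Hess}^{\mathcal C}\sum_{j=1}^lW_j\Big)^{1/2}(\mathbf y_l^{\mathcal C})\,\Big(\frac{\partial\mathbf y_l^{\mathcal C}}{\partial\mathbf m_l^{\mathcal C}}(\mathbf m_l)\Big)^t\bigg]\in\mathbb R^{l\times l}.$$ Then $(Z_n)_n$ satisfies a large deviations principle on $\mathbb R^l$ with speed $\frac n{a_n^2}$ and good rate function $$I(\mathbf m_l):=\begin{cases}\frac12\|\mathbf m_l\|_2^2,&m_{i_1}=\dots=m_{i_k}=0,\\ \infty,&\text{else.}\end{cases}$$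
   Context: Moment spaces. $\mathcal P(E)$ is the set of Borel probability measures on $E$ with moments of all orders, $m_j(\mu):=\int x^jd\mu(x)$, $\mathcal M_n(E):=\{(m_1(\mu),\dots,m_n(\mu)):\mu\in\mathcal P(E)\}$. A constraint $\mathcal C=\{m_{i_1}=c_{i_1},\dots,m_{i_k}=c_{i_k}\}$ consists of integers $1\le i_1<\dots<i_k$ and reals $c_{i_j}$ ($k=0$ allowed, with $i_k:=0$). $\mathcal P^{\mathcal C}(E):=\{\mu\in\mathcal P(E):m_{i_j}(\mu)=c_{i_j}\ \forall j\}$, $\mathcal M_n^{\mathcal C}(E):=\{(m_1(\mu),\dots,m_n(\mu)):\mu\in\mathcal P^{\mathcal C}(E)\}$. $\mathcal C$ is admissible for $E$ if $\mathcal M_{i_k}^{\mathcal C}(E)\cap\operatorname{Int}\mathcal M_{i_k}(E)\ne\emptyset$. For $n\ge i_k$, $\operatorname{relint}\mathcal M_n^{\mathcal C}(E):=\mathcal M_n^{\mathcal C}(E)\cap\operatorname{Int}\mathcal M_n(E)$. Canonical coordinates. For $\mathbf m_n=(m_1,\dots,m_n)\in\operatorname{Int}\mathcal M_n(E)$, let $m_j^-$ and (for $E=[0,1]$) $m_j^+$ be the minimal and maximal possible $j$-th moments of measures in $\mathcal P(E)$ with first $j-1$ moments $m_1,\dots,m_{j-1}$. For $E=[0,1]$: $y_j:=p_j:=\frac{m_j-m_j^-}{m_j^+-m_j^-}$, $D_j:=(0,1)$. For $E=[0,\infty)$: $y_j:=z_j:=\frac{m_j-m_j^-}{m_{j-1}-m_{j-1}^-}$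 with $m_0:=1,m_0^-:=0$, $D_j:=(0,\infty)$. For $E=\mathbb R$: the monic orthogonal polynomials of a measure with first moments $\mathbf m_n$ satisfy $P_j(x)=(x-\alpha_j)P_{j-1}(x)-\beta_{j-1}P_{j-2}(x)$ ($P_0=1$, $P_{-1}=0$), and $y_{2j-1}:=\alpha_j$, $D_{2j-1}:=\mathbb R$, $y_{2j}:=\beta_j$, $D_{2j}:=(0,\infty)$. In each case $(y_1,\dots,y_n)\mapsto\mathbf m_n$ is a smooth bijection $D_1\times\dots\times D_n\to\operatorname{Int}\mathcal M_n(E)$. Distributions. $V_j:\overline{D_j}\to\mathbb R$, $j=1,\dots,i_k+2$, are continuous, and (integrability conditions) for some $\varepsilon>0$ and all $y$ with $|y|$ large enough: if $E=[0,\infty)$, $V_j(y)\ge(2+\varepsilon)\log|y|$ for all $j$; if $E=\mathbb R$, $V_j(y)\ge(1+\varepsilon)\log|y|$ for odd $j$ and $V_j(y)\ge(2+\varepsilon)\log|y|$ for even $j$; no condition if $E=[0,1]$. Set $V_{i_k+2j-1}:=V_{i_k+1}$, $V_{i_k+2j}:=V_{i_k+2}$ for $j\ge2$. For $n\ge i_k$, let $\mathbf m_n^{\mathcal C}:=(m_j,1\le j\le n,j\ne i_1,\dots,i_k)$; $\mathcal M_n^{\mathcal C}(E)$ is identified with its projection to these coordinates and given $(n-k)$-dimensional Lebesgue measure. $\mathbb P^{\mathcal C}_{n,E,V}$ is the probability measure on $\mathcal M_n^{\mathcal C}(E)$ giving mass $0$ to the (relative) boundary and having density $\frac1{Z^{\mathcal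 C}_{n,E,V}}\exp\big(-n\sum_{j=1}^nV_j(y_j(\mathbf m_n))\big)$ on the (relative) interior, with $Z^{\mathcal C}_{n,E,V}\in(0,\infty)$ the normalizing constant. $W_j:D_j\to\mathbb R$: $W_j(y):=V_j(y)-\log(y(1-y))$ if $E=[0,1]$; $V_j(y)-\log y$ if $E=[0,\infty)$; $V_j(y)$ if $E=\mathbb R$, $j$ odd; $V_j(y)-\log y$ if $E=\mathbb R$, $j$ even. Generic. Let $\mathbf y_n^{\mathcal C}:=(y_j,1\le j\le n,j\ne i_1,\dots,i_k)$ for $n\ge i_k$; on $\operatorname{relint}\mathcal M_n^{\mathcal C}(E)$ it determines $\mathbf m_n$, the missing $y_{i_j}$ being smooth functions of $\mathbf y^{\mathcal C}_{i_k}$ determined by $m_{i_j}=c_{i_j}$. Let $F(\mathbf y_{i_k}^{\mathcal C}):=\sum_{j=1}^{i_k}W_j(y_j)$ if $\mathbf y_{i_k}^{\mathcal C}$ comes from a point of $\operatorname{relint}\mathcal M_{i_k}^{\mathcal C}(E)$, and $F:=\infty$ otherwise. $V_1,\dots,V_{i_k+2}$ are generic if $V_j\in C^2(D_j)$, the integrability conditions hold, and: (i) $W_{i_k+1}$, $W_{i_k+2}$ have unique minimizers $y_{i_k+1}^*\in D_{i_k+1}$, $y_{i_k+2}^*\in D_{i_k+2}$; (ii) $F$ has finitely many minimizers $\mathbf y^{*,1},\dots,\mathbf y^{*,p}\in\prod_{j\le i_k,\,j\ne i_1,\dots,i_k}D_j$; (iii) $W_j''(y_j^* )\ne0$ for $j=i_k+1,i_k+2$,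 and the $(i_k-k)\times(i_k-k)$ Hessian of $F$ with respect to $\mathbf y^{\mathcal C}_{i_k}$ has nonzero determinant at each $\mathbf y^{*,q}$. Limit points. For $q=1,\dots,p$, $\mathbf m_l^{*,q}\in\operatorname{relint}\mathcal M_l^{\mathcal C}(E)$ is the moment vector whose unconstrained canonical coordinates of index $\le i_k$ are $\mathbf y^{*,q}$ (the coordinates $y_{i_j}$ then being determined by $\mathcal C$) and whose canonical coordinates $y_j$, $i_k<j\le l$, equal $y^*_{i_k+1}$ if $j-i_k$ is odd and $y^*_{i_k+2}$ if $j-i_k$ is even. Notation in $\Sigma_l$: $T^{\mathcal C}:\mathbb R^{(l-k)\times(l-k)}\to\mathbb R^{l\times l}$ inserts rows and columns of zeros at the positions $i_1,\dots,i_k$; $\operatorname{Hess}^{\mathcal C}$ is the Hessian with respect to the variables $\mathbf y_l^{\mathcal C}$ of $\sum_{j=1}^lW_j(y_j)$ (with $y_{i_1},\dots,y_{i_k}$ regarded as functions of $\mathbf y_l^{\mathcal C}$); $(\cdot)^{1/2}$ is the positive definite square root; $\mathbf y_l^{\mathcal C}=\mathbf y_l^{\mathcal C}(\mathbf m_l)$ are the unconstrained canonical coordinates of $\mathbf m_l$, regarded as a function of $\mathbf m_l^{\mathcal C}$. $\frac{\partial\mathbf y_l^{\mathcal C}}{\partial\mathbf m_l^{\mathcal C}}$ is the matrix whose $(u,v)$ entry is the derivative of the $v$-th component of $\mathbf y_l^{\mathcal C}$ with respect to the $u$-th component of $\mathbf m_l^{\mathcal C}$, so its transpose is the usual Jacobian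 matrix of $\mathbf m_l^{\mathcal C}\mapsto\mathbf y_l^{\mathcal C}$. Ties in the arg min may be broken by any fixed measurable rule. LDP. Laws $\mathbb P_n$ on a topological space satisfy a large deviations principle with speed $b_n\to\infty$ and rate function $J\ge0$ (values in $[0,\infty]$) if $J$ is lower semicontinuous and for all measurable $\Gamma$: $-\inf_{\operatorname{Int}\Gamma}J\le\liminf_n\frac1{b_n}\log\mathbb P_n(\Gamma)\le\limsup_n\frac1{b_n}\log\mathbb P_n(\Gamma)\le-\inf_{\overline\Gamma}J$; $J$ is good if its sublevel sets are compact. *)

theory Defs
  imports
    "HOL-Probability.Probability"
    "HOL-Library.Landau_Symbols"
    "Jordan_Normal_Form.Determinant"
begin

text \<open>
  Vectors \<open>(x\<^sub>j)\<^sub>j\<^sub>\<in>\<^sub>I\<close> with a finite index set \<open>I\<close> of positive integers are extensional functions in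
  \<open>\<Pi>\<^sub>E j\<in>I. \<real>\<close>, with the product topology and product sigma-algebra; \<open>\<real>\<^sup>n\<close> is the case \<open>I = {1..n}\<close>.
\<close>

definition Rn_top :: "nat \<Rightarrow> (nat \<Rightarrow> real) topology" where
  "Rn_top n = product_topology (\<lambda>_. euclideanreal) {1..n}"

definition Rn_borel :: "nat \<Rightarrow> (nat \<Rightarrow> real) measure" where
  "Rn_borel n = Pi\<^sub>M {1..n} (\<lambda>_. borel)"


section \<open>Moment spaces\<close>

datatype interval_kind = Unit_Interval | Half_Line | Real_Line

fun carrier_of :: "interval_kind \<Rightarrow> real set" where
  "carrier_of Unit_Interval = {0..1}"
| "carrier_of Half_Line = {0..}"
| "carrier_of Real_Line = UNIV"

definition prob_measures :: "interval_kind \<Rightarrow> real measure set" where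
  "prob_measures E =
     {\<mu>. sets \<mu> = sets (restrict_space borel (carrier_of E)) \<and> prob_space \<mu> \<and>
         (\<forall>j::nat. integrable \<mu> (\<lambda>x. x ^ j))}"

definition moment :: "nat \<Rightarrow> real measure \<Rightarrow> real" where
  "moment j \<mu> = (\<integral>x. x ^ j \<partial>\<mu>)"

definition moment_vector :: "nat \<Rightarrow> real measure \<Rightarrow> nat \<Rightarrow> real" where
  "moment_vector n \<mu> = (\<lambda>j\<in>{1..n}. moment j \<mu>)"

definition moment_space :: "interval_kind \<Rightarrow> nat \<Rightarrow> (nat \<Rightarrow> real) set" where
  "moment_space E n = moment_vector n ` prob_measures E"

text \<open>
  A constraint \<open>{m\<^sub>i = c\<^sub>i | i \<in> I}\<close> is the finite partial map with domain \<open>I\<close> sending \<open>i\<close> to \<open>c\<^sub>i\<close>.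
\<close>

type_synonym moment_constraint = "nat \<rightharpoonup> real"

definition is_constraint :: "moment_constraint \<Rightarrow> bool" where
  "is_constraint C \<longleftrightarrow> finite (dom C) \<and> 0 \<notin> dom C"

text \<open>The largest constrained index \<open>i\<^sub>k\<close>, and \<open>0\<close> if there is none.\<close>

definition last_index :: "moment_constraint \<Rightarrow> nat" where
  "last_index C = Max (insert 0 (dom C))"

definition prob_measures_constr :: "interval_kind \<Rightarrow> moment_constraint \<Rightarrow> real measure set" where
  "prob_measures_constr E C = {\<mu> \<in> prob_measures E. \<forall>i c. C i = Some c \<longrightarrow> moment i \<mu> = c}"

definition moment_space_constr ::
    "interval_kind \<Rightarrow> moment_constraint \<Rightarrow> nat \<Rightarrow> (nat \<Rightarrow> real) set" where
  "moment_space_constr E C n = moment_vector n ` prob_measures_constr E C"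

definition relint_moment_space ::
    "interval_kind \<Rightarrow> moment_constraint \<Rightarrow> nat \<Rightarrow> (nat \<Rightarrow> real) set" where
  "relint_moment_space E C n = moment_space_constr E C n \<inter> (Rn_top n interior_of moment_space E n)"

definition admissible :: "interval_kind \<Rightarrow> moment_constraint \<Rightarrow> bool" where
  "admissible E C \<longleftrightarrow> is_constraint C \<and>
     moment_space_constr E C (last_index C) \<inter>
       (Rn_top (last_index C) interior_of moment_space E (last_index C)) \<noteq> {}"


section \<open>Canonical coordinates\<close>

fun coord_dom :: "interval_kind \<Rightarrow> nat \<Rightarrow> real set" where
  "coord_dom Unit_Interval j = {0<..<1}"
| "coord_dom Half_Line j = {0<..}"
| "coord_dom Real_Line j = (if odd j then UNIV else {0<..})"

definition possible_moments :: "interval_kind \<Rightarrow> (nat \<Rightarrow> real) \<Rightarrow> nat \<Rightarrow> real set" where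
  "possible_moments E m j =
     {moment j \<mu> | \<mu>. \<mu> \<in> prob_measures E \<and> (\<forall>i\<in>{1..<j}. moment i \<mu> = m i)}"

text \<open>\<open>m\<^sub>j\<^sup>-\<close> (with \<open>m\<^sub>0\<^sup>- = 0\<close>) and \<open>m\<^sub>j\<^sup>+\<close>.\<close>

definition min_moment :: "interval_kind \<Rightarrow> (nat \<Rightarrow> real) \<Rightarrow> nat \<Rightarrow> real" where
  "min_moment E m j = (if j = 0 then 0 else (LEAST t. t \<in> possible_moments E m j))"

definition max_moment :: "interval_kind \<Rightarrow> (nat \<Rightarrow> real) \<Rightarrow> nat \<Rightarrow> real" where
  "max_moment E m j = (GREATEST t. t \<in> possible_moments E m j)"

definition monic_orth_poly :: "real measure \<Rightarrow> nat \<Rightarrow> real poly" where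
  "monic_orth_poly \<mu> j =
     (THE P. Polynomial.degree P = j \<and> Polynomial.lead_coeff P = 1 \<and>
        (\<forall>Q. Polynomial.degree Q < j \<longrightarrow> (\<integral>x. poly P x * poly Q x \<partial>\<mu>) = 0))"

text \<open>
  The coefficients in \<open>P\<^sub>j = (x - \<alpha>\<^sub>j) P\<^sub>j\<^sub>-\<^sub>1 - \<beta>\<^sub>j\<^sub>-\<^sub>1 P\<^sub>j\<^sub>-\<^sub>2\<close>, where \<open>P\<^sub>-\<^sub>1 = 0\<close>; \<open>\<beta>\<^sub>j\<close> is read off from the
  relation for \<open>P\<^sub>j\<^sub>+\<^sub>1\<close>.
\<close>

definition recurrence_alpha :: "real measure \<Rightarrow> nat \<Rightarrow> real" where
  "recurrence_alpha \<mu> j =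
     (THE \<alpha>. \<exists>\<beta>. monic_orth_poly \<mu> j =
        [:- \<alpha>, 1:] * monic_orth_poly \<mu> (j - 1)
        - Polynomial.smult \<beta> (if j \<ge> 2 then monic_orth_poly \<mu> (j - 2) else 0))"

definition recurrence_beta :: "real measure \<Rightarrow> nat \<Rightarrow> real" where
  "recurrence_beta \<mu> j =
     (THE \<beta>. \<exists>\<alpha>. monic_orth_poly \<mu> (j + 1) =
        [:- \<alpha>, 1:] * monic_orth_poly \<mu> j - Polynomial.smult \<beta> (monic_orth_poly \<mu> (j - 1)))"

text \<open>
  The coordinate \<open>y\<^sub>j\<close> depends on \<open>m\<^sub>1, \<dots>, m\<^sub>j\<close> only.  On the real line, for \<open>(m\<^sub>1, \<dots>, m\<^sub>j)\<close> in the interior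
  of the moment space, the coefficient does not depend on the choice of the representing measure.
\<close>

fun canon_coord :: "interval_kind \<Rightarrow> (nat \<Rightarrow> real) \<Rightarrow> nat \<Rightarrow> real" where
  "canon_coord Unit_Interval m j =
     (m j - min_moment Unit_Interval m j)
     / (max_moment Unit_Interval m j - min_moment Unit_Interval m j)"
| "canon_coord Half_Line m j =
     (m j - min_moment Half_Line m j)
     / ((if j = 1 then 1 else m (j - 1)) - min_moment Half_Line m (j - 1))"
| "canon_coord Real_Line m j =
     (let \<mu> = (SOME \<mu>. \<mu> \<in> prob_measures Real_Line \<and> (\<forall>i\<in>{1..j}. moment i \<mu> = m i))
      in if odd j then recurrence_alpha \<mu> ((j + 1) div 2) else recurrence_beta \<mu> (j div 2))"


section \<open>Constrained moment vectors and their law\<close>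

definition free_indices :: "moment_constraint \<Rightarrow> nat \<Rightarrow> nat set" where
  "free_indices C n = {1..n} - dom C"

definition fill_constraint :: "moment_constraint \<Rightarrow> nat \<Rightarrow> (nat \<Rightarrow> real) \<Rightarrow> nat \<Rightarrow> real" where
  "fill_constraint C n x = (\<lambda>j\<in>{1..n}. case C j of Some c \<Rightarrow> c | None \<Rightarrow> x j)"

definition extend_potentials ::
    "moment_constraint \<Rightarrow> (nat \<Rightarrow> real \<Rightarrow> real) \<Rightarrow> nat \<Rightarrow> real \<Rightarrow> real" where
  "extend_potentials C V j =
     (if j \<le> last_index C + 2 then V j
      else if odd (j - last_index C) then V (last_index C + 1)
      else V (last_index C + 2))"

definition unnormalized_density ::
    "interval_kind \<Rightarrow> moment_constraint \<Rightarrow> (nat \<Rightarrow> real \<Rightarrow> real) \<Rightarrow> nat \<Rightarrow> (nat \<Rightarrow> real) \<Rightarrow> ennreal" where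
  "unnormalized_density E C V n m =
     indicator (relint_moment_space E C n) m *
     ennreal (exp (- real n * (\<Sum>j=1..n. extend_potentials C V j (canon_coord E m j))))"

definition partition_function ::
    "interval_kind \<Rightarrow> moment_constraint \<Rightarrow> (nat \<Rightarrow> real \<Rightarrow> real) \<Rightarrow> nat \<Rightarrow> ennreal" where
  "partition_function E C V n =
     (\<integral>\<^sup>+ x. unnormalized_density E C V n (fill_constraint C n x)
        \<partial>(Pi\<^sub>M (free_indices C n) (\<lambda>_. lborel)))"

text \<open>
  The law of the full vector \<open>(m\<^sub>1, \<dots>, m\<^sub>n)\<close>: the image of the measure on the unconstrained coordinates
  under insertion of the prescribed moments.
\<close>

definition moment_law ::
    "interval_kind \<Rightarrow> moment_constraint \<Rightarrow> (nat \<Rightarrow> real \<Rightarrow> real) \<Rightarrow> nat \<Rightarrow> (nat \<Rightarrow> real) measure" where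
  "moment_law E C V n =
     distr
       (density (Pi\<^sub>M (free_indices C n) (\<lambda>_. lborel))
          (\<lambda>x. unnormalized_density E C V n (fill_constraint C n x) / partition_function E C V n))
       (Rn_borel n) (fill_constraint C n)"


section \<open>Generic potentials\<close>

definition integrability_conditions ::
    "interval_kind \<Rightarrow> moment_constraint \<Rightarrow> (nat \<Rightarrow> real \<Rightarrow> real) \<Rightarrow> bool" where
  "integrability_conditions E C V \<longleftrightarrow>
     (\<forall>j\<in>{1..last_index C + 2}. continuous_on (closure (coord_dom E j)) (V j)) \<and>
     (\<exists>\<epsilon>>0. \<exists>R. \<forall>j\<in>{1..last_index C + 2}. \<forall>y\<in>closure (coord_dom E j). \<bar>y\<bar> \<ge> R \<longrightarrow>
        (case E of
           Unit_Interval \<Rightarrow> True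
         | Half_Line \<Rightarrow> V j y \<ge> (2 + \<epsilon>) * ln \<bar>y\<bar>
         | Real_Line \<Rightarrow> V j y \<ge> (if odd j then 1 + \<epsilon> else 2 + \<epsilon>) * ln \<bar>y\<bar>))"

definition W_pot ::
    "interval_kind \<Rightarrow> moment_constraint \<Rightarrow> (nat \<Rightarrow> real \<Rightarrow> real) \<Rightarrow> nat \<Rightarrow> real \<Rightarrow> real" where
  "W_pot E C V j y =
     extend_potentials C V j y -
     (case E of
        Unit_Interval \<Rightarrow> ln (y * (1 - y))
      | Half_Line \<Rightarrow> ln y
      | Real_Line \<Rightarrow> (if odd j then 0 else ln y))"

definition C2_on :: "(real \<Rightarrow> real) \<Rightarrow> real set \<Rightarrow> bool" where
  "C2_on f D \<longleftrightarrow>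
     (\<exists>f' f''. (\<forall>x\<in>D. (f has_real_derivative f' x) (at x) \<and> (f' has_real_derivative f'' x) (at x)) \<and>
        continuous_on D f'')"

definition free_coords ::
    "interval_kind \<Rightarrow> moment_constraint \<Rightarrow> nat \<Rightarrow> (nat \<Rightarrow> real) \<Rightarrow> nat \<Rightarrow> real" where
  "free_coords E C n m = (\<lambda>j\<in>free_indices C n. canon_coord E m j)"

text \<open>The point of the relative interior determined by its unconstrained canonical coordinates.\<close>

definition moments_of_coords ::
    "interval_kind \<Rightarrow> moment_constraint \<Rightarrow> nat \<Rightarrow> (nat \<Rightarrow> real) \<Rightarrow> nat \<Rightarrow> real" where
  "moments_of_coords E C n u = (THE m. m \<in> relint_moment_space E C n \<and> free_coords E C n m = u)"

text \<open>
  \<open>\<Sum>\<^sub>j\<^sub>\<le>\<^sub>n W\<^sub>j(y\<^sub>j)\<close> as a function of the unconstrained coordinates, the constrained \<open>y\<^sub>j\<close> being functions of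
  them; meaningful for \<open>u\<close> in the image of the relative interior.
\<close>

definition W_sum ::
    "interval_kind \<Rightarrow> moment_constraint \<Rightarrow> (nat \<Rightarrow> real \<Rightarrow> real) \<Rightarrow> nat \<Rightarrow> (nat \<Rightarrow> real) \<Rightarrow> real" where
  "W_sum E C V n u = (\<Sum>j=1..n. W_pot E C V j (canon_coord E (moments_of_coords E C n u) j))"

definition F_fun ::
    "interval_kind \<Rightarrow> moment_constraint \<Rightarrow> (nat \<Rightarrow> real \<Rightarrow> real) \<Rightarrow> (nat \<Rightarrow> real) \<Rightarrow> ereal" where
  "F_fun E C V u =
     (if u \<in> free_coords E C (last_index C) ` relint_moment_space E C (last_index C)
      then ereal (W_sum E C V (last_index C) u) else \<infinity>)"

definition F_minimizers ::
    "interval_kind \<Rightarrow> moment_constraint \<Rightarrow> (nat \<Rightarrow> real \<Rightarrow> real) \<Rightarrow> (nat \<Rightarrow> real) set" where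
  "F_minimizers E C V =
     {u. is_arg_min (F_fun E C V)
           (\<lambda>u. u \<in> (\<Pi>\<^sub>E j\<in>free_indices C (last_index C). coord_dom E j)) u}"

definition W_minimizer ::
    "interval_kind \<Rightarrow> moment_constraint \<Rightarrow> (nat \<Rightarrow> real \<Rightarrow> real) \<Rightarrow> nat \<Rightarrow> real" where
  "W_minimizer E C V j = (THE y. is_arg_min (W_pot E C V j) (\<lambda>y. y \<in> coord_dom E j) y)"

definition partial_deriv :: "nat \<Rightarrow> ((nat \<Rightarrow> real) \<Rightarrow> real) \<Rightarrow> (nat \<Rightarrow> real) \<Rightarrow> real" where
  "partial_deriv i f x = deriv (\<lambda>t. f (x(i := t))) (x i)"

text \<open>
  Matrices over the unconstrained coordinates are indexed from \<open>0\<close>: row or column \<open>a\<close> belongs to the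
  \<open>a\<close>-th entry of this list.
\<close>

definition free_list :: "moment_constraint \<Rightarrow> nat \<Rightarrow> nat list" where
  "free_list C n = sorted_list_of_set (free_indices C n)"

definition hessian_constr ::
    "moment_constraint \<Rightarrow> nat \<Rightarrow> ((nat \<Rightarrow> real) \<Rightarrow> real) \<Rightarrow> (nat \<Rightarrow> real) \<Rightarrow> real mat" where
  "hessian_constr C n f u =
     Matrix.mat (card (free_indices C n)) (card (free_indices C n))
       (\<lambda>(a, b). partial_deriv (free_list C n ! a) (partial_deriv (free_list C n ! b) f) u)"

text \<open>Near a minimizer \<open>F\<close> is finite and equals \<^const>\<open>W_sum\<close>, whose Hessian is therefore that of \<open>F\<close>.\<close>

definition generic ::
    "interval_kind \<Rightarrow> moment_constraint \<Rightarrow> (nat \<Rightarrow> real \<Rightarrow> real) \<Rightarrow> bool" where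
  "generic E C V \<longleftrightarrow>
     (\<forall>j\<in>{1..last_index C + 2}. C2_on (V j) (coord_dom E j)) \<and>
     integrability_conditions E C V \<and>
     (\<forall>j\<in>{last_index C + 1, last_index C + 2}.
        \<exists>!y. is_arg_min (W_pot E C V j) (\<lambda>y. y \<in> coord_dom E j) y) \<and>
     finite (F_minimizers E C V) \<and>
     (\<forall>j\<in>{last_index C + 1, last_index C + 2}.
        deriv (deriv (W_pot E C V j)) (W_minimizer E C V j) \<noteq> 0) \<and>
     (\<forall>u\<in>F_minimizers E C V.
        Determinant.det (hessian_constr C (last_index C) (W_sum E C V (last_index C)) u) \<noteq> 0)"


section \<open>Limit points and the normalizing matrix\<close>

definition limit_points ::
    "interval_kind \<Rightarrow> moment_constraint \<Rightarrow> (nat \<Rightarrow> real \<Rightarrow> real) \<Rightarrow> nat \<Rightarrow> (nat \<Rightarrow> real) set" where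
  "limit_points E C V l =
     (\<lambda>u. moments_of_coords E C l
        (\<lambda>j\<in>free_indices C l.
           if j \<le> last_index C then u j
           else if odd (j - last_index C) then W_minimizer E C V (last_index C + 1)
           else W_minimizer E C V (last_index C + 2))) ` F_minimizers E C V"

definition posdef_sqrt :: "real mat \<Rightarrow> real mat" where
  "posdef_sqrt A =
     (THE R. R \<in> carrier_mat (dim_row A) (dim_row A) \<and> transpose_mat R = R \<and>
        (\<forall>v\<in>carrier_vec (dim_row A). v \<noteq> 0\<^sub>v (dim_row A) \<longrightarrow> scalar_prod v (mult_mat_vec R v) > 0) \<and>
        R * R = A)"

text \<open>
  Entry \<open>(u, v)\<close> is the derivative of the \<open>v\<close>-th component of \<open>y\<^sub>l\<^sup>C\<close> with respect to the \<open>u\<close>-th component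
  of \<open>m\<^sub>l\<^sup>C\<close>, that is, the transpose of the Jacobian matrix.
\<close>

definition dy_dm :: "interval_kind \<Rightarrow> moment_constraint \<Rightarrow> nat \<Rightarrow> (nat \<Rightarrow> real) \<Rightarrow> real mat" where
  "dy_dm E C l m =
     Matrix.mat (card (free_indices C l)) (card (free_indices C l))
       (\<lambda>(u, v). partial_deriv (free_list C l ! u) (\<lambda>m. canon_coord E m (free_list C l ! v)) m)"

definition insert_zeros :: "moment_constraint \<Rightarrow> nat \<Rightarrow> real mat \<Rightarrow> real mat" where
  "insert_zeros C l A =
     Matrix.mat l l (\<lambda>(r, s).
       if Suc r \<in> dom C \<or> Suc s \<in> dom C then 0
       else A $$ (card (free_indices C r), card (free_indices C s)))"

definition Sigma_mat ::
    "interval_kind \<Rightarrow> moment_constraint \<Rightarrow> (nat \<Rightarrow> real \<Rightarrow> real) \<Rightarrow> nat \<Rightarrow> (nat \<Rightarrow> real) \<Rightarrow> real mat" where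
  "Sigma_mat E C V l m =
     insert_zeros C l
       (posdef_sqrt (hessian_constr C l (W_sum E C V l) (free_coords E C l m))
        * transpose_mat (dy_dm E C l m))"

definition mat_apply :: "nat \<Rightarrow> real mat \<Rightarrow> (nat \<Rightarrow> real) \<Rightarrow> nat \<Rightarrow> real" where
  "mat_apply l A x = (\<lambda>i\<in>{1..l}. \<Sum>j=1..l. A $$ (i - 1, j - 1) * x j)"

text \<open>\<open>m\<close> may be longer than \<open>l\<close>; \<open>mstar\<close> selects a closest limit point to a vector in \<open>\<real>\<^sup>l\<close>.\<close>

definition rescaled_deviation ::
    "interval_kind \<Rightarrow> moment_constraint \<Rightarrow> (nat \<Rightarrow> real \<Rightarrow> real) \<Rightarrow> nat \<Rightarrow> (nat \<Rightarrow> real) \<Rightarrow>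
     ((nat \<Rightarrow> real) \<Rightarrow> nat \<Rightarrow> real) \<Rightarrow> nat \<Rightarrow> (nat \<Rightarrow> real) \<Rightarrow> nat \<Rightarrow> real" where
  "rescaled_deviation E C V l a mstar n m =
     (let s = mstar (restrict m {1..l})
      in (\<lambda>i\<in>{1..l}. a n * mat_apply l (Sigma_mat E C V l s) (\<lambda>j. m j - s j) i))"

definition closest_point_rule ::
    "nat \<Rightarrow> (nat \<Rightarrow> real) set \<Rightarrow> ((nat \<Rightarrow> real) \<Rightarrow> nat \<Rightarrow> real) \<Rightarrow> bool" where
  "closest_point_rule l S mstar \<longleftrightarrow>
     mstar \<in> Rn_borel l \<rightarrow>\<^sub>M Rn_borel l \<and>
     (\<forall>x\<in>space (Rn_borel l).
        is_arg_min (\<lambda>s. L2_set (\<lambda>j. x j - s j) {1..l}) (\<lambda>s. s \<in> S) (mstar x))"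


section \<open>Large deviations principles\<close>

definition log_prob :: "'a measure \<Rightarrow> 'a set \<Rightarrow> ereal" where
  "log_prob P A = (if measure P A = 0 then -\<infinity> else ereal (ln (measure P A)))"

text \<open>
  \<open>S\<close> only provides the sigma-algebra.  The laws need to be probability measures only for all large
  enough \<open>n\<close>.
\<close>

definition large_deviations ::
    "'a topology \<Rightarrow> 'a measure \<Rightarrow> (nat \<Rightarrow> 'a measure) \<Rightarrow> (nat \<Rightarrow> real) \<Rightarrow> ('a \<Rightarrow> ereal) \<Rightarrow> bool" where
  "large_deviations T S P b J \<longleftrightarrow>
     (\<forall>\<^sub>F n in sequentially. prob_space (P n) \<and> sets (P n) = sets S) \<and>
     filterlim b at_top sequentially \<and>
     (\<forall>x\<in>topspace T. 0 \<le> J x) \<and>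
     (\<forall>c. closedin T {x \<in> topspace T. J x \<le> c}) \<and>
     (\<forall>\<Gamma>\<in>sets S.
        - (INF x\<in>T interior_of \<Gamma>. J x) \<le> liminf (\<lambda>n. ereal (1 / b n) * log_prob (P n) \<Gamma>) \<and>
        limsup (\<lambda>n. ereal (1 / b n) * log_prob (P n) \<Gamma>) \<le> - (INF x\<in>T closure_of \<Gamma>. J x))"

definition good_rate_function :: "'a topology \<Rightarrow> ('a \<Rightarrow> ereal) \<Rightarrow> bool" where
  "good_rate_function T J \<longleftrightarrow> (\<forall>c::real. compactin T {x \<in> topspace T. J x \<le> ereal c})"

definition gaussian_rate :: "moment_constraint \<Rightarrow> nat \<Rightarrow> (nat \<Rightarrow> real) \<Rightarrow> ereal" where
  "gaussian_rate C l m =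
     (if \<forall>i\<in>dom C. m i = 0 then ereal (1 / 2 * (L2_set m {1..l})\<^sup>2) else \<infinity>)"

end

theory Submission
  imports Defs
begin

text \<open>
  In canonical coordinates the density factorizes: with \<open>w\<^sub>j\<close> equal to \<open>y (1 - y)\<close>, \<open>y\<close> or \<open>1\<close>, the \<open>j\<close>-th moment
  is affine in \<open>y\<^sub>j\<close> with slope \<open>\<Prod>\<^bsub>i<j\<^esub> w\<^sub>i(y\<^sub>i)\<close>. Integrating out the moments beyond \<open>l\<close> therefore leaves a density
  proportional to \<open>\<Prod>\<^bsub>j\<le>l\<^esub> w\<^sub>j\<^bsup>n-l\<^esup> exp (- n V\<^sub>j) = k exp (- n G)\<close>, where \<open>G = \<Sum>\<^bsub>j\<le>l\<^esub> W\<^sub>j(y\<^sub>j)\<close> and \<open>k\<close> does not depend on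
  \<open>n\<close>. The minimizers of \<open>G\<close> are the limit points, where \<open>G\<close> has the nondegenerate Hessian \<open>\<Sigma>\<^sup>t \<Sigma>\<close>, so Laplace's
  method on the scale \<open>1 / a\<^sub>n\<close> gives \<open>exp (- n |z|\<^sup>2 / (2 a\<^sub>n\<^sup>2))\<close> for the probability that the rescaled deviation is
  close to \<open>z\<close>; away from the limit points the density is smaller by a factor \<open>exp (- \<delta> n)\<close>, which is negligible
  at the speed \<open>n / a\<^sub>n\<^sup>2\<close>.
\<close>

text \<open>Extremal moments and recurrence coefficients are unsuited to calculus, so the moments
  are written as explicit polynomials in the coordinates (sums over Motzkin paths), and the
  coordinates are recovered by solving this triangular system. Agreement with the defined
  coordinates needs existence and extremality of measures: the spectral theorem for truncated Jacobi
  matrices supplies quadrature measures, and nonnegative polynomials vanishing at their nodes show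
  that boundary coordinates belong to extremal moments. A constraint prescribes a moment instead of
  a coordinate in some rows of the system, so one recursion serves free and constrained indices
  alike. In moment coordinates the Hessian at a limit point involves only first derivatives of the
  coordinate change, because the gradient vanishes there; this is why the square root of the Hessian
  times the Jacobian is the right normalization. The density is integrable beyond the limit points
  only thanks to a fixed power of itself, which is split off before the decay in \<open>n\<close> is
  used. Since the rate is a function of the norm on the admissible subspace, the upper bound needs
  no covering argument.\<close>

type_synonym rvec = "nat \<Rightarrow> real"

section \<open>Spectral theorem for symmetric matrices\<close>

text \<open>Vectors are functions of which only the values below \<open>N\<close> count, and
  matrices are functions of two indices. The dimension is thus a term and may depend on the
  constraint.\<close>

definition ipn :: "nat \<Rightarrow> rvec \<Rightarrow> rvec \<Rightarrow> real" where
  "ipn N x y = (\<Sum>i<N. x i * y i)"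

definition mvn :: "nat \<Rightarrow> (nat \<Rightarrow> nat \<Rightarrow> real) \<Rightarrow> rvec \<Rightarrow> nat \<Rightarrow> real" where
  "mvn N A x i = (\<Sum>j<N. A i j * x j)"

definition orthonormal_upto :: "nat \<Rightarrow> nat \<Rightarrow> (nat \<Rightarrow> nat \<Rightarrow> real) \<Rightarrow> bool" where
  "orthonormal_upto N m w \<longleftrightarrow> (\<forall>k<m. \<forall>k'<m. ipn N (w k) (w k') = (if k = k' then 1 else 0))"

lemma ipn_commute: "ipn N x y = ipn N y x"
  by (simp add: ipn_def mult.commute)

lemma ipn_add_left: "ipn N (\<lambda>i. x i + y i) z = ipn N x z + ipn N y z"
  by (simp add: ipn_def algebra_simps sum.distrib)

lemma ipn_diff_left: "ipn N (\<lambda>i. x i - y i) z = ipn N x z - ipn N y z"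
  by (simp add: ipn_def algebra_simps sum_subtractf)

lemma ipn_scale_left: "ipn N (\<lambda>i. c * x i) z = c * ipn N x z"
  by (simp add: ipn_def sum_distrib_left algebra_simps)

lemma ipn_add_right: "ipn N z (\<lambda>i. x i + y i) = ipn N z x + ipn N z y"
  by (metis ipn_add_left ipn_commute)

lemma ipn_scale_right: "ipn N z (\<lambda>i. c * x i) = c * ipn N z x"
  by (metis ipn_scale_left ipn_commute)

lemma ipn_self_nonneg: "0 \<le> ipn N x x"
  by (auto simp: ipn_def intro!: sum_nonneg)

lemma ipn_self_eq_0_iff: "ipn N x x = 0 \<longleftrightarrow> (\<forall>i<N. x i = 0)"
  unfolding ipn_def by (subst sum_nonneg_eq_0_iff) auto

lemma ipn_cong: "(\<And>i. i < N \<Longrightarrow> x i = x' i) \<Longrightarrow> (\<And>i. i < N \<Longrightarrow> y i = y' i) \<Longrightarrow> ipn N x y = ipn N x' y'"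
  by (simp add: ipn_def)

lemma ipn_mvn_symmetric:
  assumes "\<And>i j. i < N \<Longrightarrow> j < N \<Longrightarrow> A i j = A j i"
  shows "ipn N x (mvn N A y) = ipn N (mvn N A x) y"
proof -
  have "ipn N x (mvn N A y) = (\<Sum>i<N. \<Sum>j<N. x i * (A i j * y j))"
    by (simp add: ipn_def mvn_def sum_distrib_left)
  also have "... = (\<Sum>j<N. \<Sum>i<N. x i * (A i j * y j))" by (rule sum.swap)
  also have "... = (\<Sum>j<N. \<Sum>i<N. A j i * x i * y j)"
    using assms by (intro sum.cong refl) (simp add: mult_ac)
  also have "... = ipn N (mvn N A x) y" by (simp add: ipn_def mvn_def sum_distrib_right)
  finally show ?thesis .
qed

lemma mvn_add: "mvn N A (\<lambda>i. x i + y i) = (\<lambda>i. mvn N A x i + mvn N A y i)"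
  by (simp add: mvn_def[abs_def] distrib_left sum.distrib)

lemma mvn_scale: "mvn N A (\<lambda>i. c * x i) = (\<lambda>i. c * mvn N A x i)"
  by (simp add: mvn_def[abs_def] sum_distrib_left mult.left_commute)

text \<open>For small \<open>t\<close> of the sign of \<open>b\<close> the linear term dominates.
  This turns a one-sided variational inequality into stationarity, both at the maximizer of a
  Rayleigh quotient and at a null vector of a semidefinite form.\<close>

lemma linear_le_quadratic_imp_zero:
  fixes b c :: real
  assumes "\<And>t. 2 * t * b \<le> t\<^sup>2 * c"
  shows "b = 0"
proof (rule ccontr)
  assume "b \<noteq> 0"
  define s where "s = \<bar>c\<bar> + 1"
  have s: "s > 0" "c < s" by (auto simp: s_def)
  have "2 * (b / s) * b \<le> (b / s)\<^sup>2 * c" by (rule assms)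
  hence "2 * b\<^sup>2 * s \<le> b\<^sup>2 * c" using s by (simp add: field_simps power2_eq_square)
  moreover have "b\<^sup>2 * c < b\<^sup>2 * s" using s \<open>b \<noteq> 0\<close> by simp
  moreover have "b\<^sup>2 * s > 0" using s \<open>b \<noteq> 0\<close> by simp
  ultimately show False by linarith
qed

text \<open>\<open>y j\<close> is the part of the \<open>j\<close>-th unit vector orthogonal to all
  \<open>w k\<close>. The squared lengths add up to the trace of the orthogonal projection: positive
  while a further unit vector can be found, zero for a full system, which yields
  completeness.\<close>

lemma orthogonal_residuals:
  assumes "orthonormal_upto N m w"
  defines "y \<equiv> \<lambda>j i. (if i = j then 1 else 0) - (\<Sum>k<m. w k j * w k i)"
  shows "\<And>j k. j < N \<Longrightarrow> k < m \<Longrightarrow> ipn N (y j) (w k) = 0"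
    and "(\<Sum>j<N. ipn N (y j) (y j)) = real N - real m"
proof -
  have on: "ipn N (w k) (w k') = (if k = k' then 1 else 0)" if "k < m" "k' < m" for k k'
    using assms that by (auto simp: orthonormal_upto_def)
  have decomp: "ipn N (y j) z = z j - (\<Sum>k<m. w k j * ipn N (w k) z)" if "j < N" for j z
  proof -
    have "ipn N (y j) z = (\<Sum>i<N. (if i = j then z i else 0)) - (\<Sum>i<N. \<Sum>k<m. w k j * w k i * z i)"
      unfolding ipn_def y_def sum_subtractf[symmetric]
      by (intro sum.cong refl) (simp add: left_diff_distrib sum_distrib_right)
    also have "(\<Sum>i<N. (if i = j then z i else 0)) = z j" using that by simp
    also have "(\<Sum>i<N. \<Sum>k<m. w k j * w k i * z i) = (\<Sum>k<m. w k j * ipn N (w k) z)"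
      by (subst sum.swap) (simp add: ipn_def sum_distrib_left mult_ac)
    finally show ?thesis .
  qed
  show orth: "ipn N (y j) (w k) = 0" if "j < N" "k < m" for j k
  proof -
    have "(\<Sum>k'<m. w k' j * ipn N (w k') (w k)) = (\<Sum>k'<m. if k' = k then w k' j else 0)"
      using on that by (intro sum.cong refl) auto
    thus ?thesis using that by (simp add: decomp)
  qed
  have self: "ipn N (y j) (y j) = 1 - (\<Sum>k<m. (w k j)\<^sup>2)" if "j < N" for j
  proof -
    have "ipn N (y j) (y j) = y j j - (\<Sum>k<m. w k j * ipn N (w k) (y j))" by (rule decomp[OF that])
    also have "(\<Sum>k<m. w k j * ipn N (w k) (y j)) = 0"
      by (intro sum.neutral) (use that orth in "auto simp: ipn_commute")
    finally show ?thesis by (simp add: y_def power2_eq_square)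
  qed
  have "(\<Sum>j<N. ipn N (y j) (y j)) = real N - (\<Sum>j<N. \<Sum>k<m. (w k j)\<^sup>2)"
    using self by (simp add: sum_subtractf)
  also have "(\<Sum>j<N. \<Sum>k<m. (w k j)\<^sup>2) = (\<Sum>k<m. ipn N (w k) (w k))"
    by (subst sum.swap) (simp add: ipn_def power2_eq_square)
  also have "... = real m" using on by simp
  finally show "(\<Sum>j<N. ipn N (y j) (y j)) = real N - real m" .
qed

lemma orthonormal_complete:
  assumes "orthonormal_upto N N w" "i < N" "j < N"
  shows "(\<Sum>k<N. w k i * w k j) = (if i = j then 1 else 0)"
proof -
  define y where "y = (\<lambda>j i. (if i = j then 1 else 0) - (\<Sum>k<N. w k j * w k i))"
  have "(\<Sum>j<N. ipn N (y j) (y j)) = 0"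
    using orthogonal_residuals(2)[OF assms(1)] by (simp add: y_def)
  hence "ipn N (y i) (y i) = 0"
    using assms(2) by (subst (asm) sum_nonneg_eq_0_iff) (auto simp: ipn_self_nonneg)
  hence "y i j = 0" using assms(3) ipn_self_eq_0_iff by blast
  thus ?thesis by (auto simp: y_def split: if_splits)
qed

lemma exists_orthogonal_unit:
  assumes "orthonormal_upto N m w" "m < N"
  shows "\<exists>x. (\<forall>i\<ge>N. x i = 0) \<and> ipn N x x = 1 \<and> (\<forall>k<m. ipn N x (w k) = 0)"
proof -
  define y where "y = (\<lambda>j i. (if i = j then 1 else 0) - (\<Sum>k<m. w k j * w k i))"
  have s: "(\<Sum>j<N. ipn N (y j) (y j)) = real N - real m"
    using orthogonal_residuals(2)[OF assms(1)] by (simp add: y_def)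
  have "\<exists>j<N. ipn N (y j) (y j) \<noteq> 0"
  proof (rule ccontr)
    assume "\<not> ?thesis"
    hence "(\<Sum>j<N. ipn N (y j) (y j)) = 0" by (intro sum.neutral) auto
    with s assms(2) show False by simp
  qed
  then obtain j where j: "j < N" "ipn N (y j) (y j) \<noteq> 0" by blast
  define c where "c = ipn N (y j) (y j)"
  have c: "c > 0" using j ipn_self_nonneg[of N "y j"] by (simp add: c_def)
  define x where "x = (\<lambda>i. if i < N then (1 / sqrt c) * y j i else 0)"
  have xx: "ipn N x z = (1 / sqrt c) * ipn N (y j) z" for z
    unfolding ipn_scale_left[symmetric] by (rule ipn_cong) (auto simp: x_def)
  have "ipn N x x = (1 / sqrt c) * ((1 / sqrt c) * c)"
    using xx[of x] xx[of "y j"] by (simp add: ipn_commute[of N "y j" x] c_def)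
  also have "... = 1" using c by (simp add: real_div_sqrt field_simps)
  finally have "ipn N x x = 1" .
  moreover have "ipn N x (w k) = 0" if "k < m" for k
    using orthogonal_residuals(1)[OF assms(1) j(1) that] xx by (simp add: y_def)
  ultimately show ?thesis by (intro exI[of _ x]) (auto simp: x_def)
qed

lemma compact_PiE_UNIV:
  fixes K :: "nat \<Rightarrow> real set"
  assumes "\<And>i. compact (K i)"
  shows "compact {x. \<forall>i. x i \<in> K i}"
proof -
  have "compactin (product_topology (\<lambda>i. euclidean) UNIV) (PiE UNIV K)"
    by (subst compactin_PiE) (use assms in auto)
  hence "compact (PiE UNIV K)" by (simp add: euclidean_product_topology)
  thus ?thesis by (simp add: PiE_UNIV_domain Pi_def)
qed

lemma continuous_on_coord [continuous_intros]: "continuous_on S (\<lambda>x::nat \<Rightarrow> real. x i)"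
  by (rule continuous_on_subset[OF continuous_on_product_coordinates]) simp

lemma continuous_on_ipn: "continuous_on S (\<lambda>x. ipn N x x)" "continuous_on S (\<lambda>x. ipn N x y)"
  unfolding ipn_def by (intro continuous_intros)+

text \<open>The next eigenvector maximizes the Rayleigh quotient on the unit sphere of the
  orthogonal complement of the previous ones, which is nonempty by
  \<open>exists_orthogonal_unit\<close>.\<close>

lemma eigenvectors_greedy:
  assumes sym: "\<And>i j. i < N \<Longrightarrow> j < N \<Longrightarrow> A i j = A j i" and "m \<le> N"
  shows "\<exists>lam w. orthonormal_upto N m w \<and> (\<forall>k<m. \<forall>i<N. mvn N A (w k) i = lam k * w k i)"
  using \<open>m \<le> N\<close>
proof (induction m)
  case 0
  show ?case by (simp add: orthonormal_upto_def)
next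
  case (Suc m)
  then obtain lam w where on: "orthonormal_upto N m w"
    and ev: "\<And>k i. k < m \<Longrightarrow> i < N \<Longrightarrow> mvn N A (w k) i = lam k * w k i"
    by auto
  \<comment> \<open>The entries from \<open>N\<close> on are pinned to \<open>0\<close>; otherwise
    the sphere would not be compact in the product topology.\<close>
  define S where "S = {x. (\<forall>i. x i \<in> (if i < N then {-1..1} else {0::real}))}"
  define K where "K = {x. ipn N x x = 1} \<inter> (\<Inter>k<m. {x. ipn N x (w k) = 0}) \<inter> S"
  have "compact S" unfolding S_def by (rule compact_PiE_UNIV) auto
  moreover have "closed ({x. ipn N x x = 1} \<inter> (\<Inter>k<m. {x. ipn N x (w k) = 0}))"
    by (intro closed_Int closed_INT ballI closed_Collect_eq continuous_on_ipn continuous_on_const)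
  ultimately have "compact K" unfolding K_def by (rule closed_Int_compact[rotated])
  have memK: "x \<in> K" if "\<forall>i\<ge>N. x i = 0" "ipn N x x = 1" "\<forall>k<m. ipn N x (w k) = 0" for x
  proof -
    have "\<bar>x i\<bar> \<le> 1" if "i < N" for i
    proof -
      have "(x i)\<^sup>2 \<le> ipn N x x" unfolding ipn_def power2_eq_square
        by (rule member_le_sum) (use that in auto)
      with \<open>ipn N x x = 1\<close> show ?thesis by (simp add: abs_square_le_1)
    qed
    thus ?thesis using that by (auto simp: K_def S_def abs_le_iff)
  qed
  obtain x0 where "x0 \<in> K" using exists_orthogonal_unit[OF on] Suc.prems memK by auto
  have "continuous_on K (\<lambda>x. ipn N x (mvn N A x))"
    unfolding ipn_def mvn_def by (intro continuous_intros)
  then obtain x where xK: "x \<in> K"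
    and xmax: "\<And>y. y \<in> K \<Longrightarrow> ipn N y (mvn N A y) \<le> ipn N x (mvn N A x)"
    using continuous_attains_sup[OF \<open>compact K\<close>] \<open>x0 \<in> K\<close> by blast
  define la where "la = ipn N x (mvn N A x)"
  have x: "ipn N x x = 1" "\<And>k. k < m \<Longrightarrow> ipn N x (w k) = 0"
    using xK by (auto simp: K_def)
  have bound: "ipn N y (mvn N A y) \<le> la * ipn N y y" if "\<And>k. k < m \<Longrightarrow> ipn N y (w k) = 0" for y
  proof (cases "ipn N y y = 0")
    case True
    hence "\<forall>i<N. y i = 0" by (simp only: ipn_self_eq_0_iff)
    hence "ipn N y (mvn N A y) = 0" by (simp add: ipn_def)
    with True show ?thesis by simp
  next
    case False
    define c where "c = ipn N y y"
    have c: "c > 0" using False ipn_self_nonneg[of N y] by (simp add: c_def)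
    define z where "z = (\<lambda>i. if i < N then (1 / sqrt c) * y i else 0)"
    have zz: "ipn N z u = (1 / sqrt c) * ipn N y u" for u
      unfolding ipn_scale_left[symmetric] by (rule ipn_cong) (auto simp: z_def)
    have "ipn N z z = (1 / sqrt c) * ((1 / sqrt c) * c)"
      using zz[of z] zz[of "y"] by (simp add: ipn_commute[of N y z] c_def)
    also have "... = 1" using c by (simp add: real_div_sqrt field_simps)
    finally have "ipn N z z = 1" .
    hence "z \<in> K" using that zz by (intro memK) (auto simp: z_def)
    have "mvn N A z = (\<lambda>i. (1 / sqrt c) * mvn N A y i)"
      unfolding mvn_scale[symmetric] by (auto simp: mvn_def z_def)
    hence "ipn N z (mvn N A z) = (1 / sqrt c) * ((1 / sqrt c) * ipn N y (mvn N A y))"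
      by (simp add: zz ipn_scale_right del: times_divide_eq_left)
    also have "... = ipn N y (mvn N A y) / c" using c by simp
    finally show ?thesis using xmax[OF \<open>z \<in> K\<close>] c by (simp add: la_def c_def field_simps)
  qed
  \<comment> \<open>First variation of the Rayleigh quotient at the maximizer \<open>x\<close> in
    the direction \<open>y\<close>.\<close>
  have stat: "ipn N y (mvn N A x) = la * ipn N y x" if y: "\<And>k. k < m \<Longrightarrow> ipn N y (w k) = 0" for y
  proof -
    define b where "b = ipn N y (mvn N A x) - la * ipn N y x"
    define c where "c = la * ipn N y y - ipn N y (mvn N A y)"
    have "2 * t * b \<le> t\<^sup>2 * c" for t
    proof -
      have "ipn N (\<lambda>i. x i + t * y i) (mvn N A (\<lambda>i. x i + t * y i))
          \<le> la * ipn N (\<lambda>i. x i + t * y i) (\<lambda>i. x i + t * y i)"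
        using x y by (intro bound) (simp add: ipn_add_left ipn_scale_left)
      moreover have "ipn N x (mvn N A y) = ipn N y (mvn N A x)"
        using ipn_mvn_symmetric[of N A x y] sym ipn_commute by metis
      ultimately show ?thesis using x(1)
        by (simp add: mvn_add mvn_scale ipn_add_left ipn_add_right ipn_scale_left ipn_scale_right
            ipn_commute[of N x y] la_def[symmetric] b_def c_def algebra_simps power2_eq_square)
    qed
    hence "b = 0" by (rule linear_le_quadratic_imp_zero)
    thus ?thesis by (simp add: b_def)
  qed
  \<comment> \<open>The defect of the eigenvalue equation. By symmetry of \<open>A\<close> it is
    orthogonal to the earlier eigenvectors, so it is itself an admissible direction in
    \<open>stat\<close>, which forces it to vanish.\<close>
  define y where "y = (\<lambda>i. mvn N A x i - la * x i)"
  have yw: "ipn N y (w k) = 0" if "k < m" for k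
  proof -
    have "ipn N (mvn N A x) (w k) = ipn N x (mvn N A (w k))"
      using ipn_mvn_symmetric[of N A x "w k"] sym by simp
    also have "... = ipn N x (\<lambda>i. lam k * w k i)" using ev that by (intro ipn_cong) auto
    also have "... = 0" using x that by (simp add: ipn_scale_right)
    finally show ?thesis using x(2)[OF that] by (simp add: y_def ipn_diff_left ipn_scale_left)
  qed
  have "ipn N y z = ipn N (mvn N A x) z - la * ipn N x z" for z
    by (simp add: y_def ipn_diff_left ipn_scale_left)
  hence "ipn N y y = ipn N y (mvn N A x) - la * ipn N y x"
    by (metis ipn_commute)
  hence "ipn N y y = 0" using stat[OF yw] by simp
  hence evx: "mvn N A x i = la * x i" if "i < N" for i
    using that by (auto simp: ipn_self_eq_0_iff y_def)
  have "orthonormal_upto N (Suc m) (w(m := x))"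
    using on x by (auto simp: orthonormal_upto_def less_Suc_eq ipn_commute)
  moreover have "\<forall>k<Suc m. \<forall>i<N. mvn N A ((w(m := x)) k) i = (lam(m := la)) k * (w(m := x)) k i"
    using ev evx by (auto simp: less_Suc_eq)
  ultimately show ?case by blast
qed

theorem spectral_decomposition:
  assumes sym: "\<And>i j. i < N \<Longrightarrow> j < N \<Longrightarrow> A i j = A j i"
  obtains lam :: rvec and w where "orthonormal_upto N N w"
    "\<And>k i. k < N \<Longrightarrow> i < N \<Longrightarrow> mvn N A (w k) i = lam k * w k i"
    "\<And>i j. i < N \<Longrightarrow> j < N \<Longrightarrow> A i j = (\<Sum>k<N. lam k * w k i * w k j)"
proof -
  obtain lam w where on: "orthonormal_upto N N w"
    and ev: "\<And>k i. k < N \<Longrightarrow> i < N \<Longrightarrow> mvn N A (w k) i = lam k * w k i"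
    using eigenvectors_greedy[of N A N] sym by blast
  have "A i j = (\<Sum>k<N. lam k * w k i * w k j)" if "i < N" "j < N" for i j
  proof -
    have "(\<Sum>k<N. lam k * w k i * w k j) = (\<Sum>k<N. \<Sum>l<N. A i l * w k l * w k j)"
      using ev that by (intro sum.cong refl) (simp flip: sum_distrib_right add: mvn_def[symmetric])
    also have "... = (\<Sum>l<N. A i l * (\<Sum>k<N. w k l * w k j))"
      by (subst sum.swap) (simp add: sum_distrib_left mult_ac)
    also have "... = (\<Sum>l<N. if l = j then A i l else 0)"
      using orthonormal_complete[OF on] that by (intro sum.cong refl) auto
    finally show ?thesis using that by simp
  qed
  with on ev show thesis by (rule that)
qed

section \<open>Moments as polynomials in the canonical coordinates\<close>

fun wt :: "interval_kind \<Rightarrow> nat \<Rightarrow> real \<Rightarrow> real" where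
  "wt Unit_Interval j y = y * (1 - y)"
| "wt Half_Line j y = y"
| "wt Real_Line j y = (if odd j then 1 else y)"

text \<open>
  Weighted Motzkin paths of length \<open>k\<close> from height \<open>0\<close> to height \<open>h\<close>: a level step at height \<open>h\<close> has
  weight \<open>y\<^bsub>2h+1\<^esub>\<close> (the recurrence coefficient \<open>\<alpha>\<^bsub>h+1\<^esub>\<close>), a down step to height \<open>h\<close> has weight
  \<open>y\<^bsub>2h+2\<^esub>\<close> (the coefficient \<open>\<beta>\<^bsub>h+1\<^esub>\<close>).
\<close>

primrec paths :: "rvec \<Rightarrow> nat \<Rightarrow> nat \<Rightarrow> real" where
  "paths y 0 h = (if h = 0 then 1 else 0)"
| "paths y (Suc k) h =
     (if h = 0 then 0 else paths y k (h - 1)) + y (2 * h + 1) * paths y k h + y (2 * h + 2) * paths y k (h + 1)"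

text \<open>
  On \<open>[0,\<infinity>)\<close> and \<open>[0,1]\<close> the \<open>j\<close>-th moment is the \<open>2j\<close>-th moment of the symmetric measure on the line
  obtained by the substitution \<open>x = t\<^sup>2\<close>; its recurrence coefficients are \<open>\<alpha> = 0\<close> and \<open>\<beta>\<^sub>j = z\<^sub>j\<close>, where
  \<open>z\<^sub>j = (1 - p\<^bsub>j-1\<^esub>) p\<^sub>j\<close> with \<open>p\<^sub>0 = 0\<close> in the case of \<open>[0,1]\<close>.
\<close>

fun jac_param :: "interval_kind \<Rightarrow> rvec \<Rightarrow> nat \<Rightarrow> real" where
  "jac_param Unit_Interval y i =
     (if even i then (if i = 2 then 1 else 1 - y (i div 2 - 1)) * y (i div 2) else 0)"
| "jac_param Half_Line y i = (if even i then y (i div 2) else 0)"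
| "jac_param Real_Line y i = y i"

definition mom :: "interval_kind \<Rightarrow> rvec \<Rightarrow> nat \<Rightarrow> real" where
  "mom E y j = paths (jac_param E y) (if E = Real_Line then j else 2 * j) 0"

definition slope :: "interval_kind \<Rightarrow> rvec \<Rightarrow> nat \<Rightarrow> real" where
  "slope E y j = (\<Prod>i\<in>{1..<j}. wt E i (y i))"

section \<open>Dependence of the path sums on their weights\<close>

lemma paths_eq_0: "k < h \<Longrightarrow> paths y k h = 0"
  by (induction k arbitrary: h) auto

lemma paths_diag: "paths y h h = 1"
  by (induction h) (auto simp: paths_eq_0)

text \<open>A path of \<open>k\<close> steps from \<open>0\<close> to \<open>h\<close> that uses the
  weight with index \<open>i\<close> has to climb to the corresponding height and come back to
  \<open>h\<close>, which takes at least \<open>i - h\<close> steps; hence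
  \<open>i \<le> k + h\<close>.\<close>

lemma paths_cong:
  assumes "\<And>i. 1 \<le> i \<Longrightarrow> i < j \<Longrightarrow> y i = y' i" "k + h < j"
  shows "paths y k h = paths y' k h"
  using assms(2)
proof (induction k arbitrary: h)
  case (Suc k)
  have a: "y (2 * h + 1) * paths y k h = y' (2 * h + 1) * paths y' k h"
  proof (cases "h \<le> k")
    case True
    thus ?thesis using Suc assms(1)[of "2 * h + 1"] by simp
  qed (simp add: paths_eq_0)
  have b: "y (2 * h + 2) * paths y k (h + 1) = y' (2 * h + 2) * paths y' k (h + 1)"
  proof (cases "h + 1 \<le> k")
    case True
    thus ?thesis using Suc.IH[of "h + 1"] Suc.prems assms(1)[of "2 * h + 2"] by simp
  qed (simp add: paths_eq_0)
  show ?case using a b Suc.IH[of "h - 1"] Suc.prems by simp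
qed simp

text \<open>Exactly one path uses the weight with the extreme index \<open>k + h\<close>: it climbs
  straight up, makes one step of that weight, and descends straight to \<open>h\<close>. The product
  collects the weights of its remaining down steps.\<close>

lemma paths_diff:
  assumes "\<And>i. 1 \<le> i \<Longrightarrow> i < j \<Longrightarrow> y i = y' i" "k + h = j" "h < k"
  shows "paths y k h - paths y' k h = (y j - y' j) * (\<Prod>i\<in>{i. h < i \<and> 2 * i < j}. y (2 * i))"
  using assms(2,3)
proof (induction k arbitrary: h)
  case (Suc k)
  have eq: "paths y k h' = paths y' k h'" if "k + h' < j" for h'
    using paths_cong[of j y y' k h'] assms(1) that by blast
  have "paths y (Suc k) h - paths y' (Suc k) h =
      (y (2 * h + 1) - y' (2 * h + 1)) * paths y k h +
      (y (2 * h + 2) * paths y k (h + 1) - y' (2 * h + 2) * paths y' k (h + 1))"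
    using eq[of "h - 1"] eq[of h] Suc.prems by (auto simp: algebra_simps)
  also have "... = (y j - y' j) * (\<Prod>i\<in>{i. h < i \<and> 2 * i < j}. y (2 * i))"
  proof -
    \<comment> \<open>The last step is the distinguished level step, the distinguished down step, or
      an ordinary down step of the single extreme path.\<close>
    consider "2 * h + 1 = j" | "2 * h + 2 = j" | "2 * h + 2 < j" using Suc.prems by linarith
    thus ?thesis
    proof cases
      case 1
      have "{i. h < i \<and> 2 * i < j} = {}" using 1 by auto
      hence p: "(\<Prod>i\<in>{i. h < i \<and> 2 * i < j}. y (2 * i)) = 1" by (simp only: prod.empty)
      have "k = h" using 1 Suc.prems by simp
      thus ?thesis unfolding p 1 by (simp add: paths_diag paths_eq_0)
    next
      case 2
      have "{i. h < i \<and> 2 * i < j} = {}" using 2 by auto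
      hence p: "(\<Prod>i\<in>{i. h < i \<and> 2 * i < j}. y (2 * i)) = 1" by (simp only: prod.empty)
      have "k = Suc h" using 2 Suc.prems by simp
      thus ?thesis unfolding p 2 using 2 assms(1)[of "2 * h + 1"] paths_diag[of _ "Suc h"]
        by (simp add: left_diff_distrib del: paths.simps)
    next
      case 3
      have "{i. h < i \<and> 2 * i < j} = insert (h + 1) {i. h + 1 < i \<and> 2 * i < j}" using 3 by auto
      moreover have "finite {i. h + 1 < i \<and> 2 * i < j}" by (rule finite_subset[of _ "{..j}"]) auto
      ultimately have "(\<Prod>i\<in>{i. h < i \<and> 2 * i < j}. y (2 * i))
          = y (2 * h + 2) * (\<Prod>i\<in>{i. h + 1 < i \<and> 2 * i < j}. y (2 * i))" by simp
      moreover have "paths y k (h + 1) - paths y' k (h + 1)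
          = (y j - y' j) * (\<Prod>i\<in>{i. h + 1 < i \<and> 2 * i < j}. y (2 * i))"
        using Suc.IH[of "h + 1"] Suc.prems 3 by simp
      moreover have "y (2 * h + 1) = y' (2 * h + 1)" "y (2 * h + 2) = y' (2 * h + 2)"
        using 3 assms(1)[of "2 * h + 1"] assms(1)[of "2 * h + 2"] by auto
      ultimately show ?thesis
        by (simp only: diff_self mult_zero_left add_0_left right_diff_distrib[symmetric] mult.left_commute)
    qed
  qed
  finally show ?case .
qed simp

lemma jac_param_cong:
  assumes "\<And>i. 1 \<le> i \<Longrightarrow> i < j \<Longrightarrow> y i = y' i" "1 \<le> i" "i < (if E = Real_Line then j else 2 * j)"
  shows "jac_param E y i = jac_param E y' i"
proof (cases E)
  case Unit_Interval
  show ?thesis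
  proof (cases "even i")
    case True
    then obtain r where r: "i = 2 * r" by blast
    thus ?thesis using assms Unit_Interval by (cases "r = 1") auto
  qed (simp add: Unit_Interval)
next
  case Half_Line
  thus ?thesis using assms by (auto elim!: evenE)
qed (use assms in auto)

lemma mom_cong:
  assumes "\<And>i. 1 \<le> i \<Longrightarrow> i \<le> j \<Longrightarrow> y i = y' i"
  shows "mom E y j = mom E y' j"
  unfolding mom_def
  by (rule paths_cong[of "if E = Real_Line then Suc j else 2 * Suc j"])
     (use jac_param_cong[of "Suc j" y y' _ E] assms in "auto split: if_splits")

lemma mom_0: "mom E y 0 = 1"
  by (simp add: mom_def)

lemma slope_cong: "(\<And>i. 1 \<le> i \<Longrightarrow> i < j \<Longrightarrow> y i = y' i) \<Longrightarrow> slope E y j = slope E y' j"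
  by (simp add: slope_def)

lemma slope_1 [simp]: "slope E y (Suc 0) = 1"
  by (simp add: slope_def)

lemma slope_Suc: "j \<ge> 1 \<Longrightarrow> slope E y (Suc j) = slope E y j * wt E j (y j)"
  by (simp add: slope_def)

text \<open>Regrouping: the factor \<open>1 - y i\<close> of the parameter with index
  \<open>i + 1\<close> is joined to the factor \<open>y i\<close> of the parameter with index
  \<open>i\<close>.\<close>

lemma prod_unit_params:
  assumes "j \<ge> 1"
  shows "(\<Prod>i\<in>{1..<j}. jac_param Unit_Interval y (2 * i)) * (if j = 1 then 1 else 1 - y (j - 1))
    = slope Unit_Interval y j"
  using assms
proof (induction j rule: dec_induct)
  case (step j)
  have "(\<Prod>i\<in>{1..<Suc j}. jac_param Unit_Interval y (2 * i)) * (1 - y j)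
      = (\<Prod>i\<in>{1..<j}. jac_param Unit_Interval y (2 * i)) * (if j = 1 then 1 else 1 - y (j - 1)) * (y j * (1 - y j))"
    using step.hyps by (simp add: mult_ac)
  also have "... = slope Unit_Interval y j * (y j * (1 - y j))" by (simp only: step.IH)
  finally show ?case using step.hyps by (simp add: slope_Suc)
qed simp

lemma prod_even_eq_slope_Real: "(\<Prod>i\<in>{i. 0 < i \<and> 2 * i < j}. y (2 * i)) = slope Real_Line y j"
proof -
  have "slope Real_Line y j = (\<Prod>i\<in>{i\<in>{1..<j}. even i}. y i)"
    unfolding slope_def by (subst prod.inter_filter) (auto intro!: prod.cong)
  also have "... = (\<Prod>i\<in>{i. 0 < i \<and> 2 * i < j}. y (2 * i))"
    by (rule prod.reindex_bij_witness[of _ "\<lambda>i. 2 * i" "\<lambda>i. i div 2"]) auto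
  finally show ?thesis ..
qed

text \<open>Only the last Jacobi parameter differs, so \<open>paths_diff\<close> applies; on the
  unit interval the factor \<open>1 - y (j - 1)\<close> in that parameter completes the product to
  the slope. The choice \<open>y' = y(j := t)\<close> later evaluates the moment at the boundary
  values \<open>t\<close> of a coordinate.\<close>

theorem mom_affine:
  assumes "\<And>i. 1 \<le> i \<Longrightarrow> i < j \<Longrightarrow> y i = y' i" "j \<ge> 1"
  shows "mom E y j - mom E y' j = slope E y j * (y j - y' j)"
proof -
  have set: "{i. 0 < i \<and> 2 * i < 2 * j} = {1..<j}" by auto
  have jp: "jac_param E y i = jac_param E y' i" if "1 \<le> i" "i < (if E = Real_Line then j else 2 * j)" for i
    using jac_param_cong[of j y y' i E] assms(1) that by blast
  show ?thesis
  proof (cases E)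
    case Unit_Interval
    have "mom E y j - mom E y' j = (jac_param E y (2 * j) - jac_param E y' (2 * j)) *
        (\<Prod>i\<in>{1..<j}. jac_param E y (2 * i))"
      unfolding set[symmetric] using paths_diff[of "2 * j" "jac_param E y" "jac_param E y'" "2 * j" 0] jp assms(2)
      by (simp add: mom_def Unit_Interval)
    also have "jac_param E y (2 * j) - jac_param E y' (2 * j) = (if j = 1 then 1 else 1 - y (j - 1)) * (y j - y' j)"
      using assms by (auto simp: Unit_Interval algebra_simps)
    finally show ?thesis
      using prod_unit_params[OF assms(2), of y] by (simp add: Unit_Interval mult_ac)
  next
    case Half_Line
    show ?thesis
      using paths_diff[of "2 * j" "jac_param E y" "jac_param E y'" "2 * j" 0] jp assms(2) set
      by (simp add: mom_def Half_Line slope_def mult_ac)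
  next
    case Real_Line
    show ?thesis
      using paths_diff[of j "jac_param E y" "jac_param E y'" j 0] jp assms(2) prod_even_eq_slope_Real[of y j]
      by (simp add: mom_def Real_Line mult_ac)
  qed
qed

section \<open>Admissible coordinates and the triangular system\<close>

lemma wt_pos: "y \<in> coord_dom E j \<Longrightarrow> wt E j y > 0"
  by (cases E) auto

definition coords_ok :: "interval_kind \<Rightarrow> nat \<Rightarrow> rvec \<Rightarrow> bool" where
  "coords_ok E n y \<longleftrightarrow> (\<forall>j. 1 \<le> j \<and> j \<le> n \<longrightarrow> y j \<in> coord_dom E j)"

lemma coords_okD: "coords_ok E n y \<Longrightarrow> 1 \<le> j \<Longrightarrow> j \<le> n \<Longrightarrow> y j \<in> coord_dom E j"
  by (auto simp: coords_ok_def)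

lemma coords_ok_mono: "coords_ok E n y \<Longrightarrow> m \<le> n \<Longrightarrow> coords_ok E m y"
  by (auto simp: coords_ok_def)

lemma coords_ok_Suc: "coords_ok E (Suc n) y \<longleftrightarrow> coords_ok E n y \<and> y (Suc n) \<in> coord_dom E (Suc n)"
  by (auto simp: coords_ok_def le_Suc_eq)

lemma coords_ok_cong:
  "(\<And>i. 1 \<le> i \<Longrightarrow> i \<le> n \<Longrightarrow> y i = y' i) \<Longrightarrow> coords_ok E n y \<longleftrightarrow> coords_ok E n y'"
  by (auto simp: coords_ok_def)

lemma slope_pos: "coords_ok E n y \<Longrightarrow> j \<le> Suc n \<Longrightarrow> slope E y j > 0"
  unfolding slope_def by (rule prod_pos) (auto intro!: wt_pos coords_okD)

text \<open>
  In \<open>sol E K r\<close> the entry \<open>r j\<close> is the \<open>j\<close>-th moment for \<open>j \<in> K\<close>, and the \<open>j\<close>-th canonical coordinate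
  otherwise; the result is the sequence of canonical coordinates.
\<close>

primrec sol_seq :: "interval_kind \<Rightarrow> nat set \<Rightarrow> rvec \<Rightarrow> nat \<Rightarrow> nat \<Rightarrow> real" where
  "sol_seq E K r 0 = (\<lambda>_. 0)"
| "sol_seq E K r (Suc n) = (sol_seq E K r n)(Suc n :=
     if Suc n \<in> K then (r (Suc n) - mom E (sol_seq E K r n) (Suc n)) / slope E (sol_seq E K r n) (Suc n)
     else r (Suc n))"

text \<open>Entry \<open>j\<close> of \<open>sol_seq\<close> is final after step \<open>j\<close>,
  so the diagonal collects the solution for all indices at once.\<close>

definition sol :: "interval_kind \<Rightarrow> nat set \<Rightarrow> rvec \<Rightarrow> nat \<Rightarrow> real" where
  "sol E K r j = sol_seq E K r j j"

lemma sol_seq_beyond: "i > n \<Longrightarrow> sol_seq E K r n i = 0"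
  by (induction n) auto

lemma sol_seq_eq: "i \<le> n \<Longrightarrow> sol_seq E K r n i = sol E K r i"
proof (induction n)
  case (Suc n)
  thus ?case by (cases "i = Suc n") (auto simp: sol_def)
qed (simp add: sol_def)

lemma sol_eq:
  assumes "j \<ge> 1"
  shows "sol E K r j =
    (if j \<in> K then (r j - mom E ((sol E K r)(j := 0)) j) / slope E (sol E K r) j else r j)"
proof -
  obtain n where n: "j = Suc n" using assms by (cases j) auto
  have "mom E (sol_seq E K r n) j = mom E ((sol E K r)(j := 0)) j"
    by (rule mom_cong) (auto simp: n sol_seq_eq sol_seq_beyond)
  moreover have "slope E (sol_seq E K r n) j = slope E (sol E K r) j"
    by (rule slope_cong) (auto simp: n sol_seq_eq)
  moreover have "sol E K r j = sol_seq E K r (Suc n) (Suc n)" by (simp add: sol_def n)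
  ultimately show ?thesis by (simp add: n)
qed

lemma sol_unique:
  assumes "\<And>i. 1 \<le> i \<Longrightarrow> i \<le> n \<Longrightarrow>
      y i = (if i \<in> K then (r i - mom E (y(i := 0)) i) / slope E y i else r i)"
    and "1 \<le> i" "i \<le> n"
  shows "sol E K r i = y i"
  using assms(2,3)
proof (induction i rule: less_induct)
  case (less i)
  have "mom E ((sol E K r)(i := 0)) i = mom E (y(i := 0)) i"
    by (rule mom_cong) (use less in auto)
  moreover have "slope E (sol E K r) i = slope E y i"
    by (rule slope_cong) (use less in auto)
  ultimately show ?case using sol_eq[of i E K r] assms(1)[of i] less.prems by simp
qed

lemma sol_cong:
  assumes "\<And>i. 1 \<le> i \<Longrightarrow> i \<le> j \<Longrightarrow> r i = r' i" "j \<ge> 1"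
  shows "sol E K r j = sol E K r' j"
  by (rule sol_unique[of j]) (use assms sol_eq[of _ E K r'] in auto)

text \<open>Only positivity of the slope at \<open>j\<close> enters, and this slope involves the
  coordinates below \<open>j\<close>. Hence \<open>j = Suc n\<close> is covered before the
  coordinate \<open>Suc n\<close> is known to be admissible, which drives the inductions on the
  interior of the moment space.\<close>

lemma mom_sol:
  assumes "coords_ok E n (sol E K r)" "1 \<le> j" "j \<le> Suc n" "j \<in> K"
  shows "mom E (sol E K r) j = r j"
proof -
  have "slope E (sol E K r) j > 0" using slope_pos[OF assms(1,3)] .
  moreover have "mom E (sol E K r) j - mom E ((sol E K r)(j := 0)) j = slope E (sol E K r) j * sol E K r j"
    using mom_affine[of j "sol E K r" "(sol E K r)(j := 0)" E] assms(2) by simp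
  ultimately show ?thesis using sol_eq[of j E K r] assms(2,4) by (simp add: field_simps)
qed

lemma sol_mom:
  assumes "coords_ok E n y" "\<And>i. 1 \<le> i \<Longrightarrow> i \<le> n \<Longrightarrow> r i = (if i \<in> K then mom E y i else y i)"
    and "1 \<le> i" "i \<le> n"
  shows "sol E K r i = y i"
proof (rule sol_unique[OF _ assms(3,4)])
  fix i assume i: "1 \<le> i" "i \<le> n"
  have "slope E y i > 0" using slope_pos[OF assms(1)] i by simp
  moreover have "mom E y i - mom E (y(i := 0)) i = slope E y i * y i"
    using mom_affine[of i y "y(i := 0)" E] i by simp
  ultimately show "y i = (if i \<in> K then (r i - mom E (y(i := 0)) i) / slope E y i else r i)"
    using assms(2)[OF i] by (simp add: field_simps)
qed

section \<open>Moments of finitely supported measures\<close>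

text \<open>The symmetrized Jacobi matrix of the recurrence coefficients \<open>y\<close>, with rows
  counted from \<open>0\<close>.\<close>

definition jacm :: "rvec \<Rightarrow> nat \<Rightarrow> nat \<Rightarrow> real" where
  "jacm y i j = (if i = j then y (2 * i + 1) else if j = Suc i then sqrt (y (2 * j))
     else if i = Suc j then sqrt (y (2 * i)) else 0)"

lemma mvn_jacm:
  assumes "h < N"
  shows "mvn N (jacm y) v h = (if h = 0 then 0 else sqrt (y (2 * h)) * v (h - 1)) + y (2 * h + 1) * v h
     + (if Suc h < N then sqrt (y (2 * h + 2)) * v (Suc h) else 0)"
proof -
  have "mvn N (jacm y) v h = (\<Sum>j<N. (if j = h then y (2 * h + 1) * v h else 0)
      + (if j = Suc h then sqrt (y (2 * h + 2)) * v (Suc h) else 0)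
      + (if Suc j = h then sqrt (y (2 * h)) * v (h - 1) else 0))"
    unfolding mvn_def jacm_def by (intro sum.cong refl) auto
  also have "... = (\<Sum>j<N. if j = h then y (2 * h + 1) * v h else 0)
      + (\<Sum>j<N. if j = Suc h then sqrt (y (2 * h + 2)) * v (Suc h) else 0)
      + (\<Sum>j<N. if Suc j = h then sqrt (y (2 * h)) * v (h - 1) else 0)"
    by (simp add: sum.distrib)
  also have "(\<Sum>j<N. if Suc j = h then sqrt (y (2 * h)) * v (h - 1) else 0)
      = (if h = 0 then 0 else sqrt (y (2 * h)) * v (h - 1))"
  proof (cases h)
    case (Suc h')
    thus ?thesis using assms by (simp add: sum.delta)
  qed simp
  finally show ?thesis using assms by (simp add: algebra_simps)
qed

text \<open>Gauss quadrature: the nodes are the eigenvalues of the truncated Jacobi matrix, the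
  weights the squared first entries of its eigenvectors. Since \<open>y (2 * N)\<close> vanishes, no
  path of nonzero weight returns from height \<open>N\<close>, so the truncation is exact for
  moments of every order.\<close>

lemma jacobi_spectral:
  assumes "N \<ge> 1" "\<And>i. 1 \<le> i \<Longrightarrow> i < N \<Longrightarrow> y (2 * i) \<ge> 0" "y (2 * N) = 0"
  obtains lam :: rvec and w where "orthonormal_upto N N w"
    "\<And>k i. k < N \<Longrightarrow> i < N \<Longrightarrow> mvn N (jacm y) (w k) i = lam k * w k i"
    "\<And>n. paths y n 0 = (\<Sum>k<N. (w k 0)\<^sup>2 * lam k ^ n)"
proof -
  have "jacm y i j = jacm y j i" for i j by (auto simp: jacm_def)
  then obtain lam w where on: "orthonormal_upto N N w"
    and ev: "\<And>k i. k < N \<Longrightarrow> i < N \<Longrightarrow> mvn N (jacm y) (w k) i = lam k * w k i"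
    using spectral_decomposition[of N "jacm y"] by metis
  \<comment> \<open>Spectral form of the entry \<open>h\<close> of the \<open>n\<close>-th matrix
    power applied to the first unit vector.\<close>
  define a where "a = (\<lambda>n h. \<Sum>k<N. w k 0 * lam k ^ n * w k h)"
  \<comment> \<open>In a path sum the down steps carry the full weight; in the symmetric matrix up
    and down steps carry its square root each. \<open>s h\<close> is the resulting discrepancy for a
    path ending at height \<open>h\<close>.\<close>
  define s where "s = (\<lambda>h. \<Prod>i\<in>{1..h}. sqrt (y (2 * i)))"
  have aSuc: "a (Suc n) h = mvn N (jacm y) (a n) h" if "h < N" for n h
  proof -
    have "a (Suc n) h = (\<Sum>k<N. w k 0 * lam k ^ n * mvn N (jacm y) (w k) h)"
      using ev that by (simp add: a_def mult_ac)
    also have "... = (\<Sum>j<N. jacm y h j * (\<Sum>k<N. w k 0 * lam k ^ n * w k j))"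
      unfolding mvn_def sum_distrib_left by (subst sum.swap) (simp add: mult_ac)
    finally show ?thesis by (simp add: mvn_def a_def)
  qed
  have sSuc: "s (Suc h) = s h * sqrt (y (2 * h + 2))" for h by (simp add: s_def)
  have main: "a n h = paths y n h * s h" if "h < N" for n h
    using that
  proof (induction n arbitrary: h)
    case 0
    have "a 0 h = (\<Sum>k<N. w k 0 * w k h)" by (simp add: a_def)
    also have "... = (if 0 = h then 1 else 0)" using orthonormal_complete[OF on] 0 by simp
    finally show ?case by (simp add: s_def)
  next
    case (Suc n)
    have 1: "(if h = 0 then 0 else sqrt (y (2 * h)) * a n (h - 1)) = (if h = 0 then 0 else paths y n (h - 1)) * s h"
    proof (cases h)
      case (Suc h')
      thus ?thesis using Suc.IH[of h'] Suc.prems sSuc[of h'] by simp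
    qed simp
    have 2: "(if Suc h < N then sqrt (y (2 * h + 2)) * a n (Suc h) else 0) = y (2 * h + 2) * paths y n (h + 1) * s h"
    proof (cases "Suc h < N")
      case True
      have "y (2 * h + 2) \<ge> 0" using assms(2)[of "Suc h"] True by simp
      hence "sqrt (y (2 * h + 2)) * sqrt (y (2 * h + 2)) = y (2 * h + 2)" by simp
      moreover have "sqrt (y (2 * h + 2)) * (paths y n (h + 1) * (s h * sqrt (y (2 * h + 2))))
          = sqrt (y (2 * h + 2)) * sqrt (y (2 * h + 2)) * paths y n (h + 1) * s h" by simp
      ultimately show ?thesis using True Suc.IH[of "Suc h"] sSuc[of h] by simp
    next
      \<comment> \<open>At the top row the matrix has no entry for the step down from height
        \<open>N\<close>; the corresponding term of the path recursion vanishes because of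
        \<open>y (2 * N) = 0\<close>.\<close>
      case False
      hence "N = Suc h" using Suc.prems by simp
      thus ?thesis using assms(3) by simp
    qed
    show ?case unfolding aSuc[OF Suc.prems] mvn_jacm[OF Suc.prems] 1 2 Suc.IH[OF Suc.prems]
      by (simp add: algebra_simps)
  qed
  have "paths y n 0 = (\<Sum>k<N. (w k 0)\<^sup>2 * lam k ^ n)" for n
    using main[of 0 n] assms(1) by (simp add: s_def a_def power2_eq_square mult_ac)
  with on ev show thesis by (rule that)
qed

section \<open>Realizing moments by finitely supported measures\<close>

lemma prob_measuresD:
  assumes "\<mu> \<in> prob_measures E"
  shows "prob_space \<mu>" "space \<mu> = carrier_of E" "integrable \<mu> (\<lambda>x. x ^ j)"
  using assms by (auto simp: prob_measures_def space_restrict_space dest: sets_eq_imp_space_eq)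

lemma moment_0: "\<mu> \<in> prob_measures E \<Longrightarrow> moment 0 \<mu> = 1"
  using prob_measuresD(1) prob_space.prob_space by (fastforce simp: moment_def)

lemma finitely_supported_measure:
  fixes N :: nat
  assumes "\<And>k. k < N \<Longrightarrow> c k \<ge> 0" "(\<Sum>k<N. c k) = 1" "\<And>k. k < N \<Longrightarrow> g k \<in> carrier_of E"
  shows "\<exists>\<mu>\<in>prob_measures E. \<forall>j. moment j \<mu> = (\<Sum>k<N. c k * g k ^ j)"
proof -
  define M where "M = point_measure {..<N} (\<lambda>k. ennreal (c k))"
  define R where "R = restrict_space borel (carrier_of E)"
  define \<mu> where "\<mu> = distr M R g"
  have "(\<Sum>k<N. ennreal (c k)) = 1"
    using assms(1,2) by (subst sum_ennreal) auto
  hence prob: "prob_space M" unfolding M_def by (intro prob_space_point_measure) auto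
  have gm: "g \<in> M \<rightarrow>\<^sub>M R"
    unfolding M_def R_def
    by (rule measurableI) (use assms(3) in "auto simp: space_restrict_space space_point_measure sets_point_measure")
  have pw: "(\<lambda>x. x ^ j) \<in> borel_measurable R" for j
    unfolding R_def by (rule measurable_restrict_space1) measurable
  have int: "integrable M f" for f :: rvec
    unfolding M_def by (rule integrable_point_measure_finite) auto
  have "integrable \<mu> (\<lambda>x. x ^ j)" for j
    unfolding \<mu>_def by (subst integrable_distr_eq[OF gm pw]) (rule int)
  moreover have "prob_space \<mu>" unfolding \<mu>_def by (rule prob_space.prob_space_distr[OF prob gm])
  ultimately have "\<mu> \<in> prob_measures E" by (auto simp: prob_measures_def \<mu>_def R_def)
  moreover have "moment j \<mu> = (\<Sum>k<N. c k * g k ^ j)" for j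
    unfolding moment_def \<mu>_def using assms(1)
    by (subst integral_distr[OF gm pw], unfold M_def, subst lebesgue_integral_point_measure_finite) auto
  ultimately show ?thesis by blast
qed

text \<open>Closures of the coordinate domains. Their boundary values are the coordinates of
  extremal moments, so realizability has to cover them.\<close>

fun coord_cdom :: "interval_kind \<Rightarrow> nat \<Rightarrow> real set" where
  "coord_cdom Unit_Interval j = {0..1}"
| "coord_cdom Half_Line j = {0..}"
| "coord_cdom Real_Line j = (if odd j then UNIV else {0..})"

lemma coord_dom_subset_cdom: "coord_dom E j \<subseteq> coord_cdom E j"
  by (cases E) auto

lemma jac_param_nonneg:
  assumes "\<And>i. 1 \<le> i \<Longrightarrow> i \<le> n \<Longrightarrow> y i \<in> coord_cdom E i" "1 \<le> i" "i \<le> n" "E \<noteq> Real_Line"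
  shows "jac_param E y (2 * i) \<ge> 0"
proof (cases E)
  case Unit_Interval
  have "y i \<ge> 0" using assms(1)[OF assms(2,3)] Unit_Interval by simp
  moreover have "i > 1 \<Longrightarrow> y (i - 1) \<le> 1" using assms(1)[of "i - 1"] assms(2,3) Unit_Interval by simp
  ultimately show ?thesis using assms(2) by (auto simp: Unit_Interval intro!: mult_nonneg_nonneg)
qed (use assms in auto)

text \<open>
  With \<open>z\<^sub>i = (1 - p\<^bsub>i-1\<^esub>) p\<^sub>i\<close>, AM-GM bounds each off-diagonal term
  \<open>2 \<surd>z\<^sub>i v\<^bsub>i-1\<^esub> v\<^sub>i\<close> of the quadratic form by \<open>(1 - p\<^bsub>i-1\<^esub>) v\<^bsub>i-1\<^esub>\<^sup>2 + p\<^sub>i v\<^sub>i\<^sup>2\<close>, and these bounds telescope.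
\<close>

lemma unit_jacobi_eigenvalue_bound:
  assumes p: "\<And>i. i \<le> n \<Longrightarrow> 0 \<le> p i \<and> p i \<le> 1" and "p 0 = 0"
    and z: "\<And>i. i < n \<Longrightarrow> z (2 * i + 2) = (1 - p i) * p (Suc i)" "\<And>i. z (2 * i + 1) = 0"
    and v: "ipn (Suc n) v v = 1" "\<And>i. i < Suc n \<Longrightarrow> mvn (Suc n) (jacm z) v i = la * v i"
  shows "\<bar>la\<bar> \<le> 1"
proof -
  define q where "q = (\<Sum>i<n. sqrt (z (2 * i + 2)) * v i * v (Suc i))"
  have "la = ipn (Suc n) v (\<lambda>i. la * v i)" using v(1) by (simp add: ipn_scale_right)
  also have "... = ipn (Suc n) v (mvn (Suc n) (jacm z) v)" using v(2) by (intro ipn_cong) auto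
  also have "... = (\<Sum>h<Suc n. (if h = 0 then 0 else sqrt (z (2 * h)) * v (h - 1)) * v h)
      + (\<Sum>h<Suc n. (if Suc h < Suc n then sqrt (z (2 * h + 2)) * v (Suc h) else 0) * v h)"
    unfolding ipn_def sum.distrib[symmetric]
    by (intro sum.cong refl) (simp add: mvn_jacm z(2)[simplified] distrib_left mult.commute[of "v _"])
  also have "(\<Sum>h<Suc n. (if h = 0 then 0 else sqrt (z (2 * h)) * v (h - 1)) * v h) = q"
    by (subst sum.lessThan_Suc_shift) (simp add: q_def mult_ac)
  also have "(\<Sum>h<Suc n. (if Suc h < Suc n then sqrt (z (2 * h + 2)) * v (Suc h) else 0) * v h) = q"
    by (simp add: q_def mult_ac)
  finally have la: "la = 2 * q" by simp
  have amgm: "2 * \<bar>sqrt (z (2 * i + 2)) * v i * v (Suc i)\<bar> \<le> (1 - p i) * (v i)\<^sup>2 + p (Suc i) * (v (Suc i))\<^sup>2"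
    if "i < n" for i
  proof -
    define A B where "A = sqrt (1 - p i) * \<bar>v i\<bar>" and "B = sqrt (p (Suc i)) * \<bar>v (Suc i)\<bar>"
    have "0 \<le> (A - B)\<^sup>2" by simp
    hence "2 * (A * B) \<le> A\<^sup>2 + B\<^sup>2" by (simp add: power2_diff)
    moreover have "A * B = \<bar>sqrt (z (2 * i + 2)) * v i * v (Suc i)\<bar>"
      using z(1)[OF that] p[of i] p[of "Suc i"] that by (simp add: A_def B_def real_sqrt_mult abs_mult)
    moreover have "A\<^sup>2 = (1 - p i) * (v i)\<^sup>2" "B\<^sup>2 = p (Suc i) * (v (Suc i))\<^sup>2"
      using p[of i] p[of "Suc i"] that by (auto simp: A_def B_def power_mult_distrib)
    ultimately show ?thesis by simp
  qed
  have tele: "(\<Sum>i<m. (1 - p i) * (v i)\<^sup>2 + p (Suc i) * (v (Suc i))\<^sup>2) = (\<Sum>i<m. (v i)\<^sup>2) + p m * (v m)\<^sup>2" for m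
    by (induction m) (auto simp: assms(2) algebra_simps)
  have "\<bar>la\<bar> \<le> 2 * (\<Sum>i<n. \<bar>sqrt (z (2 * i + 2)) * v i * v (Suc i)\<bar>)"
    unfolding la abs_mult[of 2 q] using sum_abs[of "\<lambda>i. sqrt (z (2 * i + 2)) * v i * v (Suc i)" "{..<n}"]
    by (simp add: q_def)
  also have "... \<le> (\<Sum>i<n. (1 - p i) * (v i)\<^sup>2 + p (Suc i) * (v (Suc i))\<^sup>2)"
    unfolding sum_distrib_left by (intro sum_mono amgm) auto
  also have "... \<le> (\<Sum>i<n. (v i)\<^sup>2) + 1 * (v n)\<^sup>2"
    unfolding tele using p[of n] by (intro add_left_mono mult_right_mono) auto
  also have "... = 1" using v(1) by (simp add: ipn_def power2_eq_square)
  finally show ?thesis .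
qed

text \<open>Cutting the coefficients off after \<open>n\<close> makes the quadrature of size
  \<open>Suc n\<close> available without changing the first \<open>n\<close> moments. On the line
  its nodes are the eigenvalues; otherwise they are the squared eigenvalues, which undoes the
  substitution \<open>x = t^2\<close> and places them in the carrier, on the unit interval by
  \<open>unit_jacobi_eigenvalue_bound\<close>.\<close>

theorem mom_realizable:
  assumes "\<And>i. 1 \<le> i \<Longrightarrow> i \<le> n \<Longrightarrow> y i \<in> coord_cdom E i"
  shows "\<exists>\<mu>\<in>prob_measures E. \<forall>j\<le>n. moment j \<mu> = mom E y j"
proof (cases "E = Real_Line")
  case True
  define y' where "y' = (\<lambda>i. if i \<le> n then y i else 0)"
  obtain lam w where on: "orthonormal_upto (Suc n) (Suc n) w"
    and P: "\<And>k. paths y' k 0 = (\<Sum>i<Suc n. (w i 0)\<^sup>2 * lam i ^ k)"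
    by (rule jacobi_spectral[of "Suc n" y']) (use assms[of "2 * _"] True in "auto simp: y'_def split: if_splits")
  have "(\<Sum>i<Suc n. (w i 0)\<^sup>2) = 1" using P[of 0] by simp
  then obtain \<mu> where \<mu>: "\<mu> \<in> prob_measures E" "\<forall>j. moment j \<mu> = (\<Sum>k<Suc n. (w k 0)\<^sup>2 * lam k ^ j)"
    using finitely_supported_measure[of "Suc n" "\<lambda>i. (w i 0)\<^sup>2" lam E] True by auto
  have "mom E y j = paths y' j 0" if "j \<le> n" for j
  proof -
    have "mom E y j = mom E y' j" by (rule mom_cong) (use that in "simp add: y'_def")
    moreover have "jac_param Real_Line y' = y'" by auto
    ultimately show ?thesis using True by (simp add: mom_def)
  qed
  with \<mu> P show ?thesis by (intro bexI[of _ \<mu>]) auto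
next
  case False
  define z where "z = (\<lambda>i. if i \<le> 2 * n then jac_param E y i else 0)"
  have odd0: "z (2 * i + 1) = 0" for i using False by (cases E) (auto simp: z_def)
  obtain lam w where on: "orthonormal_upto (Suc n) (Suc n) w"
    and ev: "\<And>k i. k < Suc n \<Longrightarrow> i < Suc n \<Longrightarrow> mvn (Suc n) (jacm z) (w k) i = lam k * w k i"
    and P: "\<And>k. paths z k 0 = (\<Sum>i<Suc n. (w i 0)\<^sup>2 * lam i ^ k)"
    by (rule jacobi_spectral[of "Suc n" z])
       (use jac_param_nonneg[OF assms _ _ False] in "auto simp: z_def")
  have car: "(lam k)\<^sup>2 \<in> carrier_of E" if "k < Suc n" for k
  proof (cases E)
    case Unit_Interval
    define p where "p = (\<lambda>i. if i = 0 then 0 else y i)"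
    have "\<bar>lam k\<bar> \<le> 1"
    proof (rule unit_jacobi_eigenvalue_bound[of n p z "w k"])
      show "0 \<le> p i \<and> p i \<le> 1" if "i \<le> n" for i
        using assms[of i] that Unit_Interval by (auto simp: p_def)
      show "z (2 * i + 2) = (1 - p i) * p (Suc i)" if "i < n" for i
        using that by (auto simp: z_def p_def Unit_Interval)
      show "ipn (Suc n) (w k) (w k) = 1" using on \<open>k < Suc n\<close> by (auto simp: orthonormal_upto_def)
    qed (use odd0 ev that in "auto simp: p_def")
    thus ?thesis using Unit_Interval by (simp add: abs_square_le_1)
  qed (use False in auto)
  have "(\<Sum>i<Suc n. (w i 0)\<^sup>2) = 1" using P[of 0] by simp
  then obtain \<mu> where \<mu>: "\<mu> \<in> prob_measures E" "\<forall>j. moment j \<mu> = (\<Sum>k<Suc n. (w k 0)\<^sup>2 * ((lam k)\<^sup>2) ^ j)"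
    using finitely_supported_measure[of "Suc n" "\<lambda>i. (w i 0)\<^sup>2" "\<lambda>i. (lam i)\<^sup>2" E] car by auto
  have "mom E y j = paths z (2 * j) 0" if "j \<le> n" for j
    using False that paths_cong[of "2 * n + 1" "jac_param E y" z "2 * j" 0] by (simp add: mom_def z_def)
  with \<mu> P show ?thesis by (intro bexI[of _ \<mu>]) (auto simp: power_mult)
qed

section \<open>Extremal moments\<close>

lemma integral_poly_moments:
  assumes "\<mu> \<in> prob_measures E"
  shows "(\<integral>x. (\<Sum>i\<le>n. c i * x ^ i) \<partial>\<mu>) = (\<Sum>i\<le>n. c i * moment i \<mu>)"
  using prob_measuresD(3)[OF assms] by (simp add: moment_def)

lemma poly_as_sum_upto: "Polynomial.degree Q \<le> n \<Longrightarrow> poly Q x = (\<Sum>i\<le>n. Polynomial.coeff Q i * x ^ i)"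
  for x :: real
  unfolding poly_altdef by (rule sum.mono_neutral_left) (auto simp: coeff_eq_0)

lemma paths_odd_eq_0:
  assumes "\<And>i. y (2 * i + 1) = 0" "odd (k + h)"
  shows "paths y k h = 0"
  using assms(2)
proof (induction k arbitrary: h)
  case (Suc k)
  have "paths y k (h + 1) = 0" using Suc by simp
  moreover have "h \<noteq> 0 \<Longrightarrow> paths y k (h - 1) = 0" using Suc by (cases h) auto
  ultimately show ?case using assms(1)[of h] by simp
qed (auto simp: odd_pos)

lemma sum_up_to_even:
  fixes f :: rvec
  assumes "\<And>i. odd i \<Longrightarrow> f i = 0"
  shows "(\<Sum>i\<le>2 * n. f i) = (\<Sum>i\<le>n. f (2 * i))"
proof (induction n)
  case (Suc n)
  have "(\<Sum>i\<le>2 * Suc n. f i) = (\<Sum>i\<le>2 * n. f i) + f (2 * n + 1) + f (2 * n + 2)" by simp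
  thus ?case using Suc assms[of "2 * n + 1"] by simp
qed simp

text \<open>The sum is the quadrature applied to \<open>Q\<close>, which sees \<open>Q\<close> at
  the nodes only.\<close>

lemma spectral_poly_sum:
  assumes "\<And>k. a k = (\<Sum>i<N. c i * lam i ^ k)" "\<And>i. i < N \<Longrightarrow> poly Q (lam i) = 0" "Polynomial.degree Q \<le> n"
  shows "(\<Sum>k\<le>n. Polynomial.coeff Q k * a k) = (0::real)"
proof -
  have "(\<Sum>k\<le>n. Polynomial.coeff Q k * a k) = (\<Sum>i<N. c i * poly Q (lam i))"
    unfolding assms(1) poly_as_sum_upto[OF assms(3)] sum_distrib_left by (subst sum.swap) (simp add: mult_ac)
  thus ?thesis using assms(2) by simp
qed

text \<open>Integrating a nonnegative polynomial to which the functional with moments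
  \<open>a\<close> assigns zero: the moments below \<open>n\<close> agree, so only the difference of
  the \<open>n\<close>-th moments survives, multiplied by the leading coefficient.\<close>

lemma moment_bound_Real:
  assumes "\<mu> \<in> prob_measures Real_Line" "\<And>i. i < n \<Longrightarrow> moment i \<mu> = a i"
    "Polynomial.degree Q \<le> n" "(\<Sum>k\<le>n. Polynomial.coeff Q k * a k) = 0" "\<And>x. poly Q x \<ge> 0"
  shows "Polynomial.coeff Q n * (moment n \<mu> - a n) \<ge> 0"
proof -
  have "0 \<le> (\<integral>x. poly Q x \<partial>\<mu>)" using assms(5) by simp
  also have "... = (\<Sum>i\<le>n. Polynomial.coeff Q i * moment i \<mu>)"
    unfolding poly_as_sum_upto[OF assms(3)] integral_poly_moments[OF assms(1)] ..
  also have "... = (\<Sum>i\<le>n. Polynomial.coeff Q i * a i) + Polynomial.coeff Q n * (moment n \<mu> - a n)"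
    using assms(2) by (cases n) (auto simp: lessThan_Suc_atMost[symmetric] algebra_simps)
  finally show ?thesis using assms(4) by simp
qed

text \<open>The even part of \<open>Q\<close> is a polynomial in \<open>t = x\<^sup>2\<close> that is nonnegative on the support of \<open>\<mu>\<close>.\<close>

lemma moment_bound_even:
  assumes "\<mu> \<in> prob_measures E" "E \<noteq> Real_Line" "\<And>i. i < n \<Longrightarrow> moment i \<mu> = a (2 * i)"
    "Polynomial.degree Q \<le> 2 * n" "(\<Sum>k\<le>2 * n. Polynomial.coeff Q k * a k) = 0" "\<And>k. odd k \<Longrightarrow> a k = 0"
    "\<And>x. x\<^sup>2 \<in> carrier_of E \<Longrightarrow> poly Q x \<ge> 0"
  shows "Polynomial.coeff Q (2 * n) * (moment n \<mu> - a (2 * n)) \<ge> 0"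
proof -
  have even: "(\<Sum>i\<le>n. Polynomial.coeff Q (2 * i) * t ^ i) \<ge> 0" if "t \<in> carrier_of E" for t
  proof -
    have t: "t \<ge> 0" using that assms(2) by (cases E) auto
    have "(\<Sum>i\<le>n. Polynomial.coeff Q (2 * i) * t ^ i)
        = (\<Sum>i\<le>n. Polynomial.coeff Q (2 * i) * ((sqrt t) ^ (2 * i) + (- sqrt t) ^ (2 * i)) / 2)"
      using t by (simp add: power_mult)
    also have "... = (\<Sum>i\<le>2 * n. Polynomial.coeff Q i * ((sqrt t) ^ i + (- sqrt t) ^ i) / 2)"
      by (rule sum_up_to_even[symmetric]) simp
    also have "... = (poly Q (sqrt t) + poly Q (- sqrt t)) / 2"
      unfolding poly_as_sum_upto[OF assms(4)]
      by (simp add: sum.distrib[symmetric] sum_divide_distrib distrib_left)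
    also have "... \<ge> 0" using assms(7)[of "sqrt t"] assms(7)[of "- sqrt t"] t that by simp
    finally show ?thesis .
  qed
  have "0 \<le> (\<integral>x. (\<Sum>i\<le>n. Polynomial.coeff Q (2 * i) * x ^ i) \<partial>\<mu>)"
    by (rule integral_nonneg_AE) (use even prob_measuresD(2)[OF assms(1)] in auto)
  also have "... = (\<Sum>i\<le>n. Polynomial.coeff Q (2 * i) * moment i \<mu>)"
    by (rule integral_poly_moments[OF assms(1)])
  also have "... = (\<Sum>i\<le>n. Polynomial.coeff Q (2 * i) * a (2 * i)) + Polynomial.coeff Q (2 * n) * (moment n \<mu> - a (2 * n))"
    using assms(3) by (cases n) (auto simp: lessThan_Suc_atMost[symmetric] algebra_simps)
  also have "(\<Sum>i\<le>n. Polynomial.coeff Q (2 * i) * a (2 * i)) = 0"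
    using sum_up_to_even[of "\<lambda>i. Polynomial.coeff Q i * a i" n] assms(5,6) by simp
  finally show ?thesis by simp
qed

definition square_node_poly :: "nat set \<Rightarrow> rvec \<Rightarrow> real poly" where
  "square_node_poly A lam = (\<Prod>k\<in>A. [:- lam k, 1:]\<^sup>2)"

lemma square_node_poly:
  assumes "finite A"
  shows "Polynomial.degree (square_node_poly A lam) = 2 * card A"
    "Polynomial.coeff (square_node_poly A lam) (2 * card A) = 1"
    "poly (square_node_poly A lam) x \<ge> 0" "k \<in> A \<Longrightarrow> poly (square_node_poly A lam) (lam k) = 0"
proof -
  show d: "Polynomial.degree (square_node_poly A lam) = 2 * card A"
    unfolding square_node_poly_def using assms
    by (subst degree_prod_eq_sum_degree) (auto simp: degree_power_eq)
  have "Polynomial.lead_coeff (square_node_poly A lam) = 1"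
    unfolding square_node_poly_def lead_coeff_prod lead_coeff_power by simp
  thus "Polynomial.coeff (square_node_poly A lam) (2 * card A) = 1" using d by simp
  show "poly (square_node_poly A lam) x \<ge> 0"
    unfolding square_node_poly_def poly_prod by (rule prod_nonneg) simp
  show "k \<in> A \<Longrightarrow> poly (square_node_poly A lam) (lam k) = 0"
    unfolding square_node_poly_def poly_prod using assms by (intro prod_zero) auto
qed

lemma jac_param_Real [simp]: "jac_param Real_Line y = y"
  by auto

text \<open>For \<open>y n = 0\<close> the moments \<open>mom E y\<close> belong to a quadrature
  with so few nodes that the monic product of squares vanishing at all of them has exactly the
  degree matching the \<open>n\<close>-th moment. Its nonnegativity gives the bound. On the line the
  \<open>n\<close>-th moment has a minimum of this kind only for even \<open>n\<close>.\<close>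

theorem moment_lower_bound:
  assumes "\<And>i. 1 \<le> i \<Longrightarrow> i < n \<Longrightarrow> y i \<in> coord_cdom E i" "n \<ge> 1" "y n = 0" "E = Real_Line \<Longrightarrow> even n"
    and \<mu>: "\<mu> \<in> prob_measures E" "\<And>i. 1 \<le> i \<Longrightarrow> i < n \<Longrightarrow> moment i \<mu> = mom E y i"
  shows "moment n \<mu> \<ge> mom E y n"
proof -
  have m: "moment i \<mu> = mom E y i" if "i < n" for i
    using \<mu>(2) that moment_0[OF \<mu>(1)] by (cases "i = 0") (auto simp: mom_0)
  show ?thesis
  proof (cases "E = Real_Line")
    case True
    then obtain r where r: "n = 2 * r" "r \<ge> 1" using assms(2,4) by (auto elim: evenE)
    obtain lam w where P: "\<And>k. paths y k 0 = (\<Sum>i<r. (w i 0)\<^sup>2 * lam i ^ k)"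
      by (rule jacobi_spectral[of r y]) (use assms(1)[of "2 * _"] assms(3) True r in auto)
    let ?Q = "square_node_poly {..<r} lam"
    have "0 \<le> Polynomial.coeff ?Q n * (moment n \<mu> - paths y n 0)"
    proof (rule moment_bound_Real)
      show "(\<Sum>k\<le>n. Polynomial.coeff ?Q k * paths y k 0) = 0"
        using square_node_poly[where A = "{..<r}" and lam = lam] r
        by (intro spectral_poly_sum[where N = r and c = "\<lambda>i. (w i 0)\<^sup>2" and lam = lam] P) auto
    qed (use \<mu>(1) True m square_node_poly[where A = "{..<r}" and lam = lam] r in "auto simp: mom_def")
    thus ?thesis using square_node_poly(2)[where A = "{..<r}" and lam = lam] True r by (simp add: mom_def)
  next
    case False
    define z where "z = (\<lambda>i. if i < 2 * n then jac_param E y i else 0)"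
    have odd0: "z (2 * i + 1) = 0" for i using False by (cases E) (auto simp: z_def)
    have nn: "z (2 * i) \<ge> 0" if "1 \<le> i" "i < n" for i
      using jac_param_nonneg[of "n - 1" y E i] assms(1) that False by (auto simp: z_def)
    obtain lam w where P: "\<And>k. paths z k 0 = (\<Sum>i<n. (w i 0)\<^sup>2 * lam i ^ k)"
      by (rule jacobi_spectral[of n z]) (use assms(2) nn in "auto simp: z_def")
    \<comment> \<open>The truncation removes the parameter with index \<open>2 * n\<close>, which is
      zero anyway since it has the factor \<open>y n\<close>.\<close>
    have jz: "jac_param E y i = z i" if "i < Suc (2 * n)" for i
    proof (cases "i = 2 * n")
      case True
      thus ?thesis using assms(2,3) False by (cases E) (auto simp: z_def)
    qed (use that in "auto simp: z_def")
    have mz: "mom E y j = paths z (2 * j) 0" if "j \<le> n" for j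
      using False that paths_cong[of "Suc (2 * n)" "jac_param E y" z "2 * j" 0] jz by (simp add: mom_def)
    let ?Q = "square_node_poly {..<n} lam"
    have "0 \<le> Polynomial.coeff ?Q (2 * n) * (moment n \<mu> - paths z (2 * n) 0)"
    proof (rule moment_bound_even)
      show "(\<Sum>k\<le>2 * n. Polynomial.coeff ?Q k * paths z k 0) = 0"
        using square_node_poly[where A = "{..<n}" and lam = lam]
        by (intro spectral_poly_sum[where N = n and c = "\<lambda>i. (w i 0)\<^sup>2" and lam = lam] P) auto
      show "paths z k 0 = 0" if "odd k" for k
        using paths_odd_eq_0[of z k 0] odd0 that by simp
    qed (use \<mu>(1) False m mz square_node_poly[where A = "{..<n}" and lam = lam] in auto)
    thus ?thesis using square_node_poly(2)[where A = "{..<n}" and lam = lam] mz[of n] by simp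
  qed
qed

text \<open>By symmetry an eigenvector for a value missing from the list would be orthogonal to a
  complete orthonormal system.\<close>

lemma eigenvalue_of_eigenvector:
  assumes sym: "\<And>i j. i < N \<Longrightarrow> j < N \<Longrightarrow> A i j = A j i"
    and on: "orthonormal_upto N N w"
    and ev: "\<And>k i. k < N \<Longrightarrow> i < N \<Longrightarrow> mvn N A (w k) i = lam k * w k i"
    and v: "\<And>i. i < N \<Longrightarrow> mvn N A v i = c * v i" "j < N" "v j \<noteq> 0"
  shows "\<exists>k<N. lam k = c"
proof (rule ccontr)
  assume neg: "\<not> ?thesis"
  have "ipn N (w k) v = 0" if "k < N" for k
  proof -
    have "c * ipn N (w k) v = ipn N (w k) (mvn N A v)"
      unfolding ipn_scale_right[symmetric] using v(1) by (intro ipn_cong) auto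
    also have "... = ipn N (mvn N A (w k)) v" by (rule ipn_mvn_symmetric[OF sym])
    also have "... = lam k * ipn N (w k) v"
      unfolding ipn_scale_left[symmetric] using ev that by (intro ipn_cong) auto
    finally show ?thesis using neg that by auto
  qed
  hence "0 = (\<Sum>k<N. w k j * ipn N (w k) v)" by simp
  also have "... = (\<Sum>i<N. (\<Sum>k<N. w k j * w k i) * v i)"
    unfolding ipn_def sum_distrib_left sum_distrib_right by (subst sum.swap) (simp add: mult_ac)
  also have "... = (\<Sum>i<N. if i = j then v i else 0)"
    using orthonormal_complete[OF on] v(2) by (intro sum.cong refl) auto
  also have "... = v j" using v(2) by simp
  finally show False using v(3) by simp
qed

text \<open>
  If \<open>p\<^sub>n = 1\<close>, equality is attained in all the AM-GM estimates of \<open>unit_jacobi_eigenvalue_bound\<close>, which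
  gives an eigenvector for the eigenvalue \<open>1\<close>; alternating its signs, one for \<open>-1\<close>.
\<close>

lemma unit_jacobi_extremal_eigenvector:
  assumes p: "\<And>i. i \<le> n \<Longrightarrow> 0 \<le> p i \<and> p i \<le> 1" "\<And>i. 1 \<le> i \<Longrightarrow> i \<le> n \<Longrightarrow> p i > 0" "p 0 = 0" "p n = 1"
    and z: "\<And>i. i < n \<Longrightarrow> z (2 * i + 2) = (1 - p i) * p (Suc i)" "\<And>i. z (2 * i + 1) = 0"
    and \<sigma>: "\<sigma> = 1 \<or> \<sigma> = - 1"
  defines "v \<equiv> \<lambda>i. \<sigma> ^ i * (\<Prod>t<i. sqrt (1 - p t) / sqrt (p (Suc t)))"
  assumes "i < Suc n"
  shows "mvn (Suc n) (jacm z) v i = \<sigma> * v i"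
proof -
  have \<sigma>2: "\<sigma> * \<sigma> = 1" using \<sigma> by auto
  have rec: "sqrt (p (Suc t)) * v (Suc t) = \<sigma> * (sqrt (1 - p t) * v t)" if "t < n" for t
    using p(2)[of "Suc t"] that by (simp add: v_def)
  have left: "sqrt (z (2 * i)) * v (i - 1) = \<sigma> * (p i * v i)" if i0: "i \<noteq> 0"
  proof -
    obtain t where t: "i = Suc t" using i0 by (cases i) auto
    have pi: "p i \<ge> 0" "p t \<le> 1" using p(1)[of i] p(1)[of t] assms(9) t by auto
    have "sqrt (z (2 * i)) = sqrt (1 - p t) * sqrt (p i)"
      using z(1)[of t] t assms(9) by (simp add: real_sqrt_mult)
    hence "sqrt (z (2 * i)) * v (i - 1) = \<sigma> * \<sigma> * (sqrt (p i) * (sqrt (1 - p t) * v t))"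
      using t \<sigma>2 by simp
    also have "... = \<sigma> * (sqrt (p i) * (\<sigma> * (sqrt (1 - p t) * v t)))" by simp
    also have "... = \<sigma> * (sqrt (p i) * (sqrt (p i) * v i))" using rec[of t] t assms(9) by simp
    also have "... = \<sigma> * (p i * v i)" using pi by (simp add: mult.assoc[symmetric])
    finally show ?thesis .
  qed
  have right: "(if Suc i < Suc n then sqrt (z (2 * i + 2)) * v (Suc i) else 0) = \<sigma> * ((1 - p i) * v i)"
  proof (cases "i < n")
    case True
    have pi: "p i \<le> 1" using p(1)[of i] True by auto
    have "sqrt (z (2 * i + 2)) * v (Suc i) = sqrt (1 - p i) * (sqrt (p (Suc i)) * v (Suc i))"
      using z(1)[OF True] by (simp add: real_sqrt_mult)
    also have "... = \<sigma> * ((1 - p i) * v i)" using rec[OF True] pi by (simp add: mult.assoc[symmetric])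
    finally show ?thesis using True by simp
  next
    case False
    hence "i = n" using assms(9) by simp
    thus ?thesis using p(4) by simp
  qed
  show ?thesis
    unfolding mvn_jacm[OF assms(9)] right z(2)
    using left p(3) by (cases "i = 0") (auto simp: algebra_simps)
qed

text \<open>For \<open>y n = 1\<close> both \<open>1\<close> and \<open>- 1\<close> are eigenvalues,
  so \<open>1 - x^2\<close> times the squares for the remaining nodes vanishes at all nodes, is
  nonnegative on \<open>[- 1, 1]\<close>, and has leading coefficient \<open>- 1\<close>, which
  reverses the inequality. The coordinates below \<open>n\<close> are taken from the open domain
  because the explicit eigenvectors divide by their square roots.\<close>

theorem moment_upper_bound:
  assumes y: "\<And>i. 1 \<le> i \<Longrightarrow> i < n \<Longrightarrow> y i \<in> coord_dom Unit_Interval i" and "n \<ge> 1" "y n = 1"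
    and \<mu>: "\<mu> \<in> prob_measures Unit_Interval"
      "\<And>i. 1 \<le> i \<Longrightarrow> i < n \<Longrightarrow> moment i \<mu> = mom Unit_Interval y i"
  shows "moment n \<mu> \<le> mom Unit_Interval y n"
proof -
  let ?E = Unit_Interval
  have m: "moment i \<mu> = mom ?E y i" if "i < n" for i
    using \<mu>(2) that moment_0[OF \<mu>(1)] by (cases "i = 0") (auto simp: mom_0)
  define z where "z = (\<lambda>i. if i \<le> 2 * n then jac_param ?E y i else 0)"
  define p where "p = (\<lambda>i. if i = 0 then 0 else y i)"
  have p: "0 \<le> p i \<and> p i \<le> 1" "1 \<le> i \<Longrightarrow> p i > 0" if "i \<le> n" for i
    using y[of i] that assms(3) by (cases "i = n"; fastforce simp: p_def)+
  have pz: "z (2 * i + 2) = (1 - p i) * p (Suc i)" if "i < n" for i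
    using that by (auto simp: z_def p_def)
  have odd0: "z (2 * i + 1) = 0" for i by (auto simp: z_def)
  obtain lam w where on: "orthonormal_upto (Suc n) (Suc n) w"
    and ev: "\<And>k i. k < Suc n \<Longrightarrow> i < Suc n \<Longrightarrow> mvn (Suc n) (jacm z) (w k) i = lam k * w k i"
    and P: "\<And>k. paths z k 0 = (\<Sum>i<Suc n. (w i 0)\<^sup>2 * lam i ^ k)"
  proof (rule jacobi_spectral[of "Suc n" z])
    show "z (2 * i) \<ge> 0" if "1 \<le> i" "i < Suc n" for i
      using pz[of "i - 1"] p(1)[of "i - 1"] p(1)[of i] that by (cases i) auto
  qed (auto simp: z_def)
  have sym: "jacm z i j = jacm z j i" for i j by (auto simp: jacm_def)
  have eig: "\<exists>k<Suc n. lam k = \<sigma>" if "\<sigma> = 1 \<or> \<sigma> = - 1" for \<sigma>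
    by (rule eigenvalue_of_eigenvector[OF sym on ev, where j = 0,
          OF _ _ unit_jacobi_extremal_eigenvector[of n p z \<sigma>]])
       (use p pz odd0 that assms(2,3) in "auto simp: p_def")
  obtain k1 where k1: "k1 < Suc n" "lam k1 = 1" using eig by blast
  obtain k2 where k2: "k2 < Suc n" "lam k2 = - 1" using eig by blast
  have k12: "k1 \<noteq> k2" using k1 k2 by auto
  define A where "A = {..<Suc n} - {k1, k2}"
  have cA: "finite A" "card A = n - 1" using k1 k2 k12 by (auto simp: A_def)
  \<comment> \<open>Of the \<open>n + 1\<close> nodes two are simple zeros and \<open>n - 1\<close>
    are double zeros, which adds up to the degree \<open>2 * n\<close>.\<close>
  define Q where "Q = [:1, 0, - 1:] * square_node_poly A lam"
  have [simp]: "[:1, 0, - 1::real:] \<noteq> 0" "square_node_poly A lam \<noteq> 0"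
    using square_node_poly(2)[OF cA(1), of lam] by auto
  have dQ: "Polynomial.degree Q = 2 * n"
    unfolding Q_def using square_node_poly(1)[OF cA(1), of lam] cA(2) assms(2)
    by (subst degree_mult_eq) auto
  have "Polynomial.lead_coeff Q = - 1"
    unfolding Q_def lead_coeff_mult using square_node_poly(1,2)[OF cA(1), of lam] by simp
  hence lc: "Polynomial.coeff Q (2 * n) = - 1" using dQ by simp
  have Q0: "poly Q (lam k) = 0" if "k < Suc n" for k
  proof (cases "k \<in> A")
    case True
    thus ?thesis using square_node_poly(4)[OF cA(1)] by (simp add: Q_def)
  next
    case False
    hence "k = k1 \<or> k = k2" using that by (auto simp: A_def)
    thus ?thesis using k1 k2 by (auto simp: Q_def)
  qed
  have mz: "mom ?E y j = paths z (2 * j) 0" if "j \<le> n" for j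
    using that paths_cong[of "2 * n + 1" "jac_param ?E y" z "2 * j" 0] by (simp add: mom_def z_def)
  have "0 \<le> Polynomial.coeff Q (2 * n) * (moment n \<mu> - paths z (2 * n) 0)"
  proof (rule moment_bound_even)
    show "(\<Sum>k\<le>2 * n. Polynomial.coeff Q k * paths z k 0) = 0"
      using dQ Q0 by (intro spectral_poly_sum[where N = "Suc n" and c = "\<lambda>i. (w i 0)\<^sup>2" and lam = lam] P) auto
    show "paths z k 0 = 0" if "odd k" for k
      using paths_odd_eq_0[of z k 0] odd0 that by simp
    show "poly Q x \<ge> 0" if "x\<^sup>2 \<in> carrier_of ?E" for x
      unfolding Q_def poly_mult using square_node_poly(3)[OF cA(1)] that
      by (intro mult_nonneg_nonneg) (auto simp: power2_eq_square)
  qed (use \<mu>(1) m mz dQ in auto)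
  thus ?thesis using lc mz[of n] by simp
qed

section \<open>The interior of the moment spaces\<close>

lemma open_box:
  fixes U :: "rvec set"
  assumes "open U" "m \<in> U"
  shows "\<exists>e>0. \<forall>x. (\<forall>i. \<bar>x i - m i\<bar> < e) \<longrightarrow> x \<in> U"
proof -
  have "openin (product_topology (\<lambda>i. euclideanreal) UNIV) U"
    using assms(1) by (simp add: open_fun_def)
  from product_topology_open_contains_basis[OF this assms(2)]
  obtain X where X: "m \<in> PiE UNIV X" "\<And>i. open (X i)" "finite {i. X i \<noteq> UNIV}" "PiE UNIV X \<subseteq> U"
    by auto
  have "\<exists>e>0. \<forall>t. \<bar>t - m i\<bar> < e \<longrightarrow> t \<in> X i" for i
    using X(1) X(2)[of i] unfolding open_dist dist_real_def by (auto simp: PiE_iff)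
  then obtain e where e: "\<And>i. e i > 0" "\<And>i t. \<bar>t - m i\<bar> < e i \<Longrightarrow> t \<in> X i" by metis
  define d where "d = Min (insert 1 (e ` {i. X i \<noteq> UNIV}))"
  have "d > 0" unfolding d_def using X(3) e(1) by auto
  moreover have "x \<in> U" if "\<forall>i. \<bar>x i - m i\<bar> < d" for x
  proof -
    have "x i \<in> X i" for i
    proof (cases "X i = UNIV")
      case False
      hence "d \<le> e i" unfolding d_def using X(3) by (intro Min_le) auto
      thus ?thesis using that e(2)[of "x i" i] by (meson order.strict_trans2)
    qed auto
    thus ?thesis using X(4) by (auto simp: PiE_iff)
  qed
  ultimately show ?thesis by blast
qed

lemma topspace_Rn_top: "topspace (Rn_top n) = PiE {1..n} (\<lambda>_. UNIV)"
  by (simp add: Rn_top_def)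

lemma openin_box:
  assumes "openin (Rn_top n) U" "m \<in> U"
  shows "\<exists>e>0. \<forall>x\<in>PiE {1..n} (\<lambda>_. UNIV). (\<forall>i\<in>{1..n}. \<bar>x i - m i\<bar> < e) \<longrightarrow> x \<in> U"
proof -
  from product_topology_open_contains_basis[OF assms[unfolded Rn_top_def]]
  obtain X where X: "m \<in> PiE {1..n} X" "\<And>i. open (X i)" "PiE {1..n} X \<subseteq> U"
    by auto
  have "\<exists>e>0. \<forall>t. \<bar>t - m i\<bar> < e \<longrightarrow> t \<in> X i" if "i \<in> {1..n}" for i
    using X(1) X(2)[of i] that unfolding open_dist dist_real_def by (auto simp: PiE_iff)
  then obtain e where e: "\<And>i. i \<in> {1..n} \<Longrightarrow> e i > 0" "\<And>i t. i \<in> {1..n} \<Longrightarrow> \<bar>t - m i\<bar> < e i \<Longrightarrow> t \<in> X i" by metis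
  define d where "d = Min (insert 1 (e ` {1..n}))"
  have "d > 0" unfolding d_def using e(1) by auto
  moreover have "x \<in> U" if "x \<in> PiE {1..n} (\<lambda>_. UNIV)" "\<forall>i\<in>{1..n}. \<bar>x i - m i\<bar> < d" for x
  proof -
    have "x i \<in> X i" if i: "i \<in> {1..n}" for i
    proof -
      have "d \<le> e i" unfolding d_def using i by (intro Min_le) auto
      thus ?thesis using \<open>\<forall>i\<in>{1..n}. \<bar>x i - m i\<bar> < d\<close> e(2)[of i "x i"] i by (meson order.strict_trans2)
    qed
    hence "x \<in> PiE {1..n} X" using that(1) by (simp add: PiE_iff)
    thus ?thesis using X(3) by blast
  qed
  ultimately show ?thesis by blast
qed

text \<open>The inclusion of extensional vectors into all functions is continuous, since the
  coordinates outside \<open>{1..n}\<close> are constant. Openness can therefore be established for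
  total functions and transferred.\<close>

lemma openin_Rn_open:
  assumes "open U"
  shows "openin (Rn_top n) (U \<inter> PiE {1..n} (\<lambda>_. UNIV))"
proof -
  have "continuous_map (Rn_top n) euclideanreal (\<lambda>m. m i)" for i
  proof (cases "i \<in> {1..n}")
    case True
    thus ?thesis unfolding Rn_top_def by (intro continuous_map_product_projection)
  next
    case False
    thus ?thesis
      by (intro continuous_map_eq[of "Rn_top n" euclideanreal "\<lambda>_. undefined" "\<lambda>m. m i"])
         (auto simp: topspace_Rn_top PiE_iff extensional_def)
  qed
  hence "continuous_map (Rn_top n) (product_topology (\<lambda>i. euclideanreal) UNIV) (\<lambda>m. m)"
    by (subst continuous_map_componentwise_UNIV) auto
  hence "continuous_map (Rn_top n) euclidean (\<lambda>m. m)"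
    by (simp add: euclidean_product_topology)
  from openin_continuous_map_preimage[OF this, of U] assms
  show ?thesis by (simp add: topspace_Rn_top Collect_conj_eq Int_commute)
qed

section \<open>Continuity of the triangular solution\<close>

lemma continuous_on_paths:
  assumes "\<And>i. 1 \<le> i \<Longrightarrow> i \<le> k + h \<Longrightarrow> continuous_on S (\<lambda>r. f r i)"
  shows "continuous_on S (\<lambda>r. paths (f r) k h)"
  using assms
proof (induction k arbitrary: h)
  case (Suc k)
  have 1: "continuous_on S (\<lambda>r. if h = 0 then 0 else paths (f r) k (h - 1))"
    using Suc by (cases h) auto
  have 2: "continuous_on S (\<lambda>r. f r (2 * h + 1) * paths (f r) k h)"
  proof (cases "h \<le> k")
    case True
    thus ?thesis using Suc by (intro continuous_on_mult) auto
  qed (simp add: paths_eq_0)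
  have 3: "continuous_on S (\<lambda>r. f r (2 * h + 2) * paths (f r) k (h + 1))"
  proof (cases "h + 1 \<le> k")
    case True
    thus ?thesis using Suc.prems Suc.IH[of "h + 1"] by (intro continuous_on_mult) auto
  qed (simp add: paths_eq_0)
  show ?case unfolding paths.simps by (intro continuous_on_add 1 2 3)
qed simp

lemma continuous_on_mom:
  assumes "\<And>i. 1 \<le> i \<Longrightarrow> i \<le> j \<Longrightarrow> continuous_on S (\<lambda>r. f r i)"
  shows "continuous_on S (\<lambda>r. mom E (f r) j)"
  unfolding mom_def
proof (rule continuous_on_paths)
  fix i assume i: "1 \<le> i" "i \<le> (if E = Real_Line then j else 2 * j) + 0"
  show "continuous_on S (\<lambda>r. jac_param E (f r) i)"
  proof (cases E)
    case Unit_Interval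
    show ?thesis
    proof (cases "even i")
      case True
      then obtain t where t: "i = 2 * t" by blast
      hence tt: "1 \<le> t" "t \<le> j" using i Unit_Interval by auto
      have "continuous_on S (\<lambda>r. f r t)" using assms tt by simp
      moreover have "t \<noteq> 1 \<Longrightarrow> continuous_on S (\<lambda>r. f r (t - 1))" using assms tt by simp
      ultimately show ?thesis using t Unit_Interval
        by (cases "t = 1") (auto intro!: continuous_intros)
    qed (simp add: Unit_Interval)
  next
    case Half_Line
    show ?thesis using assms[of "i div 2"] i by (cases "even i") (auto simp: Half_Line elim!: evenE)
  qed (use assms i in auto)
qed

lemma continuous_on_wt:
  assumes "continuous_on S f"
  shows "continuous_on S (\<lambda>r. wt E j (f r))"
  by (cases E; cases "odd j") (auto intro!: continuous_intros assms)

lemma continuous_on_slope: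
  assumes "\<And>i. 1 \<le> i \<Longrightarrow> i < j \<Longrightarrow> continuous_on S (\<lambda>r. f r i)"
  shows "continuous_on S (\<lambda>r. slope E (f r) j)"
  unfolding slope_def by (intro continuous_on_prod continuous_on_wt assms) auto

definition sol_dom :: "interval_kind \<Rightarrow> nat set \<Rightarrow> nat \<Rightarrow> rvec set" where
  "sol_dom E K n = {r. coords_ok E n (sol E K r)}"

lemma continuous_on_sol:
  assumes "1 \<le> j" "j \<le> Suc n"
  shows "continuous_on (sol_dom E K n) (\<lambda>r. sol E K r j)"
  using assms
proof (induction j rule: less_induct)
  case (less j)
  have IH: "continuous_on (sol_dom E K n) (\<lambda>r. sol E K r i)" if "1 \<le> i" "i < j" for i
    using less.IH[of i] less.prems that by simp
  have "continuous_on (sol_dom E K n) (\<lambda>r. mom E ((sol E K r)(j := 0)) j)"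
  proof (rule continuous_on_mom)
    fix i assume "1 \<le> i" "i \<le> j"
    thus "continuous_on (sol_dom E K n) (\<lambda>r. ((sol E K r)(j := 0)) i)" using IH by (cases "i = j") auto
  qed
  moreover have "continuous_on (sol_dom E K n) (\<lambda>r. slope E (sol E K r) j)"
    by (rule continuous_on_slope) (rule IH)
  moreover have "slope E (sol E K r) j \<noteq> 0" if "r \<in> sol_dom E K n" for r
    using slope_pos[of E n "sol E K r" j] that less.prems by (auto simp: sol_dom_def)
  ultimately have "continuous_on (sol_dom E K n) (\<lambda>r. if j \<in> K then (r j - mom E ((sol E K r)(j := 0)) j) / slope E (sol E K r) j else r j)"
    by (cases "j \<in> K") (auto intro!: continuous_intros)
  thus ?case using sol_eq[OF less.prems(1)] by simp
qed

lemma open_coord_dom: "open (coord_dom E j)"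
  by (cases E) auto

text \<open>One coordinate at a time: the solution at \<open>Suc n\<close> divides by a slope that
  is known to be positive only on \<open>sol_dom E K n\<close>, so its continuity there presupposes
  openness of the previous set.\<close>

lemma open_sol_dom: "open (sol_dom E K n)"
proof (induction n)
  case 0
  show ?case by (simp add: sol_dom_def coords_ok_def)
next
  case (Suc n)
  have "sol_dom E K (Suc n) = sol_dom E K n \<inter> (\<lambda>r. sol E K r (Suc n)) -` coord_dom E (Suc n)"
    by (auto simp: sol_dom_def coords_ok_Suc)
  also have "open ..."
    by (rule continuous_open_preimage[OF continuous_on_sol Suc open_coord_dom]) auto
  finally show ?case .
qed

section \<open>Interior moments and admissible coordinates\<close>

lemma moment_vector_eqI:
  assumes "m \<in> PiE {1..n} (\<lambda>_. UNIV)" "\<And>j. 1 \<le> j \<Longrightarrow> j \<le> n \<Longrightarrow> moment j \<mu> = m j"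
  shows "moment_vector n \<mu> = m"
proof
  fix j show "moment_vector n \<mu> j = m j"
    using assms by (cases "j \<in> {1..n}") (auto simp: moment_vector_def PiE_iff extensional_def)
qed

lemma sol_dom_realizable:
  assumes "coords_ok E n (sol E UNIV m)"
  shows "\<exists>\<mu>\<in>prob_measures E. \<forall>j. 1 \<le> j \<and> j \<le> n \<longrightarrow> moment j \<mu> = m j"
proof -
  obtain \<mu> where \<mu>: "\<mu> \<in> prob_measures E" "\<forall>j\<le>n. moment j \<mu> = mom E (sol E UNIV m) j"
    using mom_realizable[of n "sol E UNIV m" E] coords_okD[OF assms] coord_dom_subset_cdom by blast
  thus ?thesis using mom_sol[OF assms] by (intro bexI[of _ \<mu>]) auto
qed

lemma sol_dom_subset_moment_space:
  "sol_dom E UNIV n \<inter> PiE {1..n} (\<lambda>_. UNIV) \<subseteq> moment_space E n"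
proof
  fix m assume m: "m \<in> sol_dom E UNIV n \<inter> PiE {1..n} (\<lambda>_. UNIV)"
  hence "coords_ok E n (sol E UNIV m)" by (simp add: sol_dom_def)
  then obtain \<mu> where "\<mu> \<in> prob_measures E" "\<forall>j. 1 \<le> j \<and> j \<le> n \<longrightarrow> moment j \<mu> = m j"
    using sol_dom_realizable[of E n m] by blast
  thus "m \<in> moment_space E n"
    using moment_vector_eqI[of m n \<mu>] m unfolding moment_space_def by blast
qed

text \<open>The bounds of \<open>moment_lower_bound\<close> and \<open>moment_upper_bound\<close>, solved for the last coordinate.\<close>

lemma sol_in_cdom:
  assumes "coords_ok E n (sol E UNIV m)"
    and \<mu>: "\<mu> \<in> prob_measures E" "\<And>i. 1 \<le> i \<Longrightarrow> i \<le> Suc n \<Longrightarrow> moment i \<mu> = m i"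
  shows "sol E UNIV m (Suc n) \<in> coord_cdom E (Suc n)"
proof -
  let ?y = "sol E UNIV m" and ?n = "Suc n"
  have sp: "slope E ?y ?n > 0" using slope_pos[OF assms(1)] by simp
  have m: "m ?n = mom E ?y ?n" using mom_sol[OF assms(1), of ?n] by simp
  have aff: "mom E ?y ?n - mom E (?y(?n := t)) ?n = slope E ?y ?n * (?y ?n - t)" for t
    using mom_affine[of ?n ?y "?y(?n := t)" E] by simp
  have eq: "moment i \<mu> = mom E (?y(?n := t)) i" if "1 \<le> i" "i < ?n" for i t
  proof -
    have "mom E (?y(?n := t)) i = mom E ?y i" by (rule mom_cong) (use that in auto)
    thus ?thesis using \<mu>(2)[of i] mom_sol[OF assms(1), of i] that by simp
  qed
  have dom: "(?y(?n := t)) i \<in> coord_dom E i" if "1 \<le> i" "i < ?n" for i t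
    using that coords_okD[OF assms(1), of i] by simp
  have lower: "?y ?n \<ge> 0" if "E = Real_Line \<Longrightarrow> even ?n"
  proof -
    have "moment ?n \<mu> \<ge> mom E (?y(?n := 0)) ?n"
      by (rule moment_lower_bound[OF _ _ _ that \<mu>(1)])
         (use subsetD[OF coord_dom_subset_cdom dom] eq in auto)
    hence "0 \<le> slope E ?y ?n * ?y ?n" using aff[of 0] m \<mu>(2)[of ?n] by simp
    thus ?thesis using sp by (simp add: zero_le_mult_iff)
  qed
  have upper: "?y ?n \<le> 1" if "E = Unit_Interval"
  proof -
    have "moment ?n \<mu> \<le> mom E (?y(?n := 1)) ?n"
      unfolding that
      by (rule moment_upper_bound) (use dom eq \<mu>(1) that in auto)
    hence "slope E ?y ?n * (?y ?n - 1) \<le> 0" using aff[of 1] m \<mu>(2)[of ?n] by simp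
    thus ?thesis using sp by (simp add: mult_le_0_iff)
  qed
  show ?thesis using lower upper by (cases E) auto
qed

text \<open>For an interior point the \<open>j\<close>-th moment can be moved both ways without
  leaving the moment space. The lower coordinates stay put and the \<open>j\<close>-th one moves by
  the displacement divided by the slope. Both displaced values lie in the closed domain, so the
  original value lies in the open one.\<close>

theorem interior_moment_space:
  "Rn_top n interior_of moment_space E n = sol_dom E UNIV n \<inter> PiE {1..n} (\<lambda>_. UNIV)"
proof (rule antisym)
  show "sol_dom E UNIV n \<inter> PiE {1..n} (\<lambda>_. UNIV) \<subseteq> Rn_top n interior_of moment_space E n"
    by (rule interior_of_maximal[OF sol_dom_subset_moment_space openin_Rn_open[OF open_sol_dom]])
next
  show "Rn_top n interior_of moment_space E n \<subseteq> sol_dom E UNIV n \<inter> PiE {1..n} (\<lambda>_. UNIV)"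
  proof
    fix m assume m: "m \<in> Rn_top n interior_of moment_space E n"
    have mext: "m \<in> PiE {1..n} (\<lambda>_. UNIV)"
      using subsetD[OF interior_of_subset_topspace m] by (simp add: topspace_Rn_top)
    obtain e where e0: "e > 0" "\<forall>x\<in>PiE {1..n} (\<lambda>_. UNIV). (\<forall>i\<in>{1..n}. \<bar>x i - m i\<bar> < e) \<longrightarrow>
        x \<in> Rn_top n interior_of moment_space E n"
      using openin_box[OF openin_interior_of m] by metis
    have e: "e > 0"
      "\<And>x. x \<in> PiE {1..n} (\<lambda>_. UNIV) \<Longrightarrow> (\<And>i. i \<in> {1..n} \<Longrightarrow> \<bar>x i - m i\<bar> < e) \<Longrightarrow> x \<in> moment_space E n"
      using e0 subsetD[OF interior_of_subset[of "Rn_top n" "moment_space E n"]] by simp_all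
    have "coords_ok E j (sol E UNIV m)" if "j \<le> n" for j
      using that
    proof (induction j)
      case 0
      show ?case by (simp add: coords_ok_def)
    next
      case (Suc j)
      hence IH: "coords_ok E j (sol E UNIV m)" by simp
      let ?y = "sol E UNIV m" and ?j = "Suc j"
      have sp: "slope E ?y ?j > 0" using slope_pos[OF IH] by simp
      have pert: "?y ?j + t / slope E ?y ?j \<in> coord_cdom E ?j" if t: "\<bar>t\<bar> < e" for t
      proof -
        define x where "x = m(?j := m ?j + t)"
        have "x \<in> moment_space E n" using mext Suc.prems t
          by (intro e(2)) (auto simp: x_def PiE_iff extensional_def \<open>e > 0\<close>)
        then obtain \<mu> where \<mu>: "\<mu> \<in> prob_measures E" "moment_vector n \<mu> = x"
          by (auto simp: moment_space_def)
        have mu: "moment i \<mu> = x i" if "1 \<le> i" "i \<le> ?j" for i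
          using \<mu>(2) that Suc.prems by (auto simp: moment_vector_def fun_eq_iff split: if_splits)
        have same: "sol E UNIV x i = ?y i" if "1 \<le> i" "i \<le> j" for i
          by (rule sol_cong) (use that in "auto simp: x_def")
        have "coords_ok E j (sol E UNIV x)"
          using IH coords_ok_cong[of j "sol E UNIV x" ?y E] same by simp
        hence "sol E UNIV x ?j \<in> coord_cdom E ?j" using sol_in_cdom \<mu>(1) mu by blast
        also have "sol E UNIV x ?j = ?y ?j + t / slope E ?y ?j"
        proof -
          have "mom E ((sol E UNIV x)(?j := 0)) ?j = mom E (?y(?j := 0)) ?j"
            by (rule mom_cong) (use same in auto)
          moreover have "slope E (sol E UNIV x) ?j = slope E ?y ?j"
            by (rule slope_cong) (use same in auto)
          ultimately show ?thesis using sol_eq[of ?j E UNIV x] sol_eq[of ?j E UNIV m]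
            by (simp add: x_def field_simps add_divide_distrib diff_divide_distrib)
        qed
        finally show ?thesis .
      qed
      define d where "d = (e / 2) / slope E ?y ?j"
      have d: "d > 0" using sp e(1) by (simp add: d_def)
      have "?y ?j + d \<in> coord_cdom E ?j" "?y ?j - d \<in> coord_cdom E ?j"
        using pert[of "e / 2"] pert[of "- (e / 2)"] e(1) by (auto simp: d_def)
      hence "?y ?j \<in> coord_dom E ?j" using d by (cases E) (auto split: if_splits)
      thus ?case using IH by (simp add: coords_ok_Suc)
    qed
    thus "m \<in> sol_dom E UNIV n \<inter> PiE {1..n} (\<lambda>_. UNIV)" using mext by (simp add: sol_dom_def)
  qed
qed

lemma relint_moment_space_eq:
  assumes "is_constraint C" "n \<ge> last_index C"
  shows "relint_moment_space E C n =
    {m \<in> PiE {1..n} (\<lambda>_. UNIV). coords_ok E n (sol E UNIV m) \<and> (\<forall>i c. C i = Some c \<longrightarrow> m i = c)}"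
proof -
  have dom: "1 \<le> i \<and> i \<le> n" if "C i = Some c" for i c
  proof -
    have "i \<in> dom C" using that by blast
    moreover have "i \<le> last_index C" unfolding last_index_def
      using assms(1) \<open>i \<in> dom C\<close> by (intro Max_ge) (auto simp: is_constraint_def)
    ultimately show ?thesis using assms by (cases i) (auto simp: is_constraint_def)
  qed
  show ?thesis
  proof (intro equalityI subsetI)
    fix m assume m: "m \<in> relint_moment_space E C n"
    then obtain \<mu> where "\<mu> \<in> prob_measures_constr E C" "m = moment_vector n \<mu>"
      by (auto simp: relint_moment_space_def moment_space_constr_def)
    moreover have "m \<in> sol_dom E UNIV n \<inter> PiE {1..n} (\<lambda>_. UNIV)"
      using m by (simp add: relint_moment_space_def interior_moment_space)
    ultimately show "m \<in> {m \<in> PiE {1..n} (\<lambda>_. UNIV). coords_ok E n (sol E UNIV m) \<and> (\<forall>i c. C i = Some c \<longrightarrow> m i = c)}"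
      using dom by (auto simp: prob_measures_constr_def moment_vector_def sol_dom_def)
  next
    fix m assume m: "m \<in> {m \<in> PiE {1..n} (\<lambda>_. UNIV). coords_ok E n (sol E UNIV m) \<and> (\<forall>i c. C i = Some c \<longrightarrow> m i = c)}"
    then obtain \<mu> where \<mu>: "\<mu> \<in> prob_measures E" "\<forall>j. 1 \<le> j \<and> j \<le> n \<longrightarrow> moment j \<mu> = m j"
      using sol_dom_realizable by blast
    hence "moment_vector n \<mu> = m" using m moment_vector_eqI by blast
    moreover have "\<mu> \<in> prob_measures_constr E C" using \<mu> m dom by (auto simp: prob_measures_constr_def)
    ultimately have "m \<in> moment_space_constr E C n" by (auto simp: moment_space_constr_def)
    thus "m \<in> relint_moment_space E C n"
      using m by (auto simp: relint_moment_space_def interior_moment_space sol_dom_def)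
  qed
qed

section \<open>Identification of the canonical coordinates\<close>

lemma moment_completion:
  assumes "coords_ok E n (sol E UNIV m)" "t \<in> coord_cdom E (Suc n)"
  shows "\<exists>\<mu>\<in>prob_measures E. (\<forall>i. 1 \<le> i \<and> i \<le> n \<longrightarrow> moment i \<mu> = m i)
    \<and> moment (Suc n) \<mu> = mom E ((sol E UNIV m)(Suc n := t)) (Suc n)"
proof -
  let ?y = "(sol E UNIV m)(Suc n := t)"
  obtain \<mu> where \<mu>: "\<mu> \<in> prob_measures E" "\<forall>j\<le>Suc n. moment j \<mu> = mom E ?y j"
  proof (rule bexE[OF mom_realizable[of "Suc n" ?y E]])
    fix i assume "1 \<le> i" "i \<le> Suc n"
    thus "?y i \<in> coord_cdom E i"
      using assms coords_okD[OF assms(1), of i] coord_dom_subset_cdom[of E i] by (cases "i = Suc n") auto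
  qed
  have "moment i \<mu> = m i" if "1 \<le> i" "i \<le> n" for i
  proof -
    have "mom E ?y i = mom E (sol E UNIV m) i" by (rule mom_cong) (use that in auto)
    thus ?thesis using \<mu>(2) that mom_sol[OF assms(1), of i] by simp
  qed
  thus ?thesis using \<mu> by blast
qed

text \<open>The moment at coordinate \<open>0\<close> is attained, by
  \<open>moment_completion\<close>, and is a lower bound, by \<open>moment_lower_bound\<close>; the
  least element is thus an actual minimum.\<close>

lemma min_moment_eq:
  assumes "coords_ok E n (sol E UNIV m)" "E \<noteq> Real_Line"
  shows "min_moment E m (Suc n) = mom E ((sol E UNIV m)(Suc n := 0)) (Suc n)"
proof -
  let ?y = "(sol E UNIV m)(Suc n := 0)"
  have "(LEAST t. t \<in> possible_moments E m (Suc n)) = mom E ?y (Suc n)"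
  proof (rule Least_equality)
    have "0 \<in> coord_cdom E (Suc n)" using assms(2) by (cases E) auto
    from moment_completion[OF assms(1) this] show "mom E ?y (Suc n) \<in> possible_moments E m (Suc n)"
      unfolding possible_moments_def by force
  next
    fix t assume "t \<in> possible_moments E m (Suc n)"
    then obtain \<mu> where \<mu>: "t = moment (Suc n) \<mu>" "\<mu> \<in> prob_measures E" "\<And>i. i \<in> {1..<Suc n} \<Longrightarrow> moment i \<mu> = m i"
      by (auto simp: possible_moments_def)
    show "mom E ?y (Suc n) \<le> t" unfolding \<mu>(1)
    proof (rule moment_lower_bound)
      show "?y i \<in> coord_cdom E i" if "1 \<le> i" "i < Suc n" for i
        using that coords_okD[OF assms(1), of i] coord_dom_subset_cdom[of E i] by auto
      show "moment i \<mu> = mom E ?y i" if "1 \<le> i" "i < Suc n" for i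
      proof -
        have "mom E ?y i = mom E (sol E UNIV m) i" by (rule mom_cong) (use that in auto)
        thus ?thesis using \<mu>(3)[of i] that mom_sol[OF assms(1), of i] by simp
      qed
    qed (use \<mu> assms in auto)
  qed
  thus ?thesis by (simp add: min_moment_def)
qed

lemma max_moment_eq:
  assumes "coords_ok Unit_Interval n (sol Unit_Interval UNIV m)"
  shows "max_moment Unit_Interval m (Suc n) = mom Unit_Interval ((sol Unit_Interval UNIV m)(Suc n := 1)) (Suc n)"
  unfolding max_moment_def
proof (rule Greatest_equality)
  let ?E = Unit_Interval
  let ?y = "(sol ?E UNIV m)(Suc n := 1)"
  from moment_completion[OF assms, of 1] show "mom ?E ?y (Suc n) \<in> possible_moments ?E m (Suc n)"
    unfolding possible_moments_def by force
  fix t assume "t \<in> possible_moments ?E m (Suc n)"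
  then obtain \<mu> where \<mu>: "t = moment (Suc n) \<mu>" "\<mu> \<in> prob_measures ?E" "\<And>i. i \<in> {1..<Suc n} \<Longrightarrow> moment i \<mu> = m i"
    by (auto simp: possible_moments_def)
  show "t \<le> mom ?E ?y (Suc n)" unfolding \<mu>(1)
  proof (rule moment_upper_bound)
    show "?y i \<in> coord_dom ?E i" if "1 \<le> i" "i < Suc n" for i
      using that coords_okD[OF assms, of i] by auto
    show "moment i \<mu> = mom ?E ?y i" if "1 \<le> i" "i < Suc n" for i
    proof -
      have "mom ?E ?y i = mom ?E (sol ?E UNIV m) i" by (rule mom_cong) (use that in auto)
      thus ?thesis using \<mu>(3)[of i] that mom_sol[OF assms, of i] by simp
    qed
  qed (use \<mu> in auto)
qed

text \<open>The distance of the \<open>j\<close>-th moment from its minimum is slope times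
  coordinate, which is the slope of the next index. The denominator is therefore the slope at
  \<open>Suc n\<close>; the convention for \<open>m_0\<close> and its minimum makes this true for
  the first index too.\<close>

lemma canon_coord_Half_Line:
  assumes "coords_ok Half_Line (Suc n) (sol Half_Line UNIV m)"
  shows "canon_coord Half_Line m (Suc n) = sol Half_Line UNIV m (Suc n)"
proof -
  let ?E = Half_Line
  let ?y = "sol ?E UNIV m"
  have ok: "coords_ok ?E n ?y" using assms coords_ok_mono by fastforce
  have gap: "m j - min_moment ?E m j = slope ?E ?y j * ?y j" if "1 \<le> j" "j \<le> Suc n" for j
  proof -
    obtain i where i: "j = Suc i" using \<open>1 \<le> j\<close> by (cases j) auto
    have "coords_ok ?E i ?y" using assms coords_ok_mono that i by fastforce
    from min_moment_eq[OF this] have "min_moment ?E m j = mom ?E (?y(j := 0)) j" by (simp add: i)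
    moreover have "m j = mom ?E ?y j" using mom_sol[OF ok, of j] that by simp
    ultimately show ?thesis using mom_affine[of j ?y "?y(j := 0)" ?E] that by simp
  qed
  have "(if Suc n = 1 then 1 else m (Suc n - 1)) - min_moment ?E m (Suc n - 1) = slope ?E ?y (Suc n)"
  proof (cases n)
    case 0
    thus ?thesis by (simp add: min_moment_def)
  next
    case (Suc k)
    thus ?thesis using gap[of n] slope_Suc[of n ?E ?y] by simp
  qed
  moreover have "slope ?E ?y (Suc n) > 0" using slope_pos[OF ok] by simp
  ultimately show ?thesis using gap[of "Suc n"] by simp
qed

text \<open>The distances to the two extremal moments, at the coordinates \<open>0\<close> and
  \<open>1\<close>, differ by exactly the slope, which is therefore the length of the admissible
  range.\<close>

lemma canon_coord_Unit_Interval: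
  assumes "coords_ok Unit_Interval (Suc n) (sol Unit_Interval UNIV m)"
  shows "canon_coord Unit_Interval m (Suc n) = sol Unit_Interval UNIV m (Suc n)"
proof -
  let ?E = Unit_Interval
  let ?y = "sol ?E UNIV m" and ?j = "Suc n"
  have ok: "coords_ok ?E n ?y" using assms coords_ok_mono by fastforce
  have m: "m ?j = mom ?E ?y ?j" using mom_sol[OF ok, of ?j] by simp
  have "m ?j - min_moment ?E m ?j = slope ?E ?y ?j * ?y ?j"
    using m min_moment_eq[OF ok] mom_affine[of ?j ?y "?y(?j := 0)" ?E] by simp
  moreover have "m ?j - max_moment ?E m ?j = slope ?E ?y ?j * (?y ?j - 1)"
    using m max_moment_eq[OF ok] mom_affine[of ?j ?y "?y(?j := 1)" ?E] by simp
  ultimately have "max_moment ?E m ?j - min_moment ?E m ?j = slope ?E ?y ?j"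
    by (simp add: algebra_simps)
  moreover have "slope ?E ?y ?j > 0" using slope_pos[OF ok] by simp
  ultimately show ?thesis using \<open>m ?j - min_moment ?E m ?j = slope ?E ?y ?j * ?y ?j\<close> by simp
qed

section \<open>Orthogonal polynomials of the path functional\<close>

fun orthp :: "rvec \<Rightarrow> nat \<Rightarrow> real poly" where
  "orthp y 0 = 1"
| "orthp y (Suc 0) = [:- y 1, 1:]"
| "orthp y (Suc (Suc h)) =
     [:- y (2 * h + 3), 1:] * orthp y (Suc h) - Polynomial.smult (y (2 * h + 2)) (orthp y h)"

lemma orthp_monic: "Polynomial.degree (orthp y h) = h \<and> Polynomial.lead_coeff (orthp y h) = 1"
proof (induction y h rule: orthp.induct)
  case (3 y h)
  let ?A = "[:- y (2 * h + 3), 1:] * orthp y (Suc h)"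
  let ?B = "Polynomial.smult (y (2 * h + 2)) (orthp y h)"
  have nz: "orthp y (Suc h) \<noteq> 0" using 3(1) by auto
  have dA: "Polynomial.degree ?A = Suc (Suc h)" using 3(1) nz by (subst degree_mult_eq) auto
  have dB: "Polynomial.degree ?B < Suc (Suc h)" using 3(2) degree_smult_le[of "y (2 * h + 2)" "orthp y h"] by simp
  have "Polynomial.degree (?A - ?B) = Suc (Suc h)"
    using degree_add_eq_left[of "- ?B" ?A] dA dB by simp
  moreover have "Polynomial.coeff (?A - ?B) (Suc (Suc h)) = 1"
  proof -
    have "Polynomial.coeff (orthp y (Suc h)) (Suc h) = 1" using 3(1) by metis
    moreover have "Polynomial.coeff (orthp y (Suc h)) (Suc (Suc h)) = 0" using 3(1) by (intro coeff_eq_0) auto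
    moreover have "Polynomial.coeff (orthp y h) (Suc (Suc h)) = 0" using 3(2) by (intro coeff_eq_0) auto
    ultimately show ?thesis by (simp add: coeff_pCons)
  qed
  ultimately show ?case by simp
qed auto

text \<open>The linear functional with moments \<open>paths y i 0\<close>. With it orthogonality
  becomes an algebraic identity that mentions no measure; a measure enters only through its finitely
  many matching moments.\<close>

definition momf :: "rvec \<Rightarrow> real poly \<Rightarrow> real" where
  "momf y Q = (\<Sum>i\<le>Polynomial.degree Q. Polynomial.coeff Q i * paths y i 0)"

lemma momf_upto: "Polynomial.degree Q \<le> n \<Longrightarrow> momf y Q = (\<Sum>i\<le>n. Polynomial.coeff Q i * paths y i 0)"
  unfolding momf_def by (rule sum.mono_neutral_left) (auto simp: coeff_eq_0)

lemma momf_add: "momf y (P + Q) = momf y P + momf y Q"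
  by (simp add: momf_upto[of _ "max (Polynomial.degree P) (Polynomial.degree Q)"] degree_add_le_max
      algebra_simps sum.distrib)

lemma momf_smult: "momf y (Polynomial.smult c Q) = c * momf y Q"
  by (simp add: momf_upto[of _ "Polynomial.degree Q"] degree_smult_le sum_distrib_left algebra_simps)

lemma momf_diff: "momf y (P - Q) = momf y P - momf y Q"
  using momf_add[of y P "Polynomial.smult (- 1) Q"] momf_smult[of y "- 1" Q] by simp

text \<open>Pairing \<open>x^k\<close> with the polynomial of degree \<open>h\<close> counts the
  paths ending at height \<open>h\<close>: the three-term recurrence of the polynomials mirrors the
  last-step recursion of the paths. Orthogonality follows since no path of fewer than
  \<open>h\<close> steps reaches height \<open>h\<close>.\<close>

lemma momf_monom_orthp:
  "momf y (Polynomial.monom 1 k * orthp y h) = paths y k h * (\<Prod>i\<in>{1..h}. y (2 * i))"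
proof (induction y h arbitrary: k rule: orthp.induct)
  case (1 y)
  show ?case by (simp add: momf_upto[of _ k] degree_monom_le if_distrib[of "\<lambda>a. a * _"] cong: if_cong)
next
  case (2 y)
  have "Polynomial.monom 1 k * orthp y (Suc 0)
      = Polynomial.monom 1 (Suc k) * orthp y 0 - Polynomial.smult (y 1) (Polynomial.monom 1 k * orthp y 0)"
    by (simp add: monom_Suc algebra_simps smult_monom add_monom)
  moreover have "momf y (Polynomial.monom 1 k * orthp y 0) = paths y k 0" for k
    by (simp add: momf_upto[of _ k] degree_monom_le if_distrib[of "\<lambda>a. a * _"] cong: if_cong)
  ultimately show ?case by (simp add: momf_diff momf_smult numeral_2_eq_2 del: orthp.simps)
next
  case (3 y h)
  define B where "B = (\<Prod>i\<in>{1..Suc h}. y (2 * i))"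
  have B: "y (2 * h + 2) * (\<Prod>i\<in>{1..h}. y (2 * i)) = B" by (simp add: B_def mult.commute)
  have B2: "(\<Prod>i\<in>{1..Suc (Suc h)}. y (2 * i)) = y (2 * h + 4) * B"
  proof -
    have "2 * Suc (Suc h) = 2 * h + 4" by simp
    thus ?thesis unfolding B_def by (subst prod.nat_ivl_Suc') (auto simp only: mult.commute)
  qed
  have "Polynomial.monom 1 k * orthp y (Suc (Suc h))
      = Polynomial.monom 1 (Suc k) * orthp y (Suc h)
        - Polynomial.smult (y (2 * h + 3)) (Polynomial.monom 1 k * orthp y (Suc h))
        - Polynomial.smult (y (2 * h + 2)) (Polynomial.monom 1 k * orthp y h)"
    by (simp add: monom_Suc algebra_simps)
  hence "momf y (Polynomial.monom 1 k * orthp y (Suc (Suc h)))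
      = paths y (Suc k) (Suc h) * B - y (2 * h + 3) * (paths y k (Suc h) * B)
        - y (2 * h + 2) * (paths y k h * (\<Prod>i\<in>{1..h}. y (2 * i)))"
    by (simp only: momf_diff momf_smult 3 B_def)
  also have "y (2 * h + 2) * (paths y k h * (\<Prod>i\<in>{1..h}. y (2 * i))) = paths y k h * B"
    by (simp add: B[symmetric])
  also have "paths y (Suc k) (Suc h) = paths y k h + y (2 * h + 3) * paths y k (Suc h) + y (2 * h + 4) * paths y k (Suc (Suc h))"
    by (simp add: numeral_eq_Suc)
  also have "... * B - y (2 * h + 3) * (paths y k (Suc h) * B) - paths y k h * B
      = paths y k (Suc (Suc h)) * (y (2 * h + 4) * B)"
    by (simp add: algebra_simps)
  finally show ?case unfolding B2 .
qed

lemma momf_sum: "finite A \<Longrightarrow> momf y (\<Sum>i\<in>A. f i) = (\<Sum>i\<in>A. momf y (f i))"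
  by (induction A rule: finite_induct) (auto simp: momf_add, simp add: momf_def)

lemma momf_mult_orthp:
  assumes "Polynomial.degree Q \<le> h"
  shows "momf y (Q * orthp y h) = Polynomial.coeff Q h * (\<Prod>i\<in>{1..h}. y (2 * i))"
proof -
  have "Q = (\<Sum>i\<le>h. Polynomial.smult (Polynomial.coeff Q i) (Polynomial.monom 1 i))"
    using poly_as_sum_of_monoms'[OF assms] by (simp add: smult_monom)
  hence "Q * orthp y h = (\<Sum>i\<le>h. Polynomial.smult (Polynomial.coeff Q i) (Polynomial.monom 1 i * orthp y h))"
    by (metis (no_types, lifting) mult_smult_left sum.cong sum_distrib_right)
  hence "momf y (Q * orthp y h) = (\<Sum>i\<le>h. Polynomial.coeff Q i * (paths y i h * (\<Prod>i\<in>{1..h}. y (2 * i))))"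
    by (simp add: momf_sum momf_smult momf_monom_orthp)
  also have "... = (\<Sum>i\<le>h. if i = h then Polynomial.coeff Q h * (\<Prod>i\<in>{1..h}. y (2 * i)) else 0)"
    by (intro sum.cong refl) (auto simp: paths_eq_0 paths_diag)
  finally show ?thesis by simp
qed

lemma integral_eq_momf:
  assumes "\<mu> \<in> prob_measures E" "\<And>i. 1 \<le> i \<Longrightarrow> i \<le> n \<Longrightarrow> moment i \<mu> = paths y i 0" "Polynomial.degree Q \<le> n"
  shows "(\<integral>x. poly Q x \<partial>\<mu>) = momf y Q"
proof -
  have "moment i \<mu> = paths y i 0" if "i \<le> n" for i
    using assms(2)[of i] that moment_0[OF assms(1)] by (cases "i = 0") auto
  thus ?thesis unfolding poly_as_sum_upto[OF assms(3)] integral_poly_moments[OF assms(1)] momf_upto[OF assms(3)]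
    by simp
qed

text \<open>Existence and uniqueness behind the definite description. Both involve products of a
  polynomial of degree at most \<open>j\<close> with one of degree below \<open>j\<close>, so the
  moments up to \<open>2 * j - 1\<close> suffice.\<close>

lemma monic_orth_poly_eq:
  assumes \<mu>: "\<mu> \<in> prob_measures E" "\<And>i. 1 \<le> i \<Longrightarrow> i \<le> 2 * j - 1 \<Longrightarrow> moment i \<mu> = paths y i 0"
    and pos: "\<And>i. 1 \<le> i \<Longrightarrow> i < j \<Longrightarrow> y (2 * i) > 0"
  shows "monic_orth_poly \<mu> j = orthp y j"
  unfolding monic_orth_poly_def
proof (rule the_equality)
  have orth: "(\<integral>x. poly (orthp y j) x * poly Q x \<partial>\<mu>) = 0" if "Polynomial.degree Q < j" for Q
  proof -
    have "Polynomial.degree (Q * orthp y j) \<le> 2 * j - 1"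
      using degree_mult_le[of Q "orthp y j"] that orthp_monic[of y j] by linarith
    hence "(\<integral>x. poly (Q * orthp y j) x \<partial>\<mu>) = momf y (Q * orthp y j)"
      using \<mu>(2) by (intro integral_eq_momf[OF \<mu>(1)]) auto
    hence "(\<integral>x. poly (orthp y j) x * poly Q x \<partial>\<mu>) = momf y (Q * orthp y j)"
      by (simp add: mult.commute)
    also have "... = 0" using that by (subst momf_mult_orthp) (auto simp: coeff_eq_0)
    finally show ?thesis .
  qed
  thus "Polynomial.degree (orthp y j) = j \<and> Polynomial.lead_coeff (orthp y j) = 1 \<and>
      (\<forall>Q. Polynomial.degree Q < j \<longrightarrow> (\<integral>x. poly (orthp y j) x * poly Q x \<partial>\<mu>) = 0)"
    using orthp_monic by blast
  fix P assume P: "Polynomial.degree P = j \<and> Polynomial.lead_coeff P = 1 \<and>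
      (\<forall>Q. Polynomial.degree Q < j \<longrightarrow> (\<integral>x. poly P x * poly Q x \<partial>\<mu>) = 0)"
  show "P = orthp y j"
  proof (rule ccontr)
    assume ne: "P \<noteq> orthp y j"
    define D where "D = P - orthp y j"
    have "D \<noteq> 0" using ne by (simp add: D_def)
    have "Polynomial.coeff D j = 0" using P orthp_monic[of y j] by (auto simp: D_def)
    moreover have "Polynomial.degree D \<le> j"
      using P orthp_monic[of y j] by (auto simp: D_def intro!: degree_diff_le)
    ultimately have dD: "Polynomial.degree D < j" using \<open>D \<noteq> 0\<close>
      by (metis leading_coeff_0_iff order_le_less)
    let ?e = "Polynomial.degree D"
    \<comment> \<open>Tested against the orthogonal polynomial of its own degree, the difference
      \<open>D\<close> gives its leading coefficient times a positive product, which cannot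
      vanish.\<close>
    define R where "R = orthp y ?e"
    have dR: "Polynomial.degree R < j" using dD orthp_monic by (simp add: R_def)
    have i1: "integrable \<mu> (\<lambda>x. poly Q x)" for Q
      using prob_measuresD(3)[OF \<mu>(1)] by (simp add: poly_altdef)
    have "(\<integral>x. poly (D * R) x \<partial>\<mu>) = (\<integral>x. poly (P * R) x \<partial>\<mu>) - (\<integral>x. poly (orthp y j * R) x \<partial>\<mu>)"
      unfolding D_def left_diff_distrib poly_diff by (rule Bochner_Integration.integral_diff[OF i1 i1])
    also have "... = 0" using P orth[OF dR] dR by simp
    finally have "(\<integral>x. poly (D * R) x \<partial>\<mu>) = 0" .
    moreover have "(\<integral>x. poly (D * R) x \<partial>\<mu>) = momf y (D * R)"
    proof (rule integral_eq_momf[OF \<mu>(1) \<mu>(2)])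
      show "Polynomial.degree (D * R) \<le> 2 * j - 1"
        using degree_mult_le[of D R] dD dR by linarith
    qed auto
    moreover have "momf y (D * R) = Polynomial.lead_coeff D * (\<Prod>i\<in>{1..?e}. y (2 * i))"
      unfolding R_def by (rule momf_mult_orthp) simp
    moreover have "(\<Prod>i\<in>{1..?e}. y (2 * i)) > 0"
      by (rule prod_pos) (use pos dD in auto)
    moreover have "Polynomial.lead_coeff D \<noteq> 0" using \<open>D \<noteq> 0\<close> by simp
    ultimately show False by (metis mult_eq_0_iff less_irrefl)
  qed
qed

text \<open>The subtracted term \<open>X\<close> has degree below \<open>h\<close>, so the
  coefficient at \<open>h\<close> of the recurrence determines \<alpha> whatever the other
  coefficient is.\<close>

lemma recurrence_alpha_eq:
  assumes \<mu>: "\<mu> \<in> prob_measures E" "\<And>i. 1 \<le> i \<Longrightarrow> i \<le> 2 * h + 1 \<Longrightarrow> moment i \<mu> = paths y i 0"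
    and pos: "\<And>i. 1 \<le> i \<Longrightarrow> i < Suc h \<Longrightarrow> y (2 * i) > 0"
  shows "recurrence_alpha \<mu> (Suc h) = y (2 * h + 1)"
proof -
  have P: "monic_orth_poly \<mu> i = orthp y i" if "i \<le> Suc h" for i
    by (rule monic_orth_poly_eq[OF \<mu>(1)]) (use that \<mu>(2) pos in auto)
  define X where "X = (if Suc h \<ge> 2 then orthp y (h - 1) else 0)"
  have X0: "Polynomial.coeff X h = 0"
    using orthp_monic[of y "h - 1"] by (auto simp: X_def intro!: coeff_eq_0)
  have rec: "orthp y (Suc h) = [:- y (2 * h + 1), 1:] * orthp y h - Polynomial.smult (y (2 * h)) X"
    by (cases h) (auto simp: X_def numeral_eq_Suc)
  have cf: "Polynomial.coeff ([:- a, 1:] * orthp y h - Polynomial.smult b X) h = - a + (if h = 0 then 0 else Polynomial.coeff (orthp y h) (h - 1))" for a b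
    using X0 orthp_monic[of y h] by (cases h) (auto simp: coeff_pCons)
  have "recurrence_alpha \<mu> (Suc h) =
      (THE a. \<exists>b. orthp y (Suc h) = [:- a, 1:] * orthp y h - Polynomial.smult b X)"
    unfolding recurrence_alpha_def using P by (auto simp: X_def numeral_2_eq_2)
  also have "... = y (2 * h + 1)"
  proof (rule the_equality)
    show "\<exists>b. orthp y (Suc h) = [:- y (2 * h + 1), 1:] * orthp y h - Polynomial.smult b X"
      using rec by blast
    fix a assume "\<exists>b. orthp y (Suc h) = [:- a, 1:] * orthp y h - Polynomial.smult b X"
    then obtain b where "orthp y (Suc h) = [:- a, 1:] * orthp y h - Polynomial.smult b X" ..
    hence "Polynomial.coeff ([:- a, 1:] * orthp y h - Polynomial.smult b X) h
        = Polynomial.coeff ([:- y (2 * h + 1), 1:] * orthp y h - Polynomial.smult (y (2 * h)) X) h"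
      using rec by (simp only:)
    thus "a = y (2 * h + 1)" unfolding cf by simp
  qed
  finally show ?thesis .
qed

text \<open>The coefficient with index \<open>Suc h\<close> is read off from the polynomial of
  degree \<open>h + 2\<close>, hence the moments up to \<open>2 * h + 3\<close>, although its value
  depends on those up to \<open>2 * h + 2\<close> only.\<close>

lemma recurrence_beta_eq:
  assumes \<mu>: "\<mu> \<in> prob_measures E" "\<And>i. 1 \<le> i \<Longrightarrow> i \<le> 2 * h + 3 \<Longrightarrow> moment i \<mu> = paths y i 0"
    and pos: "\<And>i. 1 \<le> i \<Longrightarrow> i \<le> Suc h \<Longrightarrow> y (2 * i) > 0"
  shows "recurrence_beta \<mu> (Suc h) = y (2 * h + 2)"
proof -
  have P: "monic_orth_poly \<mu> i = orthp y i" if "i \<le> Suc (Suc h)" for i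
    by (rule monic_orth_poly_eq[OF \<mu>(1)]) (use that \<mu>(2) pos in auto)
  have "recurrence_beta \<mu> (Suc h) =
      (THE b. \<exists>a. orthp y (Suc (Suc h)) = [:- a, 1:] * orthp y (Suc h) - Polynomial.smult b (orthp y h))"
    unfolding recurrence_beta_def using P by simp
  also have "... = y (2 * h + 2)"
  proof (rule the_equality)
    show "\<exists>a. orthp y (Suc (Suc h)) = [:- a, 1:] * orthp y (Suc h) - Polynomial.smult (y (2 * h + 2)) (orthp y h)"
      by auto
    fix b assume "\<exists>a. orthp y (Suc (Suc h)) = [:- a, 1:] * orthp y (Suc h) - Polynomial.smult b (orthp y h)"
    then obtain a where a: "orthp y (Suc (Suc h)) = [:- a, 1:] * orthp y (Suc h) - Polynomial.smult b (orthp y h)" ..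
    have lc: "Polynomial.coeff (orthp y h) h = 1" "Polynomial.coeff (orthp y (Suc h)) (Suc h) = 1"
        "Polynomial.coeff (orthp y h) (Suc h) = 0"
      using orthp_monic[of y h] orthp_monic[of y "Suc h"] by (auto intro: coeff_eq_0)
    have "Polynomial.coeff ([:- y (2 * h + 3), 1:] * orthp y (Suc h) - Polynomial.smult (y (2 * h + 2)) (orthp y h)) (Suc h)
        = Polynomial.coeff ([:- a, 1:] * orthp y (Suc h) - Polynomial.smult b (orthp y h)) (Suc h)"
      using a by (simp only: orthp.simps)
    hence "a = y (2 * h + 3)" using lc by (simp add: coeff_pCons)
    hence "Polynomial.coeff (Polynomial.smult b (orthp y h)) h = Polynomial.coeff (Polynomial.smult (y (2 * h + 2)) (orthp y h)) h"
      using a by simp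
    thus "b = y (2 * h + 2)" using lc by simp
  qed
  finally show ?thesis .
qed

text \<open>For even index the definition consults one moment beyond those that \<open>m\<close>
  prescribes, namely that of the measure selected by \<open>SOME\<close>. Its value is absorbed in a
  coordinate that does not influence the result.\<close>

lemma canon_coord_Real_Line:
  assumes "coords_ok Real_Line (Suc n) (sol Real_Line UNIV m)"
  shows "canon_coord Real_Line m (Suc n) = sol Real_Line UNIV m (Suc n)"
proof -
  let ?E = Real_Line
  let ?y = "sol ?E UNIV m" and ?j = "Suc n"
  define \<mu> where "\<mu> = (SOME \<mu>. \<mu> \<in> prob_measures ?E \<and> (\<forall>i\<in>{1..?j}. moment i \<mu> = m i))"
  have "\<exists>\<mu>. \<mu> \<in> prob_measures ?E \<and> (\<forall>i\<in>{1..?j}. moment i \<mu> = m i)"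
    using sol_dom_realizable[OF assms] by auto
  hence \<mu>: "\<mu> \<in> prob_measures ?E" "\<And>i. i \<in> {1..?j} \<Longrightarrow> moment i \<mu> = m i"
    unfolding \<mu>_def by (rule someI2_ex; blast)+
  have mom: "moment i \<mu> = paths ?y i 0" if "1 \<le> i" "i \<le> ?j" for i
    using \<mu>(2)[of i] mom_sol[OF assms, of i] that by (simp add: mom_def)
  have pos: "?y (2 * i) > 0" if "1 \<le> i" "2 * i \<le> ?j" for i
    using coords_okD[OF assms, of "2 * i"] that by simp
  show ?thesis
  proof (cases "odd ?j")
    case True
    then obtain h where h: "?j = 2 * h + 1" by (auto elim: oddE)
    have "recurrence_alpha \<mu> (Suc h) = ?y (2 * h + 1)"
      by (rule recurrence_alpha_eq[OF \<mu>(1)]) (use mom pos h in auto)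
    moreover have "canon_coord ?E m ?j = recurrence_alpha \<mu> ((?j + 1) div 2)"
      using True by (simp add: \<mu>_def Let_def)
    ultimately show ?thesis using h by simp
  next
    case False
    define h where "h = ?j div 2 - 1"
    have h: "?j = 2 * h + 2" using False unfolding h_def by presburger
    \<comment> \<open>The coordinate \<open>Suc ?j\<close> is chosen to fit the next moment of the
      selected measure. Its index is odd, so no positivity has to be checked for it.\<close>
    define v where "v = ?y(Suc ?j := (moment (Suc ?j) \<mu> - mom ?E (?y(Suc ?j := 0)) (Suc ?j)) / slope ?E ?y (Suc ?j))"
    have sp: "slope ?E ?y (Suc ?j) > 0" using slope_pos[OF assms] by simp
    have v1: "paths v i 0 = paths ?y i 0" if "i \<le> ?j" for i
      by (rule paths_cong[of "Suc ?j"]) (use that in "auto simp: v_def")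
    have "mom ?E v (Suc ?j) - mom ?E (?y(Suc ?j := 0)) (Suc ?j) = slope ?E v (Suc ?j) * v (Suc ?j)"
      using mom_affine[of "Suc ?j" v "?y(Suc ?j := 0)" ?E] by (simp add: v_def)
    moreover have "slope ?E v (Suc ?j) = slope ?E ?y (Suc ?j)" by (rule slope_cong) (auto simp: v_def)
    ultimately have "moment (Suc ?j) \<mu> = mom ?E v (Suc ?j)" using sp by (simp add: v_def)
    hence v2: "moment (Suc ?j) \<mu> = paths v (Suc ?j) 0" by (simp add: mom_def)
    have "recurrence_beta \<mu> (Suc h) = v (2 * h + 2)"
    proof (rule recurrence_beta_eq[OF \<mu>(1)])
      show "moment i \<mu> = paths v i 0" if "1 \<le> i" "i \<le> 2 * h + 3" for i
        using that h v1[of i] v2 mom[of i] by (cases "i = Suc ?j") auto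
      show "v (2 * i) > 0" if "1 \<le> i" "i \<le> Suc h" for i
        using that h pos[of i] by (auto simp: v_def)
    qed
    moreover have "canon_coord ?E m ?j = recurrence_beta \<mu> (?j div 2)"
      using False by (simp add: \<mu>_def Let_def)
    ultimately show ?thesis using h by (simp add: v_def)
  qed
qed

theorem canon_coord_eq_sol:
  assumes "coords_ok E j (sol E UNIV m)" "j \<ge> 1"
  shows "canon_coord E m j = sol E UNIV m j"
proof -
  obtain n where "j = Suc n" using assms(2) by (cases j) auto
  thus ?thesis using assms canon_coord_Half_Line canon_coord_Unit_Interval canon_coord_Real_Line
    by (cases E) auto
qed

section \<open>Second-order calculus along finitely many coordinates\<close>

text \<open>Differentiability along lines in the directions supported in \<open>I\<close>, with
  linear dependence on the direction. This needs no norm on the function space and suffices for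
  expansions along segments.\<close>

definition has_grad :: "nat set \<Rightarrow> (rvec \<Rightarrow> real) \<Rightarrow> rvec \<Rightarrow> rvec \<Rightarrow> bool" where
  "has_grad I f g x \<longleftrightarrow> (\<forall>v. (\<forall>i. i \<notin> I \<longrightarrow> v i = 0) \<longrightarrow>
     ((\<lambda>t. f (\<lambda>i. x i + t * v i)) has_real_derivative (\<Sum>i\<in>I. g i * v i)) (at 0))"

text \<open>Gradient and Hessian are carried as explicit witnesses, and symmetry of the Hessian is
  part of the notion: it is preserved by sums, products and compositions, so no theorem on mixed
  partial derivatives is invoked.\<close>

definition smooth2_on :: "nat set \<Rightarrow> rvec set \<Rightarrow> (rvec \<Rightarrow> real) \<Rightarrow>
    (nat \<Rightarrow> rvec \<Rightarrow> real) \<Rightarrow> (nat \<Rightarrow> nat \<Rightarrow> rvec \<Rightarrow> real) \<Rightarrow> bool" where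
  "smooth2_on I U f g h \<longleftrightarrow> continuous_on U f \<and> (\<forall>i\<in>I. continuous_on U (g i)) \<and>
     (\<forall>i\<in>I. \<forall>j\<in>I. continuous_on U (h i j)) \<and>
     (\<forall>x\<in>U. has_grad I f (\<lambda>i. g i x) x \<and> (\<forall>i\<in>I. has_grad I (g i) (\<lambda>j. h i j x) x) \<and>
        (\<forall>i\<in>I. \<forall>j\<in>I. h i j x = h j i x))"

definition smooth2 :: "nat set \<Rightarrow> rvec set \<Rightarrow> (rvec \<Rightarrow> real) \<Rightarrow> bool" where
  "smooth2 I U f \<longleftrightarrow> (\<exists>g h. smooth2_on I U f g h)"

lemma has_gradD:
  "has_grad I f g x \<Longrightarrow> (\<And>i. i \<notin> I \<Longrightarrow> v i = 0) \<Longrightarrow>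
     ((\<lambda>t. f (\<lambda>i. x i + t * v i)) has_real_derivative (\<Sum>i\<in>I. g i * v i)) (at 0)"
  by (auto simp: has_grad_def)

lemma has_grad_const: "has_grad I (\<lambda>_. c) (\<lambda>_. 0) x"
  by (simp add: has_grad_def)

lemma has_grad_coord:
  assumes "finite I"
  shows "has_grad I (\<lambda>x. x k) (\<lambda>i. if i = k then 1 else 0) x"
  unfolding has_grad_def
proof (intro allI impI)
  fix v :: rvec assume v: "\<forall>i. i \<notin> I \<longrightarrow> v i = 0"
  have "(\<Sum>i\<in>I. (if i = k then 1 else 0) * v i) = (\<Sum>i\<in>I. if i = k then v k else 0)"
    by (intro sum.cong) auto
  also have "... = v k" using assms v by simp
  finally show "((\<lambda>t. x k + t * v k) has_real_derivative (\<Sum>i\<in>I. (if i = k then 1 else 0) * v i)) (at 0)"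
    by (auto intro!: derivative_eq_intros)
qed

lemma has_grad_add:
  assumes "has_grad I f g x" "has_grad I f' g' x"
  shows "has_grad I (\<lambda>x. f x + f' x) (\<lambda>i. g i + g' i) x"
  using assms unfolding has_grad_def by (auto intro!: DERIV_add simp: distrib_right sum.distrib)

lemma has_grad_mult:
  assumes "has_grad I f g x" "has_grad I f' g' x"
  shows "has_grad I (\<lambda>x. f x * f' x) (\<lambda>i. g i * f' x + f x * g' i) x"
  unfolding has_grad_def
proof (intro allI impI)
  fix v :: rvec assume v: "\<forall>i. i \<notin> I \<longrightarrow> v i = 0"
  have "((\<lambda>t. f (\<lambda>i. x i + t * v i) * f' (\<lambda>i. x i + t * v i)) has_real_derivative
      (\<Sum>i\<in>I. g i * v i) * f' (\<lambda>i. x i + 0 * v i) + (\<Sum>i\<in>I. g' i * v i) * f (\<lambda>i. x i + 0 * v i)) (at 0)"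
    by (intro DERIV_mult has_gradD[OF assms(1)] has_gradD[OF assms(2)]) (use v in auto)
  also have "(\<Sum>i\<in>I. g i * v i) * f' (\<lambda>i. x i + 0 * v i) + (\<Sum>i\<in>I. g' i * v i) * f (\<lambda>i. x i + 0 * v i)
      = (\<Sum>i\<in>I. (g i * f' x + f x * g' i) * v i)"
    by (simp add: sum_distrib_left sum_distrib_right sum.distrib algebra_simps)
  finally show "((\<lambda>t. f (\<lambda>i. x i + t * v i) * f' (\<lambda>i. x i + t * v i)) has_real_derivative
      (\<Sum>i\<in>I. (g i * f' x + f x * g' i) * v i)) (at 0)" .
qed

lemma has_grad_comp:
  assumes "has_grad I f g x" "(\<phi> has_real_derivative d) (at (f x))"
  shows "has_grad I (\<lambda>x. \<phi> (f x)) (\<lambda>i. d * g i) x"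
  unfolding has_grad_def
proof (intro allI impI)
  fix v :: rvec assume v: "\<forall>i. i \<notin> I \<longrightarrow> v i = 0"
  have "((\<lambda>t. \<phi> (f (\<lambda>i. x i + t * v i))) has_real_derivative d * (\<Sum>i\<in>I. g i * v i)) (at 0)"
    by (rule DERIV_chain2) (use assms(2) has_gradD[OF assms(1), of v] v in auto)
  thus "((\<lambda>t. \<phi> (f (\<lambda>i. x i + t * v i))) has_real_derivative (\<Sum>i\<in>I. d * g i * v i)) (at 0)"
    by (simp add: sum_distrib_left mult.assoc)
qed

lemma smooth2_const [simp]: "smooth2 I U (\<lambda>_. c)"
  unfolding smooth2_def smooth2_on_def
  by (rule exI[of _ "\<lambda>_ _. 0"], rule exI[of _ "\<lambda>_ _ _. 0"]) (auto simp: has_grad_const)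

lemma smooth2_coord: "finite I \<Longrightarrow> smooth2 I U (\<lambda>x. x k)"
  unfolding smooth2_def smooth2_on_def
  by (rule exI[of _ "\<lambda>i _. if i = k then 1 else 0"], rule exI[of _ "\<lambda>_ _ _. 0"])
     (auto simp: has_grad_const has_grad_coord intro!: continuous_intros)

lemma smooth2_add:
  assumes "smooth2 I U f" "smooth2 I U f'"
  shows "smooth2 I U (\<lambda>x. f x + f' x)"
proof -
  obtain g h g' h' where "smooth2_on I U f g h" "smooth2_on I U f' g' h'"
    using assms by (auto simp: smooth2_def)
  hence "smooth2_on I U (\<lambda>x. f x + f' x) (\<lambda>i x. g i x + g' i x) (\<lambda>i j x. h i j x + h' i j x)"
    unfolding smooth2_on_def by (auto intro!: continuous_intros has_grad_add)
  thus ?thesis by (auto simp: smooth2_def)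
qed

lemma smooth2_mult:
  assumes "smooth2 I U f" "smooth2 I U f'"
  shows "smooth2 I U (\<lambda>x. f x * f' x)"
proof -
  obtain g h g' h' where s: "smooth2_on I U f g h" "smooth2_on I U f' g' h'"
    using assms by (auto simp: smooth2_def)
  have "smooth2_on I U (\<lambda>x. f x * f' x) (\<lambda>i x. g i x * f' x + f x * g' i x)
      (\<lambda>i j x. (h i j x * f' x + g i x * g' j x) + (g j x * g' i x + f x * h' i j x))"
    using s unfolding smooth2_on_def
    by (auto intro!: continuous_intros has_grad_add has_grad_mult)
  thus ?thesis by (auto simp: smooth2_def)
qed

lemma smooth2_comp:
  assumes "smooth2 I U f" "\<And>x. x \<in> U \<Longrightarrow> f x \<in> D"
    and "\<And>y. y \<in> D \<Longrightarrow> (\<phi> has_real_derivative \<phi>' y) (at y)"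
    and "\<And>y. y \<in> D \<Longrightarrow> (\<phi>' has_real_derivative \<phi>'' y) (at y)" "continuous_on D \<phi>''"
  shows "smooth2 I U (\<lambda>x. \<phi> (f x))"
proof -
  obtain g h where s: "smooth2_on I U f g h"
    using assms by (auto simp: smooth2_def)
  have cf: "continuous_on U f" using s by (simp add: smooth2_on_def)
  have c: "continuous_on U (\<lambda>x. \<psi> (f x))" if "continuous_on D \<psi>" for \<psi>
    using continuous_on_compose2[OF that cf] assms(2) by blast
  have c0: "continuous_on D \<phi>" "continuous_on D \<phi>'"
    using assms(3,4) by (meson DERIV_isCont continuous_at_imp_continuous_on)+
  have "smooth2_on I U (\<lambda>x. \<phi> (f x)) (\<lambda>i x. \<phi>' (f x) * g i x)
      (\<lambda>i j x. (\<phi>'' (f x) * g j x) * g i x + \<phi>' (f x) * h i j x)"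
    unfolding smooth2_on_def
  proof (intro conjI ballI)
    fix x assume x: "x \<in> U"
    show "has_grad I (\<lambda>x. \<phi> (f x)) (\<lambda>i. \<phi>' (f x) * g i x) x"
      using s x assms(2,3) by (intro has_grad_comp) (auto simp: smooth2_on_def)
    show "has_grad I (\<lambda>x. \<phi>' (f x) * g i x) (\<lambda>j. \<phi>'' (f x) * g j x * g i x + \<phi>' (f x) * h i j x) x" if "i \<in> I" for i
      by (rule has_grad_mult[OF has_grad_comp[of I f _ x \<phi>']])
         (use s x that assms(2,4) in "auto simp: smooth2_on_def")
  qed (use s in "auto simp: smooth2_on_def mult.commute intro!: continuous_intros c c0 assms(5)")
  thus ?thesis by (auto simp: smooth2_def)
qed

lemma smooth2_diff:
  assumes "smooth2 I U f" "smooth2 I U f'"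
  shows "smooth2 I U (\<lambda>x. f x - f' x)"
  using smooth2_add[OF assms(1) smooth2_mult[OF smooth2_const assms(2), of "- 1"]] by simp

lemma smooth2_divide:
  assumes "smooth2 I U f" "smooth2 I U f'" "\<And>x. x \<in> U \<Longrightarrow> f' x \<noteq> 0"
  shows "smooth2 I U (\<lambda>x. f x / f' x)"
proof -
  have "smooth2 I U (\<lambda>x. inverse (f' x))"
  proof (rule smooth2_comp[OF assms(2), of "{y. y \<noteq> 0}" inverse "\<lambda>y. - inverse (y ^ 2)" "\<lambda>y. 2 * inverse (y ^ 3)"])
    show "(inverse has_real_derivative - inverse (y\<^sup>2)) (at y)" if "y \<in> {y. y \<noteq> 0}" for y :: real
      using that by (auto intro!: derivative_eq_intros simp: power2_eq_square field_simps)
    show "((\<lambda>y. - inverse (y\<^sup>2)) has_real_derivative 2 * inverse (y ^ 3)) (at y)" if "y \<in> {y. y \<noteq> 0}" for y :: real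
      using that by (auto intro!: derivative_eq_intros simp: power2_eq_square power3_eq_cube field_simps)
  qed (use assms(3) in "auto intro!: continuous_intros")
  from smooth2_mult[OF assms(1) this] show ?thesis by (simp add: divide_inverse)
qed

lemma smooth2_sum: "finite A \<Longrightarrow> (\<And>j. j \<in> A \<Longrightarrow> smooth2 I U (f j)) \<Longrightarrow> smooth2 I U (\<lambda>x. \<Sum>j\<in>A. f j x)"
  by (induction A rule: finite_induct) (auto intro!: smooth2_add)

lemma smooth2_prod: "finite A \<Longrightarrow> (\<And>j. j \<in> A \<Longrightarrow> smooth2 I U (f j)) \<Longrightarrow> smooth2 I U (\<lambda>x. \<Prod>j\<in>A. f j x)"
  by (induction A rule: finite_induct) (auto intro!: smooth2_mult)

lemma has_grad_partial:
  assumes "has_grad I f g x" "i \<in> I" "finite I"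
  shows "((\<lambda>t. f (x(i := t))) has_real_derivative g i) (at (x i))"
proof -
  define v :: rvec where "v = (\<lambda>j. if j = i then 1 else 0)"
  have "((\<lambda>t. f (\<lambda>j. x j + t * v j)) has_real_derivative (\<Sum>j\<in>I. g j * v j)) (at 0)"
    by (rule has_gradD[OF assms(1)]) (use assms(2) in "auto simp: v_def")
  also have "(\<Sum>j\<in>I. g j * v j) = g i"
    using assms by (simp add: v_def if_distrib[of "\<lambda>a. _ * a"] cong: if_cong)
  also have "(\<lambda>t. f (\<lambda>j. x j + t * v j)) = (\<lambda>t. f (x(i := t + x i)))"
    by (intro ext arg_cong[of _ _ f]) (auto simp: v_def)
  finally have "((\<lambda>t. f (x(i := t + x i))) has_real_derivative g i) (at 0)" .
  thus ?thesis using DERIV_shift[of "\<lambda>t. f (x(i := t))" "g i" 0 "x i"] by simp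
qed

lemma eventually_update:
  assumes "open U" "x \<in> U"
  shows "\<forall>\<^sub>F t in nhds (x i). x(i := t) \<in> (U :: rvec set)"
proof -
  obtain e where e: "e > 0" "\<And>y. (\<And>j. \<bar>y j - x j\<bar> < e) \<Longrightarrow> y \<in> U"
    using open_box[OF assms] by blast
  have "\<forall>\<^sub>F t in nhds (x i). t \<in> ball (x i) e" using e(1) by (intro eventually_nhds_in_open) auto
  thus ?thesis by eventually_elim (auto intro!: e simp: dist_real_def e(1))
qed

text \<open>
  \<open>F\<close> only has to agree with the smooth function on extensional vectors, and lines in the coordinate
  directions of \<open>I\<close> do not leave them.
\<close>

lemma partial_deriv_smooth2:
  assumes s: "smooth2_on I U f g h" and "open U" "finite I" "x \<in> U" "x \<in> S"
    and S: "\<And>y i t. y \<in> S \<Longrightarrow> i \<in> I \<Longrightarrow> y(i := t) \<in> S" and F: "\<And>y. y \<in> U \<Longrightarrow> y \<in> S \<Longrightarrow> F y = f y"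
    and "i \<in> I" "j \<in> I"
  shows "partial_deriv i F x = g i x" "partial_deriv j (partial_deriv i F) x = h i j x"
proof -
  have 1: "partial_deriv i F y = g i y" if y: "y \<in> U" "y \<in> S" for y
  proof -
    have "\<forall>\<^sub>F t in nhds (y i). y(i := t) \<in> U" by (rule eventually_update[OF \<open>open U\<close> y(1)])
    hence "\<forall>\<^sub>F t in nhds (y i). F (y(i := t)) = f (y(i := t))"
      by eventually_elim (use F S y \<open>i \<in> I\<close> in auto)
    hence "partial_deriv i F y = partial_deriv i f y"
      unfolding partial_deriv_def by (rule deriv_cong_ev) simp
    also have "... = g i y" unfolding partial_deriv_def
      using s y assms by (intro DERIV_imp_deriv has_grad_partial[of I]) (auto simp: smooth2_on_def)
    finally show ?thesis .
  qed
  show "partial_deriv i F x = g i x" using 1 assms by simp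
  have "\<forall>\<^sub>F t in nhds (x j). x(j := t) \<in> U" by (rule eventually_update[OF \<open>open U\<close> \<open>x \<in> U\<close>])
  hence "\<forall>\<^sub>F t in nhds (x j). partial_deriv i F (x(j := t)) = g i (x(j := t))"
    by eventually_elim (use 1 S \<open>x \<in> S\<close> \<open>j \<in> I\<close> in auto)
  hence "partial_deriv j (partial_deriv i F) x = partial_deriv j (g i) x"
    unfolding partial_deriv_def[of j] by (rule deriv_cong_ev) simp
  also have "... = h i j x" unfolding partial_deriv_def[of j]
    using s assms by (intro DERIV_imp_deriv has_grad_partial[of I]) (auto simp: smooth2_on_def)
  finally show "partial_deriv j (partial_deriv i F) x = h i j x" .
qed

section \<open>Expansions along segments\<close>

lemma has_grad_line:
  assumes "has_grad I f g (\<lambda>i. x i + t * v i)" "\<And>i. i \<notin> I \<Longrightarrow> v i = 0"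
  shows "((\<lambda>t. f (\<lambda>i. x i + t * v i)) has_real_derivative (\<Sum>i\<in>I. g i * v i)) (at t)"
proof -
  have "((\<lambda>s. f (\<lambda>i. x i + (s + t) * v i)) has_real_derivative (\<Sum>i\<in>I. g i * v i)) (at 0)"
    using has_gradD[OF assms(1), of v] assms(2) by (simp add: algebra_simps)
  thus ?thesis using DERIV_shift[of "\<lambda>t. f (\<lambda>i. x i + t * v i)" _ 0 t] by simp
qed

lemma sum_abs_mult_le:
  fixes v :: rvec
  assumes "finite I"
  shows "(\<Sum>i\<in>I. \<Sum>j\<in>I. \<bar>v i\<bar> * \<bar>v j\<bar>) \<le> real (card I) * (\<Sum>i\<in>I. (v i)\<^sup>2)"
proof -
  have "(\<Sum>i\<in>I. \<Sum>j\<in>I. \<bar>v i\<bar> * \<bar>v j\<bar>) \<le> (\<Sum>i\<in>I. \<Sum>j\<in>I. ((v i)\<^sup>2 + (v j)\<^sup>2) / 2)"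
  proof (intro sum_mono)
    fix i j
    have "0 \<le> (\<bar>v i\<bar> - \<bar>v j\<bar>)\<^sup>2" by simp
    thus "\<bar>v i\<bar> * \<bar>v j\<bar> \<le> ((v i)\<^sup>2 + (v j)\<^sup>2) / 2" by (simp add: power2_diff)
  qed
  also have "... = real (card I) * (\<Sum>i\<in>I. (v i)\<^sup>2)"
    by (simp add: add_divide_distrib sum.distrib sum_divide_distrib[symmetric] sum_distrib_left[symmetric])
  finally show ?thesis .
qed

lemma near_box:
  fixes U :: "rvec set"
  assumes "open U" "x \<in> U" "finite A" "\<And>a. a \<in> A \<Longrightarrow> continuous_on U (k a)" "e > 0"
  shows "\<exists>\<rho>>0. \<forall>y. (\<forall>i. \<bar>y i - x i\<bar> < \<rho>) \<longrightarrow> y \<in> U \<and> (\<forall>a\<in>A. \<bar>k a y - k a x\<bar> < (e::real))"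
proof -
  define U' where "U' = U \<inter> (\<Inter>a\<in>A. U \<inter> k a -` {t. \<bar>t - k a x\<bar> < e})"
  have "open {t. \<bar>t - c\<bar> < e}" for c :: real
    by (intro open_Collect_less continuous_intros)
  hence "open U'" unfolding U'_def using assms
    by (intro open_Int open_INT ballI continuous_open_preimage) auto
  moreover have "x \<in> U'" using assms by (auto simp: U'_def)
  ultimately obtain \<rho> where "\<rho> > 0" "\<forall>y. (\<forall>i. \<bar>y i - x i\<bar> < \<rho>) \<longrightarrow> y \<in> U'"
    using open_box by blast
  moreover have "y \<in> U \<and> (\<forall>a\<in>A. \<bar>k a y - k a x\<bar> < e)" if "y \<in> U'" for y
    using that unfolding U'_def by blast
  ultimately show ?thesis by blast
qed

text \<open>The one-variable Maclaurin formula on the segment from \<open>x\<close> evaluates the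
  Hessian at an intermediate point; continuity of its finitely many entries compares this with the
  Hessian at \<open>x\<close>.\<close>

theorem smooth2_taylor:
  assumes s: "smooth2_on I U f g h" and "open U" "finite I" "x \<in> U" "e > 0"
  shows "\<exists>\<rho>>0. \<forall>v. (\<forall>i. i \<notin> I \<longrightarrow> v i = 0) \<and> (\<forall>i\<in>I. \<bar>v i\<bar> < \<rho>) \<longrightarrow> (\<lambda>i. x i + v i) \<in> U \<and>
    \<bar>f (\<lambda>i. x i + v i) - f x - (\<Sum>i\<in>I. g i x * v i) - (\<Sum>i\<in>I. \<Sum>j\<in>I. h i j x * v i * v j) / 2\<bar>
      \<le> e * (\<Sum>i\<in>I. (v i)\<^sup>2)"
proof -
  \<comment> \<open>The allowed oscillation of each Hessian entry: by \<open>sum_abs_mult_le\<close>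
    the double sum of the products of the increments costs a factor \<open>card I\<close>; the added
    \<open>1\<close> covers the empty index set.\<close>
  define d where "d = e / (real (card I) + 1)"
  have d: "d > 0" using assms by (simp add: d_def)
  have "\<exists>\<rho>>0. \<forall>y. (\<forall>i. \<bar>y i - x i\<bar> < \<rho>) \<longrightarrow> y \<in> U \<and>
      (\<forall>a\<in>I \<times> I. \<bar>h (fst a) (snd a) y - h (fst a) (snd a) x\<bar> < d)"
    by (rule near_box[OF \<open>open U\<close> \<open>x \<in> U\<close>]) (use s \<open>finite I\<close> d in "auto simp: smooth2_on_def")
  then obtain \<rho> where \<rho>0: "\<rho> > 0" "\<forall>y. (\<forall>i. \<bar>y i - x i\<bar> < \<rho>) \<longrightarrow> y \<in> U \<and>
      (\<forall>a\<in>I \<times> I. \<bar>h (fst a) (snd a) y - h (fst a) (snd a) x\<bar> < d)" by blast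
  have \<rho>: "\<rho> > 0"
    "\<And>y. (\<And>i. \<bar>y i - x i\<bar> < \<rho>) \<Longrightarrow> y \<in> U"
    "\<And>y i j. (\<And>i. \<bar>y i - x i\<bar> < \<rho>) \<Longrightarrow> i \<in> I \<Longrightarrow> j \<in> I \<Longrightarrow> \<bar>h i j y - h i j x\<bar> < d"
    using \<rho>0 by auto
  show ?thesis
  proof (intro exI[of _ \<rho>] conjI allI impI)
    fix v :: rvec assume v: "(\<forall>i. i \<notin> I \<longrightarrow> v i = 0) \<and> (\<forall>i\<in>I. \<bar>v i\<bar> < \<rho>)"
    hence vb: "\<bar>v i\<bar> < \<rho>" for i using \<rho>(1) by (cases "i \<in> I") auto
    define L where "L = (\<lambda>t i. x i + t * v i)"
    have near: "\<bar>L t i - x i\<bar> < \<rho>" if "0 \<le> t" "t \<le> 1" for t i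
    proof -
      have "\<bar>L t i - x i\<bar> = t * \<bar>v i\<bar>" using that by (simp add: L_def abs_mult)
      also have "... \<le> 1 * \<bar>v i\<bar>" using that by (intro mult_right_mono) auto
      finally show ?thesis using vb[of i] by simp
    qed
    have LU: "L t \<in> U" if "0 \<le> t" "t \<le> 1" for t using \<rho>(2) near that by blast
    have L1: "L 1 = (\<lambda>i. x i + v i)" and L0: "L 0 = x" by (auto simp: L_def)
    show "(\<lambda>i. x i + v i) \<in> U" using LU[of 1] L1 by simp
    define \<phi>1 where "\<phi>1 = (\<lambda>t. \<Sum>i\<in>I. g i (L t) * v i)"
    define \<phi>2 where "\<phi>2 = (\<lambda>t. \<Sum>i\<in>I. (\<Sum>j\<in>I. h i j (L t) * v j) * v i)"
    have D1: "((\<lambda>t. f (L t)) has_real_derivative \<phi>1 t) (at t)" if "0 \<le> t" "t \<le> 1" for t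
      unfolding L_def \<phi>1_def using s LU[OF that] v by (intro has_grad_line) (auto simp: smooth2_on_def L_def)
    have Dg: "((\<lambda>t. g i (L t)) has_real_derivative (\<Sum>j\<in>I. h i j (L t) * v j)) (at t)"
      if "0 \<le> t" "t \<le> 1" "i \<in> I" for t i
      unfolding L_def using s LU[OF that(1,2)] v that by (intro has_grad_line) (auto simp: smooth2_on_def L_def)
    have D2: "(\<phi>1 has_real_derivative \<phi>2 t) (at t)" if "0 \<le> t" "t \<le> 1" for t
      unfolding \<phi>1_def \<phi>2_def using Dg that by (intro DERIV_sum DERIV_cmult_right) auto
    define df where "df = (\<lambda>m::nat. if m = 0 then (\<lambda>t. f (L t)) else if m = 1 then \<phi>1 else \<phi>2)"
    have "\<forall>m t. m < 2 \<and> 0 \<le> t \<and> t \<le> 1 \<longrightarrow> (df m has_real_derivative df (Suc m) t) (at t)"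
      using D1 D2 by (auto simp: df_def less_2_cases_iff)
    then obtain t where t: "0 < t" "t < 1" "f (L 1) = (\<Sum>m<2. df m 0 / fact m * 1 ^ m) + df 2 t / fact 2 * 1 ^ 2"
      using Maclaurin[of 1 2 df "\<lambda>t. f (L t)"] by (auto simp: df_def)
    hence tay: "f (L 1) = f x + \<phi>1 0 + \<phi>2 t / 2"
      by (simp add: df_def numeral_2_eq_2 L0)
    have "\<bar>\<phi>2 t - \<phi>2 0\<bar> = \<bar>\<Sum>i\<in>I. \<Sum>j\<in>I. (h i j (L t) - h i j x) * v j * v i\<bar>"
      unfolding \<phi>2_def L0 sum_subtractf[symmetric] by (simp add: sum_distrib_right sum_subtractf left_diff_distrib)
    also have "... \<le> (\<Sum>i\<in>I. \<Sum>j\<in>I. d * (\<bar>v i\<bar> * \<bar>v j\<bar>))"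
    proof (rule order_trans[OF sum_abs], intro sum_mono, rule order_trans[OF sum_abs], intro sum_mono)
      fix i j assume ij: "i \<in> I" "j \<in> I"
      have "\<bar>h i j (L t) - h i j x\<bar> \<le> d"
        using \<rho>(3)[of "L t" i j] near[of t] t ij by (simp add: less_imp_le)
      hence "\<bar>h i j (L t) - h i j x\<bar> * (\<bar>v j\<bar> * \<bar>v i\<bar>) \<le> d * (\<bar>v j\<bar> * \<bar>v i\<bar>)"
        by (intro mult_right_mono) auto
      thus "\<bar>(h i j (L t) - h i j x) * v j * v i\<bar> \<le> d * (\<bar>v i\<bar> * \<bar>v j\<bar>)"
        by (simp add: abs_mult mult_ac)
    qed
    also have "... = d * (\<Sum>i\<in>I. \<Sum>j\<in>I. \<bar>v i\<bar> * \<bar>v j\<bar>)"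
      by (simp add: sum_distrib_left)
    also have "... \<le> d * (real (card I) * (\<Sum>i\<in>I. (v i)\<^sup>2))"
      using d by (intro mult_left_mono sum_abs_mult_le \<open>finite I\<close>) auto
    also have "... = (d * real (card I)) * (\<Sum>i\<in>I. (v i)\<^sup>2)" by simp
    also have "... \<le> e * (\<Sum>i\<in>I. (v i)\<^sup>2)"
      using \<open>e > 0\<close> by (intro mult_right_mono sum_nonneg) (auto simp: d_def field_simps)
    finally have "\<bar>\<phi>2 t - \<phi>2 0\<bar> \<le> e * (\<Sum>i\<in>I. (v i)\<^sup>2)" .
    moreover have "f (L 1) - f x - (\<Sum>i\<in>I. g i x * v i) - (\<Sum>i\<in>I. \<Sum>j\<in>I. h i j x * v i * v j) / 2 = (\<phi>2 t - \<phi>2 0) / 2"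
    proof -
      have "\<phi>2 0 = (\<Sum>i\<in>I. \<Sum>j\<in>I. h i j x * v i * v j)"
        unfolding \<phi>2_def L0 sum_distrib_right by (simp add: mult_ac)
      thus ?thesis unfolding tay by (simp add: \<phi>1_def L0 diff_divide_distrib)
    qed
    moreover have "0 \<le> e * (\<Sum>i\<in>I. (v i)\<^sup>2)" using \<open>e > 0\<close> by (intro mult_nonneg_nonneg sum_nonneg) auto
    moreover have "\<bar>a\<bar> \<le> b \<Longrightarrow> c = a / 2 \<Longrightarrow> 0 \<le> b \<Longrightarrow> \<bar>c\<bar> \<le> b" for a b c :: real by simp
    ultimately show "\<bar>f (\<lambda>i. x i + v i) - f x - (\<Sum>i\<in>I. g i x * v i) - (\<Sum>i\<in>I. \<Sum>j\<in>I. h i j x * v i * v j) / 2\<bar>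
      \<le> e * (\<Sum>i\<in>I. (v i)\<^sup>2)" unfolding L1[symmetric] by blast
  qed (rule \<rho>(1))
qed

theorem smooth2_first_order:
  assumes s: "smooth2_on I U f g h" and "open U" "finite I" "x \<in> U" "e > 0"
  shows "\<exists>\<rho>>0. \<forall>v. (\<forall>i. i \<notin> I \<longrightarrow> v i = 0) \<and> (\<forall>i\<in>I. \<bar>v i\<bar> < \<rho>) \<longrightarrow>
    \<bar>f (\<lambda>i. x i + v i) - f x - (\<Sum>i\<in>I. g i x * v i)\<bar> \<le> e * (\<Sum>i\<in>I. \<bar>v i\<bar>)"
proof -
  have "\<exists>\<rho>>0. \<forall>y. (\<forall>i. \<bar>y i - x i\<bar> < \<rho>) \<longrightarrow> y \<in> U \<and> (\<forall>a\<in>I. \<bar>g a y - g a x\<bar> < e)"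
    by (rule near_box[OF \<open>open U\<close> \<open>x \<in> U\<close>]) (use s \<open>finite I\<close> \<open>e > 0\<close> in "auto simp: smooth2_on_def")
  then obtain \<rho> where \<rho>0: "\<rho> > 0"
    "\<forall>y. (\<forall>i. \<bar>y i - x i\<bar> < \<rho>) \<longrightarrow> y \<in> U \<and> (\<forall>a\<in>I. \<bar>g a y - g a x\<bar> < e)" by blast
  have \<rho>: "\<rho> > 0"
    "\<And>y. (\<And>i. \<bar>y i - x i\<bar> < \<rho>) \<Longrightarrow> y \<in> U"
    "\<And>y i. (\<And>i. \<bar>y i - x i\<bar> < \<rho>) \<Longrightarrow> i \<in> I \<Longrightarrow> \<bar>g i y - g i x\<bar> < e"
    using \<rho>0 by auto
  show ?thesis
  proof (intro exI[of _ \<rho>] conjI allI impI)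
    fix v :: rvec assume v: "(\<forall>i. i \<notin> I \<longrightarrow> v i = 0) \<and> (\<forall>i\<in>I. \<bar>v i\<bar> < \<rho>)"
    hence vb: "\<bar>v i\<bar> < \<rho>" for i using \<rho>(1) by (cases "i \<in> I") auto
    define L where "L = (\<lambda>t i. x i + t * v i)"
    have near: "\<bar>L t i - x i\<bar> < \<rho>" if "0 \<le> t" "t \<le> 1" for t i
    proof -
      have "\<bar>L t i - x i\<bar> = t * \<bar>v i\<bar>" using that by (simp add: L_def abs_mult)
      also have "... \<le> 1 * \<bar>v i\<bar>" using that by (intro mult_right_mono) auto
      finally show ?thesis using vb[of i] by simp
    qed
    have LU: "L t \<in> U" if "0 \<le> t" "t \<le> 1" for t using \<rho>(2) near that by blast
    have L1: "L 1 = (\<lambda>i. x i + v i)" and L0: "L 0 = x" by (auto simp: L_def)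
    have D1: "((\<lambda>t. f (L t)) has_real_derivative (\<Sum>i\<in>I. g i (L t) * v i)) (at t)" if "0 \<le> t" "t \<le> 1" for t
      unfolding L_def using s LU[OF that] v by (intro has_grad_line) (auto simp: smooth2_on_def L_def)
    then obtain t where t: "0 < t" "t < 1" "f (L 1) - f (L 0) = (1 - 0) * (\<Sum>i\<in>I. g i (L t) * v i)"
      using MVT2[of 0 1 "\<lambda>t. f (L t)" "\<lambda>t. \<Sum>i\<in>I. g i (L t) * v i"] by auto
    have "\<bar>f (L 1) - f x - (\<Sum>i\<in>I. g i x * v i)\<bar> = \<bar>\<Sum>i\<in>I. (g i (L t) - g i x) * v i\<bar>"
      using t L0 by (simp add: sum_subtractf[symmetric] algebra_simps)
    also have "... \<le> (\<Sum>i\<in>I. e * \<bar>v i\<bar>)"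
    proof (rule order_trans[OF sum_abs], intro sum_mono)
      fix i assume "i \<in> I"
      hence "\<bar>g i (L t) - g i x\<bar> \<le> e" using \<rho>(3)[of "L t" i] near[of t] t by (simp add: less_imp_le)
      thus "\<bar>(g i (L t) - g i x) * v i\<bar> \<le> e * \<bar>v i\<bar>" by (simp add: abs_mult mult_right_mono)
    qed
    finally show "\<bar>f (\<lambda>i. x i + v i) - f x - (\<Sum>i\<in>I. g i x * v i)\<bar> \<le> e * (\<Sum>i\<in>I. \<bar>v i\<bar>)"
      by (simp add: L1 sum_distrib_left)
  qed (rule \<rho>(1))
qed

section \<open>Smoothness of the canonical coordinates\<close>

lemma smooth2_paths:
  assumes "\<And>i. 1 \<le> i \<Longrightarrow> i \<le> k + h \<Longrightarrow> smooth2 I S (\<lambda>r. f r i)"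
  shows "smooth2 I S (\<lambda>r. paths (f r) k h)"
  using assms
proof (induction k arbitrary: h)
  case (Suc k)
  have 1: "smooth2 I S (\<lambda>r. if h = 0 then 0 else paths (f r) k (h - 1))"
    using Suc by (cases h) auto
  have 2: "smooth2 I S (\<lambda>r. f r (2 * h + 1) * paths (f r) k h)"
  proof (cases "h \<le> k")
    case True
    thus ?thesis using Suc by (intro smooth2_mult) auto
  qed (simp add: paths_eq_0)
  have 3: "smooth2 I S (\<lambda>r. f r (2 * h + 2) * paths (f r) k (h + 1))"
  proof (cases "h + 1 \<le> k")
    case True
    thus ?thesis using Suc.prems Suc.IH[of "h + 1"] by (intro smooth2_mult) auto
  qed (simp add: paths_eq_0)
  show ?case unfolding paths.simps by (intro smooth2_add 1 2 3)
qed simp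

lemma smooth2_mom:
  assumes "\<And>i. 1 \<le> i \<Longrightarrow> i \<le> j \<Longrightarrow> smooth2 I S (\<lambda>r. f r i)"
  shows "smooth2 I S (\<lambda>r. mom E (f r) j)"
  unfolding mom_def
proof (rule smooth2_paths)
  fix i assume i: "1 \<le> i" "i \<le> (if E = Real_Line then j else 2 * j) + 0"
  show "smooth2 I S (\<lambda>r. jac_param E (f r) i)"
  proof (cases E)
    case Unit_Interval
    show ?thesis
    proof (cases "even i")
      case True
      then obtain t where t: "i = 2 * t" by blast
      hence tt: "1 \<le> t" "t \<le> j" using i Unit_Interval by auto
      have "smooth2 I S (\<lambda>r. f r t)" using assms tt by simp
      moreover have "t \<noteq> 1 \<Longrightarrow> smooth2 I S (\<lambda>r. f r (t - 1))" using assms tt by simp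
      ultimately show ?thesis using t Unit_Interval
        by (cases "t = 1") (auto intro!: smooth2_mult smooth2_diff)
    qed (simp add: Unit_Interval)
  next
    case Half_Line
    show ?thesis using assms[of "i div 2"] i by (cases "even i") (auto simp: Half_Line elim!: evenE)
  qed (use assms i in auto)
qed

lemma smooth2_slope:
  assumes "\<And>i. 1 \<le> i \<Longrightarrow> i < j \<Longrightarrow> smooth2 I S (\<lambda>r. f r i)"
  shows "smooth2 I S (\<lambda>r. slope E (f r) j)"
proof -
  have "smooth2 I S (\<lambda>r. wt E i (f r i))" if "i \<in> {1..<j}" for i
    using assms[of i] that by (cases E; cases "odd i") (auto intro!: smooth2_mult smooth2_diff)
  thus ?thesis unfolding slope_def by (intro smooth2_prod) auto
qed

text \<open>Stated for arbitrary \<open>K\<close> and smooth input \<open>r\<close> because it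
  serves two readings: all entries are moments (\<open>K = UNIV\<close>), or only the constrained
  ones are (\<open>K = dom C\<close>).\<close>

lemma smooth2_sol:
  assumes "finite I" "U \<subseteq> {x. coords_ok E n (sol E K (r x))}"
    and r: "\<And>j. 1 \<le> j \<Longrightarrow> j \<le> Suc n \<Longrightarrow> smooth2 I U (\<lambda>x. r x j)"
    and "1 \<le> j" "j \<le> Suc n"
  shows "smooth2 I U (\<lambda>x. sol E K (r x) j)"
  using assms(4,5)
proof (induction j rule: less_induct)
  case (less j)
  have IH: "smooth2 I U (\<lambda>x. sol E K (r x) i)" if "1 \<le> i" "i < j" for i
    using less.IH[of i] less.prems that by simp
  have "smooth2 I U (\<lambda>x. mom E ((sol E K (r x))(j := 0)) j)"
  proof (rule smooth2_mom)
    fix i assume "1 \<le> i" "i \<le> j"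
    thus "smooth2 I U (\<lambda>x. ((sol E K (r x))(j := 0)) i)" using IH by (cases "i = j") auto
  qed
  moreover have "smooth2 I U (\<lambda>x. slope E (sol E K (r x)) j)"
    by (rule smooth2_slope) (rule IH)
  moreover have "slope E (sol E K (r x)) j \<noteq> 0" if "x \<in> U" for x
    using slope_pos[of E n "sol E K (r x)" j] that assms(2) less.prems by auto
  ultimately have "smooth2 I U (\<lambda>x. if j \<in> K then (r x j - mom E ((sol E K (r x))(j := 0)) j) / slope E (sol E K (r x)) j else r x j)"
    using r less.prems by (cases "j \<in> K") (auto intro!: smooth2_divide smooth2_diff)
  thus ?case using sol_eq[OF less.prems(1)] by simp
qed

section \<open>Integration in canonical coordinates\<close>

text \<open>Unlike \<open>fill_constraint\<close> it is not cut off at some \<open>n\<close>, so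
  that the coordinates do not depend on the number of moments under consideration.\<close>

definition fillc :: "moment_constraint \<Rightarrow> rvec \<Rightarrow> nat \<Rightarrow> real" where
  "fillc C x j = (case C j of Some c \<Rightarrow> c | None \<Rightarrow> x j)"

definition ycoord :: "interval_kind \<Rightarrow> moment_constraint \<Rightarrow> rvec \<Rightarrow> nat \<Rightarrow> real" where
  "ycoord E C x = sol E UNIV (fillc C x)"

lemma ycoord_cong:
  assumes "\<And>i. 1 \<le> i \<Longrightarrow> i \<le> j \<Longrightarrow> i \<notin> dom C \<Longrightarrow> x i = x' i" "j \<ge> 1"
  shows "ycoord E C x j = ycoord E C x' j"
  unfolding ycoord_def by (rule sol_cong) (use assms in "auto simp: fillc_def split: option.splits")

lemma measurable_paths:
  assumes "\<And>i. 1 \<le> i \<Longrightarrow> i \<le> k + h \<Longrightarrow> (\<lambda>r. f r i) \<in> borel_measurable M"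
  shows "(\<lambda>r. paths (f r) k h) \<in> borel_measurable M"
  using assms
proof (induction k arbitrary: h)
  case (Suc k)
  have 1: "(\<lambda>r. if h = 0 then 0 else paths (f r) k (h - 1)) \<in> borel_measurable M"
    using Suc by (cases h) auto
  have 2: "(\<lambda>r. f r (2 * h + 1) * paths (f r) k h) \<in> borel_measurable M"
  proof (cases "h \<le> k")
    case True
    thus ?thesis using Suc by (intro borel_measurable_times) auto
  qed (simp add: paths_eq_0)
  have 3: "(\<lambda>r. f r (2 * h + 2) * paths (f r) k (h + 1)) \<in> borel_measurable M"
  proof (cases "h + 1 \<le> k")
    case True
    thus ?thesis using Suc.prems Suc.IH[of "h + 1"] by (intro borel_measurable_times) auto
  qed (simp add: paths_eq_0)
  show ?case unfolding paths.simps by (intro borel_measurable_add 1 2 3)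
qed simp

lemma measurable_mom:
  assumes "\<And>i. 1 \<le> i \<Longrightarrow> i \<le> j \<Longrightarrow> (\<lambda>r. f r i) \<in> borel_measurable M"
  shows "(\<lambda>r. mom E (f r) j) \<in> borel_measurable M"
  unfolding mom_def
proof (rule measurable_paths)
  fix i assume i: "1 \<le> i" "i \<le> (if E = Real_Line then j else 2 * j) + 0"
  show "(\<lambda>r. jac_param E (f r) i) \<in> borel_measurable M"
  proof (cases E)
    case Unit_Interval
    show ?thesis
    proof (cases "even i")
      case True
      then obtain t where t: "i = 2 * t" by blast
      hence tt: "1 \<le> t" "t \<le> j" using i Unit_Interval by auto
      have "(\<lambda>r. f r t) \<in> borel_measurable M" using assms tt by simp
      moreover have "t \<noteq> 1 \<Longrightarrow> (\<lambda>r. f r (t - 1)) \<in> borel_measurable M" using assms tt by simp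
      ultimately show ?thesis using t Unit_Interval
        by (cases "t = 1") auto
    qed (simp add: Unit_Interval)
  next
    case Half_Line
    show ?thesis using assms[of "i div 2"] i by (cases "even i") (auto simp: Half_Line elim!: evenE)
  qed (use assms i in auto)
qed

lemma measurable_wt:
  "f \<in> borel_measurable M \<Longrightarrow> (\<lambda>x. wt E j (f x)) \<in> borel_measurable M"
  by (cases E; cases "odd j") auto

lemma measurable_slope:
  assumes "\<And>i. 1 \<le> i \<Longrightarrow> i < j \<Longrightarrow> (\<lambda>r. f r i) \<in> borel_measurable M"
  shows "(\<lambda>r. slope E (f r) j) \<in> borel_measurable M"
  unfolding slope_def using assms by (intro borel_measurable_prod measurable_wt) auto

lemma measurable_sol:
  assumes "\<And>i. 1 \<le> i \<Longrightarrow> i \<le> n \<Longrightarrow> (\<lambda>x. r x i) \<in> borel_measurable M" "1 \<le> j" "j \<le> n"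
  shows "(\<lambda>x. sol E K (r x) j) \<in> borel_measurable M"
  using assms(2,3)
proof (induction j rule: less_induct)
  case (less j)
  have IH: "(\<lambda>x. sol E K (r x) i) \<in> borel_measurable M" if "1 \<le> i" "i < j" for i
    using less.IH[of i] less.prems that by simp
  have "(\<lambda>x. mom E ((sol E K (r x))(j := 0)) j) \<in> borel_measurable M"
  proof (rule measurable_mom)
    fix i assume "1 \<le> i" "i \<le> j"
    thus "(\<lambda>x. ((sol E K (r x))(j := 0)) i) \<in> borel_measurable M" using IH by (cases "i = j") auto
  qed
  moreover have "(\<lambda>x. slope E (sol E K (r x)) j) \<in> borel_measurable M"
    by (rule measurable_slope) (rule IH)
  moreover have "(\<lambda>x. r x j) \<in> borel_measurable M" using assms(1) less.prems by simp
  ultimately have "(\<lambda>x. if j \<in> K then (r x j - mom E ((sol E K (r x))(j := 0)) j) / slope E (sol E K (r x)) j else r x j) \<in> borel_measurable M"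
    by (cases "j \<in> K") auto
  thus ?case using sol_eq[OF less.prems(1)] by simp
qed

abbreviation lebC :: "moment_constraint \<Rightarrow> nat \<Rightarrow> rvec measure" where
  "lebC C n \<equiv> Pi\<^sub>M (free_indices C n) (\<lambda>_. lborel)"

lemma measurable_fillc:
  assumes "1 \<le> j" "j \<le> n"
  shows "(\<lambda>x. fillc C x j) \<in> borel_measurable (lebC C n)"
proof (cases "C j")
  case None
  hence "j \<in> free_indices C n" using assms by (auto simp: free_indices_def)
  hence "(\<lambda>x. x j) \<in> lebC C n \<rightarrow>\<^sub>M lborel" by (rule measurable_component_singleton)
  thus ?thesis using None by (simp add: fillc_def)
qed (simp add: fillc_def)

lemma measurable_ycoord:
  assumes "1 \<le> j" "j \<le> n"
  shows "(\<lambda>x. ycoord E C x j) \<in> borel_measurable (lebC C n)"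
  unfolding ycoord_def by (rule measurable_sol[OF measurable_fillc assms])

lemma coord_dom_borel [measurable]: "coord_dom E j \<in> sets borel"
  by (cases E) auto

lemma measurable_coords_ok:
  "Measurable.pred (lebC C n) (\<lambda>x. coords_ok E n (ycoord E C x))"
proof -
  have "Measurable.pred (lebC C n) (\<lambda>x. ycoord E C x j \<in> coord_dom E j)" if "j \<in> {1..n}" for j
    by (rule pred_sets2[OF coord_dom_borel measurable_ycoord]) (use that in auto)
  hence "Measurable.pred (lebC C n) (\<lambda>x. \<forall>j\<in>{1..n}. ycoord E C x j \<in> coord_dom E j)"
    by (rule pred_intros_finite(3)[OF finite_atLeastAtMost])
  moreover have "(\<lambda>x. coords_ok E n (ycoord E C x)) = (\<lambda>x. \<forall>j\<in>{1..n}. ycoord E C x j \<in> coord_dom E j)"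
    by (auto simp: coords_ok_def fun_eq_iff)
  ultimately show ?thesis by simp
qed

definition coord_dens ::
    "interval_kind \<Rightarrow> moment_constraint \<Rightarrow> nat \<Rightarrow> (nat \<Rightarrow> real \<Rightarrow> ennreal) \<Rightarrow> rvec \<Rightarrow> ennreal" where
  "coord_dens E C n \<phi> x =
     indicator {x. coords_ok E n (ycoord E C x)} x * (\<Prod>j\<in>{1..n}. \<phi> j (ycoord E C x j))"

lemma measurable_coord_dens:
  assumes "\<And>j. 1 \<le> j \<Longrightarrow> j \<le> n \<Longrightarrow> \<phi> j \<in> borel_measurable borel"
  shows "coord_dens E C n \<phi> \<in> borel_measurable (lebC C n)"
  unfolding coord_dens_def[abs_def]
proof (intro borel_measurable_times_ennreal borel_measurable_prod_ennreal)
  show "(\<lambda>x. indicator {x. coords_ok E n (ycoord E C x)} x :: ennreal) \<in> borel_measurable (lebC C n)"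
  proof -
    have "(\<lambda>x. if coords_ok E n (ycoord E C x) then 1 else 0 :: ennreal) \<in> borel_measurable (lebC C n)"
      by (rule measurable_If[OF _ _ measurable_coords_ok[unfolded pred_def]]) simp_all
    also have "(\<lambda>x. if coords_ok E n (ycoord E C x) then 1 else 0 :: ennreal) = indicator {x. coords_ok E n (ycoord E C x)}"
      by (auto simp: fun_eq_iff)
    finally show ?thesis .
  qed
  show "(\<lambda>x. \<phi> j (ycoord E C x j)) \<in> borel_measurable (lebC C n)" if "j \<in> {1..n}" for j
    by (rule measurable_compose[OF measurable_ycoord assms]) (use that in auto)
qed

lemma free_indices_Suc:
  "free_indices C (Suc n) = (if Suc n \<in> dom C then free_indices C n else insert (Suc n) (free_indices C n))"
  by (auto simp: free_indices_def le_Suc_eq)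

lemma finite_free_indices [simp]: "finite (free_indices C n)"
  by (simp add: free_indices_def)

interpretation lborel_product: product_sigma_finite "\<lambda>_::nat. lborel :: real measure"
  by standard

text \<open>
  The \<open>n\<close>-th moment is an affine function of the \<open>n\<close>-th coordinate, whose slope is the product of the
  weights of the previous coordinates.
\<close>

lemma nn_integral_coord_Suc:
  assumes "Suc n \<notin> dom C"
    and \<phi>: "\<And>j. 1 \<le> j \<Longrightarrow> j \<le> Suc n \<Longrightarrow> \<phi> j \<in> borel_measurable borel"
    and f: "f \<in> borel_measurable (lebC C (Suc n))" "\<And>x t. f (x(Suc n := t)) = f x"
  shows "(\<integral>\<^sup>+x. f x * coord_dens E C (Suc n) \<phi> x \<partial>lebC C (Suc n)) =
    (\<integral>\<^sup>+x. f x * coord_dens E C n (\<lambda>j y. \<phi> j y * ennreal (wt E j y)) x \<partial>lebC C n) *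
    (\<integral>\<^sup>+y. indicator (coord_dom E (Suc n)) y * \<phi> (Suc n) y \<partial>lborel)"
proof -
  let ?n = "Suc n"
  let ?D = "coord_dom E ?n"
  define \<kappa> where "\<kappa> = (\<integral>\<^sup>+y. indicator ?D y * \<phi> ?n y \<partial>lborel)"
  have I: "free_indices C ?n = insert ?n (free_indices C n)" "?n \<notin> free_indices C n"
    using assms(1) by (auto simp: free_indices_Suc) (auto simp: free_indices_def)
  have [measurable]: "\<phi> ?n \<in> borel_measurable borel" using \<phi>[of ?n] by simp
  have meas: "(\<lambda>x. f x * coord_dens E C ?n \<phi> x) \<in> borel_measurable (lebC C ?n)"
    using f(1) measurable_coord_dens[of ?n \<phi> E C] \<phi> by simp
  have inner: "(\<integral>\<^sup>+t. f (x(?n := t)) * coord_dens E C ?n \<phi> (x(?n := t)) \<partial>lborel) =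
      f x * coord_dens E C n (\<lambda>j y. \<phi> j y * ennreal (wt E j y)) x * \<kappa>" for x
  proof (cases "coords_ok E n (ycoord E C x)")
    case False
    have "\<not> coords_ok E ?n (ycoord E C (x(?n := t)))" for t
    proof -
      have "coords_ok E n (ycoord E C (x(?n := t))) = coords_ok E n (ycoord E C x)"
        by (intro coords_ok_cong ycoord_cong) auto
      thus ?thesis using False by (simp add: coords_ok_Suc)
    qed
    thus ?thesis using False by (simp add: coord_dens_def)
  next
    case True
    define \<sigma> where "\<sigma> = slope E (ycoord E C x) ?n"
    define b where "b = mom E ((ycoord E C x)(?n := 0)) ?n"
    define P where "P = (\<Prod>j\<in>{1..n}. \<phi> j (ycoord E C x j))"
    have \<sigma>: "\<sigma> > 0" unfolding \<sigma>_def by (rule slope_pos[OF True]) simp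
    have same: "ycoord E C (x(?n := t)) j = ycoord E C x j" if "1 \<le> j" "j \<le> n" for j t
      by (rule ycoord_cong) (use that in auto)
    have last: "ycoord E C (x(?n := t)) ?n = (t - b) / \<sigma>" for t
    proof -
      have "mom E ((ycoord E C (x(?n := t)))(?n := 0)) ?n = b"
        unfolding b_def by (rule mom_cong) (use same in auto)
      moreover have "slope E (ycoord E C (x(?n := t))) ?n = \<sigma>"
        unfolding \<sigma>_def by (rule slope_cong) (use same in auto)
      moreover have "fillc C (x(?n := t)) ?n = t" using assms(1) by (auto simp: fillc_def domIff)
      ultimately show ?thesis using sol_eq[of ?n E UNIV "fillc C (x(?n := t))"]
        by (simp add: ycoord_def)
    qed
    have "coords_ok E n (ycoord E C (x(?n := t)))" for t
      using True coords_ok_cong[of n "ycoord E C (x(?n := t))" "ycoord E C x" E] same by auto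
    hence "f (x(?n := t)) * coord_dens E C ?n \<phi> (x(?n := t)) =
        (f x * P) * (indicator ?D ((t - b) / \<sigma>) * \<phi> ?n ((t - b) / \<sigma>))" for t
      using f(2) same last
      by (simp add: coord_dens_def coords_ok_Suc P_def indicator_def mult_ac)
    hence "(\<integral>\<^sup>+t. f (x(?n := t)) * coord_dens E C ?n \<phi> (x(?n := t)) \<partial>lborel) =
        (\<integral>\<^sup>+t. (f x * P) * (indicator ?D ((t - b) / \<sigma>) * \<phi> ?n ((t - b) / \<sigma>)) \<partial>lborel)" by simp
    also have "... = (f x * P) * (\<integral>\<^sup>+t. indicator ?D ((t - b) / \<sigma>) * \<phi> ?n ((t - b) / \<sigma>) \<partial>lborel)"
      by (intro nn_integral_cmult) measurable
    also have "(\<integral>\<^sup>+t. indicator ?D ((t - b) / \<sigma>) * \<phi> ?n ((t - b) / \<sigma>) \<partial>lborel) = ennreal \<sigma> * \<kappa>"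
      unfolding \<kappa>_def using \<sigma>
      by (subst nn_integral_real_affine[where c = \<sigma> and t = b]) auto
    also have "f x * P * (ennreal \<sigma> * \<kappa>) = f x * coord_dens E C n (\<lambda>j y. \<phi> j y * ennreal (wt E j y)) x * \<kappa>"
    proof -
      have "ennreal \<sigma> = (\<Prod>j\<in>{1..n}. ennreal (wt E j (ycoord E C x j)))"
        unfolding \<sigma>_def slope_def atLeastLessThanSuc_atLeastAtMost
        using wt_pos[OF coords_okD[OF True]] by (intro prod_ennreal[symmetric]) (simp add: less_imp_le)
      thus ?thesis using True by (simp add: coord_dens_def P_def prod.distrib mult_ac)
    qed
    finally show ?thesis .
  qed
  have "(\<integral>\<^sup>+x. f x * coord_dens E C ?n \<phi> x \<partial>lebC C ?n) =
      (\<integral>\<^sup>+x. (\<integral>\<^sup>+t. f (x(?n := t)) * coord_dens E C ?n \<phi> (x(?n := t)) \<partial>lborel) \<partial>lebC C n)"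
    using meas I unfolding I(1) by (intro lborel_product.product_nn_integral_insert) auto
  also have "... = (\<integral>\<^sup>+x. f x * coord_dens E C n (\<lambda>j y. \<phi> j y * ennreal (wt E j y)) x * \<kappa> \<partial>lebC C n)"
    by (simp add: inner)
  also have "... = (\<integral>\<^sup>+x. f x * coord_dens E C n (\<lambda>j y. \<phi> j y * ennreal (wt E j y)) x \<partial>lebC C n) * \<kappa>"
  proof (rule nn_integral_multc)
    \<comment> \<open>\<open>f\<close> ignores the coordinate \<open>?n\<close>, so its
      measurability passes to the smaller product by inserting \<open>0\<close> there.\<close>
    have "(\<lambda>x. x(?n := 0)) \<in> lebC C n \<rightarrow>\<^sub>M lebC C ?n"
      unfolding I(1) by (intro measurable_fun_upd[where J = "free_indices C n"]) auto
    hence "(\<lambda>x. f (x(?n := 0))) \<in> borel_measurable (lebC C n)"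
      using f(1) by (rule measurable_compose)
    hence "f \<in> borel_measurable (lebC C n)" by (simp add: f(2))
    moreover have "coord_dens E C n (\<lambda>j y. \<phi> j y * ennreal (wt E j y)) \<in> borel_measurable (lebC C n)"
      using \<phi> measurable_wt[of "\<lambda>x. x" borel E]
      by (intro measurable_coord_dens borel_measurable_times_ennreal measurable_compose[OF _ measurable_ennreal]) auto
    ultimately show "(\<lambda>x. f x * coord_dens E C n (\<lambda>j y. \<phi> j y * ennreal (wt E j y)) x) \<in> borel_measurable (lebC C n)"
      by simp
  qed
  finally show ?thesis by (simp add: \<kappa>_def)
qed

section \<open>Integrability of the weights\<close>

text \<open>The exponent \<open>e\<close> counts the later free coordinates that have been
  integrated out: each of them contributes, through its slope, one factor \<open>wt\<close> to every
  earlier coordinate.\<close>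

definition tilt :: "interval_kind \<Rightarrow> moment_constraint \<Rightarrow> (nat \<Rightarrow> real \<Rightarrow> real) \<Rightarrow> nat \<Rightarrow> nat \<Rightarrow> nat \<Rightarrow> real \<Rightarrow> real" where
  "tilt E C V n e j y = exp (- real n * extend_potentials C V j y) * wt E j y ^ e"

text \<open>The index in \<open>{1..last_index C + 2}\<close> whose potential is used at \<open>j\<close>; it has the parity of \<open>j\<close>.\<close>

definition pot_index :: "moment_constraint \<Rightarrow> nat \<Rightarrow> nat" where
  "pot_index C j = (if j \<le> last_index C + 2 then j
     else if odd (j - last_index C) then last_index C + 1 else last_index C + 2)"

lemma extend_potentials_eq: "extend_potentials C V j = V (pot_index C j)"
  by (auto simp: extend_potentials_def pot_index_def)

lemma pot_index_range: "j \<ge> 1 \<Longrightarrow> pot_index C j \<in> {1..last_index C + 2}"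
  by (auto simp: pot_index_def)

lemma odd_pot_index: "odd (pot_index C j) \<longleftrightarrow> odd j"
  by (auto simp: pot_index_def)

lemma coord_dom_pot_index: "coord_dom E (pot_index C j) = coord_dom E j"
  by (cases E) (auto simp: odd_pot_index)

lemma wt_pot_index: "wt E (pot_index C j) = wt E j"
  by (cases E) (auto simp: odd_pot_index fun_eq_iff)

lemma closure_coord_dom: "closure (coord_dom E j) = coord_cdom E j"
proof (cases E)
  case Unit_Interval
  thus ?thesis using closure_greaterThanLessThan[of 0 "1::real"] by simp
next
  case Half_Line
  thus ?thesis by (simp add: closure_greaterThan)
next
  case Real_Line
  thus ?thesis by (auto simp: closure_greaterThan)
qed

text \<open>The strength of the growth condition: \<open>wt\<close> grows at most like \<open>\<bar>y\<bar>\<^sup>r\<close> with \<open>r = growth - 1\<close>.\<close>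

definition growth :: "interval_kind \<Rightarrow> nat \<Rightarrow> real" where
  "growth E j = (if E = Real_Line \<and> odd j then 1 else 2)"

lemma wt_le_growth:
  assumes "y \<in> coord_cdom E j" "E \<noteq> Unit_Interval" "\<bar>y\<bar> \<ge> 1"
  shows "0 \<le> wt E j y \<and> wt E j y \<le> \<bar>y\<bar> powr (growth E j - 1)"
  using assms by (cases E) (auto simp: growth_def)

lemma nn_integral_powr_tail:
  fixes d R :: real
  assumes "d > 0" "R > 0"
  shows "(\<integral>\<^sup>+y. indicator {R..} y * ennreal (y powr (- 1 - d)) \<partial>lborel) < \<infinity>"
proof -
  have "(\<integral>\<^sup>+y. ennreal (y powr (- 1 - d)) * indicator {R..} y \<partial>lborel) = ennreal (0 - (- (1 / d) * R powr (- d)))"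
  proof (rule nn_integral_FTC_atLeast)
    show "((\<lambda>y. - (1 / d) * y powr (- d)) has_real_derivative x powr (- 1 - d)) (at x)" if "R \<le> x" for x
    proof -
      have "((\<lambda>y. - (1 / d) * y powr (- d)) has_real_derivative - (1 / d) * (- d * x powr (- d - 1))) (at x)"
        using that assms by (auto intro!: derivative_eq_intros)
      moreover have "- d - 1 = - 1 - d" by simp
      ultimately show ?thesis using assms by simp
    qed
    show "((\<lambda>y. - (1 / d) * y powr (- d)) \<longlongrightarrow> 0) at_top"
      using assms by (intro tendsto_mult_right_zero tendsto_neg_powr filterlim_ident) auto
  qed (use assms in auto)
  thus ?thesis by (simp add: mult.commute)
qed

lemma nn_integral_abs_powr_tail:
  fixes d R :: real
  assumes "d > 0" "R > 0"
  shows "(\<integral>\<^sup>+y. indicator {y. \<bar>y\<bar> \<ge> R} y * ennreal (\<bar>y\<bar> powr (- 1 - d)) \<partial>lborel) < \<infinity>"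
proof -
  let ?f = "\<lambda>y::real. indicator {R..} y * ennreal (y powr (- 1 - d))"
  have "(\<integral>\<^sup>+y. indicator {y. \<bar>y\<bar> \<ge> R} y * ennreal (\<bar>y\<bar> powr (- 1 - d)) \<partial>lborel)
      \<le> (\<integral>\<^sup>+y. ?f y + ?f (- y) \<partial>lborel)"
    by (intro nn_integral_mono) (auto simp: indicator_def abs_if)
  also have "... = (\<integral>\<^sup>+y. ?f y \<partial>lborel) + (\<integral>\<^sup>+y. ?f (- y) \<partial>lborel)"
    by (rule nn_integral_add) measurable
  also have "(\<integral>\<^sup>+y. ?f (- y) \<partial>lborel) = (\<integral>\<^sup>+y. ?f y \<partial>lborel)"
    using nn_integral_real_affine[of ?f "- 1" 0] by simp
  also have "(\<integral>\<^sup>+y. ?f y \<partial>lborel) + (\<integral>\<^sup>+y. ?f y \<partial>lborel) < \<infinity>"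
    using nn_integral_powr_tail[OF assms] by simp
  finally show ?thesis .
qed

lemma tilt_pos: "y \<in> coord_dom E j \<Longrightarrow> tilt E C V n e j y > 0"
  using wt_pos by (simp add: tilt_def)

text \<open>The potential contributes the power \<open>- n * (growth + \<epsilon>)\<close> of the
  absolute value, the weights at most \<open>n * (growth - 1)\<close>, because
  \<open>e \<le> n\<close>. What remains is \<open>- n * (1 + \<epsilon>)\<close>, integrable for
  every \<open>n \<ge> 1\<close>; this is what the two growth rates in the integrability conditions
  are made for.\<close>

lemma tilt_tail:
  assumes "integrability_conditions E C V" "j \<ge> 1" "n \<ge> 1" "e \<le> n"
  shows "\<exists>R\<ge>1. \<exists>d>0. \<forall>y\<in>coord_cdom E j. \<bar>y\<bar> > R \<longrightarrow> tilt E C V n e j y \<le> \<bar>y\<bar> powr (- 1 - d)"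
proof (cases "E = Unit_Interval")
  case True
  thus ?thesis by (intro exI[of _ 1]) (auto intro!: exI[of _ 1])
next
  case False
  let ?i = "pot_index C j"
  have "\<exists>\<epsilon>>0. \<exists>R. \<forall>y\<in>coord_cdom E j. \<bar>y\<bar> \<ge> R \<longrightarrow> V ?i y \<ge> (growth E j + \<epsilon>) * ln \<bar>y\<bar>"
  proof -
    obtain \<epsilon> R where "\<epsilon> > 0" and *: "\<forall>j\<in>{1..last_index C + 2}. \<forall>y\<in>closure (coord_dom E j). \<bar>y\<bar> \<ge> R \<longrightarrow>
        (case E of
           Unit_Interval \<Rightarrow> True
         | Half_Line \<Rightarrow> V j y \<ge> (2 + \<epsilon>) * ln \<bar>y\<bar>
         | Real_Line \<Rightarrow> V j y \<ge> (if odd j then 1 + \<epsilon> else 2 + \<epsilon>) * ln \<bar>y\<bar>)"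
      using assms(1) by (auto simp: integrability_conditions_def)
    have "V ?i y \<ge> (growth E j + \<epsilon>) * ln \<bar>y\<bar>" if "y \<in> coord_cdom E j" "\<bar>y\<bar> \<ge> R" for y
    proof -
      have "y \<in> closure (coord_dom E ?i)" using that by (simp add: coord_dom_pot_index closure_coord_dom)
      with * that(2) pot_index_range[OF assms(2), of C] have "(case E of
           Unit_Interval \<Rightarrow> True
         | Half_Line \<Rightarrow> V ?i y \<ge> (2 + \<epsilon>) * ln \<bar>y\<bar>
         | Real_Line \<Rightarrow> V ?i y \<ge> (if odd ?i then 1 + \<epsilon> else 2 + \<epsilon>) * ln \<bar>y\<bar>)" by blast
      thus ?thesis using False by (cases E) (auto simp: growth_def odd_pot_index)
    qed
    with \<open>\<epsilon> > 0\<close> show ?thesis by blast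
  qed
  then obtain \<epsilon> R where \<epsilon>: "\<epsilon> > 0" and V: "\<And>y. y \<in> coord_cdom E j \<Longrightarrow> \<bar>y\<bar> \<ge> R \<Longrightarrow>
      V ?i y \<ge> (growth E j + \<epsilon>) * ln \<bar>y\<bar>" by blast
  have g: "growth E j \<ge> 1" by (simp add: growth_def)
  have "\<forall>y\<in>coord_cdom E j. \<bar>y\<bar> > max R 1 \<longrightarrow> tilt E C V n e j y \<le> \<bar>y\<bar> powr (- 1 - \<epsilon>)"
  proof (intro ballI impI)
    fix y assume y: "y \<in> coord_cdom E j" "\<bar>y\<bar> > max R 1"
    let ?a = "\<bar>y\<bar>"
    have a: "?a > 1" using y by simp
    have w: "0 \<le> wt E j y" "wt E j y \<le> ?a powr (growth E j - 1)" using wt_le_growth[OF y(1) False] a by auto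
    have "real n * ((growth E j + \<epsilon>) * ln ?a) \<le> real n * V ?i y"
      using V[OF y(1)] y by (intro mult_left_mono) auto
    hence "exp (- real n * V ?i y) \<le> exp (- (real n * ((growth E j + \<epsilon>) * ln ?a)))" by simp
    also have "... = ?a powr (- (real n * (growth E j + \<epsilon>)))" using a by (simp add: powr_def)
    finally have 1: "exp (- real n * V ?i y) \<le> ?a powr (- (real n * (growth E j + \<epsilon>)))" .
    have "wt E j y ^ e \<le> (?a powr (growth E j - 1)) ^ e" using w by (intro power_mono) auto
    also have "... = ?a powr (real e * (growth E j - 1))" using a by (simp add: powr_powr powr_realpow[symmetric] mult.commute)
    also have "... \<le> ?a powr (real n * (growth E j - 1))"
      using a assms(4) g by (intro powr_mono mult_right_mono) auto
    finally have 2: "wt E j y ^ e \<le> ?a powr (real n * (growth E j - 1))" .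
    have "tilt E C V n e j y \<le> ?a powr (- (real n * (growth E j + \<epsilon>))) * ?a powr (real n * (growth E j - 1))"
      unfolding tilt_def extend_potentials_eq using 1 2 w by (intro mult_mono) auto
    also have "... = ?a powr (real n * (- 1 - \<epsilon>))" unfolding powr_add[symmetric] by (simp add: algebra_simps)
    also have "... \<le> ?a powr (- 1 - \<epsilon>)"
    proof (intro powr_mono)
      have "1 * (1 + \<epsilon>) \<le> real n * (1 + \<epsilon>)" using assms(3) \<epsilon> by (intro mult_right_mono) auto
      thus "real n * (- 1 - \<epsilon>) \<le> - 1 - \<epsilon>" by (simp add: algebra_simps)
    qed (use a in simp)
    finally show "tilt E C V n e j y \<le> ?a powr (- 1 - \<epsilon>)" .
  qed
  moreover have "max R 1 \<ge> 1" by simp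
  ultimately show ?thesis using \<epsilon> by blast
qed

lemma continuous_on_potential:
  assumes "integrability_conditions E C V" "j \<ge> 1"
  shows "continuous_on (coord_cdom E j) (extend_potentials C V j)"
proof -
  have "\<forall>i\<in>{1..last_index C + 2}. continuous_on (closure (coord_dom E i)) (V i)"
    using assms(1) by (simp add: integrability_conditions_def)
  hence "continuous_on (closure (coord_dom E (pot_index C j))) (V (pot_index C j))"
    using pot_index_range[OF assms(2)] by blast
  thus ?thesis by (simp add: coord_dom_pot_index closure_coord_dom extend_potentials_eq)
qed

lemma closed_coord_cdom: "closed (coord_cdom E j)"
  by (cases E) auto

lemma tilt_bounded:
  assumes "integrability_conditions E C V" "j \<ge> 1" "n \<ge> 1" "e \<le> n"
  shows "\<exists>B>0. \<exists>R\<ge>1. \<exists>d>0. \<forall>y\<in>coord_cdom E j. tilt E C V n e j y \<le> B \<and>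
     (\<bar>y\<bar> > R \<longrightarrow> tilt E C V n e j y \<le> \<bar>y\<bar> powr (- 1 - d))"
proof -
  obtain R d where R: "R \<ge> 1" "d > 0" "\<And>y. y \<in> coord_cdom E j \<Longrightarrow> \<bar>y\<bar> > R \<Longrightarrow> tilt E C V n e j y \<le> \<bar>y\<bar> powr (- 1 - d)"
    using tilt_tail[OF assms] by blast
  have "continuous_on (coord_cdom E j \<inter> {- R..R}) (tilt E C V n e j)"
    unfolding tilt_def[abs_def]
    by (intro continuous_intros continuous_on_wt continuous_on_subset[OF continuous_on_potential[OF assms(1,2)]]) auto
  moreover have "compact (coord_cdom E j \<inter> {- R..R})"
    by (intro closed_Int_compact closed_coord_cdom) auto
  ultimately have "bounded (tilt E C V n e j ` (coord_cdom E j \<inter> {- R..R}))"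
    by (intro compact_imp_bounded compact_continuous_image)
  then obtain B where B0: "\<forall>z\<in>tilt E C V n e j ` (coord_cdom E j \<inter> {- R..R}). norm z \<le> B"
    unfolding bounded_iff by blast
  hence B: "\<bar>tilt E C V n e j y\<bar> \<le> B" if "y \<in> coord_cdom E j \<inter> {- R..R}" for y
    using B0 that by force
  have "tilt E C V n e j y \<le> max B 1" if "y \<in> coord_cdom E j" for y
  proof (cases "\<bar>y\<bar> > R")
    case True
    have "tilt E C V n e j y \<le> \<bar>y\<bar> powr (- 1 - d)" using R(3) that True by blast
    also have "... \<le> \<bar>y\<bar> powr 0" using True R(1,2) by (intro powr_mono) auto
    finally show ?thesis using True R(1) by (auto split: if_splits)
  next
    case False
    thus ?thesis using B[of y] that by fastforce
  qed
  hence "\<forall>y\<in>coord_cdom E j. tilt E C V n e j y \<le> max B 1 \<and> (\<bar>y\<bar> > R \<longrightarrow> tilt E C V n e j y \<le> \<bar>y\<bar> powr (- 1 - d))"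
    using R(3) by blast
  moreover have "max B 1 > 0" by simp
  ultimately show ?thesis using R(1,2) by blast
qed

lemma borel_measurable_on_set:
  fixes f :: "real \<Rightarrow> real"
  assumes "continuous_on D f" "D \<in> sets borel"
  shows "(\<lambda>y. indicator D y * ennreal (f y)) \<in> borel_measurable borel"
proof -
  have "(\<lambda>y. indicator D y * f y) \<in> borel_measurable borel"
    using borel_measurable_continuous_on_indicator[OF assms(2,1)] by simp
  hence "(\<lambda>y. ennreal (indicator D y * f y)) \<in> borel_measurable borel" by measurable
  also have "(\<lambda>y. ennreal (indicator D y * f y)) = (\<lambda>y. indicator D y * ennreal (f y))"
    by (auto simp: indicator_def)
  finally show ?thesis .
qed

lemma continuous_on_tilt:
  assumes "integrability_conditions E C V" "j \<ge> 1"
  shows "continuous_on (coord_cdom E j) (tilt E C V n e j)"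
  unfolding tilt_def[abs_def] by (intro continuous_intros continuous_on_wt continuous_on_potential assms)

definition tiltD :: "interval_kind \<Rightarrow> moment_constraint \<Rightarrow> (nat \<Rightarrow> real \<Rightarrow> real) \<Rightarrow> nat \<Rightarrow> nat \<Rightarrow> nat \<Rightarrow> real \<Rightarrow> ennreal" where
  "tiltD E C V n e j y = indicator (coord_dom E j) y * ennreal (tilt E C V n e j y)"

lemma measurable_tiltD:
  assumes "integrability_conditions E C V" "j \<ge> 1"
  shows "tiltD E C V n e j \<in> borel_measurable borel"
  unfolding tiltD_def[abs_def]
  by (intro borel_measurable_on_set continuous_on_subset[OF continuous_on_tilt[OF assms]] coord_dom_subset_cdom coord_dom_borel)

lemma tiltD_wt: "tiltD E C V n e j y * ennreal (wt E j y) = tiltD E C V n (Suc e) j y"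
proof (cases "y \<in> coord_dom E j")
  case True
  hence "ennreal (tilt E C V n e j y) * ennreal (wt E j y) = ennreal (tilt E C V n (Suc e) j y)"
    using wt_pos[OF True] by (subst ennreal_mult[symmetric]) (auto simp: tilt_def mult_ac)
  thus ?thesis using True by (simp add: tiltD_def)
qed (simp add: tiltD_def)

lemma tiltD_integral:
  assumes "integrability_conditions E C V" "j \<ge> 1" "n \<ge> 1" "e \<le> n"
  shows "(\<integral>\<^sup>+y. indicator (coord_dom E j) y * tiltD E C V n e j y \<partial>lborel) < \<infinity>" (is ?fin)
    and "(\<integral>\<^sup>+y. indicator (coord_dom E j) y * tiltD E C V n e j y \<partial>lborel) > 0" (is ?pos)
proof -
  have eq: "indicator (coord_dom E j) y * tiltD E C V n e j y = tiltD E C V n e j y" for y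
    by (simp add: tiltD_def indicator_def)
  obtain B R d where B: "B > 0" "R \<ge> 1" "d > 0" "\<And>y. y \<in> coord_cdom E j \<Longrightarrow> tilt E C V n e j y \<le> B"
    "\<And>y. y \<in> coord_cdom E j \<Longrightarrow> \<bar>y\<bar> > R \<Longrightarrow> tilt E C V n e j y \<le> \<bar>y\<bar> powr (- 1 - d)"
    using tilt_bounded[OF assms] by metis
  have "(\<integral>\<^sup>+y. tiltD E C V n e j y \<partial>lborel) \<le>
      (\<integral>\<^sup>+y. ennreal B * indicator {- R..R} y + indicator {y. \<bar>y\<bar> \<ge> R} y * ennreal (\<bar>y\<bar> powr (- 1 - d)) \<partial>lborel)"
  proof (rule nn_integral_mono)
    fix y
    show "tiltD E C V n e j y \<le> ennreal B * indicator {- R..R} y + indicator {y. \<bar>y\<bar> \<ge> R} y * ennreal (\<bar>y\<bar> powr (- 1 - d))"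
    proof (cases "y \<in> coord_dom E j")
      case True
      hence y: "y \<in> coord_cdom E j" using coord_dom_subset_cdom by blast
      show ?thesis
      proof (cases "\<bar>y\<bar> > R")
        case False
        have "tiltD E C V n e j y \<le> ennreal B * indicator {- R..R} y"
          using True False B(4)[OF y] by (auto simp: tiltD_def indicator_def abs_le_iff intro!: ennreal_leI)
        thus ?thesis by (meson add_increasing2 order_trans zero_le)
      next
        case Tr: True
        have "tiltD E C V n e j y \<le> indicator {y. \<bar>y\<bar> \<ge> R} y * ennreal (\<bar>y\<bar> powr (- 1 - d))"
          using True Tr B(5)[OF y] by (auto simp: tiltD_def indicator_def intro!: ennreal_leI)
        thus ?thesis by (meson add_increasing order_trans zero_le)
      qed
    qed (simp add: tiltD_def)
  qed
  also have "... = (\<integral>\<^sup>+y. ennreal B * indicator {- R..R} y \<partial>lborel) + (\<integral>\<^sup>+y. indicator {y. \<bar>y\<bar> \<ge> R} y * ennreal (\<bar>y\<bar> powr (- 1 - d)) \<partial>lborel)"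
    by (rule nn_integral_add) measurable
  also have "... < \<infinity>"
    using nn_integral_abs_powr_tail[of d R] B(1-3) by (simp add: nn_integral_cmult_indicator ennreal_mult_less_top)
  finally show ?fin by (simp add: eq)
  show ?pos
  proof (rule ccontr)
    assume "\<not> ?pos"
    hence "(\<integral>\<^sup>+y. tiltD E C V n e j y \<partial>lborel) = 0" by (simp add: eq)
    hence "AE y in lborel. tiltD E C V n e j y = 0"
      using measurable_tiltD[OF assms(1,2)] by (subst (asm) nn_integral_0_iff_AE) auto
    hence "AE y in lborel. y \<notin> coord_dom E j"
    proof eventually_elim
      case (elim y)
      show ?case using elim tilt_pos[of y E j C V n e] by (auto simp: tiltD_def ennreal_eq_0_iff)
    qed
    hence "emeasure lborel (coord_dom E j) = 0"
      by (subst (asm) AE_iff_measurable[of "coord_dom E j"]) auto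
    \<comment> \<open>An interval of positive length contained in all the coordinate
      domains.\<close>
    moreover have "{1 / 4<..<1 / 2} \<subseteq> coord_dom E j" by (cases E) auto
    hence "emeasure lborel {1 / 4<..<1 / 2 :: real} \<le> emeasure lborel (coord_dom E j)"
      by (intro emeasure_mono) auto
    ultimately show False by simp
  qed
qed

lemma tiltD_le:
  assumes "integrability_conditions E C V" "j \<ge> 1" "n \<ge> 1" "e \<le> n"
  shows "\<exists>B>0. \<forall>y. tiltD E C V n e j y \<le> ennreal B"
proof -
  obtain B where B: "B > 0" "\<And>y. y \<in> coord_cdom E j \<Longrightarrow> tilt E C V n e j y \<le> B"
    using tilt_bounded[OF assms] by metis
  have "tiltD E C V n e j y \<le> ennreal B" for y
    using B(2)[of y] coord_dom_subset_cdom[of E j] by (auto simp: tiltD_def indicator_def intro!: ennreal_leI)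
  thus ?thesis using B(1) by blast
qed

text \<open>A free last coordinate is integrated out and raises all exponents by one; a constrained
  one carries no integration, and its factor is bounded by a constant. The hypothesis keeps every
  exponent at most \<open>n\<close> to the end, as \<open>tilt_tail\<close> demands.\<close>

lemma coord_integral_finite:
  assumes "integrability_conditions E C V" "n \<ge> 1"
    and "\<And>j. e j + s \<le> n"
  shows "(\<integral>\<^sup>+x. coord_dens E C s (\<lambda>j. tiltD E C V n (e j) j) x \<partial>lebC C s) < \<infinity>"
  using assms(3)
proof (induction s arbitrary: e)
  case 0
  have "free_indices C 0 = {}" by (simp add: free_indices_def)
  thus ?case by (simp add: coord_dens_def PiM_empty coords_ok_def)
next
  case (Suc s)
  let ?\<phi> = "\<lambda>e j. tiltD E C V n (e j) j"
  show ?case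
  proof (cases "Suc s \<in> dom C")
    case True
    obtain B where B: "\<And>y. ?\<phi> e (Suc s) y \<le> ennreal B"
      using tiltD_le[OF assms(1) _ assms(2), of "Suc s" "e (Suc s)"] Suc.prems[of "Suc s"] by auto
    have fs: "free_indices C (Suc s) = free_indices C s" using True by (simp add: free_indices_Suc)
    have "coord_dens E C (Suc s) (?\<phi> e) x \<le> coord_dens E C s (?\<phi> e) x * ennreal B" for x
    proof (cases "coords_ok E (Suc s) (ycoord E C x)")
      case True
      moreover have "coords_ok E s (ycoord E C x)" using True by (simp add: coords_ok_Suc)
      ultimately show ?thesis using B by (auto simp: coord_dens_def intro!: mult_left_mono)
    qed (simp add: coord_dens_def)
    hence "(\<integral>\<^sup>+x. coord_dens E C (Suc s) (?\<phi> e) x \<partial>lebC C (Suc s))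
        \<le> (\<integral>\<^sup>+x. coord_dens E C s (?\<phi> e) x * ennreal B \<partial>lebC C s)"
      unfolding fs by (intro nn_integral_mono) auto
    also have "... = (\<integral>\<^sup>+x. coord_dens E C s (?\<phi> e) x \<partial>lebC C s) * ennreal B"
      by (intro nn_integral_multc measurable_coord_dens measurable_tiltD assms)
    also have "... < \<infinity>" using Suc.IH[of e] Suc.prems
      by (simp add: ennreal_mult_less_top) (meson Suc_leD add_Suc_right)
    finally show ?thesis .
  next
    case False
    have "(\<integral>\<^sup>+x. coord_dens E C (Suc s) (?\<phi> e) x \<partial>lebC C (Suc s)) =
      (\<integral>\<^sup>+x. coord_dens E C s (\<lambda>j y. ?\<phi> e j y * ennreal (wt E j y)) x \<partial>lebC C s) *
      (\<integral>\<^sup>+y. indicator (coord_dom E (Suc s)) y * ?\<phi> e (Suc s) y \<partial>lborel)"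
      using nn_integral_coord_Suc[OF False, of "?\<phi> e" "\<lambda>_. 1" E] measurable_tiltD[OF assms(1)] by simp
    also have "(\<lambda>j y. ?\<phi> e j y * ennreal (wt E j y)) = ?\<phi> (\<lambda>j. Suc (e j))"
      by (simp add: tiltD_wt fun_eq_iff)
    also have "(\<integral>\<^sup>+x. coord_dens E C s (?\<phi> (\<lambda>j. Suc (e j))) x \<partial>lebC C s) *
      (\<integral>\<^sup>+y. indicator (coord_dom E (Suc s)) y * ?\<phi> e (Suc s) y \<partial>lborel) < \<infinity>"
    proof -
      have "(\<integral>\<^sup>+x. coord_dens E C s (?\<phi> (\<lambda>j. Suc (e j))) x \<partial>lebC C s) < \<infinity>"
        using Suc.prems by (intro Suc.IH) simp
      moreover have "(\<integral>\<^sup>+y. indicator (coord_dom E (Suc s)) y * ?\<phi> e (Suc s) y \<partial>lborel) < \<infinity>"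
        using Suc.prems[of "Suc s"] by (intro tiltD_integral assms) auto
      ultimately show ?thesis by (simp add: ennreal_mult_less_top)
    qed
    finally show ?thesis .
  qed
qed

text \<open>
  Integrating out the coordinates \<open>l + 1, ..., n\<close> only multiplies the density of the first \<open>l\<close> moments by
  powers of the weights, up to a constant that does not depend on the test function \<open>f\<close>.
\<close>

lemma coord_integral_marginal:
  assumes "integrability_conditions E C V" "is_constraint C" "n \<ge> 1" "last_index C \<le> l" "l \<le> s" "e + (s - l) \<le> n"
  shows "\<exists>K. 0 < K \<and> K < \<infinity> \<and> (\<forall>f. f \<in> borel_measurable (lebC C s) \<longrightarrow>
      (\<forall>x x'. (\<forall>i\<le>l. x i = x' i) \<longrightarrow> f x = f x') \<longrightarrow>
      (\<integral>\<^sup>+x. f x * coord_dens E C s (\<lambda>j. tiltD E C V n e j) x \<partial>lebC C s) =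
      (\<integral>\<^sup>+x. f x * coord_dens E C l (\<lambda>j. tiltD E C V n (e + (s - l)) j) x \<partial>lebC C l) * K)"
  using assms(5,6)
proof (induction s arbitrary: e rule: dec_induct)
  case base
  show ?case by (intro exI[of _ 1]) simp
next
  case (step s)
  have nd: "Suc s \<notin> dom C"
  proof
    assume "Suc s \<in> dom C"
    hence "Suc s \<le> last_index C" unfolding last_index_def
      using assms(2) by (intro Max_ge) (auto simp: is_constraint_def)
    thus False using step(1) assms(4) by simp
  qed
  have e': "Suc e + (s - l) = e + (Suc s - l)" using step(1) by simp
  have "Suc e + (s - l) \<le> n" using step.prems e' by simp
  from step.IH[OF this] obtain K where K: "0 < K" "K < \<infinity>" "\<forall>f. f \<in> borel_measurable (lebC C s) \<longrightarrow>
      (\<forall>x x'. (\<forall>i\<le>l. x i = x' i) \<longrightarrow> f x = f x') \<longrightarrow>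
      (\<integral>\<^sup>+x. f x * coord_dens E C s (\<lambda>j. tiltD E C V n (Suc e) j) x \<partial>lebC C s) =
      (\<integral>\<^sup>+x. f x * coord_dens E C l (\<lambda>j. tiltD E C V n (Suc e + (s - l)) j) x \<partial>lebC C l) * K"
    by (elim exE conjE)
  define \<kappa> where "\<kappa> = (\<integral>\<^sup>+y. indicator (coord_dom E (Suc s)) y * tiltD E C V n e (Suc s) y \<partial>lborel)"
  have \<kappa>: "0 < \<kappa>" "\<kappa> < \<infinity>" unfolding \<kappa>_def
    using tiltD_integral[OF assms(1) _ assms(3), of "Suc s" e] step.prems by auto
  show ?case
  proof (intro exI[of _ "K * \<kappa>"] conjI allI impI)
    show "0 < K * \<kappa>" using K \<kappa> by (simp add: ennreal_zero_less_mult_iff)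
    show "K * \<kappa> < \<infinity>" using K \<kappa> by (simp add: ennreal_mult_less_top)
    fix f :: "rvec \<Rightarrow> ennreal"
    assume f: "f \<in> borel_measurable (lebC C (Suc s))" "\<forall>x x'. (\<forall>i\<le>l. x i = x' i) \<longrightarrow> f x = f x'"
    have f2: "f (x(Suc s := t)) = f x" for x t using f(2) step(1) by auto
    have I: "free_indices C (Suc s) = insert (Suc s) (free_indices C s)"
      using nd by (auto simp: free_indices_Suc)
    have "(\<lambda>x. x(Suc s := 0)) \<in> lebC C s \<rightarrow>\<^sub>M lebC C (Suc s)"
      unfolding I by (intro measurable_fun_upd[where J = "free_indices C s"]) auto
    hence "(\<lambda>x. f (x(Suc s := 0))) \<in> borel_measurable (lebC C s)"
      using f(1) by (rule measurable_compose)
    hence f3: "f \<in> borel_measurable (lebC C s)" by (simp add: f2)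
    have "(\<integral>\<^sup>+x. f x * coord_dens E C (Suc s) (\<lambda>j. tiltD E C V n e j) x \<partial>lebC C (Suc s)) =
      (\<integral>\<^sup>+x. f x * coord_dens E C s (\<lambda>j y. tiltD E C V n e j y * ennreal (wt E j y)) x \<partial>lebC C s) * \<kappa>"
      unfolding \<kappa>_def by (rule nn_integral_coord_Suc[OF nd]) (use f f2 measurable_tiltD[OF assms(1)] in auto)
    also have "(\<lambda>j y. tiltD E C V n e j y * ennreal (wt E j y)) = (\<lambda>j. tiltD E C V n (Suc e) j)"
      by (simp add: tiltD_wt fun_eq_iff)
    also have "(\<integral>\<^sup>+x. f x * coord_dens E C s (\<lambda>j. tiltD E C V n (Suc e) j) x \<partial>lebC C s) * \<kappa> =
      (\<integral>\<^sup>+x. f x * coord_dens E C l (\<lambda>j. tiltD E C V n (e + (Suc s - l)) j) x \<partial>lebC C l) * (K * \<kappa>)"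
    proof -
      have "(\<integral>\<^sup>+x. f x * coord_dens E C s (\<lambda>j. tiltD E C V n (Suc e) j) x \<partial>lebC C s) =
        (\<integral>\<^sup>+x. f x * coord_dens E C l (\<lambda>j. tiltD E C V n (Suc e + (s - l)) j) x \<partial>lebC C l) * K"
        using K(3) f3 f(2) by blast
      thus ?thesis unfolding e' by (simp add: mult.assoc)
    qed
    finally show "(\<integral>\<^sup>+x. f x * coord_dens E C (Suc s) (\<lambda>j. tiltD E C V n e j) x \<partial>lebC C (Suc s)) =
      (\<integral>\<^sup>+x. f x * coord_dens E C l (\<lambda>j. tiltD E C V n (e + (Suc s - l)) j) x \<partial>lebC C l) * (K * \<kappa>)" .
  qed
qed

section \<open>Laplace asymptotics at nondegenerate minimizers\<close>

lemma nn_integral_exp_square: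
  assumes "t > 0"
  shows "(\<integral>\<^sup>+x. ennreal (exp (- t * (x - m)\<^sup>2)) \<partial>lborel) = ennreal (sqrt (pi / t))"
proof -
  define s where "s = sqrt (1 / (2 * t))"
  have s: "s > 0" "s\<^sup>2 = 1 / (2 * t)" using assms by (auto simp: s_def)
  have "exp (- t * (x - m)\<^sup>2) = sqrt (pi / t) * normal_density m s x" for x
    using assms by (simp add: normal_density_def s(2) real_sqrt_divide)
  hence "(\<integral>\<^sup>+x. ennreal (exp (- t * (x - m)\<^sup>2)) \<partial>lborel)
      = (\<integral>\<^sup>+x. ennreal (sqrt (pi / t)) * ennreal (normal_density m s x) \<partial>lborel)"
    using assms by (simp add: ennreal_mult)
  also have "... = ennreal (sqrt (pi / t)) * (\<integral>\<^sup>+x. ennreal (normal_density m s x) \<partial>lborel)"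
    by (rule nn_integral_cmult) measurable
  also have "(\<integral>\<^sup>+x. ennreal (normal_density m s x) \<partial>lborel) = 1"
    using s(1) by (subst nn_integral_eq_integral) auto
  finally show ?thesis by simp
qed

lemma nn_integral_gauss_PiM:
  assumes "finite I" "t > 0"
  shows "(\<integral>\<^sup>+x. ennreal (exp (- t * (\<Sum>i\<in>I. (x i - m i)\<^sup>2))) \<partial>Pi\<^sub>M I (\<lambda>_::nat. lborel))
    = ennreal (sqrt (pi / t) ^ card I)"
proof -
  have "(\<integral>\<^sup>+x. ennreal (exp (- t * (\<Sum>i\<in>I. (x i - m i)\<^sup>2))) \<partial>Pi\<^sub>M I (\<lambda>_::nat. lborel))
      = (\<integral>\<^sup>+x. (\<Prod>i\<in>I. ennreal (exp (- t * (x i - m i)\<^sup>2))) \<partial>Pi\<^sub>M I (\<lambda>_::nat. lborel))"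
    using assms(1) by (simp add: sum_distrib_left exp_sum prod_ennreal)
  also have "... = (\<Prod>i\<in>I. \<integral>\<^sup>+x. ennreal (exp (- t * (x - m i)\<^sup>2)) \<partial>lborel)"
    by (rule lborel_product.product_nn_integral_prod[OF assms(1)]) measurable
  also have "... = ennreal (sqrt (pi / t) ^ card I)"
    using assms(2) by (simp add: nn_integral_exp_square[simplified] ennreal_power)
  finally show ?thesis .
qed

text \<open>Half of the decay rate beats the polynomial factor, the other half beats the exponential
  on the slower scale, since \<open>R / (a n)^2\<close> tends to zero.\<close>

lemma exp_decay_dominates:
  assumes "\<delta> > 0" "filterlim a at_top sequentially" "L \<ge> 0" "R \<ge> 0"
  shows "\<forall>\<^sub>F n in sequentially. L * exp (- (real n - real n0) * \<delta>)
     \<le> (1 / sqrt (real n)) ^ d * exp (- (real n / (a n)\<^sup>2) * R)"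
proof -
  define b where "b = \<delta> / 2"
  have b: "b > 0" using assms by (simp add: b_def)
  have "((\<lambda>n. (b * real n) ^ d / exp (b * real n)) \<longlongrightarrow> 0) sequentially"
    by (rule filterlim_compose[OF tendsto_power_div_exp_0])
       (use b in "auto intro!: filterlim_tendsto_pos_mult_at_top[OF tendsto_const] filterlim_real_sequentially")
  hence "((\<lambda>n. L * exp (real n0 * \<delta>) / b ^ d * ((b * real n) ^ d / exp (b * real n))) \<longlongrightarrow> 0) sequentially"
    by (rule tendsto_mult_right_zero)
  hence ev1: "\<forall>\<^sub>F n in sequentially. L * exp (real n0 * \<delta>) / b ^ d * ((b * real n) ^ d / exp (b * real n)) < 1"
    by (rule order_tendstoD) simp
  have ev2: "\<forall>\<^sub>F n in sequentially. a n \<ge> 1 + R / b"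
    using assms(2) by (simp add: filterlim_at_top)
  show ?thesis
    using ev1 ev2 eventually_ge_at_top[of 1]
  proof eventually_elim
    case (elim n)
    have n: "real n \<ge> 1" using elim by simp
    have a1: "a n \<ge> 1" using elim(2) assms(4) b by (smt (verit) divide_nonneg_pos)
    have "R / b \<le> a n" using elim(2) by simp
    also have "... \<le> (a n)\<^sup>2" using a1 by (simp add: power2_eq_square)
    finally have "R \<le> b * (a n)\<^sup>2" using b by (simp add: field_simps)
    hence "R / (a n)\<^sup>2 \<le> b" using a1 by (simp add: field_simps)
    hence "real n * (R / (a n)\<^sup>2) \<le> real n * b" by (intro mult_left_mono) auto
    hence e1: "exp (- (real n * b)) \<le> exp (- (real n / (a n)\<^sup>2) * R)" by simp
    have "L * exp (real n0 * \<delta>) * real n ^ d \<le> exp (b * real n)"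
      using elim(1) b by (simp add: power_mult_distrib field_simps)
    hence e2: "L * exp (real n0 * \<delta>) * exp (- (b * real n)) \<le> (1 / real n) ^ d"
      using n by (simp add: exp_minus field_simps power_divide)
    have "sqrt (real n) \<le> real n" using n by (simp add: real_le_lsqrt power2_eq_square)
    hence e3: "(1 / real n) ^ d \<le> (1 / sqrt (real n)) ^ d"
      using n by (intro power_mono divide_left_mono) auto
    have "L * exp (- (real n - real n0) * \<delta>) = L * exp (real n0 * \<delta>) * exp (- (b * real n)) * exp (- (real n * b))"
      by (simp add: exp_add[symmetric] b_def algebra_simps)
    also have "... \<le> (1 / sqrt (real n)) ^ d * exp (- (real n / (a n)\<^sup>2) * R)"
      using e1 e2 e3 assms(3) by (intro mult_mono) auto
    finally show ?case .
  qed
qed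

text \<open>Laplace's method separated from the moment problem. \<open>Q\<close> is the squared
  length of a linear image, so that the matrix \<open>S\<close> may be a nonsymmetric factor of the
  Hessian of \<open>G\<close>. \<open>G0\<close> is the common value at the points of
  \<open>X\<close>; integrability is asked for a single \<open>n\<close> only, as decay in
  \<open>n\<close> away from \<open>X\<close> does the rest.\<close>

locale laplace_setting =
  fixes I :: "nat set" and U :: "rvec set" and G k :: "rvec \<Rightarrow> real"
    and X :: "rvec set" and S :: "rvec \<Rightarrow> nat \<Rightarrow> nat \<Rightarrow> real" and G0 :: real
  fixes M dens Q
  defines "M \<equiv> Pi\<^sub>M I (\<lambda>_. lborel :: real measure)"
    and "dens \<equiv> \<lambda>(n::nat) x. indicator U x * ennreal (k x * exp (- real n * (G x - G0)))"
    and "Q \<equiv> \<lambda>q (v :: nat \<Rightarrow> real). \<Sum>i\<in>I. (\<Sum>j\<in>I. S q i j * v j)\<^sup>2"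
  assumes finI: "finite I" and finX: "finite X" and X_ne: "X \<noteq> {}"
    and measurable_dens: "\<And>n. dens n \<in> borel_measurable M"
    and k_nonneg: "\<And>x. x \<in> U \<Longrightarrow> k x \<ge> 0"
    and taylor: "\<And>q e. q \<in> X \<Longrightarrow> e > 0 \<Longrightarrow> \<exists>\<rho>>0. \<forall>x\<in>space M. (\<forall>i\<in>I. \<bar>x i - q i\<bar> < \<rho>) \<longrightarrow>
        x \<in> U \<and> \<bar>G x - G0 - Q q (\<lambda>i. x i - q i) / 2\<bar> \<le> e * (\<Sum>i\<in>I. (x i - q i)\<^sup>2)"
    and k_local: "\<And>q. q \<in> X \<Longrightarrow> \<exists>\<rho>>0. \<exists>k1>0. \<exists>k2. \<forall>x\<in>space M. (\<forall>i\<in>I. \<bar>x i - q i\<bar> < \<rho>) \<longrightarrow>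
        k1 \<le> k x \<and> k x \<le> k2"
    and far: "\<And>\<rho>. \<rho> > 0 \<Longrightarrow> \<exists>\<delta>>0. \<forall>x\<in>U \<inter> space M. (\<forall>q\<in>X. \<exists>i\<in>I. \<bar>x i - q i\<bar> \<ge> \<rho>) \<longrightarrow> G x \<ge> G0 + \<delta>"
    and dens_finite: "\<exists>n. (\<integral>\<^sup>+x. dens n x \<partial>M) < \<infinity>"
    and coercive: "\<exists>c>0. \<forall>q\<in>X. \<forall>v. c * (\<Sum>i\<in>I. (v i)\<^sup>2) \<le> Q q v"
begin

lemma Q_nonneg: "Q q v \<ge> 0"
  unfolding Q_def by (intro sum_nonneg) auto

lemma Q_scale: "Q q (\<lambda>i. c * v i) = c\<^sup>2 * Q q v"
proof -
  have "(\<Sum>j\<in>I. S q i j * (c * v j))\<^sup>2 = c\<^sup>2 * (\<Sum>j\<in>I. S q i j * v j)\<^sup>2" for i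
    by (simp add: mult.left_commute sum_distrib_left[symmetric] power_mult_distrib)
  thus ?thesis by (simp add: Q_def sum_distrib_left)
qed

lemma Q_perturb:
  fixes z w :: rvec
  shows "\<exists>K\<ge>0. \<forall>\<delta> w. 0 \<le> \<delta> \<longrightarrow> \<delta> \<le> 1 \<longrightarrow> (\<forall>i\<in>I. \<bar>w i\<bar> \<le> \<delta>) \<longrightarrow> Q q (\<lambda>i. z i + w i) \<le> Q q z + \<delta> * K"
proof -
  define A where "A = (\<lambda>i. \<Sum>j\<in>I. S q i j * z j)"
  define s where "s = (\<lambda>i. \<Sum>j\<in>I. \<bar>S q i j\<bar>)"
  define K where "K = (\<Sum>i\<in>I. 2 * \<bar>A i\<bar> * s i + (s i)\<^sup>2)"
  have s0: "s i \<ge> 0" for i by (auto simp: s_def intro: sum_nonneg)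
  show ?thesis
  proof (intro exI[of _ K] conjI allI impI)
    show "K \<ge> 0" unfolding K_def using s0 by (intro sum_nonneg) auto
    fix \<delta> :: real and w :: rvec assume \<delta>: "0 \<le> \<delta>" "\<delta> \<le> 1" and w: "\<forall>i\<in>I. \<bar>w i\<bar> \<le> \<delta>"
    have "Q q (\<lambda>i. z i + w i) \<le> (\<Sum>i\<in>I. (A i)\<^sup>2 + \<delta> * (2 * \<bar>A i\<bar> * s i + (s i)\<^sup>2))"
      unfolding Q_def
    proof (rule sum_mono)
      fix i
      define B where "B = (\<Sum>j\<in>I. S q i j * w j)"
      have "\<bar>B\<bar> \<le> (\<Sum>j\<in>I. \<bar>S q i j\<bar> * \<delta>)"
        unfolding B_def by (rule order_trans[OF sum_abs], rule sum_mono) (use w in "auto simp: abs_mult intro!: mult_left_mono")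
      hence B: "\<bar>B\<bar> \<le> \<delta> * s i" by (simp add: s_def sum_distrib_left mult.commute)
      have "(\<Sum>j\<in>I. S q i j * (z j + w j)) = A i + B"
        by (simp add: A_def B_def distrib_left sum.distrib)
      hence "(\<Sum>j\<in>I. S q i j * (z j + w j))\<^sup>2 = (A i)\<^sup>2 + 2 * (A i * B) + B\<^sup>2"
        by (simp add: power2_sum)
      also have "A i * B \<le> \<bar>A i\<bar> * \<bar>B\<bar>" by (metis abs_ge_self abs_mult)
      also have "\<bar>A i\<bar> * \<bar>B\<bar> \<le> \<bar>A i\<bar> * (\<delta> * s i)" using B by (intro mult_left_mono) auto
      also have "B\<^sup>2 \<le> (\<delta> * s i)\<^sup>2" using B by (metis abs_ge_zero power2_abs power_mono)
      also have "(\<delta> * s i)\<^sup>2 = \<delta> * \<delta> * (s i)\<^sup>2" by (simp add: power2_eq_square)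
      also have "\<delta> * \<delta> * (s i)\<^sup>2 \<le> \<delta> * (s i)\<^sup>2"
        using \<delta> by (intro mult_right_mono) (auto simp: mult_left_le)
      finally show "(\<Sum>j\<in>I. S q i j * (z j + w j))\<^sup>2 \<le> (A i)\<^sup>2 + \<delta> * (2 * \<bar>A i\<bar> * s i + (s i)\<^sup>2)"
        by (simp add: algebra_simps)
    qed
    also have "... = Q q z + \<delta> * K"
      unfolding K_def sum_distrib_left Q_def A_def sum.distrib[symmetric] ..
    finally show "Q q (\<lambda>i. z i + w i) \<le> Q q z + \<delta> * K" .
  qed
qed

text \<open>Away from \<open>X\<close> the density with index \<open>n\<close> is at most
  \<open>exp (- (n - n0) * \<delta>)\<close> times the integrable one with index \<open>n0\<close>.
  Near a point of \<open>X\<close> a small share of the quadratic form is kept as a Gaussian, which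
  yields the volume factor, and the rest of it yields the exponential rate.\<close>

lemma mass_upper:
  assumes a: "filterlim a at_top sequentially" and \<eta>: "0 < \<eta>" "\<eta> < 1 / 2" and "\<rho>0 > 0"
    and A: "\<And>n x. x \<in> A n \<Longrightarrow> x \<in> space M"
      "\<And>n x q. x \<in> A n \<Longrightarrow> x \<in> U \<Longrightarrow> q \<in> X \<Longrightarrow> (\<forall>i\<in>I. \<bar>x i - q i\<bar> < \<rho>0) \<Longrightarrow>
         r\<^sup>2 \<le> (a n)\<^sup>2 * Q q (\<lambda>i. x i - q i)"
  shows "\<exists>C>0. \<forall>\<^sub>F n in sequentially. (\<integral>\<^sup>+x. indicator (A n) x * dens n x \<partial>M)
     \<le> ennreal (C * (1 / sqrt (real n)) ^ card I * exp (- (real n / (a n)\<^sup>2) * (r\<^sup>2 / 2 * (1 - 2 * \<eta>))))"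
proof -
  obtain c where c: "c > 0" "\<And>q v. q \<in> X \<Longrightarrow> c * (\<Sum>i\<in>I. (v i)\<^sup>2) \<le> Q q v"
    using coercive by blast
  \<comment> \<open>By coercivity with constant \<open>c\<close> the Taylor error is then at most
    \<open>\<eta> / 2\<close> times the quadratic form.\<close>
  define e where "e = \<eta> * c / 2"
  have e: "e > 0" using \<eta> c by (simp add: e_def)
  define near_ok where "near_ok = (\<lambda>q \<rho> k2. \<forall>x\<in>space M. (\<forall>i\<in>I. \<bar>x i - q i\<bar> < \<rho>) \<longrightarrow>
      \<bar>G x - G0 - Q q (\<lambda>i. x i - q i) / 2\<bar> \<le> e * (\<Sum>i\<in>I. (x i - q i)\<^sup>2) \<and> k x \<le> k2)"
  have "\<forall>q\<in>X. \<exists>\<rho>>0. \<exists>k2. near_ok q \<rho> k2"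
  proof
    fix q assume q: "q \<in> X"
    obtain \<rho>1 where 1: "\<rho>1 > 0" "\<forall>x\<in>space M. (\<forall>i\<in>I. \<bar>x i - q i\<bar> < \<rho>1) \<longrightarrow>
        x \<in> U \<and> \<bar>G x - G0 - Q q (\<lambda>i. x i - q i) / 2\<bar> \<le> e * (\<Sum>i\<in>I. (x i - q i)\<^sup>2)"
      using taylor[OF q e] by blast
    obtain \<rho>2 k1 k2 where 2: "\<rho>2 > 0" "\<forall>x\<in>space M. (\<forall>i\<in>I. \<bar>x i - q i\<bar> < \<rho>2) \<longrightarrow> k1 \<le> k x \<and> k x \<le> k2"
      using k_local[OF q] by blast
    have "near_ok q (min \<rho>1 \<rho>2) k2" using 1 2 by (auto simp: near_ok_def)
    moreover have "min \<rho>1 \<rho>2 > 0" using 1 2 by simp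
    ultimately show "\<exists>\<rho>>0. \<exists>k2. near_ok q \<rho> k2" by blast
  qed
  then obtain \<rho>' k2 where \<rho>': "\<And>q. q \<in> X \<Longrightarrow> \<rho>' q > 0" and ok: "\<And>q. q \<in> X \<Longrightarrow> near_ok q (\<rho>' q) (k2 q)"
    by metis
  have near: "\<bar>G x - G0 - Q q (\<lambda>i. x i - q i) / 2\<bar> \<le> e * (\<Sum>i\<in>I. (x i - q i)\<^sup>2) \<and> k x \<le> k2 q"
    if "q \<in> X" "x \<in> space M" "\<forall>i\<in>I. \<bar>x i - q i\<bar> < \<rho>' q" for q x
    using ok[OF that(1)] that(2,3) unfolding near_ok_def by blast
  define \<rho> where "\<rho> = Min (insert \<rho>0 (\<rho>' ` X))"
  have \<rho>: "\<rho> > 0" "\<rho> \<le> \<rho>0" "\<And>q. q \<in> X \<Longrightarrow> \<rho> \<le> \<rho>' q"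
    unfolding \<rho>_def using finX \<rho>' \<open>\<rho>0 > 0\<close> by auto
  define K where "K = (\<Sum>q\<in>X. \<bar>k2 q\<bar>) + 1"
  have K: "K > 0" "\<And>q. q \<in> X \<Longrightarrow> k2 q \<le> K"
  proof -
    show "K > 0" unfolding K_def by (simp add: add_nonneg_pos sum_nonneg)
    show "k2 q \<le> K" if "q \<in> X" for q
      using member_le_sum[of q X "\<lambda>q. \<bar>k2 q\<bar>"] that finX by (auto simp: K_def)
  qed
  obtain \<delta> where \<delta>: "\<delta> > 0"
    "\<And>x. x \<in> U \<inter> space M \<Longrightarrow> (\<forall>q\<in>X. \<exists>i\<in>I. \<bar>x i - q i\<bar> \<ge> \<rho>) \<Longrightarrow> G x \<ge> G0 + \<delta>"
    using far[OF \<rho>(1)] by blast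
  obtain n0 where n0: "(\<integral>\<^sup>+x. dens n0 x \<partial>M) < \<infinity>" using dens_finite by blast
  define L where "L = enn2real (\<integral>\<^sup>+x. dens n0 x \<partial>M)"
  have L: "(\<integral>\<^sup>+x. dens n0 x \<partial>M) = ennreal L" "L \<ge> 0" using n0 by (auto simp: L_def)
  define R where "R = r\<^sup>2 / 2 * (1 - 2 * \<eta>)"
  have R: "R \<ge> 0" using \<eta> by (simp add: R_def)
  define En where "En = (\<lambda>n. exp (- (real n / (a n)\<^sup>2) * R))"
  define t where "t = \<eta> * c / 2"
  have t: "t > 0" using \<eta> c by (simp add: t_def)
  have point: "indicator (A n) x * dens n x \<le>
      (\<Sum>q\<in>X. ennreal (K * En n) * ennreal (exp (- (real n * t) * (\<Sum>i\<in>I. (x i - q i)\<^sup>2))))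
        + ennreal (exp (- (real n - real n0) * \<delta>)) * dens n0 x"
    if n: "n \<ge> n0" "a n > 0" for n x
  proof (cases "x \<in> A n \<and> x \<in> U")
    case True
    hence x: "x \<in> A n" "x \<in> U" "x \<in> space M" using A by auto
    show ?thesis
    proof (cases "\<forall>q\<in>X. \<exists>i\<in>I. \<bar>x i - q i\<bar> \<ge> \<rho>")
      case True
      have "G x - G0 \<ge> \<delta>" using \<delta>(2)[of x] x True by auto
      hence "(real n - real n0) * \<delta> \<le> (real n - real n0) * (G x - G0)" using n by (intro mult_left_mono) auto
      hence "exp (- (real n - real n0) * (G x - G0)) \<le> exp (- (real n - real n0) * \<delta>)"
        by (simp add: algebra_simps)
      hence "exp (- real n0 * (G x - G0)) * exp (- (real n - real n0) * (G x - G0)) \<le> exp (- real n0 * (G x - G0)) * exp (- (real n - real n0) * \<delta>)"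
        by (intro mult_left_mono) auto
      hence "exp (- real n * (G x - G0)) \<le> exp (- real n0 * (G x - G0)) * exp (- (real n - real n0) * \<delta>)"
        by (simp add: exp_add[symmetric] algebra_simps)
      hence "k x * exp (- real n * (G x - G0)) \<le> k x * (exp (- real n0 * (G x - G0)) * exp (- (real n - real n0) * \<delta>))"
        using k_nonneg x by (intro mult_left_mono) auto
      hence "ennreal (k x * exp (- real n * (G x - G0))) \<le> ennreal (exp (- (real n - real n0) * \<delta>) * (k x * exp (- real n0 * (G x - G0))))"
        by (intro ennreal_leI) (simp add: mult_ac)
      also have "... = ennreal (exp (- (real n - real n0) * \<delta>)) * dens n0 x"
        using x k_nonneg by (simp add: dens_def ennreal_mult)
      finally have "indicator (A n) x * dens n x \<le> ennreal (exp (- (real n - real n0) * \<delta>)) * dens n0 x"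
        using x by (simp add: dens_def)
      thus ?thesis by (rule order_trans) simp
    next
      case False
      then obtain q where q: "q \<in> X" "\<And>i. i \<in> I \<Longrightarrow> \<bar>x i - q i\<bar> < \<rho>" by (auto simp: not_le)
      define v where "v = (\<lambda>i. x i - q i)"
      have nr: "\<bar>G x - G0 - Q q v / 2\<bar> \<le> e * (\<Sum>i\<in>I. (v i)\<^sup>2)" "k x \<le> k2 q"
        using near[OF q(1) x(3)] q(2) \<rho>(3)[OF q(1)] unfolding v_def by force+
      have r2: "r\<^sup>2 \<le> (a n)\<^sup>2 * Q q v" unfolding v_def
        using q(2) \<rho>(2) by (intro A(2)[OF x(1,2) q(1)]) force
      have Qc: "c * (\<Sum>i\<in>I. (v i)\<^sup>2) \<le> Q q v" by (rule c(2)[OF q(1)])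
      have "e * (\<Sum>i\<in>I. (v i)\<^sup>2) \<le> \<eta> / 2 * Q q v"
        using mult_left_mono[OF Qc, of "\<eta> / 2"] \<eta> by (simp add: e_def)
      hence "G x - G0 \<ge> Q q v / 2 - \<eta> / 2 * Q q v" using nr(1) by linarith
      \<comment> \<open>The first summand is bounded below by the hypothesis on \<open>A n\<close>;
        the second one is saved for the Gaussian integral.\<close>
      also have "Q q v / 2 - \<eta> / 2 * Q q v = Q q v / 2 * (1 - 2 * \<eta>) + \<eta> / 2 * Q q v"
        by (simp add: field_simps)
      finally have g: "G x - G0 \<ge> Q q v / 2 * (1 - 2 * \<eta>) + \<eta> / 2 * Q q v" .
      have "r\<^sup>2 / (a n)\<^sup>2 \<le> Q q v" using r2 n(2) by (simp add: field_simps)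
      hence "r\<^sup>2 / (a n)\<^sup>2 / 2 * (1 - 2 * \<eta>) \<le> Q q v / 2 * (1 - 2 * \<eta>)"
        using \<eta> by (intro mult_right_mono divide_right_mono) auto
      moreover have "t * (\<Sum>i\<in>I. (v i)\<^sup>2) \<le> \<eta> / 2 * Q q v"
        using mult_left_mono[OF Qc, of "\<eta> / 2"] \<eta> by (simp add: t_def)
      moreover have "R / (a n)\<^sup>2 = r\<^sup>2 / (a n)\<^sup>2 / 2 * (1 - 2 * \<eta>)" by (simp add: R_def)
      ultimately have "G x - G0 \<ge> R / (a n)\<^sup>2 + t * (\<Sum>i\<in>I. (v i)\<^sup>2)"
        using g by linarith
      hence "real n * (R / (a n)\<^sup>2 + t * (\<Sum>i\<in>I. (v i)\<^sup>2)) \<le> real n * (G x - G0)"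
        by (intro mult_left_mono) auto
      hence "exp (- real n * (G x - G0)) \<le> exp (- (real n / (a n)\<^sup>2) * R + - (real n * t) * (\<Sum>i\<in>I. (v i)\<^sup>2))"
        by (simp add: algebra_simps)
      also have "... = En n * exp (- (real n * t) * (\<Sum>i\<in>I. (v i)\<^sup>2))" by (simp only: exp_add En_def)
      finally have "k x * exp (- real n * (G x - G0)) \<le> K * (En n * exp (- (real n * t) * (\<Sum>i\<in>I. (v i)\<^sup>2)))"
        using nr(2) K(2)[OF q(1)] K(1) by (intro mult_mono) auto
      hence "ennreal (k x * exp (- real n * (G x - G0))) \<le> ennreal (K * En n) * ennreal (exp (- (real n * t) * (\<Sum>i\<in>I. (v i)\<^sup>2)))"
        using K(1) by (subst ennreal_mult[symmetric]) (auto intro!: ennreal_leI simp: En_def mult.assoc)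
      hence "indicator (A n) x * dens n x \<le> ennreal (K * En n) * ennreal (exp (- (real n * t) * (\<Sum>i\<in>I. (x i - q i)\<^sup>2)))"
        using x by (simp add: dens_def v_def)
      also have "... \<le> (\<Sum>q\<in>X. ennreal (K * En n) * ennreal (exp (- (real n * t) * (\<Sum>i\<in>I. (x i - q i)\<^sup>2))))"
        using finX q(1) by (intro member_le_sum) auto
      finally show ?thesis by (rule order_trans) simp
    qed
  qed (auto simp: dens_def indicator_def)
  have gauss_meas: "(\<lambda>x. ennreal (exp (- s * (\<Sum>i\<in>I. (x i - q i)\<^sup>2)))) \<in> borel_measurable M" for s q
    unfolding M_def by measurable
  have bound: "(\<integral>\<^sup>+x. indicator (A n) x * dens n x \<partial>M) \<le>
      (\<Sum>q\<in>X. ennreal (K * En n) * ennreal (sqrt (pi / (real n * t)) ^ card I))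
        + ennreal (exp (- (real n - real n0) * \<delta>)) * ennreal L"
    if n: "n \<ge> n0" "a n > 0" "n \<ge> 1" for n
  proof -
    have "(\<integral>\<^sup>+x. indicator (A n) x * dens n x \<partial>M) \<le>
      (\<integral>\<^sup>+x. (\<Sum>q\<in>X. ennreal (K * En n) * ennreal (exp (- (real n * t) * (\<Sum>i\<in>I. (x i - q i)\<^sup>2))))
        + ennreal (exp (- (real n - real n0) * \<delta>)) * dens n0 x \<partial>M)"
      by (intro nn_integral_mono point n)
    also have "... = (\<integral>\<^sup>+x. (\<Sum>q\<in>X. ennreal (K * En n) * ennreal (exp (- (real n * t) * (\<Sum>i\<in>I. (x i - q i)\<^sup>2)))) \<partial>M)
        + (\<integral>\<^sup>+x. ennreal (exp (- (real n - real n0) * \<delta>)) * dens n0 x \<partial>M)"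
      by (intro nn_integral_add borel_measurable_sum borel_measurable_times_ennreal gauss_meas measurable_dens borel_measurable_const)
    also have "(\<integral>\<^sup>+x. (\<Sum>q\<in>X. ennreal (K * En n) * ennreal (exp (- (real n * t) * (\<Sum>i\<in>I. (x i - q i)\<^sup>2)))) \<partial>M)
        = (\<Sum>q\<in>X. \<integral>\<^sup>+x. ennreal (K * En n) * ennreal (exp (- (real n * t) * (\<Sum>i\<in>I. (x i - q i)\<^sup>2))) \<partial>M)"
      by (intro nn_integral_sum borel_measurable_times_ennreal gauss_meas borel_measurable_const)
    also have "... = (\<Sum>q\<in>X. ennreal (K * En n) * ennreal (sqrt (pi / (real n * t)) ^ card I))"
    proof (rule sum.cong[OF refl])
      fix q
      have "(\<integral>\<^sup>+x. ennreal (K * En n) * ennreal (exp (- (real n * t) * (\<Sum>i\<in>I. (x i - q i)\<^sup>2))) \<partial>M)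
          = ennreal (K * En n) * (\<integral>\<^sup>+x. ennreal (exp (- (real n * t) * (\<Sum>i\<in>I. (x i - q i)\<^sup>2))) \<partial>M)"
        by (intro nn_integral_cmult gauss_meas)
      thus "(\<integral>\<^sup>+x. ennreal (K * En n) * ennreal (exp (- (real n * t) * (\<Sum>i\<in>I. (x i - q i)\<^sup>2))) \<partial>M)
          = ennreal (K * En n) * ennreal (sqrt (pi / (real n * t)) ^ card I)"
        unfolding M_def using nn_integral_gauss_PiM[OF finI, of "real n * t" q] n t by simp
    qed
    also have "(\<integral>\<^sup>+x. ennreal (exp (- (real n - real n0) * \<delta>)) * dens n0 x \<partial>M) = ennreal (exp (- (real n - real n0) * \<delta>)) * ennreal L"
      unfolding L(1)[symmetric] by (intro nn_integral_cmult measurable_dens)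
    finally show ?thesis .
  qed
  define C where "C = real (card X) * (K * sqrt (pi / t) ^ card I) + 1"
  have C: "C > 0" unfolding C_def using K(1) t by (intro add_nonneg_pos mult_nonneg_nonneg) auto
  show ?thesis
  proof (intro exI[of _ C] conjI C)
    have "\<forall>\<^sub>F n in sequentially. a n > 0" using a by (simp add: filterlim_at_top_dense)
    with exp_decay_dominates[OF \<delta>(1) a L(2) R, of n0 "card I"] eventually_ge_at_top[of n0] eventually_ge_at_top[of 1]
    show "\<forall>\<^sub>F n in sequentially. (\<integral>\<^sup>+x. indicator (A n) x * dens n x \<partial>M)
     \<le> ennreal (C * (1 / sqrt (real n)) ^ card I * exp (- (real n / (a n)\<^sup>2) * (r\<^sup>2 / 2 * (1 - 2 * \<eta>))))"
    proof eventually_elim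
      case (elim n)
      have sq: "sqrt (pi / (real n * t)) = sqrt (pi / t) * (1 / sqrt (real n))"
        by (simp add: real_sqrt_divide real_sqrt_mult)
      have "(\<integral>\<^sup>+x. indicator (A n) x * dens n x \<partial>M) \<le>
        (\<Sum>q\<in>X. ennreal (K * En n) * ennreal (sqrt (pi / (real n * t)) ^ card I))
        + ennreal (exp (- (real n - real n0) * \<delta>)) * ennreal L"
        using elim by (intro bound) auto
      also have "... = ennreal (real (card X) * (K * En n * sqrt (pi / (real n * t)) ^ card I) + L * exp (- (real n - real n0) * \<delta>))"
      proof -
        have nn: "K * En n \<ge> 0" "sqrt (pi / (real n * t)) ^ card I \<ge> 0" using K(1) t by (auto simp: En_def)
        have "(\<Sum>q\<in>X. ennreal (K * En n) * ennreal (sqrt (pi / (real n * t)) ^ card I)) = ennreal (real (card X) * (K * En n * sqrt (pi / (real n * t)) ^ card I))"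
        proof -
          have "ennreal (K * En n) * ennreal (sqrt (pi / (real n * t)) ^ card I) = ennreal (K * En n * sqrt (pi / (real n * t)) ^ card I)"
            by (rule ennreal_mult[symmetric, OF nn])
          moreover have "0 \<le> K * En n * sqrt (pi / (real n * t)) ^ card I" using nn by (rule mult_nonneg_nonneg)
          ultimately show ?thesis
            by (simp only: sum_constant ennreal_of_nat_eq_real_of_nat ennreal_mult[OF of_nat_0_le_iff])
        qed
        moreover have "ennreal (exp (- (real n - real n0) * \<delta>)) * ennreal L = ennreal (L * exp (- (real n - real n0) * \<delta>))"
          using L(2) by (simp add: ennreal_mult mult.commute)
        moreover have "0 \<le> real (card X) * (K * En n * sqrt (pi / (real n * t)) ^ card I)"
          using nn K(1) by (intro mult_nonneg_nonneg) (auto simp: En_def)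
        ultimately show ?thesis using L(2) by (simp add: ennreal_plus[symmetric] del: ennreal_plus)
      qed
      also have "... \<le> ennreal (C * (1 / sqrt (real n)) ^ card I * En n)"
      proof (rule ennreal_leI)
        have "L * exp (- (real n - real n0) * \<delta>) \<le> (1 / sqrt (real n)) ^ card I * En n"
          using elim by (simp add: En_def)
        thus "real (card X) * (K * En n * sqrt (pi / (real n * t)) ^ card I) + L * exp (- (real n - real n0) * \<delta>)
            \<le> C * (1 / sqrt (real n)) ^ card I * En n"
          unfolding sq power_mult_distrib C_def by (simp add: algebra_simps)
      qed
      finally show ?case by (simp add: En_def R_def)
    qed
  qed
qed

text \<open>The set is a box of side \<open>2 * \<delta> / a n\<close> around
  \<open>q + z / a n\<close>. Its volume gives the polynomial factor, and on it
  \<open>(a n)^2 * (G x - G0)\<close> is at most \<open>Q q z / 2 + \<eta>\<close>.\<close>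

lemma mass_lower:
  assumes q: "q \<in> X" and "\<eta> > 0" and a: "filterlim a at_top sequentially"
  shows "\<exists>\<delta>0>0. \<forall>\<delta>. 0 < \<delta> \<and> \<delta> \<le> \<delta>0 \<longrightarrow> (\<exists>c>0. \<forall>\<^sub>F n in sequentially.
    ennreal (c * (1 / a n) ^ card I * exp (- (real n / (a n)\<^sup>2) * (Q q z / 2 + \<eta>)))
     \<le> (\<integral>\<^sup>+x. indicator {x\<in>space M. \<forall>i\<in>I. \<bar>a n * (x i - q i) - z i\<bar> \<le> \<delta>} x * dens n x \<partial>M))"
proof -
  obtain K where K: "K \<ge> 0" "\<And>\<delta> w. 0 \<le> \<delta> \<Longrightarrow> \<delta> \<le> 1 \<Longrightarrow> (\<forall>i\<in>I. \<bar>w i\<bar> \<le> \<delta>) \<Longrightarrow> Q q (\<lambda>i. z i + w i) \<le> Q q z + \<delta> * K"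
    using Q_perturb[of q z] by blast
  define Z where "Z = (\<Sum>i\<in>I. (\<bar>z i\<bar> + 1)\<^sup>2)"
  have Z: "Z \<ge> 0" by (auto simp: Z_def intro: sum_nonneg)
  \<comment> \<open>\<open>Z\<close> bounds the squared length of the rescaled points of the box, so
    the rescaled Taylor error is at most half of \<open>\<eta>\<close>; the other half is left to
    the perturbation of \<open>Q\<close>.\<close>
  define e where "e = \<eta> / (2 * (Z + 1))"
  have e: "e > 0" using \<open>\<eta> > 0\<close> Z by (simp add: e_def)
  have eZ: "e * Z \<le> \<eta> / 2" using \<open>\<eta> > 0\<close> Z by (simp add: e_def field_simps)
  obtain \<rho>1 where 1: "\<rho>1 > 0" "\<And>x. x \<in> space M \<Longrightarrow> (\<forall>i\<in>I. \<bar>x i - q i\<bar> < \<rho>1) \<Longrightarrow>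
        x \<in> U \<and> \<bar>G x - G0 - Q q (\<lambda>i. x i - q i) / 2\<bar> \<le> e * (\<Sum>i\<in>I. (x i - q i)\<^sup>2)"
    using taylor[OF q e] by blast
  obtain \<rho>2 k1 where 2: "\<rho>2 > 0" "k1 > 0" "\<And>x. x \<in> space M \<Longrightarrow> (\<forall>i\<in>I. \<bar>x i - q i\<bar> < \<rho>2) \<Longrightarrow> k1 \<le> k x"
    using k_local[OF q] by blast
  define \<rho> where "\<rho> = min \<rho>1 \<rho>2"
  have \<rho>: "\<rho> > 0" using 1 2 by (simp add: \<rho>_def)
  \<comment> \<open>Makes the perturbation bound \<open>\<delta> * K\<close> of \<open>Q\<close> at
    most \<open>\<eta>\<close>; the minimum with \<open>1\<close> meets the side condition of
    \<open>Q_perturb\<close>.\<close>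
  define \<delta>0 where "\<delta>0 = min 1 (\<eta> / (K + 1))"
  have \<delta>0: "\<delta>0 > 0" using \<open>\<eta> > 0\<close> K by (simp add: \<delta>0_def)
  define zm where "zm = (\<Sum>i\<in>I. \<bar>z i\<bar>) + 1"
  have zm: "\<bar>z i\<bar> + 1 \<le> zm" if "i \<in> I" for i
    using member_le_sum[of i I "\<lambda>i. \<bar>z i\<bar>"] that finI by (auto simp: zm_def)
  show ?thesis
  proof (rule exI[of _ \<delta>0], intro conjI allI impI \<delta>0)
    fix \<delta> assume \<delta>: "0 < \<delta> \<and> \<delta> \<le> \<delta>0"
    have \<delta>1: "\<delta> \<le> 1" "\<delta> * K \<le> \<eta>"
    proof -
      show "\<delta> \<le> 1" using \<delta> by (simp add: \<delta>0_def)
      have "\<delta> * K \<le> \<eta> / (K + 1) * K" using \<delta> K by (intro mult_right_mono) (auto simp: \<delta>0_def)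
      also have "... \<le> \<eta>" using K \<open>\<eta> > 0\<close> by (simp add: field_simps)
      finally show "\<delta> * K \<le> \<eta>" .
    qed
    define c where "c = k1 * (2 * \<delta>) ^ card I"
    have c: "c > 0" using 2 \<delta> by (simp add: c_def)
    have ev: "\<forall>\<^sub>F n in sequentially. a n > max 0 (zm / \<rho>)"
      using a unfolding filterlim_at_top_dense by blast
    have "\<forall>\<^sub>F n in sequentially.
      ennreal (c * (1 / a n) ^ card I * exp (- (real n / (a n)\<^sup>2) * (Q q z / 2 + \<eta>)))
       \<le> (\<integral>\<^sup>+x. indicator {x\<in>space M. \<forall>i\<in>I. \<bar>a n * (x i - q i) - z i\<bar> \<le> \<delta>} x * dens n x \<partial>M)"
      using ev
    proof eventually_elim
      case (elim n)
      hence an: "a n > 0" "zm < \<rho> * a n" using \<rho> by (auto simp: field_simps)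
      define B where "B = {x\<in>space M. \<forall>i\<in>I. \<bar>a n * (x i - q i) - z i\<bar> \<le> \<delta>}"
      define Ex where "Ex = exp (- (real n / (a n)\<^sup>2) * (Q q z / 2 + \<eta>))"
      have box: "B = PiE I (\<lambda>i. {q i + (z i - \<delta>) / a n..q i + (z i + \<delta>) / a n})"
      proof -
        have "\<bar>a n * (t - q i) - z i\<bar> \<le> \<delta> \<longleftrightarrow> t \<in> {q i + (z i - \<delta>) / a n..q i + (z i + \<delta>) / a n}" for t i
          using an(1) by (simp add: abs_le_iff field_simps) argo
        thus ?thesis by (auto simp: B_def M_def space_PiM PiE_iff extensional_def)
      qed
      have "emeasure M B = (\<Prod>i\<in>I. emeasure lborel {q i + (z i - \<delta>) / a n..q i + (z i + \<delta>) / a n})"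
        unfolding box M_def by (rule lborel_product.emeasure_PiM[OF finI]) auto
      also have "... = (\<Prod>i\<in>I. ennreal (2 * \<delta> / a n))"
      proof (rule prod.cong[OF refl])
        fix i
        have "(z i - \<delta>) / a n \<le> (z i + \<delta>) / a n" using an(1) \<delta> by (intro divide_right_mono) auto
        hence "emeasure lborel {q i + (z i - \<delta>) / a n..q i + (z i + \<delta>) / a n}
            = ennreal (q i + (z i + \<delta>) / a n - (q i + (z i - \<delta>) / a n))" by (intro emeasure_lborel_Icc) auto
        also have "q i + (z i + \<delta>) / a n - (q i + (z i - \<delta>) / a n) = 2 * \<delta> / a n"
          by (simp add: add_divide_distrib diff_divide_distrib)
        finally show "emeasure lborel {q i + (z i - \<delta>) / a n..q i + (z i + \<delta>) / a n} = ennreal (2 * \<delta> / a n)" .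
      qed
      also have "... = ennreal ((2 * \<delta> / a n) ^ card I)"
        using an(1) \<delta> by (simp add: ennreal_power)
      finally have vol: "emeasure M B = ennreal ((2 * \<delta> / a n) ^ card I)" .
      have Bs: "B \<in> sets M" unfolding box M_def by (rule sets_PiM_I_finite[OF finI]) auto
      have point: "indicator B x * ennreal (k1 * Ex) \<le> indicator B x * dens n x" for x
      proof (cases "x \<in> B")
        case True
        hence x: "x \<in> space M" "\<And>i. i \<in> I \<Longrightarrow> \<bar>a n * (x i - q i) - z i\<bar> \<le> \<delta>" by (auto simp: B_def)
        define v where "v = (\<lambda>i. x i - q i)"
        have av: "\<bar>a n * v i\<bar> \<le> \<bar>z i\<bar> + 1" if "i \<in> I" for i using x(2)[OF that] \<delta>1(1) by (simp add: v_def)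
        have vr: "\<bar>v i\<bar> < \<rho>" if "i \<in> I" for i
        proof -
          have "a n * \<bar>v i\<bar> \<le> zm" using av[OF that] zm[OF that] an(1) by (simp add: abs_mult)
          also have "zm < a n * \<rho>" using an(2) by (simp add: mult.commute)
          finally show ?thesis using an(1) by simp
        qed
        have U: "x \<in> U" and tay: "\<bar>G x - G0 - Q q v / 2\<bar> \<le> e * (\<Sum>i\<in>I. (v i)\<^sup>2)"
          using 1(2)[OF x(1)] vr by (auto simp: v_def \<rho>_def)
        have kx: "k1 \<le> k x" using 2(3)[OF x(1)] vr by (auto simp: v_def \<rho>_def)
        have "(a n)\<^sup>2 * Q q v = Q q (\<lambda>i. a n * v i)" by (simp add: Q_scale)
        also have "... = Q q (\<lambda>i. z i + (a n * v i - z i))" by simp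
        also have "... \<le> Q q z + \<delta> * K"
          using \<delta> \<delta>1 x(2) by (intro K(2)) (auto simp: v_def)
        finally have Qb: "(a n)\<^sup>2 * Q q v \<le> Q q z + \<eta>" using \<delta>1(2) by simp
        have "(a n)\<^sup>2 * (\<Sum>i\<in>I. (v i)\<^sup>2) = (\<Sum>i\<in>I. \<bar>a n * v i\<bar>\<^sup>2)"
          by (simp add: sum_distrib_left power_mult_distrib)
        also have "... \<le> Z" unfolding Z_def using av by (intro sum_mono power_mono) auto
        finally have "e * ((a n)\<^sup>2 * (\<Sum>i\<in>I. (v i)\<^sup>2)) \<le> e * Z" using e by (intro mult_left_mono) auto
        hence Sb: "e * ((a n)\<^sup>2 * (\<Sum>i\<in>I. (v i)\<^sup>2)) \<le> \<eta> / 2" using eZ by linarith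
        have "(a n)\<^sup>2 * (G x - G0) \<le> (a n)\<^sup>2 * (Q q v / 2 + e * (\<Sum>i\<in>I. (v i)\<^sup>2))"
          using tay by (intro mult_left_mono) auto
        also have "... \<le> Q q z / 2 + \<eta>" using Qb Sb by (simp add: algebra_simps)
        finally have "G x - G0 \<le> (Q q z / 2 + \<eta>) / (a n)\<^sup>2" using an(1) by (simp add: field_simps)
        hence "real n * (G x - G0) \<le> real n * ((Q q z / 2 + \<eta>) / (a n)\<^sup>2)" by (intro mult_left_mono) auto
        hence "Ex \<le> exp (- real n * (G x - G0))" by (simp add: Ex_def)
        hence "k1 * Ex \<le> k x * exp (- real n * (G x - G0))"
          using kx 2(2) by (intro mult_mono) (auto simp: Ex_def)
        thus ?thesis using U True by (auto simp: dens_def intro!: ennreal_leI)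
      qed simp
      have "ennreal (c * (1 / a n) ^ card I * Ex) = ennreal (k1 * Ex) * emeasure M B"
        unfolding vol using 2(2) an(1) \<delta> by (subst ennreal_mult[symmetric]) (auto simp: c_def Ex_def power_divide mult_ac)
      also have "... = (\<integral>\<^sup>+x. indicator B x * ennreal (k1 * Ex) \<partial>M)"
        by (simp only: nn_integral_cmult_indicator[OF Bs, symmetric] mult.commute[of "indicator B _"])
      also have "... \<le> (\<integral>\<^sup>+x. indicator B x * dens n x \<partial>M)"
        by (intro nn_integral_mono point)
      finally show ?case by (simp add: Ex_def B_def)
    qed
    with c show "\<exists>c>0. \<forall>\<^sub>F n in sequentially.
      ennreal (c * (1 / a n) ^ card I * exp (- (real n / (a n)\<^sup>2) * (Q q z / 2 + \<eta>)))
       \<le> (\<integral>\<^sup>+x. indicator {x\<in>space M. \<forall>i\<in>I. \<bar>a n * (x i - q i) - z i\<bar> \<le> \<delta>} x * dens n x \<partial>M)" by blast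
  qed
qed

section \<open>The total mass and normalized estimates\<close>

definition mass :: "nat \<Rightarrow> ennreal" where "mass n = (\<integral>\<^sup>+x. dens n x \<partial>M)"

text \<open>Both bounds come from the estimates above on the scale \<open>a n = sqrt n\<close>: the
  upper one with \<open>r = 0\<close>, where the hypothesis on the set is nonnegativity of
  \<open>Q\<close>, the lower one around a point of \<open>X\<close>, where the exponential factor
  is a constant.\<close>

lemma mass_bounds:
  "\<exists>c>0. \<exists>C>0. \<forall>\<^sub>F n in sequentially. ennreal (c * (1 / sqrt (real n)) ^ card I) \<le> mass n \<and>
     mass n \<le> ennreal (C * (1 / sqrt (real n)) ^ card I)"
proof -
  have sq: "filterlim (\<lambda>n. sqrt (real n)) at_top sequentially"
    by (rule filterlim_compose[OF sqrt_at_top filterlim_real_sequentially])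
  have "\<exists>C>0. \<forall>\<^sub>F n in sequentially. (\<integral>\<^sup>+x. indicator (space M) x * dens n x \<partial>M)
     \<le> ennreal (C * (1 / sqrt (real n)) ^ card I * exp (- (real n / (sqrt (real n))\<^sup>2) * (0\<^sup>2 / 2 * (1 - 2 * (1/4)))))"
    by (rule mass_upper[OF sq, of "1/4" 1]) (auto simp: Q_nonneg)
  then obtain C where C: "C > 0" "\<forall>\<^sub>F n in sequentially. mass n \<le> ennreal (C * (1 / sqrt (real n)) ^ card I)"
    by (auto simp: mass_def cong: nn_integral_cong)
  obtain q where q: "q \<in> X" using X_ne by blast
  obtain \<delta>0 where \<delta>0: "\<delta>0 > 0" "\<And>\<delta>. 0 < \<delta> \<Longrightarrow> \<delta> \<le> \<delta>0 \<Longrightarrow> (\<exists>c>0. \<forall>\<^sub>F n in sequentially.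
    ennreal (c * (1 / sqrt (real n)) ^ card I * exp (- (real n / (sqrt (real n))\<^sup>2) * (Q q (\<lambda>_. 0) / 2 + 1)))
     \<le> (\<integral>\<^sup>+x. indicator {x\<in>space M. \<forall>i\<in>I. \<bar>sqrt (real n) * (x i - q i) - 0\<bar> \<le> \<delta>} x * dens n x \<partial>M))"
    using mass_lower[where q = q and \<eta> = 1 and a = "\<lambda>n. sqrt (real n)" and z = "\<lambda>_. 0"] q sq by auto
  obtain c where c: "c > 0" "\<forall>\<^sub>F n in sequentially.
    ennreal (c * (1 / sqrt (real n)) ^ card I * exp (- (real n / (sqrt (real n))\<^sup>2) * (Q q (\<lambda>_. 0) / 2 + 1)))
     \<le> (\<integral>\<^sup>+x. indicator {x\<in>space M. \<forall>i\<in>I. \<bar>sqrt (real n) * (x i - q i) - 0\<bar> \<le> \<delta>0} x * dens n x \<partial>M)"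
    using \<delta>0(2)[OF \<delta>0(1) order_refl] by blast
  define c' where "c' = c * exp (- (Q q (\<lambda>_. 0) / 2 + 1))"
  have "c' > 0" using c by (simp add: c'_def)
  moreover have "\<forall>\<^sub>F n in sequentially. ennreal (c' * (1 / sqrt (real n)) ^ card I) \<le> mass n \<and>
     mass n \<le> ennreal (C * (1 / sqrt (real n)) ^ card I)"
    using c(2) C(2) eventually_ge_at_top[of 1]
  proof eventually_elim
    case (elim n)
    have "real n / (sqrt (real n))\<^sup>2 = 1" using elim by simp
    hence "ennreal (c' * (1 / sqrt (real n)) ^ card I) \<le> (\<integral>\<^sup>+x. indicator {x\<in>space M. \<forall>i\<in>I. \<bar>sqrt (real n) * (x i - q i) - 0\<bar> \<le> \<delta>0} x * dens n x \<partial>M)"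
      using elim(1) by (simp add: c'_def mult_ac)
    also have "... \<le> mass n" unfolding mass_def
      by (intro nn_integral_mono) (auto simp: indicator_def)
    finally show ?case using elim(2) by simp
  qed
  ultimately show ?thesis using C(1) by blast
qed

lemma mass_pos_finite: "\<forall>\<^sub>F n in sequentially. 0 < mass n \<and> mass n < \<infinity>"
proof -
  obtain c C where "c > 0" and ev: "\<forall>\<^sub>F n in sequentially. ennreal (c * (1 / sqrt (real n)) ^ card I) \<le> mass n \<and>
     mass n \<le> ennreal (C * (1 / sqrt (real n)) ^ card I)"
    using mass_bounds by blast
  show ?thesis using ev eventually_ge_at_top[of 1]
  proof eventually_elim
    case (elim n)
    have "0 < ennreal (c * (1 / sqrt (real n)) ^ card I)" using elim \<open>c > 0\<close> by simp
    hence "0 < mass n" using elim(1) by (blast intro: less_le_trans)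
    moreover have "mass n < \<infinity>" unfolding infinity_ennreal_def using elim(1) ennreal_less_top by (blast intro: le_less_trans)
    ultimately show ?case by simp
  qed
qed

definition speed_ok :: "rvec \<Rightarrow> bool" where
  "speed_ok a \<longleftrightarrow> filterlim a at_top sequentially \<and> filterlim (\<lambda>n. real n / (a n)\<^sup>2) at_top sequentially"

text \<open>Numerator and total mass have the same polynomial order, so their quotient leaves only a
  constant, which \<open>exp (n / (a n)^2 * \<eta> / 2)\<close> eventually exceeds because the speed
  tends to infinity.\<close>

lemma prob_upper:
  assumes "speed_ok a" "\<eta> > 0" "\<rho>0 > 0"
    and A: "\<And>n x. x \<in> A n \<Longrightarrow> x \<in> space M"
      "\<And>n x q. x \<in> A n \<Longrightarrow> x \<in> U \<Longrightarrow> q \<in> X \<Longrightarrow> (\<forall>i\<in>I. \<bar>x i - q i\<bar> < \<rho>0) \<Longrightarrow>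
         r\<^sup>2 \<le> (a n)\<^sup>2 * Q q (\<lambda>i. x i - q i)"
  shows "\<forall>\<^sub>F n in sequentially. (\<integral>\<^sup>+x. indicator (A n) x * dens n x \<partial>M) / mass n
     \<le> ennreal (exp (- (real n / (a n)\<^sup>2) * (r\<^sup>2 / 2 - \<eta>)))"
proof -
  \<comment> \<open>The relative loss in the exponent becomes an absolute one of at most
    \<open>\<eta> / 2\<close>; the \<open>1\<close> in the denominator covers
    \<open>r = 0\<close>.\<close>
  define \<eta>' where "\<eta>' = min (1/4) (\<eta> / (2 * (r\<^sup>2 + 1)))"
  have \<eta>': "0 < \<eta>'" "\<eta>' < 1 / 2" using assms(2) by (auto simp: \<eta>'_def add_nonneg_pos)
  have "r\<^sup>2 * \<eta>' \<le> r\<^sup>2 * (\<eta> / (2 * (r\<^sup>2 + 1)))" by (intro mult_left_mono) (auto simp: \<eta>'_def)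
  also have "... \<le> \<eta> / 2"
  proof -
    have "r\<^sup>2 / (r\<^sup>2 + 1) \<le> 1" by (simp add: add_nonneg_pos)
    hence "\<eta> / 2 * (r\<^sup>2 / (r\<^sup>2 + 1)) \<le> \<eta> / 2 * 1" using assms(2) by (intro mult_left_mono) auto
    thus ?thesis by (simp add: mult.commute)
  qed
  finally have r\<eta>: "r\<^sup>2 / 2 * (1 - 2 * \<eta>') \<ge> r\<^sup>2 / 2 - \<eta> / 2" by (simp add: algebra_simps)
  have a: "filterlim a at_top sequentially" using assms(1) by (simp add: speed_ok_def)
  have "\<exists>C>0. \<forall>\<^sub>F n in sequentially. (\<integral>\<^sup>+x. indicator (A n) x * dens n x \<partial>M)
     \<le> ennreal (C * (1 / sqrt (real n)) ^ card I * exp (- (real n / (a n)\<^sup>2) * (r\<^sup>2 / 2 * (1 - 2 * \<eta>'))))"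
  proof (rule mass_upper[OF a \<eta>' assms(3)])
    show "x \<in> space M" if "x \<in> A n" for n x using that by (rule A(1))
    show "r\<^sup>2 \<le> (a n)\<^sup>2 * Q q (\<lambda>i. x i - q i)"
      if "x \<in> A n" "x \<in> U" "q \<in> X" "\<forall>i\<in>I. \<bar>x i - q i\<bar> < \<rho>0" for n x q using that by (rule A(2))
  qed
  then obtain C where C: "C > 0" "\<forall>\<^sub>F n in sequentially. (\<integral>\<^sup>+x. indicator (A n) x * dens n x \<partial>M)
     \<le> ennreal (C * (1 / sqrt (real n)) ^ card I * exp (- (real n / (a n)\<^sup>2) * (r\<^sup>2 / 2 * (1 - 2 * \<eta>'))))"
    by blast
  obtain c where c: "c > 0" "\<forall>\<^sub>F n in sequentially. ennreal (c * (1 / sqrt (real n)) ^ card I) \<le> mass n"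
    using mass_bounds unfolding eventually_conj_iff by blast
  have "\<forall>\<^sub>F n in sequentially. real n / (a n)\<^sup>2 \<ge> ln (C / c) / (\<eta> / 2)"
    using assms(1) by (simp add: speed_ok_def filterlim_at_top)
  thus ?thesis using C(2) c(2) eventually_ge_at_top[of 1]
  proof eventually_elim
    case (elim n)
    let ?b = "real n / (a n)\<^sup>2"
    define s where "s = (1 / sqrt (real n)) ^ card I"
    have s: "s > 0" using elim by (simp add: s_def)
    have "ln (C / c) \<le> ?b * (\<eta> / 2)" using elim(1) assms(2) by (simp add: field_simps)
    hence "C / c \<le> exp (?b * (\<eta> / 2))" using C(1) c(1) by (metis divide_pos_pos exp_le_cancel_iff exp_ln)
    hence Cc: "C \<le> c * exp (?b * (\<eta> / 2))" using c(1) by (simp add: field_simps)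
    have "?b * (r\<^sup>2 / 2 - \<eta> / 2) \<le> ?b * (r\<^sup>2 / 2 * (1 - 2 * \<eta>'))" using r\<eta> by (intro mult_left_mono) auto
    hence "exp (- ?b * (r\<^sup>2 / 2 * (1 - 2 * \<eta>'))) \<le> exp (- ?b * (r\<^sup>2 / 2 - \<eta> / 2))" by simp
    hence "C * exp (- ?b * (r\<^sup>2 / 2 * (1 - 2 * \<eta>'))) \<le> c * exp (?b * (\<eta> / 2)) * exp (- ?b * (r\<^sup>2 / 2 - \<eta> / 2))"
      using Cc C(1) by (intro mult_mono) auto
    also have "... = c * exp (- ?b * (r\<^sup>2 / 2 - \<eta>))"
    proof -
      have "b * (\<eta> / 2) + - b * (y - \<eta> / 2) = - b * (y - \<eta>)" for b y :: real by (simp add: field_simps)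
      thus ?thesis by (simp only: mult.assoc exp_add[symmetric])
    qed
    finally have "C * s * exp (- ?b * (r\<^sup>2 / 2 * (1 - 2 * \<eta>'))) \<le> exp (- ?b * (r\<^sup>2 / 2 - \<eta>)) * (c * s)"
      using s by (simp add: mult_ac)
    hence "ennreal (C * s * exp (- ?b * (r\<^sup>2 / 2 * (1 - 2 * \<eta>')))) \<le> ennreal (exp (- ?b * (r\<^sup>2 / 2 - \<eta>)) * (c * s))"
      by (rule ennreal_leI)
    also have "... = ennreal (exp (- ?b * (r\<^sup>2 / 2 - \<eta>))) * ennreal (c * s)"
      using s c(1) by (simp add: ennreal_mult)
    also have "... \<le> ennreal (exp (- ?b * (r\<^sup>2 / 2 - \<eta>))) * mass n"
      using elim(3) by (intro mult_left_mono) (auto simp: s_def)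
    finally have le: "(\<integral>\<^sup>+x. indicator (A n) x * dens n x \<partial>M) \<le> ennreal (exp (- ?b * (r\<^sup>2 / 2 - \<eta>))) * mass n"
      using elim(2) by (simp add: s_def)
    have "mass n \<noteq> 0"
    proof
      assume "mass n = 0"
      hence "ennreal (c * s) \<le> 0" using elim(3) by (simp add: s_def)
      moreover have "c * s > 0" using s c(1) by simp
      ultimately show False by (simp add: ennreal_eq_0_iff)
    qed
    with le show ?case by (intro divide_le_posI_ennreal) (auto simp: mult.commute zero_less_iff_neq_zero)
  qed
qed

text \<open>Here the polynomial orders differ, but in the favourable direction: \<open>a n\<close>
  is eventually at most \<open>sqrt n\<close>, so the volume of the box is not too small in
  comparison with the total mass.\<close>

lemma prob_lower:
  assumes "speed_ok a" "\<eta> > 0" "q \<in> X"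
  shows "\<exists>\<delta>0>0. \<forall>\<delta>. 0 < \<delta> \<and> \<delta> \<le> \<delta>0 \<longrightarrow> (\<forall>\<^sub>F n in sequentially.
    ennreal (exp (- (real n / (a n)\<^sup>2) * (Q q z / 2 + \<eta>)))
     \<le> (\<integral>\<^sup>+x. indicator {x\<in>space M. \<forall>i\<in>I. \<bar>a n * (x i - q i) - z i\<bar> \<le> \<delta>} x * dens n x \<partial>M) / mass n)"
proof -
  have a: "filterlim a at_top sequentially" using assms(1) by (simp add: speed_ok_def)
  obtain \<delta>0 where \<delta>0: "\<delta>0 > 0" "\<And>\<delta>. 0 < \<delta> \<Longrightarrow> \<delta> \<le> \<delta>0 \<Longrightarrow> (\<exists>c>0. \<forall>\<^sub>F n in sequentially.
    ennreal (c * (1 / a n) ^ card I * exp (- (real n / (a n)\<^sup>2) * (Q q z / 2 + \<eta> / 2)))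
     \<le> (\<integral>\<^sup>+x. indicator {x\<in>space M. \<forall>i\<in>I. \<bar>a n * (x i - q i) - z i\<bar> \<le> \<delta>} x * dens n x \<partial>M))"
    using mass_lower[OF assms(3) _ a, of "\<eta> / 2" z] assms(2) by auto
  obtain C where C: "C > 0" "\<forall>\<^sub>F n in sequentially. mass n \<le> ennreal (C * (1 / sqrt (real n)) ^ card I)"
    using mass_bounds unfolding eventually_conj_iff by blast
  show ?thesis
  proof (intro exI[of _ \<delta>0] conjI allI impI \<delta>0(1))
    fix \<delta> assume "0 < \<delta> \<and> \<delta> \<le> \<delta>0"
    then obtain c where c: "c > 0" "\<forall>\<^sub>F n in sequentially.
      ennreal (c * (1 / a n) ^ card I * exp (- (real n / (a n)\<^sup>2) * (Q q z / 2 + \<eta> / 2)))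
       \<le> (\<integral>\<^sup>+x. indicator {x\<in>space M. \<forall>i\<in>I. \<bar>a n * (x i - q i) - z i\<bar> \<le> \<delta>} x * dens n x \<partial>M)"
      using \<delta>0(2) by blast
    have "\<forall>\<^sub>F n in sequentially. real n / (a n)\<^sup>2 \<ge> max 1 (ln (C / c) / (\<eta> / 2))"
      using assms(1) unfolding speed_ok_def filterlim_at_top by blast
    moreover have "\<forall>\<^sub>F n in sequentially. a n > 0" using a by (simp add: filterlim_at_top_dense)
    ultimately show "\<forall>\<^sub>F n in sequentially. ennreal (exp (- (real n / (a n)\<^sup>2) * (Q q z / 2 + \<eta>)))
     \<le> (\<integral>\<^sup>+x. indicator {x\<in>space M. \<forall>i\<in>I. \<bar>a n * (x i - q i) - z i\<bar> \<le> \<delta>} x * dens n x \<partial>M) / mass n"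
      using C(2) c(2) mass_pos_finite
    proof eventually_elim
      case (elim n)
      let ?b = "real n / (a n)\<^sup>2"
      have b1: "?b \<ge> 1" using elim(1) by simp
      have "ln (C / c) / (\<eta> / 2) \<le> ?b" using elim(1) by simp
      hence "ln (C / c) \<le> ?b * (\<eta> / 2)" using assms(2) by (simp add: field_simps)
      hence "C / c \<le> exp (?b * (\<eta> / 2))" using C(1) c(1) by (metis divide_pos_pos exp_le_cancel_iff exp_ln)
      hence Cc: "C \<le> c * exp (?b * (\<eta> / 2))" using c(1) by (simp add: field_simps)
      have "(a n)\<^sup>2 \<le> real n" using b1 elim(2) by (simp add: field_simps)
      hence asq: "a n \<le> sqrt (real n)" using elim(2) by (simp add: real_le_rsqrt)
      \<comment> \<open>The only place of this proof where the two scales are compared; it uses that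
        the speed is at least \<open>1\<close>.\<close>
      hence s: "(1 / sqrt (real n)) ^ card I \<le> (1 / a n) ^ card I"
      proof -
        have "sqrt (real n) > 0" using asq elim(2) by linarith
        thus ?thesis using elim(2) asq by (intro power_mono divide_left_mono mult_pos_pos) auto
      qed
      define J where "J = (\<integral>\<^sup>+x. indicator {x\<in>space M. \<forall>i\<in>I. \<bar>a n * (x i - q i) - z i\<bar> \<le> \<delta>} x * dens n x \<partial>M)"
      have "exp (- ?b * (Q q z / 2 + \<eta>)) * (C * (1 / sqrt (real n)) ^ card I)
          \<le> exp (- ?b * (Q q z / 2 + \<eta>)) * ((c * exp (?b * (\<eta> / 2))) * (1 / a n) ^ card I)"
        using Cc s C(1) c(1) by (intro mult_left_mono mult_mono) auto
      also have "... = c * (1 / a n) ^ card I * (exp (- ?b * (Q q z / 2 + \<eta>)) * exp (?b * (\<eta> / 2)))"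
        by (simp only: mult_ac)
      also have "exp (- ?b * (Q q z / 2 + \<eta>)) * exp (?b * (\<eta> / 2)) = exp (- ?b * (Q q z / 2 + \<eta> / 2))"
      proof -
        have "- b * (y + \<eta>) + b * (\<eta> / 2) = - b * (y + \<eta> / 2)" for b y :: real by (simp add: field_simps)
        thus ?thesis by (simp only: exp_add[symmetric])
      qed
      finally have "ennreal (exp (- ?b * (Q q z / 2 + \<eta>)) * (C * (1 / sqrt (real n)) ^ card I))
          \<le> ennreal (c * (1 / a n) ^ card I * exp (- ?b * (Q q z / 2 + \<eta> / 2)))" by (rule ennreal_leI)
      also have "... \<le> J" using elim(4) by (simp only: J_def)
      finally have "ennreal (exp (- ?b * (Q q z / 2 + \<eta>)) * (C * (1 / sqrt (real n)) ^ card I)) \<le> J" .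
      hence "ennreal (exp (- ?b * (Q q z / 2 + \<eta>))) * ennreal (C * (1 / sqrt (real n)) ^ card I) \<le> J"
        using C(1) by (simp add: ennreal_mult)
      moreover have "ennreal (exp (- ?b * (Q q z / 2 + \<eta>))) * mass n
          \<le> ennreal (exp (- ?b * (Q q z / 2 + \<eta>))) * ennreal (C * (1 / sqrt (real n)) ^ card I)"
        using elim(3) by (intro mult_left_mono) auto
      ultimately have "ennreal (exp (- ?b * (Q q z / 2 + \<eta>))) * mass n \<le> J" by (rule order_trans[rotated])
      hence "ennreal (exp (- ?b * (Q q z / 2 + \<eta>))) * mass n / mass n \<le> J / mass n"
        by (rule divide_right_mono_ennreal)
      moreover have "mass n \<noteq> 0" "mass n < \<infinity>" using elim(5) by auto
      ultimately show ?case by (simp add: J_def mult_divide_eq_ennreal less_top[symmetric])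
    qed
  qed
qed

end

section \<open>The positive definite square root\<close>

definition posdef_fun :: "nat \<Rightarrow> (nat \<Rightarrow> nat \<Rightarrow> real) \<Rightarrow> bool" where
  "posdef_fun d A \<longleftrightarrow> (\<forall>v. (\<exists>i<d. v i \<noteq> 0) \<longrightarrow> ipn d v (mvn d A v) > 0)"

lemma scalar_prod_mult_mat_vec:
  assumes "A \<in> carrier_mat d d" "v \<in> carrier_vec d"
  shows "scalar_prod v (mult_mat_vec A v) = ipn d (vec_index v) (mvn d (\<lambda>i j. A $$ (i, j)) (vec_index v))"
  using assms by (auto simp: scalar_prod_def ipn_def mvn_def atLeast0LessThan intro!: sum.cong)

lemma posdef_fun_iff:
  assumes "A \<in> carrier_mat d d"
  shows "posdef_fun d (\<lambda>i j. A $$ (i, j)) \<longleftrightarrow>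
    (\<forall>v\<in>carrier_vec d. v \<noteq> 0\<^sub>v d \<longrightarrow> scalar_prod v (mult_mat_vec A v) > 0)"
proof
  assume pd: "posdef_fun d (\<lambda>i j. A $$ (i, j))"
  show "\<forall>v\<in>carrier_vec d. v \<noteq> 0\<^sub>v d \<longrightarrow> scalar_prod v (mult_mat_vec A v) > 0"
  proof (intro ballI impI)
    fix v :: "real Matrix.vec" assume v: "v \<in> carrier_vec d" "v \<noteq> 0\<^sub>v d"
    have "\<exists>i<d. vec_index v i \<noteq> 0"
    proof (rule ccontr)
      assume "\<not> ?thesis"
      hence "v = 0\<^sub>v d" using v(1) by (intro eq_vecI) auto
      thus False using v(2) by simp
    qed
    thus "scalar_prod v (mult_mat_vec A v) > 0"
      using pd scalar_prod_mult_mat_vec[OF assms v(1)] by (auto simp: posdef_fun_def)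
  qed
next
  assume pd: "\<forall>v\<in>carrier_vec d. v \<noteq> 0\<^sub>v d \<longrightarrow> scalar_prod v (mult_mat_vec A v) > 0"
  show "posdef_fun d (\<lambda>i j. A $$ (i, j))"
    unfolding posdef_fun_def
  proof (intro allI impI)
    fix v :: rvec assume "\<exists>i<d. v i \<noteq> 0"
    then obtain i where i: "i < d" "v i \<noteq> 0" by blast
    define w where "w = Matrix.vec d v"
    have w: "w \<in> carrier_vec d" by (simp add: w_def)
    have "w \<noteq> 0\<^sub>v d"
    proof
      assume "w = 0\<^sub>v d"
      hence "vec_index w i = 0" using i by simp
      thus False using i by (simp add: w_def)
    qed
    hence "scalar_prod w (mult_mat_vec A w) > 0" using pd w by blast
    also have "scalar_prod w (mult_mat_vec A w) = ipn d v (mvn d (\<lambda>i j. A $$ (i, j)) v)"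
      unfolding scalar_prod_mult_mat_vec[OF assms w] by (auto simp: ipn_def mvn_def w_def intro!: sum.cong)
    finally show "ipn d v (mvn d (\<lambda>i j. A $$ (i, j)) v) > 0" .
  qed
qed

text \<open>
  Uniqueness: if \<open>R\<^sup>2 = S\<^sup>2\<close> and \<open>T = R - S\<close>, then \<open>R T + T S = 0\<close>, so \<open>tr (T R T) + tr (T S T) = 0\<close>. Both
  traces are nonnegative, and \<open>tr (T R T)\<close> vanishes only for \<open>T = 0\<close>.
\<close>

lemma posdef_sqrt_fun_unique:
  assumes r: "\<And>i j. i < d \<Longrightarrow> j < d \<Longrightarrow> r i j = r j i" "posdef_fun d r"
    and s: "\<And>i j. i < d \<Longrightarrow> j < d \<Longrightarrow> s i j = s j i" "posdef_fun d s"
    and eq: "\<And>i j. i < d \<Longrightarrow> j < d \<Longrightarrow> (\<Sum>m<d. r i m * r m j) = (\<Sum>m<d. s i m * s m j)"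
    and ij: "i < d" "j < d"
  shows "r i j = s i j"
proof -
  define t where "t = (\<lambda>i j. r i j - s i j)"
  have t: "t i j = t j i" if "i < d" "j < d" for i j using r(1) s(1) that by (simp add: t_def)
  have rt: "(\<Sum>m<d. r i m * t m j) = - (\<Sum>m<d. t i m * s m j)" if "i < d" "j < d" for i j
  proof -
    have "(\<Sum>m<d. r i m * t m j) + (\<Sum>m<d. t i m * s m j) = (\<Sum>m<d. r i m * r m j) - (\<Sum>m<d. s i m * s m j)"
      by (simp add: t_def algebra_simps sum.distrib[symmetric] sum_subtractf[symmetric])
    thus ?thesis using eq[OF that] by simp
  qed
  have nonneg: "ipn d v (mvn d q v) \<ge> 0" if "posdef_fun d q" for q v
  proof (cases "\<exists>i<d. v i \<noteq> 0")
    case False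
    thus ?thesis by (simp add: ipn_def)
  qed (use that in "auto simp: posdef_fun_def less_imp_le")
  have "(\<Sum>j<d. ipn d (t j) (mvn d r (t j))) = (\<Sum>j<d. \<Sum>i<d. t j i * (\<Sum>m<d. r i m * t m j))"
    using t by (auto simp: ipn_def mvn_def intro!: sum.cong)
  also have "... = - (\<Sum>j<d. \<Sum>i<d. t j i * (\<Sum>m<d. t i m * s m j))"
    using rt by (simp add: sum_negf)
  also have "(\<Sum>j<d. \<Sum>i<d. t j i * (\<Sum>m<d. t i m * s m j)) = (\<Sum>j<d. \<Sum>i<d. \<Sum>m<d. t i m * (s m j * t i j))"
    unfolding sum_distrib_left using t by (intro sum.cong refl) (auto simp: mult_ac)
  also have "... = (\<Sum>i<d. \<Sum>j<d. \<Sum>m<d. t i m * (s m j * t i j))" by (rule sum.swap)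
  also have "... = (\<Sum>i<d. \<Sum>m<d. \<Sum>j<d. t i m * (s m j * t i j))"
    by (intro sum.cong refl sum.swap)
  also have "... = (\<Sum>i<d. ipn d (t i) (mvn d s (t i)))"
    by (simp add: ipn_def mvn_def sum_distrib_left)
  finally have "(\<Sum>j<d. ipn d (t j) (mvn d r (t j))) \<le> 0"
    using nonneg[OF s(2)] by (simp add: sum_nonneg)
  moreover have "(\<Sum>j<d. ipn d (t j) (mvn d r (t j))) \<ge> 0" by (intro sum_nonneg nonneg r(2))
  ultimately have "(\<Sum>j<d. ipn d (t j) (mvn d r (t j))) = 0" by linarith
  hence "ipn d (t i) (mvn d r (t i)) = 0"
    using nonneg[OF r(2)] ij(1) by (subst (asm) sum_nonneg_eq_0_iff) auto
  hence "\<not> (\<exists>j<d. t i j \<noteq> 0)" using r(2) unfolding posdef_fun_def by (metis less_irrefl)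
  thus ?thesis using ij(2) by (simp add: t_def)
qed

text \<open>Square roots of the eigenvalues in the spectral decomposition; definiteness of
  \<open>A\<close> makes all eigenvalues positive.\<close>

lemma posdef_sqrt_fun_exists:
  assumes sym: "\<And>i j. i < d \<Longrightarrow> j < d \<Longrightarrow> A i j = A j i" and pd: "posdef_fun d A"
  shows "\<exists>r. (\<forall>i<d. \<forall>j<d. r i j = r j i) \<and> posdef_fun d r \<and> (\<forall>i<d. \<forall>j<d. (\<Sum>m<d. r i m * r m j) = A i j)"
proof -
  obtain lam w where on: "orthonormal_upto d d w"
    and ev: "\<And>k i. k < d \<Longrightarrow> i < d \<Longrightarrow> mvn d A (w k) i = lam k * w k i"
    and dec: "\<And>i j. i < d \<Longrightarrow> j < d \<Longrightarrow> A i j = (\<Sum>k<d. lam k * w k i * w k j)"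
    by (rule spectral_decomposition[of d A]) (use sym in auto)
  have onD: "ipn d (w k) (w k') = (if k = k' then 1 else 0)" if "k < d" "k' < d" for k k'
    using on that by (auto simp: orthonormal_upto_def)
  have lam: "lam k > 0" if k: "k < d" for k
  proof -
    have "ipn d (w k) (w k) = 1" using onD k by simp
    hence "\<exists>i<d. w k i \<noteq> 0" using ipn_self_eq_0_iff[of d "w k"] by auto
    hence "0 < ipn d (w k) (mvn d A (w k))" using pd by (auto simp: posdef_fun_def)
    also have "... = ipn d (w k) (\<lambda>i. lam k * w k i)" using ev k by (intro ipn_cong) auto
    also have "... = lam k" using onD k by (simp add: ipn_scale_right)
    finally show ?thesis .
  qed
  define r where "r = (\<lambda>i j. \<Sum>k<d. sqrt (lam k) * w k i * w k j)"
  have "r i j = r j i" for i j by (simp add: r_def mult_ac)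
  moreover have "posdef_fun d r"
    unfolding posdef_fun_def
  proof (intro allI impI)
    fix v :: rvec assume "\<exists>i<d. v i \<noteq> 0"
    then obtain i where i: "i < d" "v i \<noteq> 0" by blast
    have mv: "mvn d r v i = (\<Sum>k<d. sqrt (lam k) * ipn d (w k) v * w k i)" for i
      unfolding mvn_def r_def ipn_def sum_distrib_right sum_distrib_left
      by (subst sum.swap) (simp add: mult_ac)
    have q: "ipn d v (mvn d r v) = (\<Sum>k<d. sqrt (lam k) * (ipn d (w k) v)\<^sup>2)"
    proof -
      have "ipn d v (mvn d r v) = (\<Sum>k<d. \<Sum>i<d. sqrt (lam k) * ipn d (w k) v * (w k i * v i))"
        unfolding ipn_def[of d v] mv sum_distrib_left by (subst sum.swap) (simp add: mult_ac)
      also have "... = (\<Sum>k<d. sqrt (lam k) * ipn d (w k) v * ipn d (w k) v)"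
        by (simp add: sum_distrib_left[symmetric] ipn_def[of d "w _" v, symmetric])
      finally show ?thesis by (simp add: power2_eq_square mult.assoc)
    qed
    have "\<exists>k<d. ipn d (w k) v \<noteq> 0"
    proof (rule ccontr)
      assume neg: "\<not> ?thesis"
      have "v i = (\<Sum>j<d. (if i = j then 1 else 0) * v j)" using i by (simp add: if_distrib[of "\<lambda>a. a * _"] cong: if_cong)
      also have "... = (\<Sum>j<d. (\<Sum>k<d. w k i * w k j) * v j)"
        using orthonormal_complete[OF on i(1)] by (intro sum.cong refl) auto
      also have "... = (\<Sum>k<d. w k i * ipn d (w k) v)"
        unfolding ipn_def sum_distrib_right sum_distrib_left by (subst sum.swap) (simp add: mult_ac)
      also have "... = 0" using neg by simp
      finally show False using i by simp
    qed
    then obtain k where k: "k < d" "ipn d (w k) v \<noteq> 0" by blast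
    have "0 < sqrt (lam k) * (ipn d (w k) v)\<^sup>2" using lam[OF k(1)] k(2) by simp
    also have "... \<le> (\<Sum>k<d. sqrt (lam k) * (ipn d (w k) v)\<^sup>2)"
      by (rule member_le_sum) (use k lam in "auto simp: less_imp_le")
    finally show "ipn d v (mvn d r v) > 0" using q by simp
  qed
  moreover have "(\<Sum>m<d. r i m * r m j) = A i j" if "i < d" "j < d" for i j
  proof -
    have "(\<Sum>m<d. r i m * r m j) = (\<Sum>m<d. \<Sum>k<d. \<Sum>k'<d. sqrt (lam k) * w k i * sqrt (lam k') * w k' j * (w k m * w k' m))"
      unfolding r_def by (simp add: sum_product mult_ac)
    also have "... = (\<Sum>k<d. \<Sum>m<d. \<Sum>k'<d. sqrt (lam k) * w k i * sqrt (lam k') * w k' j * (w k m * w k' m))"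
      by (rule sum.swap)
    also have "... = (\<Sum>k<d. \<Sum>k'<d. \<Sum>m<d. sqrt (lam k) * w k i * sqrt (lam k') * w k' j * (w k m * w k' m))"
      by (intro sum.cong refl sum.swap)
    also have "... = (\<Sum>k<d. \<Sum>k'<d. sqrt (lam k) * w k i * sqrt (lam k') * w k' j * ipn d (w k) (w k'))"
      by (simp add: ipn_def sum_distrib_left)
    also have "... = (\<Sum>k<d. \<Sum>k'<d. if k' = k then sqrt (lam k) * w k i * sqrt (lam k) * w k j else 0)"
      using onD by (intro sum.cong refl) auto
    also have "... = (\<Sum>k<d. lam k * w k i * w k j)"
    proof (intro sum.cong refl)
      fix k assume "k \<in> {..<d}"
      hence "sqrt (lam k) * sqrt (lam k) = lam k" using lam[of k] by simp
      hence "sqrt (lam k) * w k i * sqrt (lam k) * w k j = lam k * w k i * w k j" by (simp add: mult_ac)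
      thus "(\<Sum>k'<d. if k' = k then sqrt (lam k) * w k i * sqrt (lam k) * w k j else 0) = lam k * w k i * w k j"
        using \<open>k \<in> {..<d}\<close> by simp
    qed
    finally show ?thesis using dec[OF that] by simp
  qed
  ultimately show ?thesis by blast
qed

lemma mult_mat_index:
  assumes "A \<in> carrier_mat d d" "B \<in> carrier_mat d d" "i < d" "j < d"
  shows "(A * B) $$ (i, j) = (\<Sum>m<d. A $$ (i, m) * B $$ (m, j))"
  using assms by (auto simp: scalar_prod_def atLeast0LessThan intro!: sum.cong)

theorem posdef_sqrt_spec:
  assumes A: "A \<in> carrier_mat d d" and sym: "\<And>i j. i < d \<Longrightarrow> j < d \<Longrightarrow> A $$ (i, j) = A $$ (j, i)"
    and pd: "posdef_fun d (\<lambda>i j. A $$ (i, j))"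
  shows "posdef_sqrt A \<in> carrier_mat d d"
    "\<And>i j. i < d \<Longrightarrow> j < d \<Longrightarrow> posdef_sqrt A $$ (i, j) = posdef_sqrt A $$ (j, i)"
    "posdef_fun d (\<lambda>i j. posdef_sqrt A $$ (i, j))"
    "\<And>i j. i < d \<Longrightarrow> j < d \<Longrightarrow> (\<Sum>m<d. posdef_sqrt A $$ (i, m) * posdef_sqrt A $$ (m, j)) = A $$ (i, j)"
proof -
  define P where "P = (\<lambda>R. R \<in> carrier_mat (dim_row A) (dim_row A) \<and> transpose_mat R = R \<and>
        (\<forall>v\<in>carrier_vec (dim_row A). v \<noteq> 0\<^sub>v (dim_row A) \<longrightarrow> scalar_prod v (mult_mat_vec R v) > 0) \<and>
        R * R = A)"
  have d: "dim_row A = d" using A by simp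
  have P_iff: "P R \<longleftrightarrow> R \<in> carrier_mat d d \<and> (\<forall>i<d. \<forall>j<d. R $$ (i, j) = R $$ (j, i)) \<and>
      posdef_fun d (\<lambda>i j. R $$ (i, j)) \<and> (\<forall>i<d. \<forall>j<d. (\<Sum>m<d. R $$ (i, m) * R $$ (m, j)) = A $$ (i, j))" for R
  proof (cases "R \<in> carrier_mat d d")
    case True
    have "transpose_mat R = R \<longleftrightarrow> (\<forall>i<d. \<forall>j<d. R $$ (i, j) = R $$ (j, i))"
    proof
      assume eq: "transpose_mat R = R"
      show "\<forall>i<d. \<forall>j<d. R $$ (i, j) = R $$ (j, i)"
      proof (intro allI impI)
        fix i j assume "i < d" "j < d"
        hence "transpose_mat R $$ (i, j) = R $$ (j, i)" using True by simp
        thus "R $$ (i, j) = R $$ (j, i)" by (simp add: eq)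
      qed
    qed (use True in "auto intro!: eq_matI")
    moreover have "R * R = A \<longleftrightarrow> (\<forall>i<d. \<forall>j<d. (\<Sum>m<d. R $$ (i, m) * R $$ (m, j)) = A $$ (i, j))"
    proof
      assume "R * R = A"
      thus "\<forall>i<d. \<forall>j<d. (\<Sum>m<d. R $$ (i, m) * R $$ (m, j)) = A $$ (i, j)"
        using mult_mat_index[OF True True] by auto
    next
      assume eq: "\<forall>i<d. \<forall>j<d. (\<Sum>m<d. R $$ (i, m) * R $$ (m, j)) = A $$ (i, j)"
      show "R * R = A"
      proof (rule eq_matI)
        fix i j assume "i < dim_row A" "j < dim_col A"
        hence ij: "i < d" "j < d" using A by auto
        show "(R * R) $$ (i, j) = A $$ (i, j)" using mult_mat_index[OF True True ij] eq ij by simp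
      qed (use True A in auto)
    qed
    ultimately show ?thesis using True posdef_fun_iff[OF True] by (auto simp: P_def d)
  qed (auto simp: P_def d)
  obtain r where r: "\<forall>i<d. \<forall>j<d. r i j = r j i" "posdef_fun d r" "\<forall>i<d. \<forall>j<d. (\<Sum>m<d. r i m * r m j) = A $$ (i, j)"
    using posdef_sqrt_fun_exists[of d "\<lambda>i j. A $$ (i, j)"] sym pd by auto
  define R where "R = Matrix.mat d d (\<lambda>(i, j). r i j)"
  have "posdef_fun d (\<lambda>i j. R $$ (i, j))"
  proof -
    have "ipn d v (mvn d (\<lambda>i j. R $$ (i, j)) v) = ipn d v (mvn d r v)" for v
      by (auto simp: ipn_def mvn_def R_def intro!: sum.cong)
    thus ?thesis using r(2) by (simp add: posdef_fun_def)
  qed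
  hence "P R" using r(1,3) by (auto simp: P_iff R_def)
  moreover have "R1 = R2" if "P R1" "P R2" for R1 R2
  proof (rule eq_matI)
    fix i j assume "i < dim_row R2" "j < dim_col R2"
    hence ij: "i < d" "j < d" using that by (auto simp: P_iff)
    show "R1 $$ (i, j) = R2 $$ (i, j)"
      by (rule posdef_sqrt_fun_unique[of d]) (use that ij in "auto simp: P_iff")
  qed (use that in "auto simp: P_iff")
  ultimately have "\<exists>!R. P R" by (intro ex1I[of P R])
  hence "P (THE R. P R)" by (rule theI')
  moreover have "(THE R. P R) = posdef_sqrt A" by (simp only: posdef_sqrt_def P_def)
  ultimately have "P (posdef_sqrt A)" by (simp only:)
  note spec = this[unfolded P_iff]
  show "posdef_sqrt A \<in> carrier_mat d d" by (rule conjunct1[OF spec])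
  show "posdef_sqrt A $$ (i, j) = posdef_sqrt A $$ (j, i)" if "i < d" "j < d" for i j
    using spec[THEN conjunct2, THEN conjunct1] that by blast
  show "posdef_fun d (\<lambda>i j. posdef_sqrt A $$ (i, j))"
    by (rule spec[THEN conjunct2, THEN conjunct2, THEN conjunct1])
  show "(\<Sum>m<d. posdef_sqrt A $$ (i, m) * posdef_sqrt A $$ (m, j)) = A $$ (i, j)" if "i < d" "j < d" for i j
    using spec[THEN conjunct2, THEN conjunct2, THEN conjunct2] that by blast
qed

section \<open>Definiteness, inverses and coercivity from injectivity\<close>

lemma det_nonzero_iff_injective:
  fixes A :: "real Matrix.mat"
  assumes "A \<in> carrier_mat d d"
  shows "Determinant.det A \<noteq> 0 \<longleftrightarrow>
    (\<forall>v. (\<forall>i<d. mvn d (\<lambda>i j. A $$ (i, j)) v i = 0) \<longrightarrow> (\<forall>i<d. v i = 0))"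
proof -
  have idx: "vec_index (mult_mat_vec A v) i = mvn d (\<lambda>i j. A $$ (i, j)) (vec_index v) i"
    if "v \<in> carrier_vec d" "i < d" for v i
    using assms that by (auto simp: scalar_prod_def mvn_def atLeast0LessThan intro!: sum.cong)
  show ?thesis
  proof
    assume nz: "Determinant.det A \<noteq> 0"
    show "\<forall>v. (\<forall>i<d. mvn d (\<lambda>i j. A $$ (i, j)) v i = 0) \<longrightarrow> (\<forall>i<d. v i = 0)"
    proof (intro allI impI)
      fix v :: rvec and i assume v: "\<forall>i<d. mvn d (\<lambda>i j. A $$ (i, j)) v i = 0" and i: "i < d"
      define w where "w = Matrix.vec d v"
      have w: "w \<in> carrier_vec d" by (simp add: w_def)
      have "mult_mat_vec A w = 0\<^sub>v d"
      proof (rule eq_vecI)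
        fix i assume "i < dim_vec (0\<^sub>v d :: real Matrix.vec)"
        hence i: "i < d" by simp
        have "mvn d (\<lambda>i j. A $$ (i, j)) (vec_index w) i = mvn d (\<lambda>i j. A $$ (i, j)) v i"
          by (simp add: mvn_def w_def)
        thus "vec_index (mult_mat_vec A w) i = vec_index (0\<^sub>v d) i" using idx[OF w i] v i by simp
      qed (use assms in auto)
      hence "w = 0\<^sub>v d" using nz det_0_iff_vec_prod_zero_field[OF assms] w by blast
      hence "vec_index w i = 0" using i by simp
      thus "v i = 0" using i by (simp add: w_def)
    qed
  next
    assume inj: "\<forall>v. (\<forall>i<d. mvn d (\<lambda>i j. A $$ (i, j)) v i = 0) \<longrightarrow> (\<forall>i<d. v i = 0)"
    show "Determinant.det A \<noteq> 0"
    proof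
      assume "Determinant.det A = 0"
      then obtain v where v: "v \<in> carrier_vec d" "v \<noteq> 0\<^sub>v d" "mult_mat_vec A v = 0\<^sub>v d"
        using det_0_iff_vec_prod_zero_field[OF assms] by blast
      have "\<forall>i<d. mvn d (\<lambda>i j. A $$ (i, j)) (vec_index v) i = 0"
        using idx[OF v(1)] v(3) by (metis index_zero_vec(1))
      hence "\<forall>i<d. vec_index v i = 0" using inj by blast
      hence "v = 0\<^sub>v d" using v(1) by (intro eq_vecI) auto
      thus False using v(2) by simp
    qed
  qed
qed

text \<open>A vector on which a semidefinite form vanishes minimizes it, so the first variation
  vanishes and the vector lies in the kernel, which a nonzero determinant makes trivial.\<close>

lemma psd_det_imp_posdef:
  assumes A: "A \<in> carrier_mat d d" and sym: "\<And>i j. i < d \<Longrightarrow> j < d \<Longrightarrow> A $$ (i, j) = A $$ (j, i)"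
    and psd: "\<And>v. ipn d v (mvn d (\<lambda>i j. A $$ (i, j)) v) \<ge> 0" and det: "Determinant.det A \<noteq> 0"
  shows "posdef_fun d (\<lambda>i j. A $$ (i, j))"
  unfolding posdef_fun_def
proof (intro allI impI)
  let ?A = "\<lambda>i j. A $$ (i, j)"
  fix v :: rvec assume v: "\<exists>i<d. v i \<noteq> 0"
  show "ipn d v (mvn d ?A v) > 0"
  proof (rule ccontr)
    assume "\<not> ?thesis"
    hence 0: "ipn d v (mvn d ?A v) = 0" using psd[of v] by simp
    have orth: "ipn d w (mvn d ?A v) = 0" for w
    proof -
      define b where "b = - ipn d w (mvn d ?A v)"
      define c where "c = ipn d w (mvn d ?A w)"
      have "2 * t * b \<le> t\<^sup>2 * c" for t
      proof -
        have "ipn d v (mvn d ?A w) = ipn d w (mvn d ?A v)"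
          using ipn_mvn_symmetric[of d ?A v w] sym ipn_commute by metis
        thus ?thesis using psd[of "\<lambda>i. v i + t * w i"] 0
          by (simp add: mvn_add mvn_scale ipn_add_left ipn_add_right ipn_scale_left ipn_scale_right
              b_def c_def algebra_simps power2_eq_square)
      qed
      hence "b = 0" by (rule linear_le_quadratic_imp_zero)
      thus ?thesis by (simp add: b_def)
    qed
    have "\<forall>i<d. mvn d ?A v i = 0" using orth[of "mvn d ?A v"] ipn_self_eq_0_iff by blast
    hence "\<forall>i<d. v i = 0" using det det_nonzero_iff_injective[OF A] by blast
    thus False using v by blast
  qed
qed

lemma injective_imp_inverse:
  fixes s :: "nat \<Rightarrow> nat \<Rightarrow> real"
  assumes "\<And>v. (\<forall>i<d. mvn d s v i = 0) \<Longrightarrow> (\<forall>i<d. v i = 0)"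
  shows "\<exists>b. (\<forall>v. \<forall>i<d. mvn d b (mvn d s v) i = v i) \<and> (\<forall>v. \<forall>i<d. mvn d s (mvn d b v) i = v i)"
proof -
  define A where "A = Matrix.mat d d (\<lambda>(i, j). s i j)"
  have A: "A \<in> carrier_mat d d" by (simp add: A_def)
  have sA: "A $$ (i, j) = s i j" if "i < d" "j < d" for i j using that by (simp add: A_def)
  have As: "mvn d (\<lambda>i j. A $$ (i, j)) v i = mvn d s v i" if "i < d" for v i
    using that by (simp add: mvn_def A_def)
  have nz: "Determinant.det A \<noteq> 0"
    unfolding det_nonzero_iff_injective[OF A] using assms As by auto
  define b where "b = (\<lambda>i j. adj_mat A $$ (i, j) / Determinant.det A)"
  have assoc: "mvn d p (mvn d q v) i = (\<Sum>j<d. (\<Sum>m<d. p i m * q m j) * v j)" for p q :: "nat \<Rightarrow> nat \<Rightarrow> real" and v i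
    unfolding mvn_def sum_distrib_left sum_distrib_right by (subst sum.swap) (simp add: mult_ac)
  have "(\<Sum>m<d. b i m * s m j) = (if i = j then 1 else 0)" if "i < d" "j < d" for i j
  proof -
    have "(\<Sum>m<d. adj_mat A $$ (i, m) * s m j) = (adj_mat A * A) $$ (i, j)"
      unfolding mult_mat_index[OF adj_mat(1)[OF A] A that] using that sA by simp
    also have "... = (if i = j then Determinant.det A else 0)"
      unfolding adj_mat(3)[OF A] using that by simp
    finally have "(\<Sum>m<d. adj_mat A $$ (i, m) * s m j) = (if i = j then Determinant.det A else 0)" .
    moreover have "(\<Sum>m<d. b i m * s m j) = (\<Sum>m<d. adj_mat A $$ (i, m) * s m j) / Determinant.det A"
      by (simp add: b_def sum_divide_distrib)
    ultimately show ?thesis using nz by simp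
  qed
  moreover have "(\<Sum>m<d. s i m * b m j) = (if i = j then 1 else 0)" if "i < d" "j < d" for i j
  proof -
    have "(\<Sum>m<d. s i m * adj_mat A $$ (m, j)) = (A * adj_mat A) $$ (i, j)"
      unfolding mult_mat_index[OF A adj_mat(1)[OF A] that] using that sA by simp
    also have "... = (if i = j then Determinant.det A else 0)"
      unfolding adj_mat(2)[OF A] using that by simp
    finally have "(\<Sum>m<d. s i m * adj_mat A $$ (m, j)) = (if i = j then Determinant.det A else 0)" .
    moreover have "(\<Sum>m<d. s i m * b m j) = (\<Sum>m<d. s i m * adj_mat A $$ (m, j)) / Determinant.det A"
      by (simp add: b_def sum_divide_distrib)
    ultimately show ?thesis using nz by simp
  qed
  ultimately have "mvn d b (mvn d s v) i = v i \<and> mvn d s (mvn d b v) i = v i" if "i < d" for v i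
    unfolding assoc using that by (simp add: if_distrib[of "\<lambda>a. a * _"] cong: if_cong)
  thus ?thesis by blast
qed

text \<open>Each entry of \<open>v\<close> is the inner product of a row of the inverse with the
  image of \<open>v\<close>, so Cauchy-Schwarz bounds the length of \<open>v\<close> by that of the
  image.\<close>

lemma injective_imp_coercive:
  fixes s :: "nat \<Rightarrow> nat \<Rightarrow> real"
  assumes "\<And>v. (\<forall>i<d. mvn d s v i = 0) \<Longrightarrow> (\<forall>i<d. v i = 0)"
  shows "\<exists>c>0. \<forall>v. c * ipn d v v \<le> ipn d (mvn d s v) (mvn d s v)"
proof -
  obtain b where b: "\<And>v i. i < d \<Longrightarrow> mvn d b (mvn d s v) i = v i"
    using injective_imp_inverse[of d s] assms by blast
  define K where "K = (\<Sum>i<d. ipn d (b i) (b i))"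
  have K: "K \<ge> 0" by (auto simp: K_def intro!: sum_nonneg ipn_self_nonneg)
  have "(1 / (K + 1)) * ipn d v v \<le> ipn d (mvn d s v) (mvn d s v)" for v
  proof -
    let ?z = "mvn d s v"
    have "ipn d v v = (\<Sum>i<d. (ipn d (b i) ?z)\<^sup>2)"
      unfolding ipn_def[of d v] using b by (intro sum.cong) (auto simp: ipn_def mvn_def power2_eq_square)
    also have "... \<le> (\<Sum>i<d. ipn d (b i) (b i) * ipn d ?z ?z)"
      using Cauchy_Schwarz_ineq_sum[of "b _" ?z "{..<d}"] by (intro sum_mono) (simp add: ipn_def power2_eq_square)
    also have "... = K * ipn d ?z ?z" by (simp add: K_def sum_distrib_right)
    also have "... \<le> (K + 1) * ipn d ?z ?z" using ipn_self_nonneg[of d ?z] by (simp add: algebra_simps)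
    finally show ?thesis using K by (simp add: field_simps)
  qed
  moreover have "1 / (K + 1) > 0" using K by simp
  ultimately show ?thesis by blast
qed

section \<open>Constrained coordinates and minimizers\<close>

lemma W_pot_eq: "W_pot E C V j y = extend_potentials C V j y - ln (wt E j y)"
  by (cases E) (auto simp: W_pot_def)

lemma W_pot_pot_index: "W_pot E C V (pot_index C j) = W_pot E C V j"
proof -
  have "pot_index C (pot_index C j) = pot_index C j" by (auto simp: pot_index_def)
  thus ?thesis by (simp add: fun_eq_iff W_pot_eq extend_potentials_eq wt_pot_index)
qed

lemma C2_on_diff:
  assumes "C2_on f D" "C2_on g D"
  shows "C2_on (\<lambda>x. f x - g x) D"
proof -
  obtain f' f'' where "\<forall>x\<in>D. (f has_real_derivative f' x) (at x) \<and> (f' has_real_derivative f'' x) (at x)" "continuous_on D f''"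
    using assms(1) by (auto simp: C2_on_def)
  moreover obtain g' g'' where "\<forall>x\<in>D. (g has_real_derivative g' x) (at x) \<and> (g' has_real_derivative g'' x) (at x)" "continuous_on D g''"
    using assms(2) by (auto simp: C2_on_def)
  ultimately show ?thesis unfolding C2_on_def
    by (intro exI[of _ "\<lambda>x. f' x - g' x"] exI[of _ "\<lambda>x. f'' x - g'' x"]) (auto intro!: DERIV_diff continuous_on_diff)
qed

lemma C2_on_ln_wt: "C2_on (\<lambda>y. ln (wt E j y)) (coord_dom E j)"
proof -
  have ln: "C2_on ln {0<..}" unfolding C2_on_def
    by (rule exI[of _ "\<lambda>x. 1 / x"], rule exI[of _ "\<lambda>x. - (1 / x ^ 2)"])
       (auto intro!: derivative_eq_intros continuous_intros simp: power2_eq_square)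
  have unit: "C2_on (\<lambda>y. ln (y * (1 - y))) {0<..<1}" unfolding C2_on_def
  proof (rule exI[of _ "\<lambda>x. 1 / x - 1 / (1 - x)"], rule exI[of _ "\<lambda>x. - (1 / x ^ 2) - 1 / (1 - x) ^ 2"],
      intro conjI ballI)
    fix x :: real assume x: "x \<in> {0<..<1}"
    have "((\<lambda>y. ln (y * (1 - y))) has_real_derivative (1 / (x * (1 - x))) * (1 - 2 * x)) (at x)"
      using x by (auto intro!: derivative_eq_intros)
    also have "(1 / (x * (1 - x))) * (1 - 2 * x) = 1 / x - 1 / (1 - x)"
      using x by (simp add: field_simps)
    finally show "((\<lambda>y. ln (y * (1 - y))) has_real_derivative 1 / x - 1 / (1 - x)) (at x)" .
    show "((\<lambda>x. 1 / x - 1 / (1 - x)) has_real_derivative - (1 / x ^ 2) - 1 / (1 - x) ^ 2) (at x)"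
      using x by (auto intro!: derivative_eq_intros simp: power2_eq_square)
  qed (auto intro!: continuous_intros)
  have const: "C2_on (\<lambda>_. c) UNIV" for c unfolding C2_on_def
    by (rule exI[of _ "\<lambda>_. 0"], rule exI[of _ "\<lambda>_. 0"]) auto
  show ?thesis using ln unit const[of "ln 1"] by (cases E) auto
qed

text \<open>For \<open>e = n = 1\<close> the tilt is \<open>exp (- W)\<close>; it vanishes on the boundary of \<open>D\<^sub>j\<close> and at infinity.\<close>

lemma W_pot_sublevel_compact:
  assumes "integrability_conditions E C V" "j \<ge> 1"
  shows "\<exists>K. compact K \<and> K \<subseteq> coord_dom E j \<and> (\<forall>y\<in>coord_dom E j. W_pot E C V j y \<le> c \<longrightarrow> y \<in> K)"
proof -
  obtain R d where R: "R \<ge> 1" "d > 0"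
    "\<And>y. y \<in> coord_cdom E j \<Longrightarrow> \<bar>y\<bar> > R \<Longrightarrow> tilt E C V 1 1 j y \<le> \<bar>y\<bar> powr (- 1 - d)"
    using tilt_tail[OF assms order_refl order_refl] by blast
  define K where "K = {y \<in> coord_cdom E j. tilt E C V 1 1 j y \<ge> exp (- c)}"
  have "closed K" unfolding K_def
    using continuous_closed_preimage[OF continuous_on_tilt[OF assms] closed_coord_cdom, of "{exp (- c)..}" 1 1]
    by (simp add: vimage_def Int_def)
  moreover have "\<bar>y\<bar> \<le> max R (exp c)" if "y \<in> K" for y
  proof (rule ccontr)
    assume "\<not> ?thesis"
    hence y: "\<bar>y\<bar> > R" "\<bar>y\<bar> > exp c" by auto
    have "exp (- c) \<le> \<bar>y\<bar> powr (- 1 - d)" using R(3)[of y] y that by (auto simp: K_def)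
    also have "... \<le> \<bar>y\<bar> powr (- 1)" using y R by (intro powr_mono) auto
    also have "... = 1 / \<bar>y\<bar>" using y R(1) by (simp add: powr_minus_divide)
    finally have "exp (- c) * \<bar>y\<bar> \<le> 1" using y R(1) by (simp add: field_simps)
    moreover have "exp (- c) * \<bar>y\<bar> > exp (- c) * exp c" using y(2) by (intro mult_strict_left_mono) auto
    ultimately show False by (simp add: exp_minus)
  qed
  hence "bounded K" unfolding bounded_iff by (auto intro!: exI[of _ "max R (exp c)"])
  ultimately have "compact K" by (simp add: compact_eq_bounded_closed)
  moreover have "K \<subseteq> coord_dom E j"
  proof
    fix y assume "y \<in> K"
    hence y: "y \<in> coord_cdom E j" "tilt E C V 1 1 j y > 0"
      using order.strict_trans2[OF exp_gt_zero[of "- c"]] by (auto simp: K_def)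
    hence "wt E j y \<noteq> 0" by (auto simp: tilt_def)
    thus "y \<in> coord_dom E j" using y(1) by (cases E) (auto split: if_splits)
  qed
  moreover have "y \<in> K" if "y \<in> coord_dom E j" "W_pot E C V j y \<le> c" for y
  proof -
    have "tilt E C V 1 1 j y = exp (- W_pot E C V j y)"
      using wt_pos[OF that(1)] by (simp add: tilt_def W_pot_eq exp_diff exp_minus field_simps)
    thus ?thesis using that coord_dom_subset_cdom[of E j] by (auto simp: K_def)
  qed
  ultimately show ?thesis by blast
qed

section \<open>Constrained points in moment form and in coordinate form\<close>

locale generic_setting =
  fixes E :: interval_kind and C :: moment_constraint and V :: "nat \<Rightarrow> real \<Rightarrow> real" and l :: nat
  assumes adm: "admissible E C" and gen: "generic E C V"
    and l_ge: "last_index C \<le> l" and l_pos: "1 \<le> l"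
begin

abbreviation fill :: "nat \<Rightarrow> rvec \<Rightarrow> nat \<Rightarrow> real" where "fill \<equiv> fill_constraint C"

abbreviation free :: "nat \<Rightarrow> nat set" where "free \<equiv> free_indices C"

abbreviation leb :: "nat \<Rightarrow> rvec measure" where "leb \<equiv> lebC C"

abbreviation yc :: "rvec \<Rightarrow> nat \<Rightarrow> real" where "yc \<equiv> ycoord E C"

abbreviation FM :: "rvec set" where "FM \<equiv> F_minimizers E C V"

abbreviation L :: nat where "L \<equiv> last_index C"

abbreviation W :: "nat \<Rightarrow> real \<Rightarrow> real" where "W \<equiv> W_pot E C V"

text \<open>Where \<open>yc\<close> reads the free entries as moments, \<open>Y\<close> reads them
  as canonical coordinates; the constrained entries are prescribed moments in both. Both return the
  full sequence of coordinates.\<close>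

definition Y :: "rvec \<Rightarrow> nat \<Rightarrow> real" where
  "Y u = sol E (dom C) (fillc C u)"

lemma constr: "is_constraint C"
  using adm by (simp add: admissible_def)

lemma dom_range: "i \<in> dom C \<Longrightarrow> 1 \<le> i \<and> i \<le> L"
proof -
  assume i: "i \<in> dom C"
  have "i \<le> L" unfolding last_index_def using constr i by (intro Max_ge) (auto simp: is_constraint_def)
  moreover have "i \<noteq> 0" using constr i by (metis is_constraint_def)
  ultimately show ?thesis by simp
qed

lemma IC: "integrability_conditions E C V"
  using gen by (simp add: generic_def)

lemma C2_W: "j \<ge> 1 \<Longrightarrow> C2_on (W j) (coord_dom E j)"
proof -
  assume j: "j \<ge> 1"
  have "C2_on (V (pot_index C j)) (coord_dom E j)"
    using gen pot_index_range[OF j, of C] coord_dom_pot_index[of E C j] by (metis generic_def)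
  from C2_on_diff[OF this C2_on_ln_wt] show "C2_on (W j) (coord_dom E j)"
    by (simp add: W_pot_eq[abs_def] extend_potentials_eq[abs_def])
qed

lemma continuous_on_W: "j \<ge> 1 \<Longrightarrow> continuous_on (coord_dom E j) (W j)"
  using C2_W[of j] unfolding C2_on_def by (metis DERIV_isCont continuous_at_imp_continuous_on)

lemma sol_fill: "1 \<le> j \<Longrightarrow> j \<le> n \<Longrightarrow> sol E UNIV (fill n x) j = yc x j"
  unfolding ycoord_def by (rule sol_cong) (auto simp: fill_constraint_def fillc_def)

lemma ok_fill: "coords_ok E n (sol E UNIV (fill n x)) \<longleftrightarrow> coords_ok E n (yc x)"
  by (rule coords_ok_cong) (rule sol_fill)

lemma fill_in_relint_iff:
  assumes "L \<le> n"
  shows "fill n x \<in> relint_moment_space E C n \<longleftrightarrow> coords_ok E n (yc x)"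
proof -
  have "fill n x i = c" if "C i = Some c" for i c
  proof -
    have "1 \<le> i \<and> i \<le> L" by (rule dom_range) (use that in blast)
    thus ?thesis using that assms by (simp add: fill_constraint_def)
  qed
  moreover have "fill n x \<in> PiE {1..n} (\<lambda>_. UNIV)" by (simp add: fill_constraint_def)
  ultimately show ?thesis unfolding relint_moment_space_eq[OF constr assms] by (simp add: ok_fill)
qed

lemma relint_eq_fill:
  assumes "L \<le> n" "m \<in> relint_moment_space E C n"
  shows "m = fill n m" "coords_ok E n (yc m)"
proof -
  have m: "m \<in> PiE {1..n} (\<lambda>_. UNIV)" "\<forall>i c. C i = Some c \<longrightarrow> m i = c"
    using assms(2) unfolding relint_moment_space_eq[OF constr assms(1)] by auto
  show eq: "m = fill n m"
    using m by (auto simp: fill_constraint_def fun_eq_iff PiE_iff extensional_def split: option.splits)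
  show "coords_ok E n (yc m)" using fill_in_relint_iff[OF assms(1), of m] assms(2) eq by simp
qed

lemma canon_coord_fill:
  assumes "coords_ok E n (yc x)" "1 \<le> j" "j \<le> n"
  shows "canon_coord E (fill n x) j = yc x j"
proof -
  have "coords_ok E j (sol E UNIV (fill n x))"
    using assms coords_ok_mono[of E n _ j] by (simp add: ok_fill)
  thus ?thesis using canon_coord_eq_sol assms(2,3) sol_fill by simp
qed

lemma Y_free: "j \<ge> 1 \<Longrightarrow> j \<notin> dom C \<Longrightarrow> Y u j = u j"
  unfolding Y_def by (subst sol_eq) (auto simp: fillc_def domIff)

lemma Y_cong:
  assumes "\<And>i. 1 \<le> i \<Longrightarrow> i \<le> j \<Longrightarrow> i \<notin> dom C \<Longrightarrow> u i = u' i" "j \<ge> 1"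
  shows "Y u j = Y u' j"
  unfolding Y_def by (rule sol_cong) (use assms in "auto simp: fillc_def split: option.splits")

lemma mom_ycoord:
  assumes "coords_ok E n (yc x)" "1 \<le> j" "j \<le> n"
  shows "mom E (yc x) j = fillc C x j"
  unfolding ycoord_def by (rule mom_sol[of E n]) (use assms in "auto simp: ycoord_def")

text \<open>Together with \<open>Y_ycoord\<close> this says that passing from free coordinates to
  moments and from free moments to coordinates are mutually inverse on admissible points.\<close>

lemma ycoord_mom_Y:
  assumes "coords_ok E n (Y u)" "1 \<le> j" "j \<le> n"
  shows "yc (mom E (Y u)) j = Y u j"
  unfolding ycoord_def
proof (rule sol_mom[OF assms(1) _ assms(2,3)])
  fix i assume i: "1 \<le> i" "i \<le> n"
  have *: "mom E (Y u) i = fillc C u i" if "i \<in> dom C"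
    unfolding Y_def by (rule mom_sol[of E n]) (use assms i that in "auto simp: Y_def")
  show "fillc C (mom E (Y u)) i = (if i \<in> UNIV then mom E (Y u) i else Y u i)"
  proof (cases "C i")
    case (Some c)
    hence "i \<in> dom C" by blast
    thus ?thesis using * Some by (simp add: fillc_def)
  qed (simp add: fillc_def)
qed

lemma Y_ycoord:
  assumes "coords_ok E n (yc x)"
    and u: "\<And>i. 1 \<le> i \<Longrightarrow> i \<le> n \<Longrightarrow> i \<notin> dom C \<Longrightarrow> u i = yc x i" and "1 \<le> j" "j \<le> n"
  shows "Y u j = yc x j"
  unfolding Y_def
proof (rule sol_mom[OF assms(1) _ assms(3,4)])
  fix i assume i: "1 \<le> i" "i \<le> n"
  show "fillc C u i = (if i \<in> dom C then mom E (yc x) i else yc x i)"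
    using u[OF i] mom_ycoord[OF assms(1) i] by (auto simp: fillc_def split: option.splits)
qed

text \<open>Discharges the definite description: any candidate agrees with \<open>Y u\<close> in its
  coordinates by \<open>Y_ycoord\<close>, hence also in its moments.\<close>

lemma moments_of_coords_eq:
  assumes "L \<le> n" "u \<in> PiE (free n) (\<lambda>_. UNIV)" "coords_ok E n (Y u)"
  shows "moments_of_coords E C n u = fill n (mom E (Y u))"
  unfolding moments_of_coords_def
proof (rule the_equality)
  let ?x = "mom E (Y u)"
  have ok: "coords_ok E n (yc ?x)"
    using assms(3) coords_ok_cong[of n "yc ?x" "Y u" E] ycoord_mom_Y[OF assms(3)] by simp
  have "free_coords E C n (fill n ?x) = u"
  proof
    fix j show "free_coords E C n (fill n ?x) j = u j"
    proof (cases "j \<in> free n")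
      case True
      hence j: "1 \<le> j" "j \<le> n" "j \<notin> dom C" by (auto simp: free_indices_def)
      thus ?thesis using True canon_coord_fill[OF ok j(1,2)] ycoord_mom_Y[OF assms(3) j(1,2)] Y_free[OF j(1,3)]
        by (simp add: free_coords_def)
    qed (use assms(2) in "auto simp: free_coords_def PiE_iff extensional_def")
  qed
  thus "fill n ?x \<in> relint_moment_space E C n \<and> free_coords E C n (fill n ?x) = u"
    using ok by (simp add: fill_in_relint_iff[OF assms(1)])
  fix m assume m: "m \<in> relint_moment_space E C n \<and> free_coords E C n m = u"
  have mf: "m = fill n m" "coords_ok E n (yc m)"
    using relint_eq_fill[OF assms(1)] m by blast+
  have "u i = yc m i" if "1 \<le> i" "i \<le> n" "i \<notin> dom C" for i
  proof -
    have "i \<in> free n" using that unfolding free_indices_def by simp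
    hence "free_coords E C n m i = canon_coord E m i" by (simp add: free_coords_def)
    hence "u i = canon_coord E m i" using m by simp
    also have "... = canon_coord E (fill n m) i" using mf(1) by simp
    finally show ?thesis using canon_coord_fill[OF mf(2) that(1,2)] by simp
  qed
  hence Y: "Y u j = yc m j" if "1 \<le> j" "j \<le> n" for j
    using Y_ycoord[OF mf(2)] that by blast
  have "fill n m = fill n ?x"
  proof
    fix j show "fill n m j = fill n ?x j"
    proof (cases "j \<in> {1..n}")
      case True
      hence "mom E (Y u) j = mom E (yc m) j" using Y by (intro mom_cong) auto
      also have "... = fillc C m j" using mom_ycoord[OF mf(2)] True by simp
      finally show ?thesis using True by (auto simp: fill_constraint_def fillc_def split: option.splits)
    qed (auto simp: fill_constraint_def)
  qed
  thus "m = fill n ?x" using mf(1) by simp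
qed

lemma canon_coord_moments_of_coords:
  assumes "L \<le> n" "u \<in> PiE (free n) (\<lambda>_. UNIV)" "coords_ok E n (Y u)" "1 \<le> j" "j \<le> n"
  shows "canon_coord E (moments_of_coords E C n u) j = Y u j"
proof -
  have "coords_ok E n (yc (mom E (Y u)))"
    using assms(3) coords_ok_cong[of n "yc (mom E (Y u))" "Y u" E] ycoord_mom_Y[OF assms(3)] by simp
  thus ?thesis
    unfolding moments_of_coords_eq[OF assms(1-3)] using canon_coord_fill ycoord_mom_Y[OF assms(3)] assms(4,5) by simp
qed

text \<open>\<open>W_sum\<close> freed from the definite description: a function of total vectors
  that is smooth on an open set and agrees with \<open>W_sum\<close> on extensional admissible
  ones.\<close>

definition WY :: "nat \<Rightarrow> rvec \<Rightarrow> real" where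
  "WY n u = (\<Sum>j=1..n. W j (Y u j))"

lemma W_sum_eq:
  assumes "L \<le> n" "u \<in> PiE (free n) (\<lambda>_. UNIV)" "coords_ok E n (Y u)"
  shows "W_sum E C V n u = WY n u"
  unfolding W_sum_def WY_def using canon_coord_moments_of_coords[OF assms] by (intro sum.cong) auto

lemma free_coords_image_iff:
  assumes "L \<le> n"
  shows "u \<in> free_coords E C n ` relint_moment_space E C n \<longleftrightarrow>
    u \<in> PiE (free n) (\<lambda>_. UNIV) \<and> coords_ok E n (Y u)"
proof
  assume "u \<in> free_coords E C n ` relint_moment_space E C n"
  then obtain m where m: "m \<in> relint_moment_space E C n" "u = free_coords E C n m" by blast
  have mf: "m = fill n m" "coords_ok E n (yc m)"
    using relint_eq_fill[OF assms m(1)] by blast+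
  have "u i = yc m i" if "1 \<le> i" "i \<le> n" "i \<notin> dom C" for i
  proof -
    have "i \<in> free n" using that unfolding free_indices_def by simp
    hence "free_coords E C n m i = canon_coord E m i" by (simp add: free_coords_def)
    hence "u i = canon_coord E m i" using m by simp
    also have "... = canon_coord E (fill n m) i" using mf(1) by simp
    finally show ?thesis using canon_coord_fill[OF mf(2) that(1,2)] by simp
  qed
  hence "Y u j = yc m j" if "1 \<le> j" "j \<le> n" for j
    using Y_ycoord[OF mf(2)] that by blast
  hence "coords_ok E n (Y u)" using mf(2) coords_ok_cong[of n "Y u" "yc m" E] by simp
  thus "u \<in> PiE (free n) (\<lambda>_. UNIV) \<and> coords_ok E n (Y u)"
    using m(2) by (auto simp: free_coords_def)
next
  assume u: "u \<in> PiE (free n) (\<lambda>_. UNIV) \<and> coords_ok E n (Y u)"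
  let ?x = "mom E (Y u)"
  have ok: "coords_ok E n (yc ?x)"
    using u coords_ok_cong[of n "yc ?x" "Y u" E] ycoord_mom_Y[of n u] by simp
  have "free_coords E C n (fill n ?x) = u"
  proof
    fix j show "free_coords E C n (fill n ?x) j = u j"
    proof (cases "j \<in> free n")
      case True
      hence j: "1 \<le> j" "j \<le> n" "j \<notin> dom C" by (auto simp: free_indices_def)
      thus ?thesis using True canon_coord_fill[OF ok j(1,2)] ycoord_mom_Y[of n u j] u Y_free[OF j(1,3)]
        by (simp add: free_coords_def)
    qed (use u in "auto simp: free_coords_def PiE_iff extensional_def")
  qed
  thus "u \<in> free_coords E C n ` relint_moment_space E C n"
    using ok fill_in_relint_iff[OF assms, of ?x] by (metis image_eqI)
qed

lemma F_fun_eq: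
  "F_fun E C V u = (if u \<in> PiE (free L) (\<lambda>_. UNIV) \<and> coords_ok E L (Y u) then ereal (WY L u) else \<infinity>)"
  unfolding F_fun_def free_coords_image_iff[OF order_refl] using W_sum_eq[OF order_refl] by auto

lemma coords_ok_nonempty: "\<exists>u\<in>PiE (free L) (\<lambda>_. UNIV). coords_ok E L (Y u)"
proof -
  have "relint_moment_space E C L \<noteq> {}" using adm by (auto simp: admissible_def relint_moment_space_def)
  thus ?thesis using free_coords_image_iff[OF order_refl] by blast
qed

text \<open>Turns an extended real minimization over a product of domains into a real one over
  admissible points. The competitors \<open>u'\<close> need not be extensional, which is convenient
  for calculus and harmless because \<open>WY\<close> reads free entries only.\<close>

lemma F_minimizers_iff:
  "u \<in> FM \<longleftrightarrow> u \<in> PiE (free L) (\<lambda>_. UNIV) \<and> coords_ok E L (Y u) \<and>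
     (\<forall>u'. coords_ok E L (Y u') \<longrightarrow> WY L u \<le> WY L u')" (is "_ \<longleftrightarrow> ?R u")
proof
  have in_dom: "v \<in> (\<Pi>\<^sub>E j\<in>free L. coord_dom E j)"
    if "v \<in> PiE (free L) (\<lambda>_. UNIV)" "coords_ok E L (Y v)" for v
  proof -
    have "v j \<in> coord_dom E j" if "j \<in> free L" for j
      using coords_okD[OF \<open>coords_ok E L (Y v)\<close>, of j] Y_free[of j v] that by (auto simp: free_indices_def)
    thus ?thesis using that(1) by (simp add: PiE_iff)
  qed
  {
    assume "u \<in> FM"
    hence u: "u \<in> (\<Pi>\<^sub>E j\<in>free L. coord_dom E j)"
      "\<And>v. v \<in> (\<Pi>\<^sub>E j\<in>free L. coord_dom E j) \<Longrightarrow> \<not> F_fun E C V v < F_fun E C V u"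
      by (auto simp: F_minimizers_def is_arg_min_def)
    have uU: "u \<in> PiE (free L) (\<lambda>_. UNIV)" using u(1) by (simp add: PiE_iff)
    \<comment> \<open>Admissibility of the constraint provides a point with finite \<open>F\<close>,
      so a minimizer cannot have the value \<open>\<infinity>\<close>.\<close>
    obtain v where v: "v \<in> PiE (free L) (\<lambda>_. UNIV)" "coords_ok E L (Y v)" using coords_ok_nonempty by blast
    have "\<not> F_fun E C V v < F_fun E C V u" by (intro u(2) in_dom v)
    hence ok: "coords_ok E L (Y u)" using v uU by (auto simp: F_fun_eq split: if_splits)
    moreover have "WY L u \<le> WY L u'" if u': "coords_ok E L (Y u')" for u'
    proof -
      let ?v = "restrict u' (free L)"
      have eq: "Y ?v j = Y u' j" if "1 \<le> j" "j \<le> L" for j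
        by (rule Y_cong) (use that in "auto simp: free_indices_def")
      hence "coords_ok E L (Y ?v)" using u' coords_ok_cong[of L "Y ?v" "Y u'" E] by simp
      moreover from this have "\<not> F_fun E C V ?v < F_fun E C V u" by (intro u(2) in_dom) auto
      ultimately have "WY L u \<le> WY L ?v" using uU ok by (simp add: F_fun_eq not_less)
      also have "WY L ?v = WY L u'" unfolding WY_def using eq by (intro sum.cong) auto
      finally show ?thesis .
    qed
    ultimately show "?R u" using uU by blast
  }
  assume R: "?R u"
  have "\<not> F_fun E C V v < F_fun E C V u" for v using R by (auto simp: F_fun_eq not_less)
  thus "u \<in> FM" using R in_dom[of u] by (auto simp: F_minimizers_def is_arg_min_def)
qed

section \<open>Limit points as the minimizers of \<open>Gx\<close>\<close>

definition ystar :: rvec where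
  "ystar j = (if odd (j - L) then W_minimizer E C V (L + 1) else W_minimizer E C V (L + 2))"

lemma ystar:
  assumes "j > L"
  shows "ystar j \<in> coord_dom E j" "\<And>y. y \<in> coord_dom E j \<Longrightarrow> W j (ystar j) \<le> W j y"
    "\<And>y. y \<in> coord_dom E j \<Longrightarrow> W j y \<le> W j (ystar j) \<Longrightarrow> y = ystar j"
    "deriv (deriv (W j)) (ystar j) \<noteq> 0"
proof -
  define i where "i = pot_index C j"
  have i: "i \<in> {L + 1, L + 2}" "ystar j = W_minimizer E C V i"
  proof -
    consider "j = L + 1" | "j = L + 2" | "j > L + 2" using assms by linarith
    hence "i \<in> {L + 1, L + 2} \<and> ystar j = W_minimizer E C V i"
      by cases (auto simp: i_def pot_index_def ystar_def)
    thus "i \<in> {L + 1, L + 2}" "ystar j = W_minimizer E C V i" by auto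
  qed
  have Wi: "W i = W j" "coord_dom E i = coord_dom E j"
    by (simp_all add: i_def W_pot_pot_index coord_dom_pot_index)
  have ex1: "\<exists>!y. is_arg_min (W i) (\<lambda>y. y \<in> coord_dom E i) y" and d2: "deriv (deriv (W i)) (W_minimizer E C V i) \<noteq> 0"
    using gen i(1) by (auto simp: generic_def)
  have m: "is_arg_min (W i) (\<lambda>y. y \<in> coord_dom E i) (ystar j)"
    unfolding i(2) W_minimizer_def by (rule theI'[OF ex1])
  show "ystar j \<in> coord_dom E j" "\<And>y. y \<in> coord_dom E j \<Longrightarrow> W j (ystar j) \<le> W j y"
    using m unfolding Wi by (auto simp: is_arg_min_def not_less)
  show "y = ystar j" if "y \<in> coord_dom E j" "W j y \<le> W j (ystar j)" for y
  proof -
    have "is_arg_min (W i) (\<lambda>y. y \<in> coord_dom E i) y"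
      using m that unfolding Wi by (auto simp: is_arg_min_def not_less)
    thus ?thesis using ex1 m by blast
  qed
  show "deriv (deriv (W j)) (ystar j) \<noteq> 0" using d2 unfolding Wi i(2) .
qed

abbreviation I :: "nat set" where "I \<equiv> free l"

lemma I_iff: "j \<in> I \<longleftrightarrow> 1 \<le> j \<and> j \<le> l \<and> j \<notin> dom C"
  by (auto simp: free_indices_def)

definition ext :: "rvec \<Rightarrow> nat \<Rightarrow> real" where
  "ext u = (\<lambda>j\<in>I. if j \<le> L then u j else ystar j)"

lemma Y_ext:
  assumes "coords_ok E L (Y u)"
  shows "\<And>j. 1 \<le> j \<Longrightarrow> j \<le> L \<Longrightarrow> Y (ext u) j = Y u j"
    "\<And>j. L < j \<Longrightarrow> j \<le> l \<Longrightarrow> Y (ext u) j = ystar j" "coords_ok E l (Y (ext u))"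
proof -
  show 1: "Y (ext u) j = Y u j" if "1 \<le> j" "j \<le> L" for j
    by (rule Y_cong) (use that l_ge in "auto simp: ext_def I_iff")
  show 2: "Y (ext u) j = ystar j" if "L < j" "j \<le> l" for j
  proof -
    have "j \<notin> dom C" using dom_range[of j] that by auto
    thus ?thesis using Y_free[of j "ext u"] that by (simp add: ext_def I_iff)
  qed
  show "coords_ok E l (Y (ext u))"
    unfolding coords_ok_def
  proof (intro allI impI)
    fix j assume "1 \<le> j \<and> j \<le> l"
    thus "Y (ext u) j \<in> coord_dom E j"
      using 1[of j] 2[of j] coords_okD[OF assms, of j] ystar(1)[of j] by (cases "j \<le> L") auto
  qed
qed

definition Gx :: "rvec \<Rightarrow> real" where
  "Gx x = (\<Sum>j=1..l. W j (yc x j))"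

definition Ux :: "rvec set" where
  "Ux = {x. coords_ok E l (yc x)}"

text \<open>The limit point belonging to the minimizer \<open>u\<close>, projected to its free
  moments; \<open>fill l\<close> restores the full vector.\<close>

definition xpt :: "rvec \<Rightarrow> nat \<Rightarrow> real" where
  "xpt u = restrict (mom E (Y (ext u))) I"

definition X :: "rvec set" where
  "X = xpt ` FM"

lemma finite_X: "finite X"
  unfolding X_def using gen by (intro finite_imageI) (simp add: generic_def)

lemma ycoord_xpt:
  assumes "coords_ok E L (Y u)" "1 \<le> j" "j \<le> l"
  shows "yc (xpt u) j = Y (ext u) j"
proof -
  have "yc (xpt u) j = yc (mom E (Y (ext u))) j"
    by (rule ycoord_cong) (use assms in "auto simp: xpt_def I_iff")
  thus ?thesis using ycoord_mom_Y[OF Y_ext(3)[OF assms(1)] assms(2,3)] by simp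
qed

lemma xpt_in_Ux: "coords_ok E L (Y u) \<Longrightarrow> xpt u \<in> Ux"
  unfolding Ux_def using Y_ext(3)[of u] coords_ok_cong[of l "yc (xpt u)" "Y (ext u)" E] ycoord_xpt[of u] by simp

lemma ext_PiE: "ext u \<in> PiE I (\<lambda>_. UNIV)"
  by (simp add: ext_def)

lemma limit_points_eq: "limit_points E C V l = fill l ` X"
proof -
  have "moments_of_coords E C l (\<lambda>j\<in>I. if j \<le> L then u j
           else if odd (j - L) then W_minimizer E C V (L + 1) else W_minimizer E C V (L + 2))
      = fill l (xpt u)" if "u \<in> FM" for u
  proof -
    have ok: "coords_ok E L (Y u)" using that F_minimizers_iff by blast
    have "moments_of_coords E C l (ext u) = fill l (mom E (Y (ext u)))"
      by (rule moments_of_coords_eq[OF l_ge ext_PiE Y_ext(3)[OF ok]])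
    also have "... = fill l (xpt u)"
      by (auto simp: fill_constraint_def xpt_def I_iff fun_eq_iff split: option.splits)
    finally show ?thesis by (simp add: ext_def ystar_def cong: if_cong)
  qed
  thus ?thesis unfolding limit_points_def X_def image_image by (intro image_cong) auto
qed

lemma Gx_split: "Gx x = (\<Sum>j=1..L. W j (yc x j)) + (\<Sum>j\<in>{L<..l}. W j (yc x j))"
proof -
  have set: "{1..l} = {1..L} \<union> {L<..l}" using l_ge by auto
  show ?thesis unfolding Gx_def set by (rule sum.union_disjoint) auto
qed

text \<open>The first \<open>L\<close> coordinates of a point carry \<open>F\<close>, the remaining ones are independent.\<close>

lemma Gx_ge:
  assumes u: "u \<in> FM" and x: "x \<in> Ux"
  shows "Gx (xpt u) \<le> Gx x"
    and "Gx x \<le> Gx (xpt u) \<Longrightarrow> restrict x I \<in> X"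
proof -
  have ok: "coords_ok E L (Y u)" and umin: "\<And>u'. coords_ok E L (Y u') \<Longrightarrow> WY L u \<le> WY L u'"
    using u F_minimizers_iff by blast+
  have xok: "coords_ok E l (yc x)" using x by (simp add: Ux_def)
  define v where "v = restrict (yc x) (free L)"
  have xokL: "coords_ok E L (yc x)" using coords_ok_mono[OF xok l_ge] .
  have vY: "Y v j = yc x j" if "1 \<le> j" "j \<le> L" for j
    by (rule Y_ycoord[OF xokL]) (use that in "auto simp: v_def free_indices_def")
  have vok: "coords_ok E L (Y v)" using xokL coords_ok_cong[of L "Y v" "yc x" E] vY by simp
  have A: "(\<Sum>j=1..L. W j (yc x j)) = WY L v" unfolding WY_def using vY by (intro sum.cong) auto
  have A': "(\<Sum>j=1..L. W j (yc (xpt u) j)) = WY L u"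
    unfolding WY_def using ycoord_xpt[OF ok] Y_ext(1)[OF ok] l_ge by (intro sum.cong) auto
  have B': "(\<Sum>j\<in>{L<..l}. W j (yc (xpt u) j)) = (\<Sum>j\<in>{L<..l}. W j (ystar j))"
    using ycoord_xpt[OF ok] Y_ext(2)[OF ok] by (intro sum.cong) auto
  have dom: "yc x j \<in> coord_dom E j" if "j \<in> {L<..l}" for j
    using coords_okD[OF xok, of j] that by auto
  have B: "(\<Sum>j\<in>{L<..l}. W j (ystar j)) \<le> (\<Sum>j\<in>{L<..l}. W j (yc x j))"
    using ystar(2) dom by (intro sum_mono) auto
  have A2: "WY L u \<le> WY L v" by (rule umin[OF vok])
  show "Gx (xpt u) \<le> Gx x" unfolding Gx_split A A' B' using A2 B by simp
  assume "Gx x \<le> Gx (xpt u)"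
  hence eqs: "WY L v \<le> WY L u" "(\<Sum>j\<in>{L<..l}. W j (yc x j)) \<le> (\<Sum>j\<in>{L<..l}. W j (ystar j))"
    using A2 B unfolding Gx_split A A' B' by linarith+
  have vmin: "v \<in> FM"
    unfolding F_minimizers_iff using vok umin eqs(1) by (auto simp: v_def intro: order_trans)
  have ys: "yc x j = ystar j" if j: "j \<in> {L<..l}" for j
  proof (rule ystar(3))
    show "W j (yc x j) \<le> W j (ystar j)"
    proof (rule ccontr)
      assume "\<not> ?thesis"
      hence "(\<Sum>j\<in>{L<..l}. W j (ystar j)) < (\<Sum>j\<in>{L<..l}. W j (yc x j))"
        using ystar(2) dom j by (intro sum_strict_mono_ex1) (auto intro!: bexI[of _ j])
      thus False using eqs(2) by simp
    qed
  qed (use j dom in auto)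
  have Yx: "Y (ext v) j = yc x j" if "1 \<le> j" "j \<le> l" for j
    using Y_ext(1,2)[OF vok, of j] vY[of j] ys[of j] that by (cases "j \<le> L") auto
  have "restrict x I = xpt v"
  proof
    fix j show "restrict x I j = xpt v j"
    proof (cases "j \<in> I")
      case True
      hence j: "1 \<le> j" "j \<le> l" "j \<notin> dom C" by (auto simp: I_iff)
      have "mom E (Y (ext v)) j = mom E (yc x) j" using Yx j by (intro mom_cong) auto
      also have "... = x j" using mom_ycoord[OF xok j(1,2)] j(3) by (auto simp: fillc_def domIff)
      finally show ?thesis using True by (simp add: xpt_def)
    qed (simp add: xpt_def)
  qed
  thus "restrict x I \<in> X" using vmin by (simp add: X_def)
qed

text \<open>The compactness argument is carried out in coordinates rather than in moments: there the
  sublevel sets of each \<open>W j\<close> are compact inside the open domain, and the moments are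
  polynomials, so the constraint and the distance condition are closed. A minimum on such a set is
  attained and exceeds the value at the limit points.\<close>

lemma Gx_far:
  assumes u: "u \<in> FM" and "\<rho> > 0"
  shows "\<exists>\<delta>>0. \<forall>x\<in>Ux. (\<forall>q\<in>X. \<exists>i\<in>I. \<bar>x i - q i\<bar> \<ge> \<rho>) \<longrightarrow> Gx x \<ge> Gx (xpt u) + \<delta>"
proof -
  define G0 where "G0 = Gx (xpt u)"
  have "\<exists>b. \<forall>y\<in>coord_dom E j. b \<le> W j y" if j: "j \<ge> 1" for j
  proof -
    obtain K where K: "compact K" "K \<subseteq> coord_dom E j" "\<forall>y\<in>coord_dom E j. W j y \<le> 0 \<longrightarrow> y \<in> K"
      using W_pot_sublevel_compact[OF IC j, of 0] by blast
    have "compact (W j ` K)" by (intro compact_continuous_image continuous_on_subset[OF continuous_on_W[OF j]] K)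
    hence "bdd_below (W j ` K)" by (intro bounded_imp_bdd_below compact_imp_bounded)
    then obtain b where b: "\<forall>y\<in>K. b \<le> W j y" unfolding bdd_below_def by blast
    have "\<forall>y\<in>coord_dom E j. min b 0 \<le> W j y"
    proof
      fix y assume "y \<in> coord_dom E j"
      thus "min b 0 \<le> W j y" using K(3) b by (cases "W j y \<le> 0") (simp_all add: min.coboundedI1 min.coboundedI2)
    qed
    thus ?thesis by blast
  qed
  hence "\<forall>j. \<exists>b. j \<ge> 1 \<longrightarrow> (\<forall>y\<in>coord_dom E j. b \<le> W j y)" by blast
  from choice[OF this] obtain b where b: "\<And>j y. j \<ge> 1 \<Longrightarrow> y \<in> coord_dom E j \<Longrightarrow> b j \<le> W j y" by blast
  \<comment> \<open>If \<open>Gx\<close> is at most \<open>G0 + 1\<close>, then \<open>W j\<close>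
    is at most \<open>c j\<close>, because the other summands are bounded below by the
    \<open>b i\<close>.\<close>
  define c where "c = (\<lambda>j. G0 + 1 - (\<Sum>i\<in>{1..l} - {j}. b i))"
  have "\<forall>j. \<exists>K. j \<ge> 1 \<longrightarrow> compact K \<and> K \<subseteq> coord_dom E j \<and> (\<forall>y\<in>coord_dom E j. W j y \<le> c j \<longrightarrow> y \<in> K)"
    using W_pot_sublevel_compact[OF IC] by blast
  from choice[OF this] obtain K where KK: "\<forall>j. j \<ge> 1 \<longrightarrow> compact (K j) \<and> K j \<subseteq> coord_dom E j \<and>
      (\<forall>y\<in>coord_dom E j. W j y \<le> c j \<longrightarrow> y \<in> K j)" by blast
  have K: "\<And>j. j \<ge> 1 \<Longrightarrow> compact (K j)" "\<And>j. j \<ge> 1 \<Longrightarrow> K j \<subseteq> coord_dom E j"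
    "\<And>j y. j \<ge> 1 \<Longrightarrow> y \<in> coord_dom E j \<Longrightarrow> W j y \<le> c j \<Longrightarrow> y \<in> K j"
    using KK by simp_all
  \<comment> \<open>The coordinates outside \<open>{1..l}\<close> are fixed at \<open>0\<close> to
    make the set compact in the full product.\<close>
  define KK where "KK = {y. \<forall>j. y j \<in> (if j \<in> {1..l} then K j else {0})}"
  have KKc: "compact KK" unfolding KK_def by (rule compact_PiE_UNIV) (use K(1) in auto)
  define Cl where "Cl = {y. \<forall>i\<in>dom C. mom E y i = the (C i)} \<inter> {y. \<forall>q\<in>X. \<exists>i\<in>I. \<bar>mom E y i - q i\<bar> \<ge> \<rho>}"
  have cm: "continuous_on UNIV (\<lambda>y. mom E y i)" for i
    by (rule continuous_on_mom) (rule continuous_on_coord)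
  have "Cl = (\<Inter>i\<in>dom C. {y. mom E y i = the (C i)}) \<inter> (\<Inter>q\<in>X. \<Union>i\<in>I. {y. \<rho> \<le> \<bar>mom E y i - q i\<bar>})"
    by (auto simp: Cl_def)
  moreover have "closed ..."
    by (intro closed_Int closed_INT ballI closed_UN closed_Collect_eq closed_Collect_le continuous_intros cm finite_free_indices)
  ultimately have "closed Cl" by simp
  hence KC: "compact (KK \<inter> Cl)" using KKc by (rule compact_Int_closed[rotated])
  define T where "T = (\<lambda>y. \<Sum>j=1..l. W j (y j))"
  have Tc: "continuous_on (KK \<inter> Cl) T"
    unfolding T_def
  proof (intro continuous_on_sum)
    fix j assume j: "j \<in> {1..l}"
    show "continuous_on (KK \<inter> Cl) (\<lambda>y. W j (y j))"
    proof (rule continuous_on_compose2[OF continuous_on_W continuous_on_coord])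
      show "(\<lambda>y. y j) ` (KK \<inter> Cl) \<subseteq> coord_dom E j"
      proof (rule image_subsetI)
        fix y assume "y \<in> KK \<inter> Cl"
        hence "y j \<in> (if j \<in> {1..l} then K j else {0})" unfolding KK_def by blast
        thus "y j \<in> coord_dom E j" using K(2)[of j] j by auto
      qed
    qed (use j in auto)
  qed
  have lift: "(\<lambda>j. if j \<in> {1..l} then yc x j else 0) \<in> KK \<inter> Cl \<and> T (\<lambda>j. if j \<in> {1..l} then yc x j else 0) = Gx x"
    if x: "x \<in> Ux" "\<forall>q\<in>X. \<exists>i\<in>I. \<bar>x i - q i\<bar> \<ge> \<rho>" "Gx x \<le> G0 + 1" for x
  proof -
    let ?y = "\<lambda>j. if j \<in> {1..l} then yc x j else 0"
    have xok: "coords_ok E l (yc x)" using x(1) by (simp add: Ux_def)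
    have "?y j \<in> (if j \<in> {1..l} then K j else {0})" for j
    proof (cases "j \<in> {1..l}")
      case True
      hence j: "1 \<le> j" "j \<le> l" by auto
      have dj: "yc x i \<in> coord_dom E i" if "i \<in> {1..l}" for i using coords_okD[OF xok, of i] that by auto
      have "Gx x = W j (yc x j) + (\<Sum>i\<in>{1..l} - {j}. W i (yc x i))"
        unfolding Gx_def using True by (subst sum.remove[of _ j]) auto
      moreover have "(\<Sum>i\<in>{1..l} - {j}. b i) \<le> (\<Sum>i\<in>{1..l} - {j}. W i (yc x i))"
        using b dj by (intro sum_mono) auto
      ultimately have "W j (yc x j) \<le> c j" using x(3) by (simp add: c_def)
      thus ?thesis using K(3)[OF j(1) dj[OF True]] True by simp
    qed auto
    moreover have momy: "mom E ?y i = fillc C x i" if "1 \<le> i" "i \<le> l" for i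
    proof -
      have "mom E ?y i = mom E (yc x) i" by (rule mom_cong) (use that in auto)
      thus ?thesis using mom_ycoord[OF xok that] by simp
    qed
    moreover have "mom E ?y i = the (C i)" if "i \<in> dom C" for i
    proof -
      have "1 \<le> i" "i \<le> l" using dom_range[OF that] l_ge by auto
      thus ?thesis using momy[of i] that by (auto simp: fillc_def)
    qed
    moreover have "mom E ?y i = x i" if "i \<in> I" for i
      using momy[of i] that by (auto simp: I_iff fillc_def domIff)
    ultimately have "?y \<in> KK \<inter> Cl" using x(2) unfolding KK_def Cl_def by simp
    moreover have "T ?y = Gx x" unfolding T_def Gx_def by (intro sum.cong) auto
    ultimately show ?thesis by blast
  qed
  show ?thesis
  proof (cases "KK \<inter> Cl = {}")
    case True
    have "Gx x \<ge> G0 + 1" if "x \<in> Ux" "\<forall>q\<in>X. \<exists>i\<in>I. \<bar>x i - q i\<bar> \<ge> \<rho>" for x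
      using lift[OF that] True by fastforce
    thus ?thesis unfolding G0_def by (intro exI[of _ 1]) auto
  next
    case False
    then obtain y where y: "y \<in> KK \<inter> Cl" and ymin: "\<And>y'. y' \<in> KK \<inter> Cl \<Longrightarrow> T y \<le> T y'"
      using continuous_attains_inf[OF KC _ Tc] by blast
    have yok: "coords_ok E l y" unfolding coords_ok_def
    proof (intro allI impI)
      fix j assume j: "1 \<le> j \<and> j \<le> l"
      moreover have "y j \<in> (if j \<in> {1..l} then K j else {0})" using y unfolding KK_def by blast
      ultimately have "y j \<in> K j" by simp
      thus "y j \<in> coord_dom E j" using K(2)[of j] j by auto
    qed
    let ?x = "mom E y"
    have yc: "yc ?x j = y j" if "1 \<le> j" "j \<le> l" for j
      unfolding ycoord_def
    proof (rule sol_mom[OF yok _ that])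
      fix i assume "1 \<le> i" "i \<le> l"
      show "fillc C ?x i = (if i \<in> UNIV then mom E y i else y i)"
      proof (cases "C i")
        case (Some c)
        hence "i \<in> dom C" by blast
        hence "mom E y i = the (C i)" using y unfolding Cl_def by blast
        thus ?thesis using Some by (simp add: fillc_def)
      qed (simp add: fillc_def)
    qed
    have xU: "?x \<in> Ux" unfolding Ux_def using yok coords_ok_cong[of l "yc ?x" y E] yc by simp
    have "Gx ?x = T y" unfolding Gx_def T_def using yc by (intro sum.cong) auto
    \<comment> \<open>Membership would contradict the distance condition at the point itself; thus
      the second part of \<open>Gx_ge\<close> makes the inequality strict.\<close>
    moreover have "restrict ?x I \<notin> X"
    proof
      assume "restrict ?x I \<in> X"
      then obtain i where "i \<in> I" "\<bar>mom E y i - restrict ?x I i\<bar> \<ge> \<rho>" using y unfolding Cl_def by blast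
      thus False using \<open>\<rho> > 0\<close> by simp
    qed
    ultimately have "T y > G0" using Gx_ge(2)[OF u xU] unfolding G0_def by force
    define \<delta> where "\<delta> = min 1 (T y - G0)"
    have "Gx x \<ge> G0 + \<delta>" if "x \<in> Ux" "\<forall>q\<in>X. \<exists>i\<in>I. \<bar>x i - q i\<bar> \<ge> \<rho>" for x
    proof (cases "Gx x \<le> G0 + 1")
      case True
      from lift[OF that True] have "T y \<le> Gx x" using ymin by metis
      thus ?thesis by (simp add: \<delta>_def)
    qed (simp add: \<delta>_def)
    moreover have "\<delta> > 0" using \<open>T y > G0\<close> by (simp add: \<delta>_def)
    ultimately show ?thesis unfolding G0_def by blast
  qed
qed

end

section \<open>The quadratic approximation at the limit points\<close>

lemma smooth2_witness:
  assumes s: "smooth2_on I U f g h" and "open U" "finite I" "x \<in> U" "i \<in> I" "j \<in> I"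
  shows "g i x = partial_deriv i f x" "h i j x = partial_deriv j (partial_deriv i f) x"
  using partial_deriv_smooth2[OF s assms(2-4), of UNIV f i j] assms(5,6) by simp_all

lemma smooth2_symmetric:
  assumes "smooth2 I U f" "open U" "finite I" "x \<in> U" "i \<in> I" "j \<in> I"
  shows "partial_deriv j (partial_deriv i f) x = partial_deriv i (partial_deriv j f) x"
proof -
  obtain g h where s: "smooth2_on I U f g h" using assms(1) by (auto simp: smooth2_def)
  have "h i j x = h j i x" using s assms by (auto simp: smooth2_on_def)
  thus ?thesis using smooth2_witness(2)[OF s assms(2-4)] assms(5,6) by simp
qed

lemma smooth2_taylor_partial:
  assumes "smooth2 I U f" "open U" "finite I" "x \<in> U" "e > 0"
  shows "\<exists>\<rho>>0. \<forall>v. (\<forall>i. i \<notin> I \<longrightarrow> v i = 0) \<and> (\<forall>i\<in>I. \<bar>v i\<bar> < \<rho>) \<longrightarrow> (\<lambda>i. x i + v i) \<in> U \<and>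
    \<bar>f (\<lambda>i. x i + v i) - f x - (\<Sum>i\<in>I. partial_deriv i f x * v i)
      - (\<Sum>i\<in>I. \<Sum>j\<in>I. partial_deriv j (partial_deriv i f) x * v i * v j) / 2\<bar> \<le> e * (\<Sum>i\<in>I. (v i)\<^sup>2)"
proof -
  obtain g h where s: "smooth2_on I U f g h" using assms(1) by (auto simp: smooth2_def)
  have "(\<Sum>i\<in>I. g i x * v i) = (\<Sum>i\<in>I. partial_deriv i f x * v i)" for v
    using smooth2_witness(1)[OF s assms(2-4)] by (intro sum.cong) auto
  moreover have "(\<Sum>i\<in>I. \<Sum>j\<in>I. h i j x * v i * v j) = (\<Sum>i\<in>I. \<Sum>j\<in>I. partial_deriv j (partial_deriv i f) x * v i * v j)" for v
    using smooth2_witness(2)[OF s assms(2-4)] by (intro sum.cong refl) auto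
  ultimately show ?thesis using smooth2_taylor[OF s assms(2-5)] by simp
qed

lemma smooth2_first_order_partial:
  assumes "smooth2 I U f" "open U" "finite I" "x \<in> U" "e > 0"
  shows "\<exists>\<rho>>0. \<forall>v. (\<forall>i. i \<notin> I \<longrightarrow> v i = 0) \<and> (\<forall>i\<in>I. \<bar>v i\<bar> < \<rho>) \<longrightarrow>
    \<bar>f (\<lambda>i. x i + v i) - f x - (\<Sum>i\<in>I. partial_deriv i f x * v i)\<bar> \<le> e * (\<Sum>i\<in>I. \<bar>v i\<bar>)"
proof -
  obtain g h where s: "smooth2_on I U f g h" using assms(1) by (auto simp: smooth2_def)
  have "(\<Sum>i\<in>I. g i x * v i) = (\<Sum>i\<in>I. partial_deriv i f x * v i)" for v
    using smooth2_witness(1)[OF s assms(2-4)] by (intro sum.cong) auto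
  thus ?thesis using smooth2_first_order[OF s assms(2-5)] by simp
qed

lemma smooth2_min_gradient:
  assumes "smooth2 I U f" "open U" "finite I" "x \<in> U" "\<And>y. y \<in> U \<Longrightarrow> f x \<le> f y" "i \<in> I"
  shows "partial_deriv i f x = 0"
proof -
  obtain g h where s: "smooth2_on I U f g h" using assms(1) by (auto simp: smooth2_def)
  have D: "((\<lambda>t. f (x(i := t))) has_real_derivative g i x) (at (x i))"
    using s assms by (intro has_grad_partial[of I]) (auto simp: smooth2_on_def)
  have "\<forall>\<^sub>F t in nhds (x i). x(i := t) \<in> U" by (rule eventually_update[OF assms(2,4)])
  then obtain d where d: "d > 0" "\<And>t. dist t (x i) < d \<Longrightarrow> x(i := t) \<in> U"
    by (auto simp: eventually_nhds_metric)
  have "g i x = 0"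
    by (rule DERIV_local_min[OF D d(1)])
       (use d(2) assms(5) in "auto simp: dist_real_def abs_minus_commute")
  thus ?thesis using smooth2_witness(1)[OF s assms(2-4)] assms(6) by simp
qed

text \<open>After rescaling the direction into the range of the Taylor expansion, the quadratic form
  is at least \<open>- 2 * e * N\<close> for every positive \<open>e\<close>.\<close>

lemma smooth2_min_psd:
  assumes "smooth2 I U f" "open U" "finite I" "x \<in> U" "\<And>y. y \<in> U \<Longrightarrow> f x \<le> f y"
  shows "(\<Sum>i\<in>I. \<Sum>j\<in>I. partial_deriv j (partial_deriv i f) x * v i * v j) \<ge> 0"
proof -
  define q where "q = (\<lambda>v. \<Sum>i\<in>I. \<Sum>j\<in>I. partial_deriv j (partial_deriv i f) x * v i * v j)"
  define N where "N = (\<Sum>i\<in>I. (v i)\<^sup>2)"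
  have N: "N \<ge> 0" by (auto simp: N_def intro: sum_nonneg)
  have bound: "q v \<ge> - (2 * e * N)" if e: "e > 0" for e
  proof -
    obtain \<rho> where \<rho>: "\<rho> > 0" "\<And>w. (\<forall>i. i \<notin> I \<longrightarrow> w i = 0) \<and> (\<forall>i\<in>I. \<bar>w i\<bar> < \<rho>) \<Longrightarrow> (\<lambda>i. x i + w i) \<in> U \<and>
      \<bar>f (\<lambda>i. x i + w i) - f x - (\<Sum>i\<in>I. partial_deriv i f x * w i) - q w / 2\<bar> \<le> e * (\<Sum>i\<in>I. (w i)\<^sup>2)"
      using smooth2_taylor_partial[OF assms(1-4) e] unfolding q_def by blast
    define s where "s = (\<Sum>i\<in>I. \<bar>v i\<bar>) + 1"
    have s: "s > 0" by (auto simp: s_def add_nonneg_pos sum_nonneg)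
    define t where "t = \<rho> / (2 * s)"
    have t: "t > 0" using \<rho>(1) s by (simp add: t_def)
    define w where "w = (\<lambda>i. if i \<in> I then t * v i else 0)"
    have wb: "\<bar>w i\<bar> < \<rho>" if "i \<in> I" for i
    proof -
      have "\<bar>v i\<bar> \<le> s" using member_le_sum[of i I "\<lambda>i. \<bar>v i\<bar>"] that assms(3) by (auto simp: s_def)
      hence "\<bar>w i\<bar> \<le> t * s" using t that by (auto simp: w_def abs_mult intro!: mult_left_mono)
      also have "... < \<rho>" using s \<rho>(1) by (simp add: t_def)
      finally show ?thesis .
    qed
    have qw: "q w = t\<^sup>2 * q v"
      unfolding q_def sum_distrib_left by (intro sum.cong refl) (simp add: w_def power2_eq_square)
    have nw: "(\<Sum>i\<in>I. (w i)\<^sup>2) = t\<^sup>2 * N"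
      unfolding N_def sum_distrib_left by (intro sum.cong refl) (simp add: w_def power_mult_distrib)
    have "(\<Sum>i\<in>I. partial_deriv i f x * w i) = 0"
      using smooth2_min_gradient[OF assms(1-5)] by simp
    moreover have "(\<lambda>i. x i + w i) \<in> U" and "\<bar>f (\<lambda>i. x i + w i) - f x - (\<Sum>i\<in>I. partial_deriv i f x * w i) - q w / 2\<bar> \<le> e * (\<Sum>i\<in>I. (w i)\<^sup>2)"
      using \<rho>(2)[of w] wb by (auto simp: w_def)
    moreover have "f x \<le> f (\<lambda>i. x i + w i)" by (rule assms(5)) fact
    ultimately have "- (e * (t\<^sup>2 * N)) \<le> t\<^sup>2 * q v / 2" unfolding qw nw by linarith
    hence "t\<^sup>2 * - (2 * e * N) \<le> t\<^sup>2 * q v" by (simp add: algebra_simps)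
    thus ?thesis using t by (simp only: mult_le_cancel_left_pos zero_less_power)
  qed
  have "q v \<ge> 0"
  proof (rule ccontr)
    assume "\<not> ?thesis"
    hence neg: "q v < 0" by simp
    define e where "e = - q v / (4 * (N + 1))"
    have e: "e > 0" using neg N by (simp add: e_def divide_neg_pos)
    have "2 * e * N = - q v / 2 * (N / (N + 1))" using N by (simp add: e_def field_simps)
    also have "... \<le> - q v / 2 * 1" using neg N by (intro mult_left_mono) auto
    finally show False using bound[OF e] neg by linarith
  qed
  thus ?thesis by (simp add: q_def)
qed

lemma deriv_deriv_C2:
  assumes "open D" "\<And>x. x \<in> D \<Longrightarrow> (f has_real_derivative f' x) (at x)"
    "\<And>x. x \<in> D \<Longrightarrow> (f' has_real_derivative f'' x) (at x)" "x \<in> D"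
  shows "deriv (deriv f) x = f'' x"
proof -
  have "\<forall>\<^sub>F y in nhds x. y \<in> D" using assms(1,4) by (rule eventually_nhds_in_open)
  hence "\<forall>\<^sub>F y in nhds x. deriv f y = f' y" by eventually_elim (rule DERIV_imp_deriv[OF assms(2)])
  hence "deriv (deriv f) x = deriv f' x" by (rule deriv_cong_ev) simp
  thus ?thesis using DERIV_imp_deriv[OF assms(3)[OF assms(4)]] by simp
qed

lemma free_list_props:
  "set (free_list C n) = free_indices C n" "distinct (free_list C n)"
  "length (free_list C n) = card (free_indices C n)"
  by (simp_all add: free_list_def)

lemma sum_free_indices:
  "(\<Sum>i\<in>free_indices C n. f i) = (\<Sum>a<card (free_indices C n). f (free_list C n ! a))"
  using sum.reindex_bij_betw[OF bij_betw_nth[OF free_list_props(2)[of C n] refl refl], of f]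
  by (simp add: free_list_props lessThan_atLeast0)

lemma free_list_index: "i \<in> free_indices C n \<Longrightarrow> \<exists>a<card (free_indices C n). free_list C n ! a = i"
  using free_list_props[of C n] in_set_conv_nth[of i "free_list C n"] by simp

lemma free_list_in: "a < card (free_indices C n) \<Longrightarrow> free_list C n ! a \<in> free_indices C n"
  using nth_mem[of a "free_list C n"] by (simp add: free_list_props)

text \<open>Position and index are inverse to each other: \<open>insert_zeros\<close> finds the
  entry of index \<open>i\<close> at the position \<open>card (free_indices C (i - 1))\<close>,
  whereas Hessian and Jacobian are built from \<open>free_list\<close>.\<close>

lemma card_free_below:
  assumes "a < card (free_indices C n)"
  shows "card (free_indices C (free_list C n ! a - 1)) = a"
proof -
  let ?xs = "free_list C n"
  have len: "length ?xs = card (free_indices C n)" by (rule free_list_props)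
  have sorted: "sorted_wrt (<) ?xs" unfolding free_list_def by simp
  have i: "?xs ! a \<in> free_indices C n" by (rule free_list_in[OF assms])
  have "free_indices C (?xs ! a - 1) = {j \<in> free_indices C n. j < ?xs ! a}"
    using i by (auto simp: free_indices_def)
  also have "... = (!) ?xs ` {..<a}"
  proof (intro equalityI subsetI)
    fix j assume "j \<in> {j \<in> free_indices C n. j < ?xs ! a}"
    hence j: "j \<in> set ?xs" "j < ?xs ! a" by (auto simp: free_list_props)
    then obtain b where b: "b < length ?xs" "?xs ! b = j" by (auto simp: in_set_conv_nth)
    have "b < a"
    proof (rule ccontr)
      assume "\<not> b < a"
      hence "a = b \<or> a < b" by auto
      thus False using j(2) b sorted_wrt_nth_less[OF sorted, of a b] by auto
    qed
    thus "j \<in> (!) ?xs ` {..<a}" using b by auto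
  next
    fix j assume "j \<in> (!) ?xs ` {..<a}"
    then obtain b where b: "b < a" "j = ?xs ! b" by auto
    thus "j \<in> {j \<in> free_indices C n. j < ?xs ! a}"
      using sorted_wrt_nth_less[OF sorted b(1)] assms len free_list_in[of b C n] by auto
  qed
  also have "card ... = a"
  proof -
    have "inj_on ((!) ?xs) {..<a}"
      using free_list_props(2)[of C n] assms len by (intro inj_on_nth) auto
    thus ?thesis by (simp add: card_image)
  qed
  finally show ?thesis .
qed

section \<open>The Hessian in the free coordinates\<close>

context generic_setting
begin

lemma continuous_on_fillc: "continuous_on S (fillc C)"
proof -
  have "continuous_on S (\<lambda>x. fillc C x j)" for j
    by (cases "C j") (auto simp: fillc_def intro: continuous_on_coord)
  thus ?thesis by (intro continuous_on_coordinatewise_then_product)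
qed

definition Uu :: "nat \<Rightarrow> rvec set" where
  "Uu n = {u. coords_ok E n (Y u)}"

lemma open_Uu: "open (Uu n)"
proof -
  have "Uu n = fillc C -` sol_dom E (dom C) n" by (auto simp: Uu_def sol_dom_def Y_def)
  thus ?thesis using open_vimage[OF open_sol_dom continuous_on_fillc] by simp
qed

lemma open_Ux: "open Ux"
proof -
  have "Ux = fillc C -` sol_dom E UNIV l" by (auto simp: Ux_def sol_dom_def ycoord_def)
  thus ?thesis using open_vimage[OF open_sol_dom continuous_on_fillc] by simp
qed

lemma smooth2_fillc: "finite J \<Longrightarrow> smooth2 J U (\<lambda>u. fillc C u j)"
  by (cases "C j") (auto simp: fillc_def intro: smooth2_coord)

lemma smooth2_Y: "finite J \<Longrightarrow> 1 \<le> j \<Longrightarrow> j \<le> n \<Longrightarrow> smooth2 J (Uu n) (\<lambda>u. Y u j)"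
  unfolding Y_def by (rule smooth2_sol[where n = n]) (auto simp: Uu_def Y_def smooth2_fillc)

lemma smooth2_ycoord: "1 \<le> j \<Longrightarrow> j \<le> l \<Longrightarrow> smooth2 I Ux (\<lambda>x. yc x j)"
  unfolding ycoord_def by (rule smooth2_sol[where n = l]) (auto simp: Ux_def ycoord_def smooth2_fillc)

lemma smooth2_WY:
  assumes "finite J" "m \<le> n"
  shows "smooth2 J (Uu n) (WY m)"
proof -
  have "smooth2 J (Uu n) (\<lambda>u. W j (Y u j))" if "j \<in> {1..m}" for j
  proof -
    have j: "1 \<le> j" "j \<le> n" using that assms(2) by auto
    obtain f' f'' where f: "\<forall>x\<in>coord_dom E j. (W j has_real_derivative f' x) (at x) \<and> (f' has_real_derivative f'' x) (at x)"
      "continuous_on (coord_dom E j) f''"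
      using C2_W[OF j(1)] by (auto simp: C2_on_def)
    show ?thesis
      by (rule smooth2_comp[OF smooth2_Y[OF assms(1) j], of "coord_dom E j" "W j" f' f''])
         (use f coords_okD[of E n _ j] j in "auto simp: Uu_def")
  qed
  thus ?thesis unfolding WY_def[abs_def] by (intro smooth2_sum) auto
qed

definition hs :: "nat \<Rightarrow> rvec \<Rightarrow> nat \<Rightarrow> nat \<Rightarrow> real" where
  "hs n u i j = partial_deriv j (partial_deriv i (WY n)) u"

lemma WY_cong: "(\<And>i. 1 \<le> i \<Longrightarrow> i \<le> n \<Longrightarrow> i \<notin> dom C \<Longrightarrow> u i = u' i) \<Longrightarrow> WY n u = WY n u'"
  unfolding WY_def by (intro sum.cong refl arg_cong[of _ _ "W _"] Y_cong) auto

lemma hessian_constr_eq: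
  assumes "L \<le> n" "u \<in> PiE (free n) (\<lambda>_. UNIV)" "u \<in> Uu n"
    and "a < card (free n)" "b < card (free n)"
  shows "hessian_constr C n (W_sum E C V n) u $$ (a, b) = hs n u (free_list C n ! b) (free_list C n ! a)"
proof -
  let ?J = "free n"
  obtain g h where s: "smooth2_on ?J (Uu n) (WY n) g h"
    using smooth2_WY[of ?J n n] by (auto simp: smooth2_def)
  have J: "free_list C n ! a \<in> ?J" "free_list C n ! b \<in> ?J" using assms free_list_in by blast+
  have "partial_deriv (free_list C n ! a) (partial_deriv (free_list C n ! b) (W_sum E C V n)) u
      = h (free_list C n ! b) (free_list C n ! a) u"
    by (rule partial_deriv_smooth2(2)[OF s open_Uu _ assms(3,2)])
       (use W_sum_eq[OF assms(1)] J in "auto simp: Uu_def PiE_iff extensional_def")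
  also have "... = hs n u (free_list C n ! b) (free_list C n ! a)"
    unfolding hs_def using smooth2_witness(2)[OF s open_Uu _ assms(3)] J by simp
  finally show ?thesis using assms(4,5) by (simp add: hessian_constr_def)
qed

lemma hs_symmetric: "u \<in> Uu n \<Longrightarrow> i \<in> free n \<Longrightarrow> j \<in> free n \<Longrightarrow> hs n u i j = hs n u j i"
  unfolding hs_def by (rule smooth2_symmetric[OF smooth2_WY[OF _ order_refl] open_Uu]) auto

lemma quadratic_form_reindex:
  assumes A: "\<And>a b. a < card (free n) \<Longrightarrow> b < card (free n) \<Longrightarrow>
      A $$ (a, b) = H (free_list C n ! b) (free_list C n ! a)"
  shows "ipn (card (free n)) (\<lambda>a. w (free_list C n ! a)) (mvn (card (free n)) (\<lambda>i j. A $$ (i, j)) (\<lambda>a. w (free_list C n ! a)))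
    = (\<Sum>i\<in>free n. \<Sum>j\<in>free n. H i j * w i * w j)"
proof -
  let ?d = "card (free n)" and ?x = "free_list C n"
  have "(\<Sum>i\<in>free n. \<Sum>j\<in>free n. H i j * w i * w j)
      = (\<Sum>b<?d. \<Sum>a<?d. H (?x ! b) (?x ! a) * w (?x ! b) * w (?x ! a))"
    unfolding sum_free_indices ..
  also have "... = (\<Sum>a<?d. \<Sum>b<?d. H (?x ! b) (?x ! a) * w (?x ! b) * w (?x ! a))" by (rule sum.swap)
  also have "... = (\<Sum>a<?d. \<Sum>b<?d. w (?x ! a) * (A $$ (a, b) * w (?x ! b)))"
    using A by (intro sum.cong refl) simp
  finally show ?thesis by (simp add: ipn_def mvn_def sum_distrib_left)
qed

text \<open>\<open>ext u\<close> minimizes \<open>WY l\<close> over all admissible free coordinates,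
  by \<open>Gx_ge\<close> read in coordinates; so the gradient vanishes and the Hessian is
  semidefinite on both levels.\<close>

lemma hs_psd_level:
  assumes "u \<in> FM"
  shows "(\<Sum>i\<in>free L. \<Sum>j\<in>free L. hs L u i j * v i * v j) \<ge> 0"
    and "(\<Sum>i\<in>I. \<Sum>j\<in>I. hs l (ext u) i j * v i * v j) \<ge> 0"
    and "i \<in> I \<Longrightarrow> partial_deriv i (WY l) (ext u) = 0"
proof -
  have ok: "coords_ok E L (Y u)" and umin: "\<And>u'. coords_ok E L (Y u') \<Longrightarrow> WY L u \<le> WY L u'"
    using assms F_minimizers_iff by blast+
  show "(\<Sum>i\<in>free L. \<Sum>j\<in>free L. hs L u i j * v i * v j) \<ge> 0"
    unfolding hs_def using ok umin
    by (intro smooth2_min_psd[OF smooth2_WY[OF _ order_refl] open_Uu]) (auto simp: Uu_def)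
  have extU: "ext u \<in> Uu l" using Y_ext(3)[OF ok] by (simp add: Uu_def)
  have min: "WY l (ext u) \<le> WY l w" if "w \<in> Uu l" for w
  proof -
    have wok: "coords_ok E l (Y w)" using that by (simp add: Uu_def)
    have "WY l w = Gx (mom E (Y w))"
      unfolding WY_def Gx_def using ycoord_mom_Y[OF wok] by (intro sum.cong) auto
    moreover have "mom E (Y w) \<in> Ux"
      unfolding Ux_def using wok coords_ok_cong[of l "yc (mom E (Y w))" "Y w" E] ycoord_mom_Y[OF wok] by simp
    moreover have "WY l (ext u) = Gx (xpt u)"
      unfolding WY_def Gx_def using ycoord_xpt[OF ok] by (intro sum.cong) auto
    ultimately show ?thesis using Gx_ge(1)[OF assms] by simp
  qed
  show "(\<Sum>i\<in>I. \<Sum>j\<in>I. hs l (ext u) i j * v i * v j) \<ge> 0"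
    unfolding hs_def using min extU by (intro smooth2_min_psd[OF smooth2_WY[OF _ order_refl] open_Uu]) auto
  show "i \<in> I \<Longrightarrow> partial_deriv i (WY l) (ext u) = 0"
    using min extU by (intro smooth2_min_gradient[OF smooth2_WY[OF _ order_refl] open_Uu]) auto
qed

text \<open>Minimality gives semidefiniteness, genericity a nonzero determinant, and the two
  together definiteness.\<close>

lemma hs_posdef_L:
  assumes u: "u \<in> FM" and v: "i \<in> free L" "v i \<noteq> 0"
  shows "(\<Sum>i\<in>free L. \<Sum>j\<in>free L. hs L u i j * v i * v j) > 0"
proof -
  let ?J = "free L"
  let ?d = "card ?J" and ?A = "hessian_constr C L (W_sum E C V L) u"
  have ok: "u \<in> PiE ?J (\<lambda>_. UNIV)" "u \<in> Uu L" using u by (auto simp: F_minimizers_iff Uu_def)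
  have A: "?A $$ (a, b) = hs L u (free_list C L ! b) (free_list C L ! a)" if "a < ?d" "b < ?d" for a b
    by (rule hessian_constr_eq[OF order_refl ok that])
  have "posdef_fun ?d (\<lambda>i j. ?A $$ (i, j))"
  proof (rule psd_det_imp_posdef)
    show "?A \<in> carrier_mat ?d ?d" by (simp add: hessian_constr_def)
    show "?A $$ (a, b) = ?A $$ (b, a)" if "a < ?d" "b < ?d" for a b
      using A[OF that] A[OF that(2,1)] hs_symmetric[OF ok(2) free_list_in[OF that(1)] free_list_in[OF that(2)]] by simp
    show "Determinant.det ?A \<noteq> 0" using gen u by (simp add: generic_def)
    fix w :: rvec
    \<comment> \<open>Reads a vector indexed by positions as one indexed by free indices.\<close>
    define w' where "w' = (\<lambda>i. w (card (free (i - 1))))"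
    have w': "w' (free_list C L ! a) = w a" if "a < ?d" for a
      using card_free_below[OF that] by (simp add: w'_def)
    have "ipn ?d w (mvn ?d (\<lambda>i j. ?A $$ (i, j)) w)
        = ipn ?d (\<lambda>a. w' (free_list C L ! a)) (mvn ?d (\<lambda>i j. ?A $$ (i, j)) (\<lambda>a. w' (free_list C L ! a)))"
      using w' by (intro ipn_cong) (auto simp: mvn_def)
    also have "... = (\<Sum>i\<in>?J. \<Sum>j\<in>?J. hs L u i j * w' i * w' j)"
      by (rule quadratic_form_reindex[OF A])
    also have "... \<ge> 0" by (rule hs_psd_level(1)[OF u])
    finally show "ipn ?d w (mvn ?d (\<lambda>i j. ?A $$ (i, j)) w) \<ge> 0" .
  qed
  moreover have "\<exists>a<?d. v (free_list C L ! a) \<noteq> 0"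
    using free_list_index[OF v(1)] v(2) by blast
  ultimately have "ipn ?d (\<lambda>a. v (free_list C L ! a)) (mvn ?d (\<lambda>i j. ?A $$ (i, j)) (\<lambda>a. v (free_list C L ! a))) > 0"
    by (simp add: posdef_fun_def)
  moreover have "ipn ?d (\<lambda>a. v (free_list C L ! a)) (mvn ?d (\<lambda>i j. ?A $$ (i, j)) (\<lambda>a. v (free_list C L ! a)))
    = (\<Sum>i\<in>?J. \<Sum>j\<in>?J. hs L u i j * v i * v j)" by (rule quadratic_form_reindex[OF A])
  ultimately show ?thesis by simp
qed

text \<open>Beyond \<open>L\<close> the coordinates are free and \<open>W\<close> is a separate sum in them, so the Hessian is block diagonal.\<close>

lemma hs_block:
  assumes "u \<in> FM" "i \<in> I" "j \<in> I"
  shows "hs l (ext u) i j = (if i \<le> L \<and> j \<le> L then hs L u i j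
    else if i = j then deriv (deriv (W i)) (ystar i) else 0)"
proof -
  have ok: "coords_ok E L (Y u)" using assms(1) F_minimizers_iff by blast
  have extU: "ext u \<in> Uu l" using Y_ext(3)[OF ok] by (simp add: Uu_def)
  have "\<forall>j. \<exists>f' f''. j \<ge> 1 \<longrightarrow> (\<forall>x\<in>coord_dom E j. (W j has_real_derivative f' x) (at x) \<and> (f' has_real_derivative f'' x) (at x))
      \<and> continuous_on (coord_dom E j) f''"
    using C2_W unfolding C2_on_def by blast
  then obtain f' where "\<forall>j. \<exists>f''. j \<ge> 1 \<longrightarrow> (\<forall>x\<in>coord_dom E j. (W j has_real_derivative f' j x) (at x) \<and> (f' j has_real_derivative f'' x) (at x))
      \<and> continuous_on (coord_dom E j) f''" by (rule choice[THEN exE])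
  then obtain f'' where f0: "\<forall>j. j \<ge> 1 \<longrightarrow> (\<forall>x\<in>coord_dom E j. (W j has_real_derivative f' j x) (at x) \<and> (f' j has_real_derivative f'' j x) (at x))
      \<and> continuous_on (coord_dom E j) (f'' j)" by (rule choice[THEN exE])
  have f: "(W j has_real_derivative f' j x) (at x)" "(f' j has_real_derivative f'' j x) (at x)"
    if "j \<ge> 1" "x \<in> coord_dom E j" for j x using f0 that by blast+
  have fc: "continuous_on (coord_dom E j) (f'' j)" if "j \<ge> 1" for j using f0 that by blast
  define T where "T = {L<..l}"
  have T: "j \<in> I" "j \<ge> 1" if "j \<in> T" for j
  proof -
    have "j \<notin> dom C" using dom_range[of j] that by (auto simp: T_def)
    thus "j \<in> I" "j \<ge> 1" using that by (auto simp: T_def I_iff)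
  qed
  have dT: "w k \<in> coord_dom E k" if "w \<in> Uu l" "k \<in> T" for w k
    using coords_okD[of E l "Y w" k] Y_free[of k w] T[OF that(2)] that by (auto simp: Uu_def I_iff)
  define r where "r = (\<lambda>w. \<Sum>k\<in>T. W k (w k))"
  have WYl: "WY l w = WY L w + r w" for w
  proof -
    have set: "{1..l} = {1..L} \<union> T" using l_ge by (auto simp: T_def)
    have "WY l w = WY L w + (\<Sum>k\<in>T. W k (Y w k))"
      unfolding WY_def set by (rule sum.union_disjoint) (auto simp: T_def)
    also have "(\<Sum>k\<in>T. W k (Y w k)) = r w"
      unfolding r_def using Y_free T by (intro sum.cong refl) (auto simp: I_iff)
    finally show ?thesis .
  qed
  obtain g1 h1 where s1: "smooth2_on I (Uu l) (WY L) g1 h1"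
    using smooth2_WY[of I L l] l_ge by (auto simp: smooth2_def)
  have coordT: "continuous_on (Uu l) (\<lambda>w. \<psi> k (w k))" if "k \<in> T" "continuous_on (coord_dom E k) (\<psi> k)" for \<psi> :: "nat \<Rightarrow> real \<Rightarrow> real" and k
    by (rule continuous_on_compose2[OF that(2) continuous_on_coord]) (use dT that(1) in auto)
  have cf: "continuous_on (coord_dom E k) (f' k)" if "k \<ge> 1" for k
    using f(2)[OF that] by (meson DERIV_isCont continuous_at_imp_continuous_on)
  have hg: "has_grad I (\<lambda>w. \<psi> (w k)) (\<lambda>j. if j = k then d else 0) w" if "(\<psi> has_real_derivative d) (at (w k))" for \<psi> :: "real \<Rightarrow> real" and d w k
    using has_grad_comp[OF has_grad_coord[of I k w], of \<psi> d] that by (simp add: if_distrib[of "\<lambda>a. d * a"] cong: if_cong)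
  have hgsum: "has_grad I (\<lambda>w. \<Sum>k\<in>A. f k w) (\<lambda>j. \<Sum>k\<in>A. g k j) w"
    if "finite A" "\<And>k. k \<in> A \<Longrightarrow> has_grad I (f k) (g k) w" for A :: "nat set" and f g w
    using that by (induction A rule: finite_induct) (auto intro: has_grad_add has_grad_const)
  have s2: "smooth2_on I (Uu l) r (\<lambda>i w. if i \<in> T then f' i (w i) else 0) (\<lambda>i j w. if i = j \<and> i \<in> T then f'' i (w i) else 0)"
    unfolding smooth2_on_def
  proof (intro conjI ballI)
    show "continuous_on (Uu l) r" unfolding r_def
      using continuous_on_W T by (intro continuous_on_sum coordT) auto
    show "continuous_on (Uu l) (\<lambda>w. if i \<in> T then f' i (w i) else 0)" for i
      using cf T coordT[of i f'] by (cases "i \<in> T") auto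
    show "continuous_on (Uu l) (\<lambda>w. if i = j \<and> i \<in> T then f'' i (w i) else 0)" for i j
      using fc[of i] T[of i] coordT[of i f''] by (cases "i = j"; cases "i \<in> T") auto
    fix w assume w: "w \<in> Uu l"
    have "has_grad I r (\<lambda>j. \<Sum>k\<in>T. if j = k then f' k (w k) else 0) w"
      unfolding r_def using f(1) T dT[OF w] by (intro hgsum hg) (auto simp: T_def)
    also have "(\<lambda>j. \<Sum>k\<in>T. if j = k then f' k (w k) else 0) = (\<lambda>j. if j \<in> T then f' j (w j) else 0)"
      by (auto simp: T_def fun_eq_iff)
    finally show "has_grad I r (\<lambda>i. if i \<in> T then f' i (w i) else 0) w" .
    show "has_grad I (\<lambda>w. if i \<in> T then f' i (w i) else 0) (\<lambda>j. if i = j \<and> i \<in> T then f'' i (w i) else 0) w" for i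
    proof (cases "i \<in> T")
      case True
      have "has_grad I (\<lambda>w. f' i (w i)) (\<lambda>j. if j = i then f'' i (w i) else 0) w"
        using f(2) T True dT[OF w True] by (intro hg) auto
      also have "(\<lambda>j. if j = i then f'' i (w i) else 0) = (\<lambda>j. if i = j \<and> i \<in> T then f'' i (w i) else 0)"
        using True by auto
      finally show ?thesis using True by simp
    qed (simp add: has_grad_const)
  qed auto
  have s: "smooth2_on I (Uu l) (WY l) (\<lambda>i w. g1 i w + (if i \<in> T then f' i (w i) else 0))
      (\<lambda>i j w. h1 i j w + (if i = j \<and> i \<in> T then f'' i (w i) else 0))"
    unfolding WYl[abs_def] using s1 s2 unfolding smooth2_on_def
    by (auto intro!: continuous_on_add has_grad_add)
  have eq: "hs l (ext u) i j = h1 i j (ext u) + (if i = j \<and> i \<in> T then f'' i (ext u i) else 0)"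
    unfolding hs_def using smooth2_witness(2)[OF s open_Uu _ extU assms(2,3)] by simp
  have h1: "h1 i j (ext u) = partial_deriv j (partial_deriv i (WY L)) (ext u)"
    using smooth2_witness(2)[OF s1 open_Uu _ extU assms(2,3)] by simp
  have zero: "partial_deriv k (WY L) w = 0" if "k \<in> T" for k w
  proof -
    have "(\<lambda>t. WY L (w(k := t))) = (\<lambda>t. WY L w)" using that by (intro ext WY_cong) (auto simp: T_def)
    thus ?thesis by (simp add: partial_deriv_def)
  qed
  have h1zero: "h1 i j (ext u) = 0" if "i \<in> T \<or> j \<in> T"
  proof (cases "i \<in> T")
    case True
    have "partial_deriv i (WY L) = (\<lambda>_. 0)" using zero[OF True] by auto
    thus ?thesis unfolding h1 by (simp add: partial_deriv_def)
  next
    case False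
    hence "j \<in> T" using that by simp
    hence "partial_deriv j (WY L) = (\<lambda>_. 0)" using zero by auto
    hence "partial_deriv i (partial_deriv j (WY L)) (ext u) = 0" by (simp add: partial_deriv_def)
    moreover have "h1 i j (ext u) = h1 j i (ext u)" using s1 extU assms(2,3) by (auto simp: smooth2_on_def)
    ultimately show ?thesis using smooth2_witness(2)[OF s1 open_Uu _ extU assms(3,2)] by simp
  qed
  show ?thesis
  proof (cases "i \<le> L \<and> j \<le> L")
    case True
    have upd: "WY L (((ext u)(j := t))(i := s)) = WY L ((u(j := t))(i := s))" for s t
      by (rule WY_cong) (use l_ge in "auto simp: ext_def I_iff")
    have e: "ext u j = u j" using True assms(3) by (simp add: ext_def)
    have e': "((ext u)(j := t)) i = (u(j := t)) i" for t using True assms(2) by (simp add: ext_def)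
    have "h1 i j (ext u) = hs L u i j"
      unfolding h1 hs_def partial_deriv_def[of j] partial_deriv_def[of i] upd e e' ..
    thus ?thesis using eq True by (auto simp: T_def)
  next
    case False
    hence "i \<in> T \<or> j \<in> T" using assms(2,3) by (auto simp: T_def I_iff)
    hence "hs l (ext u) i j = (if i = j \<and> i \<in> T then f'' i (ext u i) else 0)" using eq h1zero by simp
    moreover have "f'' i (ext u i) = deriv (deriv (W i)) (ystar i)" if "i \<in> T"
    proof -
      have "ext u i = ystar i" using that T[OF that] by (auto simp: ext_def T_def)
      moreover have "deriv (deriv (W i)) (ystar i) = f'' i (ystar i)"
        by (rule deriv_deriv_C2[OF open_coord_dom[of E i] f(1) f(2)]) (use T(2)[OF that] ystar(1)[of i] that in "auto simp: T_def")
      ultimately show ?thesis by simp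
    qed
    moreover have "i = j \<Longrightarrow> i \<in> T" using False assms(2) by (auto simp: T_def I_iff)
    ultimately show ?thesis using False by auto
  qed
qed

text \<open>The block up to \<open>L\<close> is definite already. For the diagonal entries beyond
  \<open>L\<close>, semidefiniteness of the whole Hessian gives the sign and genericity excludes
  zero.\<close>

lemma hs_posdef_l:
  assumes u: "u \<in> FM" and v: "i \<in> I" "v i \<noteq> 0"
  shows "(\<Sum>i\<in>I. \<Sum>j\<in>I. hs l (ext u) i j * v i * v j) > 0"
proof -
  let ?J = "free L"
  define T where "T = {L<..l}"
  define s where "s = (\<lambda>i. deriv (deriv (W i)) (ystar i))"
  have TI: "T \<subseteq> I"
  proof
    fix k assume k: "k \<in> T"
    have "k \<notin> dom C" using dom_range[of k] k by (auto simp: T_def)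
    thus "k \<in> I" using k by (auto simp: T_def I_iff)
  qed
  have I: "I = ?J \<union> T" "?J \<inter> T = {}" using TI l_ge by (auto simp: free_indices_def T_def)
  have JI: "?J \<subseteq> I" using I by blast
  have block: "hs l (ext u) i j = (if i \<le> L \<and> j \<le> L then hs L u i j else if i = j then s i else 0)" if "i \<in> I" "j \<in> I" for i j
    unfolding s_def by (rule hs_block[OF u that])
  have split: "(\<Sum>i\<in>I. \<Sum>j\<in>I. hs l (ext u) i j * w i * w j)
      = (\<Sum>i\<in>?J. \<Sum>j\<in>?J. hs L u i j * w i * w j) + (\<Sum>i\<in>T. s i * (w i)\<^sup>2)" for w
  proof -
    have finT: "finite T" by (simp add: T_def)
    have JL: "i \<le> L" if "i \<in> ?J" for i using that by (simp add: free_indices_def)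
    have 1: "(\<Sum>j\<in>I. hs l (ext u) i j * w i * w j) = (\<Sum>j\<in>?J. hs L u i j * w i * w j)" if i: "i \<in> ?J" for i
    proof -
      have "(\<Sum>j\<in>I. hs l (ext u) i j * w i * w j) = (\<Sum>j\<in>?J. hs l (ext u) i j * w i * w j) + (\<Sum>j\<in>T. hs l (ext u) i j * w i * w j)"
        unfolding I(1) using finT I(2) by (intro sum.union_disjoint) auto
      also have "(\<Sum>j\<in>T. hs l (ext u) i j * w i * w j) = 0"
      proof (intro sum.neutral ballI)
        fix j assume j: "j \<in> T"
        have "\<not> j \<le> L" "i \<noteq> j" using j JL[OF i] by (auto simp: T_def)
        thus "hs l (ext u) i j * w i * w j = 0" using block[of i j] i j JI TI by auto
      qed
      also have "(\<Sum>j\<in>?J. hs l (ext u) i j * w i * w j) = (\<Sum>j\<in>?J. hs L u i j * w i * w j)"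
        using block i JL JI by (intro sum.cong refl) (auto simp: subset_iff)
      finally show ?thesis by simp
    qed
    have 2: "(\<Sum>j\<in>I. hs l (ext u) i j * w i * w j) = s i * (w i)\<^sup>2" if i: "i \<in> T" for i
    proof -
      have iI: "i \<in> I" and iL: "\<not> i \<le> L" using i TI by (auto simp: T_def)
      have "(\<Sum>j\<in>I. hs l (ext u) i j * w i * w j) = (\<Sum>j\<in>I. if j = i then s i * (w i)\<^sup>2 else 0)"
        using block[OF iI] iL by (intro sum.cong refl) (auto simp: power2_eq_square)
      thus ?thesis using iI by simp
    qed
    have "(\<Sum>i\<in>I. \<Sum>j\<in>I. hs l (ext u) i j * w i * w j)
        = (\<Sum>i\<in>?J. \<Sum>j\<in>I. hs l (ext u) i j * w i * w j) + (\<Sum>i\<in>T. \<Sum>j\<in>I. hs l (ext u) i j * w i * w j)"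
      using sum.union_disjoint[of ?J T "\<lambda>i. \<Sum>j\<in>I. hs l (ext u) i j * w i * w j"] finT I by simp
    thus ?thesis using 1 2 by simp
  qed
  have spos: "s k > 0" if k: "k \<in> T" for k
  proof -
    \<comment> \<open>Testing the semidefinite form with a unit vector isolates one diagonal
      entry.\<close>
    define w where "w = (\<lambda>j. if j = k then 1 else 0 :: real)"
    have "(\<Sum>i\<in>?J. \<Sum>j\<in>?J. hs L u i j * w i * w j) = 0"
      using k by (intro sum.neutral ballI) (auto simp: w_def T_def free_indices_def)
    moreover have "(\<Sum>i\<in>T. s i * (w i)\<^sup>2) = s k"
    proof -
      have "(\<Sum>i\<in>T. s i * (w i)\<^sup>2) = (\<Sum>i\<in>T. if i = k then s k else 0)" by (intro sum.cong) (auto simp: w_def)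
      thus ?thesis using k by (simp add: T_def)
    qed
    ultimately have "s k \<ge> 0" using hs_psd_level(2)[OF u, of w] split[of w] by simp
    moreover have "s k \<noteq> 0" unfolding s_def using ystar(4)[of k] k by (simp add: T_def)
    ultimately show ?thesis by simp
  qed
  have B: "(\<Sum>i\<in>T. s i * (v i)\<^sup>2) \<ge> 0" using spos by (intro sum_nonneg) (simp add: less_imp_le)
  show ?thesis
  proof (cases "i \<in> T")
    case True
    have "0 < s i * (v i)\<^sup>2" using spos[OF True] v(2) by simp
    also have "... \<le> (\<Sum>i\<in>T. s i * (v i)\<^sup>2)"
      using True spos by (intro member_le_sum) (auto simp: T_def less_imp_le)
    finally show ?thesis unfolding split using hs_psd_level(1)[OF u, of v] by linarith
  next
    case False
    hence "i \<in> ?J" using v(1) I by blast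
    thus ?thesis unfolding split using hs_posdef_L[of u i v] u v(2) B by linarith
  qed
qed

section \<open>The Jacobian of the coordinates and the normalizing matrix\<close>

definition JJ :: "rvec \<Rightarrow> nat \<Rightarrow> nat \<Rightarrow> real" where
  "JJ q i j = partial_deriv j (\<lambda>x. yc x i) q"

lemma JJ_upper: "i < j \<Longrightarrow> i \<in> I \<Longrightarrow> JJ q i j = 0"
proof -
  assume ij: "i < j" "i \<in> I"
  have "(\<lambda>t. yc (q(j := t)) i) = (\<lambda>t. yc q i)"
    using ij by (intro ext ycoord_cong) (auto simp: I_iff)
  thus "JJ q i j = 0" by (simp add: JJ_def partial_deriv_def)
qed

text \<open>A free moment is affine in its own coordinate, so the diagonal entry is the reciprocal
  of the slope; with \<open>JJ_upper\<close> the Jacobian is triangular and invertible.\<close>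

lemma JJ_diag:
  assumes "q \<in> Ux" "i \<in> I"
  shows "JJ q i i \<noteq> 0"
proof -
  have i: "1 \<le> i" "i \<le> l" "i \<notin> dom C" using assms(2) by (auto simp: I_iff)
  define \<sigma> where "\<sigma> = slope E (yc q) i"
  define b where "b = mom E ((yc q)(i := 0)) i"
  have \<sigma>: "\<sigma> > 0" unfolding \<sigma>_def using assms(1) i by (intro slope_pos[of E l]) (auto simp: Ux_def)
  have same: "yc (q(i := t)) j = yc q j" if "1 \<le> j" "j < i" for j t
    by (rule ycoord_cong) (use that in auto)
  have "yc (q(i := t)) i = (t - b) / \<sigma>" for t
  proof -
    have "mom E ((yc (q(i := t)))(i := 0)) i = b"
      unfolding b_def by (rule mom_cong) (use same in auto)
    moreover have "slope E (yc (q(i := t))) i = \<sigma>"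
      unfolding \<sigma>_def by (rule slope_cong) (use same in auto)
    moreover have "fillc C (q(i := t)) i = t" using i(3) by (auto simp: fillc_def domIff)
    ultimately show ?thesis using sol_eq[of i E UNIV "fillc C (q(i := t))"] i by (simp add: ycoord_def)
  qed
  moreover have "deriv (\<lambda>t. (t - b) / \<sigma>) (q i) = 1 / \<sigma>"
    using \<sigma> by (intro DERIV_imp_deriv) (auto intro!: derivative_eq_intros)
  ultimately have "JJ q i i = 1 / \<sigma>" by (simp add: JJ_def partial_deriv_def)
  thus ?thesis using \<sigma> by simp
qed

lemma JJ_injective:
  assumes "q \<in> Ux" "\<And>i. i \<in> I \<Longrightarrow> (\<Sum>j\<in>I. JJ q i j * v j) = 0" "i \<in> I"
  shows "v i = 0"
  using assms(3)
proof (induction i rule: less_induct)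
  case (less i)
  have "(\<Sum>j\<in>I. JJ q i j * v j) = (\<Sum>j\<in>I. if j = i then JJ q i i * v i else 0)"
  proof (intro sum.cong refl)
    fix j assume j: "j \<in> I"
    show "JJ q i j * v j = (if j = i then JJ q i i * v i else 0)"
      using less.IH[OF _ j] JJ_upper[OF _ less.prems, of j q] by (cases i j rule: linorder_cases) auto
  qed
  hence "JJ q i i * v i = 0" using assms(2)[OF less.prems] less.prems by simp
  thus ?case using JJ_diag[OF assms(1) less.prems] by simp
qed

definition Sg :: "rvec \<Rightarrow> nat \<Rightarrow> nat \<Rightarrow> real" where
  "Sg q i j = Sigma_mat E C V l (fill l q) $$ (i - 1, j - 1)"

text \<open>\<open>canon_coord\<close> is under control on filled vectors with admissible
  coordinates. As \<open>Ux\<close> is open, it coincides with the smooth \<open>yc\<close> for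
  small changes of a free moment, which is enough for the derivative.\<close>

lemma dy_dm_eq:
  assumes "q \<in> Ux" "i \<in> I" "j \<in> I"
  shows "partial_deriv i (\<lambda>m. canon_coord E m j) (fill l q) = JJ q j i"
proof -
  have si: "fill l q i = q i" using assms(2) by (auto simp: fill_constraint_def I_iff domIff)
  have upd: "(fill l q)(i := t) = fill l (q(i := t))" for t
    using assms(2) by (auto simp: fill_constraint_def I_iff domIff fun_eq_iff split: option.splits)
  have "\<forall>\<^sub>F t in nhds (q i). q(i := t) \<in> Ux" by (rule eventually_update[OF open_Ux assms(1)])
  hence "\<forall>\<^sub>F t in nhds (q i). canon_coord E ((fill l q)(i := t)) j = yc (q(i := t)) j"
  proof eventually_elim
    case (elim t)
    thus ?case unfolding upd using canon_coord_fill[of l "q(i := t)" j] assms(3) by (simp add: Ux_def I_iff)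
  qed
  thus ?thesis unfolding JJ_def partial_deriv_def si by (rule deriv_cong_ev) simp
qed

abbreviation d :: nat where "d \<equiv> card I"

abbreviation xs :: "nat list" where "xs \<equiv> free_list C l"

definition Rm :: "rvec \<Rightarrow> real mat" where
  "Rm u = posdef_sqrt (hessian_constr C l (W_sum E C V l) (ext u))"

lemma ext_in_Uu: "u \<in> FM \<Longrightarrow> ext u \<in> Uu l"
  using Y_ext(3)[of u] F_minimizers_iff by (auto simp: Uu_def)

text \<open>The last claim holds because the root is symmetric: the squared length of its image is
  the form of its square, which is the Hessian.\<close>

lemma Rm_spec:
  assumes u: "u \<in> FM"
  shows "Rm u \<in> carrier_mat d d" "\<And>a b. a < d \<Longrightarrow> b < d \<Longrightarrow> Rm u $$ (a, b) = Rm u $$ (b, a)"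
    "posdef_fun d (\<lambda>a b. Rm u $$ (a, b))"
    "\<And>w. ipn d (mvn d (\<lambda>a b. Rm u $$ (a, b)) (\<lambda>a. w (xs ! a))) (mvn d (\<lambda>a b. Rm u $$ (a, b)) (\<lambda>a. w (xs ! a)))
      = (\<Sum>i\<in>I. \<Sum>j\<in>I. hs l (ext u) i j * w i * w j)"
proof -
  let ?A = "hessian_constr C l (W_sum E C V l) (ext u)"
  have extU: "ext u \<in> Uu l" by (rule ext_in_Uu[OF u])
  have A: "?A $$ (a, b) = hs l (ext u) (xs ! b) (xs ! a)" if "a < d" "b < d" for a b
    by (rule hessian_constr_eq[OF l_ge ext_PiE extU that])
  have car: "?A \<in> carrier_mat d d" by (simp add: hessian_constr_def)
  have sym: "?A $$ (a, b) = ?A $$ (b, a)" if "a < d" "b < d" for a b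
    using A[OF that] A[OF that(2,1)] hs_symmetric[OF extU free_list_in[OF that(1)] free_list_in[OF that(2)]] by simp
  have pd: "posdef_fun d (\<lambda>a b. ?A $$ (a, b))"
    unfolding posdef_fun_def
  proof (intro allI impI)
    fix w :: rvec assume "\<exists>a<d. w a \<noteq> 0"
    then obtain a where a: "a < d" "w a \<noteq> 0" by blast
    define w' where "w' = (\<lambda>i. w (card (free (i - 1))))"
    have w': "w' (xs ! a) = w a" if "a < d" for a
      using card_free_below[OF that] by (simp add: w'_def)
    have "ipn d w (mvn d (\<lambda>i j. ?A $$ (i, j)) w)
        = ipn d (\<lambda>a. w' (xs ! a)) (mvn d (\<lambda>i j. ?A $$ (i, j)) (\<lambda>a. w' (xs ! a)))"
      using w' by (intro ipn_cong) (auto simp: mvn_def)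
    also have "... = (\<Sum>i\<in>I. \<Sum>j\<in>I. hs l (ext u) i j * w' i * w' j)"
      by (rule quadratic_form_reindex[OF A])
    also have "... > 0"
      by (rule hs_posdef_l[OF u free_list_in[OF a(1)]]) (use a w' in auto)
    finally show "ipn d w (mvn d (\<lambda>i j. ?A $$ (i, j)) w) > 0" .
  qed
  have sym': "\<And>a b. a < d \<Longrightarrow> b < d \<Longrightarrow> ?A $$ (a, b) = ?A $$ (b, a)" by (rule sym)
  note R = posdef_sqrt_spec[OF car sym' pd, folded Rm_def]
  show "Rm u \<in> carrier_mat d d" by (rule R(1))
  show Rsym: "Rm u $$ (a, b) = Rm u $$ (b, a)" if "a < d" "b < d" for a b by (rule R(2)) (use that in auto)
  show "posdef_fun d (\<lambda>a b. Rm u $$ (a, b))" by (rule R(3))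
  have R4: "(\<Sum>m<d. Rm u $$ (a, m) * Rm u $$ (m, b)) = ?A $$ (a, b)" if "a < d" "b < d" for a b
    by (rule R(4)) (use that in auto)
  fix w :: rvec
  let ?R = "\<lambda>a b. Rm u $$ (a, b)" and ?w = "\<lambda>a. w (xs ! a)"
  have "ipn d (mvn d ?R ?w) (mvn d ?R ?w) = ipn d ?w (mvn d ?R (mvn d ?R ?w))"
    by (rule ipn_mvn_symmetric[symmetric]) (rule Rsym)
  also have "... = ipn d ?w (mvn d (\<lambda>a b. ?A $$ (a, b)) ?w)"
  proof (rule ipn_cong)
    fix a assume a: "a < d"
    have "mvn d ?R (mvn d ?R ?w) a = (\<Sum>b<d. (\<Sum>m<d. ?R a m * ?R m b) * ?w b)"
      unfolding mvn_def sum_distrib_left sum_distrib_right by (subst sum.swap) (simp add: mult_ac)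
    thus "mvn d ?R (mvn d ?R ?w) a = mvn d (\<lambda>a b. ?A $$ (a, b)) ?w a"
      using R4[OF a] by (simp add: mvn_def)
  qed simp
  also have "... = (\<Sum>i\<in>I. \<Sum>j\<in>I. hs l (ext u) i j * w i * w j)" by (rule quadratic_form_reindex[OF A])
  finally show "ipn d (mvn d ?R ?w) (mvn d ?R ?w) = (\<Sum>i\<in>I. \<Sum>j\<in>I. hs l (ext u) i j * w i * w j)" .
qed

lemma free_coords_xpt:
  assumes "u \<in> FM"
  shows "free_coords E C l (fill l (xpt u)) = ext u"
proof
  have ok: "coords_ok E L (Y u)" using assms F_minimizers_iff by blast
  fix j show "free_coords E C l (fill l (xpt u)) j = ext u j"
  proof (cases "j \<in> I")
    case True
    hence j: "1 \<le> j" "j \<le> l" "j \<notin> dom C" by (auto simp: I_iff)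
    have "canon_coord E (fill l (xpt u)) j = yc (xpt u) j"
      using xpt_in_Ux[OF ok] j by (intro canon_coord_fill) (auto simp: Ux_def)
    thus ?thesis using True ycoord_xpt[OF ok j(1,2)] Y_free[OF j(1,3)] by (simp add: free_coords_def)
  qed (auto simp: free_coords_def ext_def)
qed

text \<open>On free indices the normalizing matrix is root times Jacobian: \<open>dy_dm\<close> is
  the transposed Jacobian and \<open>Sigma_mat\<close> transposes it back.\<close>

lemma Sg_eq:
  assumes u: "u \<in> FM" and "a < d" "b < d"
  shows "Sg (xpt u) (xs ! a) (xs ! b) = (\<Sum>c<d. Rm u $$ (a, c) * JJ (xpt u) (xs ! c) (xs ! b))"
proof -
  have qU: "xpt u \<in> Ux" using xpt_in_Ux u F_minimizers_iff by blast
  let ?s = "fill l (xpt u)"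
  let ?K = "dy_dm E C l ?s"
  have K: "?K \<in> carrier_mat d d" by (simp add: dy_dm_def)
  have ab: "xs ! a \<in> I" "xs ! b \<in> I" using assms(2,3) free_list_in by blast+
  hence nd: "xs ! a \<notin> dom C" "xs ! b \<notin> dom C" "1 \<le> xs ! a" "xs ! a \<le> l" "1 \<le> xs ! b" "xs ! b \<le> l" by (auto simp: I_iff)
  have "Sg (xpt u) (xs ! a) (xs ! b) = (Rm u * transpose_mat ?K) $$ (a, b)"
    using nd card_free_below[OF assms(2)] card_free_below[OF assms(3)] free_coords_xpt[OF u]
    by (simp add: Sg_def Sigma_mat_def insert_zeros_def Rm_def)
  also have "... = (\<Sum>c<d. Rm u $$ (a, c) * transpose_mat ?K $$ (c, b))"
    using K by (intro mult_mat_index[OF Rm_spec(1)[OF u] _ assms(2,3)]) simp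
  also have "... = (\<Sum>c<d. Rm u $$ (a, c) * JJ (xpt u) (xs ! c) (xs ! b))"
  proof (intro sum.cong refl)
    fix c assume c: "c \<in> {..<d}"
    have "transpose_mat ?K $$ (c, b) = partial_deriv (xs ! b) (\<lambda>m. canon_coord E m (xs ! c)) ?s"
      using c assms(3) by (simp add: dy_dm_def)
    thus "Rm u $$ (a, c) * transpose_mat ?K $$ (c, b) = Rm u $$ (a, c) * JJ (xpt u) (xs ! c) (xs ! b)"
      using dy_dm_eq[OF qU ab(2) free_list_in] c by simp
  qed
  finally show ?thesis .
qed

lemma Sg_sum:
  assumes u: "u \<in> FM" and "a < d"
  shows "(\<Sum>j\<in>I. Sg (xpt u) (xs ! a) j * v j)
    = mvn d (\<lambda>a b. Rm u $$ (a, b)) (\<lambda>c. \<Sum>j\<in>I. JJ (xpt u) (xs ! c) j * v j) a"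
proof -
  have "(\<Sum>j\<in>I. Sg (xpt u) (xs ! a) j * v j) = (\<Sum>b<d. \<Sum>c<d. Rm u $$ (a, c) * (JJ (xpt u) (xs ! c) (xs ! b) * v (xs ! b)))"
    unfolding sum_free_indices using Sg_eq[OF u assms(2)] by (intro sum.cong refl) (simp add: sum_distrib_right mult.assoc)
  also have "... = (\<Sum>c<d. \<Sum>b<d. Rm u $$ (a, c) * (JJ (xpt u) (xs ! c) (xs ! b) * v (xs ! b)))" by (rule sum.swap)
  also have "... = mvn d (\<lambda>a b. Rm u $$ (a, b)) (\<lambda>c. \<Sum>j\<in>I. JJ (xpt u) (xs ! c) j * v j) a"
    unfolding mvn_def sum_free_indices sum_distrib_left ..
  finally show ?thesis .
qed

definition QQ :: "rvec \<Rightarrow> rvec \<Rightarrow> real" where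
  "QQ q v = (\<Sum>i\<in>I. (\<Sum>j\<in>I. Sg q i j * v j)\<^sup>2)"

text \<open>The squared length of the normalized deviation is the Hessian form in coordinates
  evaluated at the linearized coordinate increment \<open>w v\<close>.\<close>

lemma QQ_eq:
  assumes u: "u \<in> FM"
  defines "w \<equiv> \<lambda>v i. \<Sum>j\<in>I. JJ (xpt u) i j * v j"
  shows "QQ (xpt u) v = (\<Sum>i\<in>I. \<Sum>j\<in>I. hs l (ext u) i j * w v i * w v j)"
proof -
  have "QQ (xpt u) v = (\<Sum>a<d. (\<Sum>j\<in>I. Sg (xpt u) (xs ! a) j * v j)\<^sup>2)"
    unfolding QQ_def by (subst sum_free_indices) (rule refl)
  also have "... = ipn d (mvn d (\<lambda>a b. Rm u $$ (a, b)) (\<lambda>c. w v (xs ! c))) (mvn d (\<lambda>a b. Rm u $$ (a, b)) (\<lambda>c. w v (xs ! c)))"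
    unfolding ipn_def w_def using Sg_sum[OF u] by (intro sum.cong refl) (simp add: power2_eq_square)
  also have "... = (\<Sum>i\<in>I. \<Sum>j\<in>I. hs l (ext u) i j * w v i * w v j)" by (rule Rm_spec(4)[OF u])
  finally show ?thesis .
qed

text \<open>A composition of two injective maps: the root is definite and the Jacobian is triangular
  with nonzero diagonal.\<close>

lemma Sg_injective:
  assumes u: "u \<in> FM" and "\<And>a. a < d \<Longrightarrow> mvn d (\<lambda>a b. Sg (xpt u) (xs ! a) (xs ! b)) v a = 0" "a < d"
  shows "v a = 0"
proof -
  have qU: "xpt u \<in> Ux" using xpt_in_Ux u F_minimizers_iff by blast
  define v' where "v' = (\<lambda>i. v (card (free (i - 1))))"
  have v': "v' (xs ! a) = v a" if "a < d" for a using card_free_below[OF that] by (simp add: v'_def)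
  define w where "w = (\<lambda>c. \<Sum>j\<in>I. JJ (xpt u) (xs ! c) j * v' j)"
  have "mvn d (\<lambda>a b. Rm u $$ (a, b)) w b = 0" if "b < d" for b
  proof -
    have "mvn d (\<lambda>a b. Rm u $$ (a, b)) w b = (\<Sum>j\<in>I. Sg (xpt u) (xs ! b) j * v' j)"
      unfolding w_def by (rule Sg_sum[OF u that, symmetric])
    also have "... = mvn d (\<lambda>a b. Sg (xpt u) (xs ! a) (xs ! b)) v b"
      unfolding sum_free_indices mvn_def using v' by (intro sum.cong) auto
    finally show ?thesis using assms(2)[OF that] by simp
  qed
  hence "ipn d w (mvn d (\<lambda>a b. Rm u $$ (a, b)) w) = 0" by (simp add: ipn_def)
  hence w0: "w c = 0" if "c < d" for c
    using Rm_spec(3)[OF u] that unfolding posdef_fun_def by fastforce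
  have "(\<Sum>j\<in>I. JJ (xpt u) i j * v' j) = 0" if "i \<in> I" for i
  proof -
    obtain c where "c < d" "xs ! c = i"
      using free_list_index[OF \<open>i \<in> I\<close>] by blast
    thus ?thesis using w0[of c] by (auto simp: w_def)
  qed
  hence "v' (xs ! a) = 0" using JJ_injective[OF qU _ free_list_in[OF assms(3)], of v'] by blast
  thus ?thesis using v' assms(3) by simp
qed

lemma QQ_coercive_one:
  assumes "q \<in> X"
  shows "\<exists>c>0. \<forall>v. c * (\<Sum>i\<in>I. (v i)\<^sup>2) \<le> QQ q v"
proof -
  obtain u where u: "u \<in> FM" "q = xpt u" using assms by (auto simp: X_def)
  let ?s = "\<lambda>a b. Sg q (xs ! a) (xs ! b)"
  have "\<exists>c>0. \<forall>v. c * ipn d v v \<le> ipn d (mvn d ?s v) (mvn d ?s v)"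
    by (rule injective_imp_coercive) (use Sg_injective[OF u(1)] u(2) in blast)
  then obtain c where c: "c > 0" "\<And>v. c * ipn d v v \<le> ipn d (mvn d ?s v) (mvn d ?s v)" by blast
  have "c * (\<Sum>i\<in>I. (v i)\<^sup>2) \<le> QQ q v" for v
    using c(2)[of "\<lambda>a. v (xs ! a)"] unfolding QQ_def sum_free_indices ipn_def mvn_def
    by (simp add: power2_eq_square)
  thus ?thesis using c(1) by blast
qed

lemma QQ_coercive: "\<exists>c>0. \<forall>q\<in>X. \<forall>v. c * (\<Sum>i\<in>I. (v i)\<^sup>2) \<le> QQ q v"
proof -
  have "\<forall>q\<in>X. \<exists>c. c > 0 \<and> (\<forall>v. c * (\<Sum>i\<in>I. (v i)\<^sup>2) \<le> QQ q v)" using QQ_coercive_one by blast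
  from bchoice[OF this] obtain c where c: "\<forall>q\<in>X. c q > 0 \<and> (\<forall>v. c q * (\<Sum>i\<in>I. (v i)\<^sup>2) \<le> QQ q v)" ..
  define c0 where "c0 = Min (insert 1 (c ` X))"
  have "c0 > 0" unfolding c0_def using finite_X c by auto
  moreover have "c0 * (\<Sum>i\<in>I. (v i)\<^sup>2) \<le> QQ q v" if "q \<in> X" for q v
  proof -
    have "c0 \<le> c q" unfolding c0_def using finite_X that by (intro Min_le) auto
    hence "c0 * (\<Sum>i\<in>I. (v i)\<^sup>2) \<le> c q * (\<Sum>i\<in>I. (v i)\<^sup>2)" by (intro mult_right_mono sum_nonneg) auto
    also have "... \<le> QQ q v" using c that by blast
    finally show ?thesis .
  qed
  ultimately show ?thesis by blast
qed

lemma Sg_surjective: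
  assumes "q \<in> X"
  shows "\<exists>\<zeta>. \<forall>i\<in>I. (\<Sum>j\<in>I. Sg q i j * \<zeta> j) = z i"
proof -
  obtain u where u: "u \<in> FM" "q = xpt u" using assms by (auto simp: X_def)
  let ?s = "\<lambda>a b. Sg q (xs ! a) (xs ! b)"
  have "\<exists>b. (\<forall>v. \<forall>i<d. mvn d b (mvn d ?s v) i = v i) \<and> (\<forall>v. \<forall>i<d. mvn d ?s (mvn d b v) i = v i)"
    by (rule injective_imp_inverse) (use Sg_injective[OF u(1)] u(2) in blast)
  then obtain b where b: "\<And>v i. i < d \<Longrightarrow> mvn d ?s (mvn d b v) i = v i" by blast
  define y where "y = mvn d b (\<lambda>a. z (xs ! a))"
  define \<zeta> where "\<zeta> = (\<lambda>i. y (card (free (i - 1))))"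
  have \<zeta>: "\<zeta> (xs ! a) = y a" if "a < d" for a using card_free_below[OF that] by (simp add: \<zeta>_def)
  have "(\<Sum>j\<in>I. Sg q i j * \<zeta> j) = z i" if "i \<in> I" for i
  proof -
    obtain c where c: "c < d" "xs ! c = i"
      using free_list_index[OF \<open>i \<in> I\<close>] by blast
    have "(\<Sum>j\<in>I. Sg q i j * \<zeta> j) = mvn d ?s y c"
      unfolding sum_free_indices mvn_def using \<zeta> c by (intro sum.cong) auto
    thus ?thesis using b[OF c(1), of "\<lambda>a. z (xs ! a)"] c(2) by (simp add: y_def)
  qed
  thus ?thesis by blast
qed

end

section \<open>Transfer of the expansion to moment coordinates\<close>

lemma common_radius:
  assumes "finite I" "\<And>i. i \<in> I \<Longrightarrow> \<exists>\<rho>>0. P i \<rho>" "\<And>i \<rho> \<rho>'. P i \<rho> \<Longrightarrow> 0 < \<rho>' \<Longrightarrow> \<rho>' \<le> \<rho> \<Longrightarrow> P i \<rho>'"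
  shows "\<exists>\<rho>>0::real. \<forall>i\<in>I. P i \<rho>"
  using assms(1,2)
proof (induction I rule: finite_induct)
  case empty
  show ?case by (rule exI[of _ 1]) simp
next
  case (insert i I)
  then obtain \<rho>1 where 1: "\<rho>1 > 0" "\<forall>i\<in>I. P i \<rho>1" by blast
  obtain \<rho>2 where 2: "\<rho>2 > 0" "P i \<rho>2" using insert.prems by blast
  show ?case
  proof (intro exI[of _ "min \<rho>1 \<rho>2"] conjI ballI)
    fix j assume "j \<in> insert i I"
    thus "P j (min \<rho>1 \<rho>2)" using 1 2 assms(3)[of j \<rho>1 "min \<rho>1 \<rho>2"] assms(3)[of i \<rho>2 "min \<rho>1 \<rho>2"] by auto
  qed (use 1 2 in auto)
qed

lemma quadratic_form_diff_le:
  fixes H :: "nat \<Rightarrow> nat \<Rightarrow> real"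
  assumes "\<And>i. i \<in> I \<Longrightarrow> \<bar>\<delta> i - w i\<bar> \<le> a" "\<And>i. i \<in> I \<Longrightarrow> \<bar>\<delta> i\<bar> \<le> b" "\<And>i. i \<in> I \<Longrightarrow> \<bar>w i\<bar> \<le> b" "0 \<le> a" "0 \<le> b"
  shows "\<bar>(\<Sum>i\<in>I. \<Sum>j\<in>I. H i j * \<delta> i * \<delta> j) - (\<Sum>i\<in>I. \<Sum>j\<in>I. H i j * w i * w j)\<bar>
    \<le> (\<Sum>i\<in>I. \<Sum>j\<in>I. \<bar>H i j\<bar>) * (2 * a * b)"
proof -
  have "\<bar>H i j * \<delta> i * \<delta> j - H i j * w i * w j\<bar> \<le> \<bar>H i j\<bar> * (2 * a * b)" if "i \<in> I" "j \<in> I" for i j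
  proof -
    have "\<bar>\<delta> i * (\<delta> j - w j) + w j * (\<delta> i - w i)\<bar> \<le> \<bar>\<delta> i\<bar> * \<bar>\<delta> j - w j\<bar> + \<bar>w j\<bar> * \<bar>\<delta> i - w i\<bar>"
      by (simp add: abs_mult[symmetric] abs_triangle_ineq)
    also have "... \<le> b * a + b * a" using assms that by (intro add_mono mult_mono) auto
    finally have "\<bar>H i j\<bar> * \<bar>\<delta> i * (\<delta> j - w j) + w j * (\<delta> i - w i)\<bar> \<le> \<bar>H i j\<bar> * (2 * a * b)"
      by (intro mult_left_mono) auto
    moreover have "H i j * \<delta> i * \<delta> j - H i j * w i * w j = H i j * (\<delta> i * (\<delta> j - w j) + w j * (\<delta> i - w i))"
      by (simp add: algebra_simps)
    ultimately show ?thesis by (simp add: abs_mult)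
  qed
  hence "(\<Sum>i\<in>I. \<Sum>j\<in>I. \<bar>H i j * \<delta> i * \<delta> j - H i j * w i * w j\<bar>) \<le> (\<Sum>i\<in>I. \<Sum>j\<in>I. \<bar>H i j\<bar> * (2 * a * b))"
    by (intro sum_mono)
  moreover have "\<bar>\<Sum>i\<in>I. \<Sum>j\<in>I. H i j * \<delta> i * \<delta> j - H i j * w i * w j\<bar>
      \<le> (\<Sum>i\<in>I. \<Sum>j\<in>I. \<bar>H i j * \<delta> i * \<delta> j - H i j * w i * w j\<bar>)"
    by (rule order_trans[OF sum_abs]) (intro sum_mono sum_abs)
  ultimately show ?thesis by (simp add: sum_subtractf sum_distrib_right)
qed

context generic_setting
begin

lemma ycoord_first_order:
  assumes "q \<in> Ux" "e > 0"
  shows "\<exists>\<rho>>0. \<forall>i\<in>I. \<forall>v. (\<forall>i. i \<notin> I \<longrightarrow> v i = 0) \<and> (\<forall>i\<in>I. \<bar>v i\<bar> < \<rho>) \<longrightarrow>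
    \<bar>yc (\<lambda>i. q i + v i) i - yc q i - (\<Sum>j\<in>I. JJ q i j * v j)\<bar> \<le> e * (\<Sum>i\<in>I. \<bar>v i\<bar>)"
proof (rule common_radius)
  fix i assume "i \<in> I"
  hence i: "1 \<le> i" "i \<le> l" by (auto simp: I_iff)
  show "\<exists>\<rho>>0. \<forall>v. (\<forall>i. i \<notin> I \<longrightarrow> v i = 0) \<and> (\<forall>i\<in>I. \<bar>v i\<bar> < \<rho>) \<longrightarrow>
    \<bar>yc (\<lambda>i. q i + v i) i - yc q i - (\<Sum>j\<in>I. JJ q i j * v j)\<bar> \<le> e * (\<Sum>i\<in>I. \<bar>v i\<bar>)"
    using smooth2_first_order_partial[OF smooth2_ycoord[OF i] open_Ux _ assms] by (simp add: JJ_def)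
qed (simp, meson less_le_trans)

text \<open>The second-order expansion of \<open>WY l\<close> is composed with the first-order
  expansion of the coordinates. First order suffices since the gradient of \<open>WY l\<close>
  vanishes at \<open>ext u\<close>, so the curvature of the coordinate change enters only in the
  error.\<close>

lemma Gx_taylor:
  assumes u: "u \<in> FM" and "e > 0"
  shows "\<exists>\<rho>>0. \<forall>x\<in>PiE I (\<lambda>_. UNIV). (\<forall>i\<in>I. \<bar>x i - xpt u i\<bar> < \<rho>) \<longrightarrow> x \<in> Ux \<and>
    \<bar>Gx x - Gx (xpt u) - QQ (xpt u) (\<lambda>i. x i - xpt u i) / 2\<bar> \<le> e * (\<Sum>i\<in>I. (x i - xpt u i)\<^sup>2)"
proof -
  define q where "q = xpt u"
  have ok: "coords_ok E L (Y u)" using u F_minimizers_iff by blast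
  have qU: "q \<in> Ux" unfolding q_def by (rule xpt_in_Ux[OF ok])
  define H where "H = hs l (ext u)"
  define K where "K = (\<Sum>i\<in>I. \<Sum>j\<in>I. \<bar>H i j\<bar>)"
  define B where "B = (\<Sum>i\<in>I. \<Sum>j\<in>I. \<bar>JJ q i j\<bar>)"
  define c where "c = real (card I)"
  have K: "K \<ge> 0" and B: "B \<ge> 0" and c: "c \<ge> 0" by (auto simp: K_def B_def c_def intro!: sum_nonneg)
  \<comment> \<open>The coordinate increments are at most \<open>(B + 1) * s\<close>, and
    \<open>s^2\<close> is at most \<open>c * N\<close>; with \<open>e2\<close> the Taylor error of
    \<open>WY l\<close> therefore uses up half of \<open>e * N\<close>.\<close>
  define P where "P = c\<^sup>2 * (B + 1)\<^sup>2 + 1"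
  define e2 where "e2 = e / (2 * P)"
  \<comment> \<open>Chosen so that replacing the true increments by the linearized ones changes the
    quadratic form by at most \<open>e * N\<close>; the factor one half in front of the form makes
    this the other half of the error.\<close>
  define R where "R = K * (B + 1) * c + 1"
  define e1 where "e1 = min 1 (e / (2 * R))"
  have e2: "e2 > 0" "e2 * (c\<^sup>2 * (B + 1)\<^sup>2) \<le> e / 2"
  proof -
    have p: "P > 0" unfolding P_def by (intro add_nonneg_pos) auto
    thus "e2 > 0" using assms(2) by (simp add: e2_def)
    have "e2 * (c\<^sup>2 * (B + 1)\<^sup>2) \<le> e2 * P" using \<open>e2 > 0\<close> by (intro mult_left_mono) (auto simp: P_def)
    also have "... = e / 2" using p by (simp add: e2_def)
    finally show "e2 * (c\<^sup>2 * (B + 1)\<^sup>2) \<le> e / 2" .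
  qed
  have e1: "e1 > 0" "e1 \<le> 1" "e1 * (K * (B + 1) * c) \<le> e / 2"
  proof -
    have nn: "K * (B + 1) * c \<ge> 0" using K B c by simp
    hence R: "R > 0" by (simp add: R_def)
    thus "e1 > 0" "e1 \<le> 1" using assms(2) by (auto simp: e1_def)
    have "e1 * (K * (B + 1) * c) \<le> e / (2 * R) * R"
      using nn R assms(2) by (intro mult_mono) (auto simp: e1_def R_def)
    also have "... = e / 2" using R by simp
    finally show "e1 * (K * (B + 1) * c) \<le> e / 2" .
  qed
  obtain \<rho>1 where \<rho>1: "\<rho>1 > 0" "\<And>i v. i \<in> I \<Longrightarrow> (\<forall>i. i \<notin> I \<longrightarrow> v i = 0) \<Longrightarrow> (\<forall>i\<in>I. \<bar>v i\<bar> < \<rho>1) \<Longrightarrow>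
    \<bar>yc (\<lambda>i. q i + v i) i - yc q i - (\<Sum>j\<in>I. JJ q i j * v j)\<bar> \<le> e1 * (\<Sum>i\<in>I. \<bar>v i\<bar>)"
    using ycoord_first_order[OF qU e1(1)] by blast
  have sm: "smooth2 I (Uu l) (WY l)" by (rule smooth2_WY) auto
  obtain \<rho>2 where \<rho>2: "\<rho>2 > 0" "\<And>\<delta>. (\<forall>i. i \<notin> I \<longrightarrow> \<delta> i = 0) \<Longrightarrow> (\<forall>i\<in>I. \<bar>\<delta> i\<bar> < \<rho>2) \<Longrightarrow>
    \<bar>WY l (\<lambda>i. ext u i + \<delta> i) - WY l (ext u) - (\<Sum>i\<in>I. partial_deriv i (WY l) (ext u) * \<delta> i)
      - (\<Sum>i\<in>I. \<Sum>j\<in>I. H i j * \<delta> i * \<delta> j) / 2\<bar> \<le> e2 * (\<Sum>i\<in>I. (\<delta> i)\<^sup>2)"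
    using smooth2_taylor_partial[OF sm open_Uu _ ext_in_Uu[OF u] e2(1)] unfolding H_def hs_def by auto
  obtain \<rho>3 where \<rho>3: "\<rho>3 > 0" "\<And>x. (\<forall>i. \<bar>x i - q i\<bar> < \<rho>3) \<Longrightarrow> x \<in> Ux"
    using open_box[OF open_Ux qU] by blast
  \<comment> \<open>The last bound keeps the coordinate increments below \<open>\<rho>2\<close>;
    \<open>c + 1\<close> in place of \<open>c\<close> makes the estimate strict.\<close>
  define \<rho> where "\<rho> = min \<rho>1 (min \<rho>3 (\<rho>2 / ((B + 1) * (c + 1))))"
  have pos: "(B + 1) * (c + 1) > 0" using B c by simp
  have \<rho>: "\<rho> > 0" "\<rho> \<le> \<rho>1" "\<rho> \<le> \<rho>3" "\<rho> \<le> \<rho>2 / ((B + 1) * (c + 1))"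
    using \<rho>1(1) \<rho>2(1) \<rho>3(1) pos by (auto simp: \<rho>_def)
  have qext: "q i = undefined" if "i \<notin> I" for i using that by (simp add: q_def xpt_def)
  show ?thesis
  proof (rule exI[of _ \<rho>], intro conjI ballI impI)
    fix x assume xP: "x \<in> PiE I (\<lambda>_. UNIV)" and near: "\<forall>i\<in>I. \<bar>x i - xpt u i\<bar> < \<rho>"
    define v where "v = (\<lambda>i. x i - q i)"
    have v0: "v i = 0" if "i \<notin> I" for i using that xP qext[OF that] by (auto simp: v_def PiE_def extensional_def)
    have vlt: "\<bar>v i\<bar> < \<rho>" for i using near v0[of i] \<rho>(1) by (cases "i \<in> I") (auto simp: v_def q_def)
    have xq: "(\<lambda>i. q i + v i) = x" by (simp add: v_def)
    show xU: "x \<in> Ux" using \<rho>3(2)[of x] vlt \<rho>(3) by (auto simp: v_def intro: less_le_trans)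
    define s where "s = (\<Sum>i\<in>I. \<bar>v i\<bar>)"
    define N where "N = (\<Sum>i\<in>I. (v i)\<^sup>2)"
    have s0: "s \<ge> 0" and N0: "N \<ge> 0" by (auto simp: s_def N_def intro!: sum_nonneg)
    have sN: "s\<^sup>2 \<le> c * N"
      using sum_abs_mult_le[of I v] by (simp add: s_def N_def c_def power2_eq_square sum_product)
    have srho: "s \<le> c * \<rho>"
      unfolding s_def c_def using vlt sum_bounded_above[of I "\<lambda>i. \<bar>v i\<bar>" \<rho>] by (simp add: less_imp_le)
    define w where "w = (\<lambda>i. \<Sum>j\<in>I. JJ q i j * v j)"
    \<comment> \<open>The true coordinate increment, to be compared with its linearization
      \<open>w\<close>.\<close>
    define \<delta> where "\<delta> = (\<lambda>i. if i \<in> I then yc x i - yc q i else 0)"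
    have dw: "\<bar>\<delta> i - w i\<bar> \<le> e1 * s" if "i \<in> I" for i
      using \<rho>1(2)[OF that, of v] v0 vlt \<rho>(2) that unfolding xq by (auto simp: \<delta>_def w_def s_def intro: less_le_trans)
    have wb: "\<bar>w i\<bar> \<le> B * s" if "i \<in> I" for i
    proof -
      have "\<bar>w i\<bar> \<le> (\<Sum>j\<in>I. \<bar>JJ q i j\<bar> * \<bar>v j\<bar>)" unfolding w_def by (rule order_trans[OF sum_abs]) (simp add: abs_mult)
      also have "... \<le> (\<Sum>j\<in>I. \<bar>JJ q i j\<bar> * s)"
        unfolding s_def by (intro sum_mono mult_left_mono member_le_sum) auto
      also have "... = (\<Sum>j\<in>I. \<bar>JJ q i j\<bar>) * s" by (simp add: sum_distrib_right)
      also have "... \<le> B * s"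
        unfolding B_def using that s0 by (intro mult_right_mono member_le_sum[of i I "\<lambda>i. \<Sum>j\<in>I. \<bar>JJ q i j\<bar>"]) (auto intro: sum_nonneg)
      finally show ?thesis .
    qed
    have e1s: "e1 * s \<le> s" using e1 s0 by (simp add: mult_left_le_one_le)
    have db: "\<bar>\<delta> i\<bar> \<le> (B + 1) * s" if "i \<in> I" for i
    proof -
      have "\<bar>\<delta> i\<bar> \<le> \<bar>\<delta> i - w i\<bar> + \<bar>w i\<bar>" by linarith
      also have "... \<le> s + B * s" using dw[OF that] wb[OF that] e1s by linarith
      finally show ?thesis by (simp add: algebra_simps)
    qed
    have dlt: "\<bar>\<delta> i\<bar> < \<rho>2" if "i \<in> I" for i
    proof -
      have "(B + 1) * s \<le> (B + 1) * (c * \<rho>)" using srho B by (intro mult_left_mono) auto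
      also have "... < (B + 1) * ((c + 1) * \<rho>)" using B \<rho>(1) by (intro mult_strict_left_mono) (auto simp: algebra_simps)
      also have "... \<le> \<rho>2" using \<rho>(4) pos by (simp add: field_simps)
      finally show ?thesis using db[OF that] by linarith
    qed
    have okx: "coords_ok E l (yc x)" using xU by (simp add: Ux_def)
    have eq: "WY l (\<lambda>i. ext u i + \<delta> i) = Gx x"
      unfolding WY_def Gx_def
    proof (intro sum.cong refl arg_cong[of _ _ "W _"])
      fix j assume j: "j \<in> {1..l}"
      show "Y (\<lambda>i. ext u i + \<delta> i) j = yc x j"
      proof (rule Y_ycoord[OF okx])
        fix i assume i: "1 \<le> i" "i \<le> l" "i \<notin> dom C"
        have "yc q i = ext u i" unfolding q_def using ycoord_xpt[OF ok i(1,2)] Y_free[OF i(1,3)] by simp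
        thus "ext u i + \<delta> i = yc x i" using i by (simp add: \<delta>_def I_iff)
      qed (use j in auto)
    qed
    have eq0: "WY l (ext u) = Gx q"
      unfolding WY_def Gx_def q_def using ycoord_xpt[OF ok] by (intro sum.cong refl) auto
    have grad: "(\<Sum>i\<in>I. partial_deriv i (WY l) (ext u) * \<delta> i) = 0"
      using hs_psd_level(3)[OF u] by (intro sum.neutral) auto
    have "\<bar>Gx x - Gx q - (\<Sum>i\<in>I. \<Sum>j\<in>I. H i j * \<delta> i * \<delta> j) / 2\<bar> \<le> e2 * (\<Sum>i\<in>I. (\<delta> i)\<^sup>2)"
      using \<rho>2(2)[of \<delta>] dlt unfolding eq eq0 grad by (simp add: \<delta>_def)
    also have "(\<Sum>i\<in>I. (\<delta> i)\<^sup>2) \<le> c * ((B + 1) * s)\<^sup>2"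
      unfolding c_def using db sum_bounded_above[of I "\<lambda>i. (\<delta> i)\<^sup>2" "((B + 1) * s)\<^sup>2"] B s0 by (simp add: abs_le_square_iff[symmetric] abs_mult)
    also have "c * ((B + 1) * s)\<^sup>2 = c * (B + 1)\<^sup>2 * s\<^sup>2" by (simp add: power_mult_distrib)
    also have "c * (B + 1)\<^sup>2 * s\<^sup>2 \<le> c * (B + 1)\<^sup>2 * (c * N)" using sN c by (intro mult_left_mono) auto
    finally have 1: "\<bar>Gx x - Gx q - (\<Sum>i\<in>I. \<Sum>j\<in>I. H i j * \<delta> i * \<delta> j) / 2\<bar> \<le> e2 * (c * (B + 1)\<^sup>2 * (c * N))"
      using e2(1) by (simp add: mult_left_mono)
    have "e2 * (c * (B + 1)\<^sup>2 * (c * N)) = e2 * (c\<^sup>2 * (B + 1)\<^sup>2) * N" by (simp add: power2_eq_square)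
    also have "... \<le> e / 2 * N" using e2(2) N0 by (rule mult_right_mono)
    finally have 2: "e2 * (c * (B + 1)\<^sup>2 * (c * N)) \<le> e / 2 * N" .
    have "\<bar>(\<Sum>i\<in>I. \<Sum>j\<in>I. H i j * \<delta> i * \<delta> j) - (\<Sum>i\<in>I. \<Sum>j\<in>I. H i j * w i * w j)\<bar>
        \<le> K * (2 * (e1 * s) * ((B + 1) * s))"
      unfolding K_def
    proof (rule quadratic_form_diff_le)
      show "\<bar>w i\<bar> \<le> (B + 1) * s" if "i \<in> I" for i using wb[OF that] s0 by (simp add: algebra_simps)
    qed (use dw db e1(1) s0 B in auto)
    also have "... = 2 * (e1 * (K * (B + 1))) * s\<^sup>2" by (simp add: power2_eq_square)
    also have "... \<le> 2 * (e1 * (K * (B + 1))) * (c * N)" using sN e1(1) K B by (intro mult_left_mono) auto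
    also have "... = 2 * (e1 * (K * (B + 1) * c)) * N" by simp
    also have "... \<le> 2 * (e / 2) * N" using e1(3) N0 by (intro mult_right_mono) auto
    finally have 3: "\<bar>(\<Sum>i\<in>I. \<Sum>j\<in>I. H i j * \<delta> i * \<delta> j) - (\<Sum>i\<in>I. \<Sum>j\<in>I. H i j * w i * w j)\<bar> \<le> e * N" by simp
    have "QQ q v = (\<Sum>i\<in>I. \<Sum>j\<in>I. H i j * w i * w j)"
      using QQ_eq[OF u, of v] by (simp add: q_def w_def H_def)
    hence "\<bar>Gx x - Gx q - QQ q v / 2\<bar> \<le> e * N" using 1 2 3 by linarith
    thus "\<bar>Gx x - Gx (xpt u) - QQ (xpt u) (\<lambda>i. x i - xpt u i) / 2\<bar> \<le> e * (\<Sum>i\<in>I. (x i - xpt u i)\<^sup>2)"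
      by (simp add: q_def v_def N_def)
  qed (rule \<rho>(1))
qed

text \<open>
  After integrating out the coordinates beyond \<open>l\<close>, the density of the first \<open>l\<close> moments is
  \<open>kx x * exp (- n * Gx x)\<close>: the Jacobian contributes each weight to the power \<open>n - l\<close>.
\<close>

definition kx :: "rvec \<Rightarrow> real" where
  "kx x = (\<Prod>j\<in>{1..l}. 1 / wt E j (yc x j) ^ l)"

lemma wt_ycoord_pos: "x \<in> Ux \<Longrightarrow> j \<in> {1..l} \<Longrightarrow> wt E j (yc x j) > 0"
  using coords_okD[of E l "yc x" j] by (auto simp: Ux_def intro!: wt_pos)

lemma kx_pos: "x \<in> Ux \<Longrightarrow> kx x > 0"
  unfolding kx_def by (intro prod_pos) (auto intro!: zero_less_power wt_ycoord_pos)

lemma continuous_on_kx: "continuous_on Ux kx"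
proof -
  have c: "continuous_on Ux (\<lambda>x. yc x j)" if "j \<in> {1..l}" for j
    using smooth2_ycoord[of j] that by (auto simp: smooth2_def smooth2_on_def)
  have "continuous_on Ux (\<lambda>x. 1 / wt E j (yc x j) ^ l)" if j: "j \<in> {1..l}" for j
  proof (intro continuous_intros continuous_on_wt c[OF j])
    show "\<forall>x\<in>Ux. wt E j (yc x j) ^ l \<noteq> 0"
    proof
      fix x assume "x \<in> Ux"
      thus "wt E j (yc x j) ^ l \<noteq> 0" using wt_ycoord_pos[OF _ j, of x] by simp
    qed
  qed
  thus ?thesis unfolding kx_def[abs_def] by (intro continuous_on_prod) auto
qed

lemma kx_local:
  assumes "q \<in> X"
  shows "\<exists>\<rho>>0. \<exists>k1>0. \<exists>k2. \<forall>x\<in>PiE I (\<lambda>_. UNIV). (\<forall>i\<in>I. \<bar>x i - q i\<bar> < \<rho>) \<longrightarrow> k1 \<le> kx x \<and> kx x \<le> k2"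
proof -
  obtain u where u: "u \<in> FM" "q = xpt u" using assms by (auto simp: X_def)
  have qU: "q \<in> Ux" using u xpt_in_Ux F_minimizers_iff by blast
  have qext: "q i = undefined" if "i \<notin> I" for i using that by (simp add: u xpt_def)
  let ?V = "Ux \<inter> kx -` {kx q / 2 <..< 2 * kx q}"
  have op: "open ?V"
    using continuous_open_preimage[OF continuous_on_kx open_Ux, of "{kx q / 2 <..< 2 * kx q}"] by (simp add: open_greaterThanLessThan)
  have "q \<in> ?V" using qU kx_pos[OF qU] by simp
  then obtain \<rho> where \<rho>: "\<rho> > 0" "\<And>x. (\<forall>i. \<bar>x i - q i\<bar> < \<rho>) \<Longrightarrow> x \<in> ?V" using open_box[OF op] by blast
  have *: "kx q / 2 \<le> kx x \<and> kx x \<le> 2 * kx q" if "x \<in> PiE I (\<lambda>_. UNIV)" "\<forall>i\<in>I. \<bar>x i - q i\<bar> < \<rho>" for x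
  proof -
    have "\<bar>x i - q i\<bar> < \<rho>" for i
      using that qext[of i] \<rho>(1) by (cases "i \<in> I") (auto simp: PiE_def extensional_def)
    thus ?thesis using \<rho>(2)[of x] by auto
  qed
  show ?thesis
    by (rule exI[of _ \<rho>], rule conjI[OF \<rho>(1)], rule exI[of _ "kx q / 2"], rule conjI)
       (use kx_pos[OF qU] in simp, rule exI[of _ "2 * kx q"], use * in blast)
qed

definition G0 :: real where "G0 = Gx (xpt (SOME u. u \<in> FM))"

lemma Gx_X: "q \<in> X \<Longrightarrow> Gx q = G0"
proof -
  assume "q \<in> X"
  then obtain u where u: "u \<in> FM" "q = xpt u" by (auto simp: X_def)
  define u0 where "u0 = (SOME u. u \<in> FM)"
  have u0: "u0 \<in> FM" unfolding u0_def by (rule someI[of "\<lambda>u. u \<in> FM"]) (rule u(1))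
  have "xpt u \<in> Ux" "xpt u0 \<in> Ux" using xpt_in_Ux u(1) u0 F_minimizers_iff by blast+
  hence "Gx (xpt u0) \<le> Gx (xpt u)" "Gx (xpt u) \<le> Gx (xpt u0)" using Gx_ge(1) u(1) u0 by blast+
  thus "Gx q = G0" by (simp add: G0_def u0_def u(2))
qed

section \<open>The marginal density of the first moments\<close>

definition dens :: "nat \<Rightarrow> rvec \<Rightarrow> ennreal" where
  "dens n x = indicator Ux x * ennreal (kx x * exp (- real n * (Gx x - G0)))"

text \<open>Valid for all \<open>n\<close>, also below \<open>l\<close>, where the exponent
  \<open>n - l\<close> of \<open>dens_eq_tilt\<close> would be truncated; measurability for every
  \<open>n\<close> rests on this form.\<close>

lemma dens_eq_coord_dens:
  "dens n x = ennreal (exp (real n * G0)) *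
     coord_dens E C l (\<lambda>j y. indicator (coord_dom E j) y * ennreal (exp (- real n * W j y) / wt E j y ^ l)) x"
proof (cases "x \<in> Ux")
  case True
  have ok: "yc x j \<in> coord_dom E j" if "j \<in> {1..l}" for j
    using True coords_okD[of E l "yc x" j] that by (auto simp: Ux_def)
  have "(\<Prod>j\<in>{1..l}. indicator (coord_dom E j) (yc x j) * ennreal (exp (- real n * W j (yc x j)) / wt E j (yc x j) ^ l))
      = (\<Prod>j\<in>{1..l}. ennreal (exp (- real n * W j (yc x j)) / wt E j (yc x j) ^ l))"
    using ok by (intro prod.cong) auto
  also have "... = ennreal (\<Prod>j\<in>{1..l}. exp (- real n * W j (yc x j)) / wt E j (yc x j) ^ l)"
    using wt_ycoord_pos[OF True] by (intro prod_ennreal) (simp add: less_imp_le)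
  also have "(\<Prod>j\<in>{1..l}. exp (- real n * W j (yc x j)) / wt E j (yc x j) ^ l)
      = (\<Prod>j\<in>{1..l}. exp (- real n * W j (yc x j))) * kx x"
    unfolding kx_def prod.distrib[symmetric] by simp
  also have "(\<Prod>j\<in>{1..l}. exp (- real n * W j (yc x j))) = exp (- real n * Gx x)"
    by (simp add: Gx_def exp_sum[symmetric] sum_distrib_left sum_negf)
  finally have "coord_dens E C l (\<lambda>j y. indicator (coord_dom E j) y * ennreal (exp (- real n * W j y) / wt E j y ^ l)) x
      = ennreal (exp (- real n * Gx x) * kx x)"
    using True by (simp add: coord_dens_def Ux_def)
  moreover have "dens n x = ennreal (exp (real n * G0) * (exp (- real n * Gx x) * kx x))"
    using True by (simp add: dens_def exp_diff[symmetric] mult_ac exp_add[symmetric] right_diff_distrib)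
  ultimately show ?thesis using kx_pos[OF True] by (simp add: ennreal_mult)
qed (simp add: dens_def coord_dens_def Ux_def)

lemma dens_eq_tilt:
  assumes "l \<le> n"
  shows "dens n x = ennreal (exp (real n * G0)) * coord_dens E C l (\<lambda>j. tiltD E C V n (n - l) j) x"
proof -
  have "exp (- real n * W j y) / wt E j y ^ l = tilt E C V n (n - l) j y" if "y \<in> coord_dom E j" for j y
  proof -
    have w: "wt E j y > 0" by (rule wt_pos[OF that])
    have "exp (- real n * W j y) = exp (- real n * extend_potentials C V j y) * exp (real n * ln (wt E j y))"
      by (simp add: W_pot_eq exp_add[symmetric] algebra_simps)
    also have "exp (real n * ln (wt E j y)) = wt E j y ^ n" using w by (simp add: exp_of_nat_mult)
    also have "wt E j y ^ n = wt E j y ^ (n - l) * wt E j y ^ l" using assms by (simp add: power_add[symmetric])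
    finally show ?thesis using w by (simp add: tilt_def)
  qed
  hence "(\<lambda>j y. indicator (coord_dom E j) y * ennreal (exp (- real n * W j y) / wt E j y ^ l)) = (\<lambda>j. tiltD E C V n (n - l) j)"
    by (auto simp: fun_eq_iff tiltD_def indicator_def)
  thus ?thesis using dens_eq_coord_dens[of n x] by (simp only:)
qed

lemma measurable_dens: "dens n \<in> borel_measurable (leb l)"
proof -
  have "(\<lambda>y. indicator (coord_dom E j) y * ennreal (exp (- real n * W j y) / wt E j y ^ l)) \<in> borel_measurable borel"
    if "1 \<le> j" for j
  proof (rule borel_measurable_on_set[OF _ coord_dom_borel])
    show "continuous_on (coord_dom E j) (\<lambda>y. exp (- real n * W j y) / wt E j y ^ l)"
    proof (intro continuous_intros continuous_on_wt continuous_on_W[OF that])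
      show "\<forall>y\<in>coord_dom E j. wt E j y ^ l \<noteq> 0"
      proof
        fix y assume "y \<in> coord_dom E j"
        thus "wt E j y ^ l \<noteq> 0" using wt_pos[of y E j] by simp
      qed
    qed
  qed
  hence "coord_dens E C l (\<lambda>j y. indicator (coord_dom E j) y * ennreal (exp (- real n * W j y) / wt E j y ^ l))
      \<in> borel_measurable (leb l)"
    by (intro measurable_coord_dens)
  thus ?thesis unfolding dens_eq_coord_dens[abs_def] by (rule borel_measurable_times_ennreal[OF borel_measurable_const])
qed

end

section \<open>Laplace's method at the limit points\<close>

locale deviation_setting = generic_setting +
  fixes a :: rvec and mstar :: "rvec \<Rightarrow> nat \<Rightarrow> real"
  assumes a_top: "filterlim a at_top sequentially"
    and a_small: "a \<in> o(\<lambda>n. sqrt (real n))"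
    and rule: "closest_point_rule l (limit_points E C V l) mstar"
begin

lemma space_free: "space (leb n) = PiE (free n) (\<lambda>_. UNIV)"
  by (simp add: space_PiM)

lemma space_Rn: "space (Rn_borel n) = PiE {1..n} (\<lambda>_. UNIV)"
  by (simp add: Rn_borel_def space_PiM)

lemma mstar_limit_point: "x \<in> space (Rn_borel l) \<Longrightarrow> mstar x \<in> fill l ` X"
  using rule unfolding closest_point_rule_def limit_points_eq by (auto simp: is_arg_min_def)

text \<open>A selection rule returns an element of the set of limit points, so there is one.\<close>

lemma X_ne: "X \<noteq> {}"
proof -
  have "restrict (\<lambda>_. 0) {1..l} \<in> space (Rn_borel l)" by (simp add: space_Rn)
  thus ?thesis using mstar_limit_point by blast
qed

sublocale lap: laplace_setting I Ux Gx kx X Sg G0 "leb l" dens QQ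
proof (unfold_locales)
  show "leb l \<equiv> leb l" by (rule reflexive)
  show "dens \<equiv> \<lambda>n x. indicator Ux x * ennreal (kx x * exp (- real n * (Gx x - G0)))"
    by (rule eq_reflection) (simp add: fun_eq_iff dens_def)
  show "QQ \<equiv> \<lambda>q v. \<Sum>i\<in>I. (\<Sum>j\<in>I. Sg q i j * v j)\<^sup>2"
    by (rule eq_reflection) (simp add: fun_eq_iff QQ_def)
  show "finite I" by simp
  show "finite X" by (rule finite_X)
  show "X \<noteq> {}" by (rule X_ne)
  show "(\<lambda>x. indicator Ux x * ennreal (kx x * exp (- real n * (Gx x - G0)))) \<in> borel_measurable (leb l)" for n
    using measurable_dens[of n] unfolding dens_def[abs_def] .
  show "0 \<le> kx x" if "x \<in> Ux" for x using kx_pos[OF that] by simp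
  show "\<exists>\<rho>>0. \<forall>x\<in>space (leb l). (\<forall>i\<in>I. \<bar>x i - q i\<bar> < \<rho>) \<longrightarrow>
        x \<in> Ux \<and> \<bar>Gx x - G0 - (\<Sum>i\<in>I. (\<Sum>j\<in>I. Sg q i j * (x j - q j))\<^sup>2) / 2\<bar> \<le> e * (\<Sum>i\<in>I. (x i - q i)\<^sup>2)"
    if q: "q \<in> X" and e: "e > 0" for q e
  proof -
    obtain u where u: "u \<in> FM" "q = xpt u" using q by (auto simp: X_def)
    show ?thesis using Gx_taylor[OF u(1) e] Gx_X[OF q] unfolding space_free u(2) QQ_def by simp
  qed
  show "\<exists>\<rho>>0. \<exists>k1>0. \<exists>k2. \<forall>x\<in>space (leb l). (\<forall>i\<in>I. \<bar>x i - q i\<bar> < \<rho>) \<longrightarrow> k1 \<le> kx x \<and> kx x \<le> k2"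
    if "q \<in> X" for q using kx_local[OF that] unfolding space_free .
  show "\<exists>\<delta>>0. \<forall>x\<in>Ux \<inter> space (leb l). (\<forall>q\<in>X. \<exists>i\<in>I. \<bar>x i - q i\<bar> \<ge> \<rho>) \<longrightarrow> Gx x \<ge> G0 + \<delta>"
    if "\<rho> > 0" for \<rho>
  proof -
    obtain q where q: "q \<in> X" using X_ne by blast
    then obtain u where u: "u \<in> FM" "q = xpt u" by (auto simp: X_def)
    show ?thesis using Gx_far[OF u(1) that] Gx_X[OF q] unfolding u(2) by auto
  qed
  show "\<exists>n. (\<integral>\<^sup>+x. indicator Ux x * ennreal (kx x * exp (- real n * (Gx x - G0))) \<partial>leb l) < \<infinity>"
    unfolding dens_def[symmetric]
  \<comment> \<open>At \<open>n = l\<close> nothing has been integrated out and the exponent of the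
    weights is zero, so the integral is covered by \<open>coord_integral_finite\<close>.\<close>
  proof (rule exI[of _ l])
    have "(\<integral>\<^sup>+x. coord_dens E C l (\<lambda>j. tiltD E C V l 0 j) x \<partial>leb l) < \<infinity>"
      by (rule coord_integral_finite[OF IC l_pos]) simp
    moreover have "coord_dens E C l (\<lambda>j. tiltD E C V l 0 j) \<in> borel_measurable (leb l)"
      by (intro measurable_coord_dens measurable_tiltD IC)
    ultimately show "(\<integral>\<^sup>+x. dens l x \<partial>leb l) < \<infinity>"
      using dens_eq_tilt[of l] by (simp add: nn_integral_cmult ennreal_mult_less_top)
  qed
  show "\<exists>c>0. \<forall>q\<in>X. \<forall>v. c * (\<Sum>i\<in>I. (v i)\<^sup>2) \<le> (\<Sum>i\<in>I. (\<Sum>j\<in>I. Sg q i j * v j)\<^sup>2)"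
    using QQ_coercive unfolding QQ_def .
qed

end

section \<open>The large deviations principle\<close>

lemma measurable_fill: "fill_constraint C n \<in> lebC C n \<rightarrow>\<^sub>M Rn_borel n"
proof -
  have "(\<lambda>x. \<lambda>j\<in>{1..n}. fillc C x j) \<in> lebC C n \<rightarrow>\<^sub>M Rn_borel n"
    unfolding Rn_borel_def by (intro measurable_restrict measurable_fillc) auto
  thus ?thesis by (simp add: fill_constraint_def[abs_def] fillc_def cong: restrict_cong)
qed

lemma log_prob_le:
  assumes "emeasure P A \<le> ennreal (exp x)"
  shows "log_prob P A \<le> ereal x"
proof -
  have "measure P A \<le> exp x" unfolding measure_def using assms by (intro enn2real_leI) auto
  moreover have "ln (measure P A) \<le> x" if "measure P A \<noteq> 0"
  proof -
    have pos: "measure P A > 0" using that measure_nonneg[of P A] by linarith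
    have "ln (measure P A) \<le> ln (exp x)" using pos calculation by (subst ln_le_cancel_iff) auto
    thus ?thesis by simp
  qed
  ultimately show ?thesis by (simp add: log_prob_def)
qed

lemma log_prob_ge:
  assumes "prob_space P" "ennreal (exp x) \<le> emeasure P A"
  shows "ereal x \<le> log_prob P A"
proof -
  interpret prob_space P by fact
  have le: "exp x \<le> measure P A" using assms(2) by (simp add: emeasure_eq_measure)
  hence pos: "measure P A > 0" using exp_gt_zero[of x] by linarith
  have "ln (exp x) \<le> ln (measure P A)" using le pos by (subst ln_le_cancel_iff) auto
  thus ?thesis using pos by (simp add: log_prob_def)
qed

text \<open>A closed subset of a cube: the vanishing of the constrained entries is the closed
  condition that their squares sum to at most zero.\<close>

lemma gaussian_rate_sublevel:
  assumes "is_constraint C" "last_index C \<le> l"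
  shows "compactin (Rn_top l) {x \<in> topspace (Rn_top l). gaussian_rate C l x \<le> ereal c}" (is "compactin _ ?S")
proof (rule closed_compactin)
  have sub: "dom C \<subseteq> {1..l}"
  proof
    fix i assume i: "i \<in> dom C"
    have "i \<le> last_index C" unfolding last_index_def using assms(1) i by (intro Max_ge) (auto simp: is_constraint_def)
    moreover have "i \<noteq> 0" using i assms(1) unfolding is_constraint_def by (intro notI) simp
    ultimately show "i \<in> {1..l}" using assms(2) by simp
  qed
  have fin: "finite (dom C)" using assms(1) by (simp add: is_constraint_def)
  define f where "f = (\<lambda>x. \<Sum>i\<in>dom C. x i * x i :: real)"
  define g where "g = (\<lambda>x. \<Sum>i\<in>{1..l}. x i * x i :: real)"
  have cont: "continuous_map (Rn_top l) euclideanreal (\<lambda>x. \<Sum>i\<in>A. x i * x i)" if "A \<subseteq> {1..l}" for A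
    unfolding Rn_top_def using that
    by (intro continuous_map_sum continuous_map_real_mult continuous_map_product_projection) (auto intro: finite_subset)
  have L2: "(L2_set x {1..l})\<^sup>2 = g x" for x
    by (simp add: L2_set_def g_def sum_nonneg power2_eq_square)
  have f0: "(\<forall>i\<in>dom C. x i = 0) \<longleftrightarrow> f x \<le> 0" for x
  proof
    assume "f x \<le> 0"
    moreover have "f x \<ge> 0" unfolding f_def by (intro sum_nonneg) auto
    ultimately have "f x = 0" by simp
    thus "\<forall>i\<in>dom C. x i = 0" unfolding f_def using fin by (subst (asm) sum_nonneg_eq_0_iff) auto
  qed (simp add: f_def)
  have S: "?S = {x \<in> topspace (Rn_top l). f x \<in> {..0}} \<inter> {x \<in> topspace (Rn_top l). g x \<in> {..2 * c}}"
    by (auto simp: gaussian_rate_def L2 f0 simp del: One_nat_def)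
  show "closedin (Rn_top l) ?S"
    unfolding S f_def g_def
    by (intro closedin_Int closedin_continuous_map_preimage[OF cont]) (use sub in auto)
  show "compactin (Rn_top l) (PiE {1..l} (\<lambda>_. {- sqrt (2 * c)..sqrt (2 * c)}))"
    unfolding Rn_top_def compactin_PiE by simp
  show "?S \<subseteq> PiE {1..l} (\<lambda>_. {- sqrt (2 * c)..sqrt (2 * c)})"
  proof
    fix x assume x: "x \<in> ?S"
    hence xP: "x \<in> PiE {1..l} (\<lambda>_. UNIV)" and gx: "g x \<le> 2 * c" unfolding S by (auto simp: topspace_Rn_top)
    have "x i \<in> {- sqrt (2 * c)..sqrt (2 * c)}" if i: "i \<in> {1..l}" for i
    proof -
      have "x i * x i \<le> g x" unfolding g_def by (rule member_le_sum[OF i]) auto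
      hence "(x i)\<^sup>2 \<le> 2 * c" using gx by (simp add: power2_eq_square)
      hence "\<bar>x i\<bar> \<le> sqrt (2 * c)" using real_sqrt_le_mono[of "(x i)\<^sup>2" "2 * c"] by simp
      thus ?thesis by (auto simp: abs_le_iff)
    qed
    thus "x \<in> PiE {1..l} (\<lambda>_. {- sqrt (2 * c)..sqrt (2 * c)})" using xP by (auto simp: PiE_iff)
  qed
qed

context generic_setting
begin

lemma unnormalized_density_eq:
  assumes "L \<le> n"
  shows "unnormalized_density E C V n (fill n x) = coord_dens E C n (\<lambda>j. tiltD E C V n 0 j) x"
proof (cases "coords_ok E n (yc x)")
  case True
  have "tiltD E C V n 0 j (yc x j) = ennreal (exp (- real n * extend_potentials C V j (canon_coord E (fill n x) j)))"
    if "j \<in> {1..n}" for j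
    using that coords_okD[OF True, of j] canon_coord_fill[OF True, of j] by (simp add: tiltD_def tilt_def)
  hence "(\<Prod>j\<in>{1..n}. tiltD E C V n 0 j (yc x j))
      = (\<Prod>j\<in>{1..n}. ennreal (exp (- real n * extend_potentials C V j (canon_coord E (fill n x) j))))"
    by (intro prod.cong) auto
  also have "... = ennreal (\<Prod>j\<in>{1..n}. exp (- real n * extend_potentials C V j (canon_coord E (fill n x) j)))"
    by (rule prod_ennreal) simp
  also have "(\<Prod>j\<in>{1..n}. exp (- real n * extend_potentials C V j (canon_coord E (fill n x) j)))
      = exp (- real n * (\<Sum>j=1..n. extend_potentials C V j (canon_coord E (fill n x) j)))"
    by (simp add: exp_sum[symmetric] sum_distrib_left sum_negf)
  finally show ?thesis
    using True fill_in_relint_iff[OF assms, of x] by (simp add: unnormalized_density_def coord_dens_def)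
next
  case False
  thus ?thesis using fill_in_relint_iff[OF assms, of x] by (simp add: unnormalized_density_def coord_dens_def)
qed

lemma marginal_dens:
  assumes "l \<le> n"
  shows "\<exists>c. 0 < c \<and> c < \<infinity> \<and> (\<forall>f. f \<in> borel_measurable (leb n) \<longrightarrow> f \<in> borel_measurable (leb l) \<longrightarrow>
      (\<forall>x x'. (\<forall>i\<le>l. x i = x' i) \<longrightarrow> f x = f x') \<longrightarrow>
      (\<integral>\<^sup>+x. f x * coord_dens E C n (\<lambda>j. tiltD E C V n 0 j) x \<partial>leb n) =
      (\<integral>\<^sup>+x. f x * dens n x \<partial>leb l) * c)"
proof -
  obtain K where K: "0 < K" "K < \<infinity>" "\<And>f. f \<in> borel_measurable (leb n) \<Longrightarrow>
      (\<And>x x'. (\<forall>i\<le>l. x i = x' i) \<Longrightarrow> f x = f x') \<Longrightarrow>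
      (\<integral>\<^sup>+x. f x * coord_dens E C n (\<lambda>j. tiltD E C V n 0 j) x \<partial>leb n) =
      (\<integral>\<^sup>+x. f x * coord_dens E C l (\<lambda>j. tiltD E C V n (0 + (n - l)) j) x \<partial>leb l) * K"
    using coord_integral_marginal[OF IC constr, of n l n 0] l_ge l_pos assms by auto
  let ?e = "ennreal (exp (- (real n * G0)))"
  have ee: "?e * ennreal (exp (real n * G0)) = 1"
    by (simp add: ennreal_mult[symmetric] exp_add[symmetric])
  have ci: "coord_dens E C l (\<lambda>j. tiltD E C V n (0 + (n - l)) j) x = ?e * dens n x" for x
    unfolding dens_eq_tilt[OF assms] mult.assoc[symmetric] ee by simp
  show ?thesis
  proof (intro exI[of _ "?e * K"] conjI allI impI)
    show "0 < ?e * K" using K(1) by (simp add: ennreal_zero_less_mult_iff)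
    show "?e * K < \<infinity>" using K(2) by (simp add: ennreal_mult_less_top)
    fix f :: "rvec \<Rightarrow> ennreal"
    assume f: "f \<in> borel_measurable (leb n)" "f \<in> borel_measurable (leb l)"
      "\<forall>x x'. (\<forall>i\<le>l. x i = x' i) \<longrightarrow> f x = f x'"
    have "(\<integral>\<^sup>+x. f x * (?e * dens n x) \<partial>leb l) = (\<integral>\<^sup>+x. ?e * (f x * dens n x) \<partial>leb l)"
      by (simp add: mult_ac)
    also have "... = ?e * (\<integral>\<^sup>+x. f x * dens n x \<partial>leb l)"
      using f(2) measurable_dens by (intro nn_integral_cmult borel_measurable_times_ennreal)
    finally show "(\<integral>\<^sup>+x. f x * coord_dens E C n (\<lambda>j. tiltD E C V n 0 j) x \<partial>leb n) =
      (\<integral>\<^sup>+x. f x * dens n x \<partial>leb l) * (?e * K)"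
      using K(3)[OF f(1)] f(3) unfolding ci by (simp add: mult_ac)
  qed
qed

end

section \<open>The law of the rescaled deviation\<close>

context deviation_setting
begin

abbreviation T :: "nat \<Rightarrow> rvec \<Rightarrow> nat \<Rightarrow> real" where
  "T \<equiv> rescaled_deviation E C V l a mstar"

abbreviation law :: "nat \<Rightarrow> rvec measure" where
  "law n \<equiv> distr (moment_law E C V n) (Rn_borel l) (T n)"

lemma T_cong:
  assumes "\<And>j. j \<in> {1..l} \<Longrightarrow> m j = m' j"
  shows "T n m = T n m'"
proof -
  have r: "restrict m {1..l} = restrict m' {1..l}" using assms by (rule restrict_ext)
  have "mat_apply l A (\<lambda>j. m j - s j) = mat_apply l A (\<lambda>j. m' j - s j)" for A s
    unfolding mat_apply_def using assms by (intro restrict_ext sum.cong refl) auto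
  thus ?thesis unfolding rescaled_deviation_def r by simp
qed

lemma T_fill_cong: "(\<And>i. i \<le> l \<Longrightarrow> x i = x' i) \<Longrightarrow> T n (fill l x) = T n (fill l x')"
  by (rule T_cong) (auto simp: fill_constraint_def split: option.splits)

lemma T_fill: "l \<le> k \<Longrightarrow> T n (fill k x) = T n (fill l x)"
  by (rule T_cong) (auto simp: fill_constraint_def)

lemma singleton_Rn_borel: "s \<in> PiE {1..l} (\<lambda>_. UNIV) \<Longrightarrow> {s} \<in> sets (Rn_borel l)"
proof -
  assume s: "s \<in> PiE {1..l} (\<lambda>_. UNIV)"
  have "{s} = PiE {1..l} (\<lambda>i. {s i})" using s PiE_singleton[of s "{1..l}"] by (simp add: PiE_def)
  also have "... \<in> sets (Rn_borel l)" unfolding Rn_borel_def by (intro sets_PiM_I_finite) auto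
  finally show ?thesis .
qed

text \<open>The matrix is not shown to depend measurably on the base point. Instead
  \<open>mstar\<close> takes finitely many values, and \<open>T n\<close> is a finite sum of
  indicators times affine maps.\<close>

lemma measurable_T:
  assumes "l \<le> k"
  shows "T n \<in> Rn_borel k \<rightarrow>\<^sub>M Rn_borel l"
proof -
  let ?LP = "fill l ` X"
  have res: "(\<lambda>m. restrict m {1..l}) \<in> Rn_borel k \<rightarrow>\<^sub>M Rn_borel l"
    unfolding Rn_borel_def using assms by (intro measurable_restrict_subset) auto
  have ms: "mstar \<in> Rn_borel l \<rightarrow>\<^sub>M Rn_borel l" using rule by (simp add: closest_point_rule_def)
  have sel: "(\<lambda>m. mstar (restrict m {1..l})) \<in> Rn_borel k \<rightarrow>\<^sub>M Rn_borel l"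
    by (rule measurable_compose[OF res ms])
  have coord: "(\<lambda>m. m j) \<in> borel_measurable (Rn_borel k)" if "j \<in> {1..l}" for j
    unfolding Rn_borel_def using that assms by (intro measurable_component_singleton) auto
  define g where "g = (\<lambda>s m i. a n * mat_apply l (Sigma_mat E C V l s) (\<lambda>j. m j - s j) i)"
  have g: "(\<lambda>m. g s m i) \<in> borel_measurable (Rn_borel k)" if "i \<in> {1..l}" for s i
  proof -
    have "(\<lambda>m. a n * (\<Sum>j=1..l. Sigma_mat E C V l s $$ (i - 1, j - 1) * (m j - s j))) \<in> borel_measurable (Rn_borel k)"
      by (intro borel_measurable_times borel_measurable_const borel_measurable_sum borel_measurable_diff coord)
    thus ?thesis using that by (simp add: g_def mat_apply_def)
  qed
  have ind: "(\<lambda>m. indicator {s} (mstar (restrict m {1..l})) :: real) \<in> borel_measurable (Rn_borel k)" if "s \<in> ?LP" for s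
  proof (rule measurable_compose[OF sel])
    have "s \<in> PiE {1..l} (\<lambda>_. UNIV)" using that by (auto simp: fill_constraint_def)
    thus "indicator {s} \<in> borel_measurable (Rn_borel l)" by (intro borel_measurable_indicator singleton_Rn_borel)
  qed
  have "(\<lambda>m. \<lambda>i\<in>{1..l}. \<Sum>s\<in>?LP. indicator {s} (mstar (restrict m {1..l})) * g s m i) \<in> Rn_borel k \<rightarrow>\<^sub>M Rn_borel l"
    unfolding Rn_borel_def[of l]
    by (intro measurable_restrict borel_measurable_sum borel_measurable_times ind g)
  moreover have "T n m = (\<lambda>i\<in>{1..l}. \<Sum>s\<in>?LP. indicator {s} (mstar (restrict m {1..l})) * g s m i)"
    if "m \<in> space (Rn_borel k)" for m
  proof -
    let ?s = "mstar (restrict m {1..l})"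
    have s: "?s \<in> ?LP" by (rule mstar_limit_point) (simp add: space_Rn)
    have "(\<Sum>s\<in>?LP. indicator {s} ?s * g s m i) = g ?s m i" for i
    proof -
      have "(\<Sum>s\<in>?LP. indicator {s} ?s * g s m i) = (\<Sum>s\<in>?LP. if s = ?s then g ?s m i else 0)"
        by (intro sum.cong refl) (auto simp: indicator_def)
      thus ?thesis using s finite_X by simp
    qed
    thus ?thesis by (simp add: rescaled_deviation_def Let_def g_def)
  qed
  ultimately show ?thesis by (subst measurable_cong) auto
qed

text \<open>The marginal constant \<open>c\<close> of \<open>marginal_dens\<close> is the same for
  the event and for the partition function, so it cancels in the quotient.\<close>

lemma emeasure_law:
  assumes "l \<le> n" "0 < lap.mass n" "lap.mass n < \<infinity>" "A \<in> sets (Rn_borel l)"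
  shows "emeasure (law n) A =
    (\<integral>\<^sup>+x. indicator {x \<in> space (leb l). T n (fill l x) \<in> A} x * dens n x \<partial>leb l) / lap.mass n"
proof -
  let ?F = "leb n" and ?ci = "coord_dens E C n (\<lambda>j. tiltD E C V n 0 j)"
  define Z where "Z = partition_function E C V n"
  define f where "f = (\<lambda>x. indicator A (T n (fill l x)) :: ennreal)"
  have Ln: "L \<le> n" using l_ge assms(1) by simp
  have u: "unnormalized_density E C V n (fill n x) = ?ci x" for x
    by (rule unnormalized_density_eq[OF Ln])
  have ci: "?ci \<in> borel_measurable ?F" by (intro measurable_coord_dens measurable_tiltD IC)
  obtain c where c0: "0 < c \<and> c < \<infinity> \<and> (\<forall>f. f \<in> borel_measurable ?F \<longrightarrow> f \<in> borel_measurable (leb l) \<longrightarrow>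
      (\<forall>x x'. (\<forall>i\<le>l. x i = x' i) \<longrightarrow> f x = f x') \<longrightarrow>
      (\<integral>\<^sup>+x. f x * ?ci x \<partial>?F) = (\<integral>\<^sup>+x. f x * dens n x \<partial>leb l) * c)"
    using marginal_dens[OF assms(1)] ..
  note c = c0[THEN conjunct1] c0[THEN conjunct2, THEN conjunct1]
    and marg = c0[THEN conjunct2, THEN conjunct2, THEN spec, THEN mp, THEN mp, THEN mp]
  have Z: "Z = lap.mass n * c"
  proof -
    have "Z = (\<integral>\<^sup>+x. 1 * ?ci x \<partial>?F)" by (simp only: Z_def partition_function_def u mult_1)
    also have "... = (\<integral>\<^sup>+x. 1 * dens n x \<partial>leb l) * c"
      by (rule marg[OF borel_measurable_const borel_measurable_const]) simp
    also have "... = lap.mass n * c" by (simp only: lap.mass_def mult_1)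
    finally show ?thesis .
  qed
  have TF: "(\<lambda>x. T n (fill k x)) \<in> leb k \<rightarrow>\<^sub>M Rn_borel l" if "l \<le> k" for k
    by (rule measurable_compose[OF measurable_fill measurable_T[OF that]])
  have fm: "f \<in> borel_measurable (leb k)" if "l \<le> k" for k
    unfolding f_def using measurable_compose[OF TF[OF that] borel_measurable_indicator[OF assms(4)]] T_fill[OF that] by simp
  have fdep: "\<forall>x x'. (\<forall>i\<le>l. x i = x' i) \<longrightarrow> f x = f x'"
  proof (intro allI impI)
    fix x x' :: rvec assume "\<forall>i\<le>l. x i = x' i"
    hence "T n (fill l x) = T n (fill l x')" by (intro T_fill_cong) simp
    thus "f x = f x'" by (simp add: f_def)
  qed
  let ?D = "density ?F (\<lambda>x. ?ci x / Z)"
  have law_eq: "moment_law E C V n = distr ?D (Rn_borel n) (fill n)"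
    by (simp add: moment_law_def u Z_def)
  have "law n = distr ?D (Rn_borel l) (\<lambda>x. T n (fill n x))"
    unfolding law_eq using measurable_fill measurable_T[OF assms(1)]
    by (subst distr_distr) (auto simp: comp_def)
  also have "(\<lambda>x. T n (fill n x)) = (\<lambda>x. T n (fill l x))" using T_fill[OF assms(1)] by simp
  finally have lw: "law n = distr ?D (Rn_borel l) (\<lambda>x. T n (fill l x))" .
  have TFl: "(\<lambda>x. T n (fill l x)) \<in> ?F \<rightarrow>\<^sub>M Rn_borel l" using TF[OF assms(1)] T_fill[OF assms(1)] by simp
  hence S: "(\<lambda>x. T n (fill l x)) -` A \<inter> space ?F \<in> sets ?F" using assms(4) by (rule measurable_sets)
  have "emeasure (law n) A = emeasure ?D ((\<lambda>x. T n (fill l x)) -` A \<inter> space ?F)"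
    unfolding lw using TFl by (subst emeasure_distr[OF _ assms(4)]) auto
  also have "... = (\<integral>\<^sup>+x. ?ci x / Z * indicator ((\<lambda>x. T n (fill l x)) -` A \<inter> space ?F) x \<partial>?F)"
    using ci by (intro emeasure_density S) simp
  also have "... = (\<integral>\<^sup>+x. f x * ?ci x / Z \<partial>?F)"
    by (intro nn_integral_cong) (auto simp: f_def indicator_def)
  also have "... = (\<integral>\<^sup>+x. f x * ?ci x \<partial>?F) / Z"
    using fm[OF assms(1)] ci by (intro nn_integral_divide) simp
  also have "... = (\<integral>\<^sup>+x. f x * dens n x \<partial>leb l) / lap.mass n"
    unfolding Z marg[OF fm[OF assms(1)] fm[OF order_refl] fdep] using c by (intro divide_mult_eq) auto
  also have "(\<integral>\<^sup>+x. f x * dens n x \<partial>leb l)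
      = (\<integral>\<^sup>+x. indicator {x \<in> space (leb l). T n (fill l x) \<in> A} x * dens n x \<partial>leb l)"
    by (intro nn_integral_cong) (auto simp: f_def indicator_def)
  finally show ?thesis .
qed

lemma eventually_law:
  "\<forall>\<^sub>F n in sequentially. l \<le> n \<and> 0 < lap.mass n \<and> lap.mass n < \<infinity>"
  using eventually_ge_at_top[of l] lap.mass_pos_finite by eventually_elim simp

lemma prob_space_law: "\<forall>\<^sub>F n in sequentially. prob_space (law n)"
  using eventually_law
proof eventually_elim
  case (elim n)
  have TF: "(\<lambda>x. T n (fill l x)) \<in> leb l \<rightarrow>\<^sub>M Rn_borel l"
    by (rule measurable_compose[OF measurable_fill measurable_T[OF order_refl]])
  have "emeasure (law n) (space (Rn_borel l)) =
    (\<integral>\<^sup>+x. indicator {x \<in> space (leb l). T n (fill l x) \<in> space (Rn_borel l)} x * dens n x \<partial>leb l) / lap.mass n"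
    using elim by (intro emeasure_law) auto
  also have "(\<integral>\<^sup>+x. indicator {x \<in> space (leb l). T n (fill l x) \<in> space (Rn_borel l)} x * dens n x \<partial>leb l)
      = lap.mass n"
    unfolding lap.mass_def using measurable_space[OF TF] by (intro nn_integral_cong) (auto simp: indicator_def)
  also have "lap.mass n / lap.mass n = 1" using elim by (intro ennreal_divide_self) auto
  finally show ?case by (intro prob_spaceI) simp
qed

text \<open>The distinct points of the finite set \<open>X\<close> are separated, so the nearest
  limit point to a vector close to \<open>q\<close> can only be that of \<open>q\<close>, whatever
  rule breaks ties.\<close>

lemma near_selects:
  "\<exists>\<rho>>0. \<forall>q\<in>X. \<forall>x. (\<forall>i\<in>I. \<bar>x i - q i\<bar> < \<rho>) \<longrightarrow> mstar (fill l x) = fill l q"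
proof -
  define D where "D = (\<lambda>q q'. \<Sum>i\<in>I. \<bar>q i - q' i\<bar> :: real)"
  define sep where "sep = Min (insert 1 ((\<lambda>(q, q'). D q q') ` {(q, q') \<in> X \<times> X. q \<noteq> q'}))"
  have fin: "finite {(q, q') \<in> X \<times> X. q \<noteq> q'}"
    by (rule finite_subset[of _ "X \<times> X"]) (use finite_X in auto)
  have Xext: "q i = undefined" if "q \<in> X" "i \<notin> I" for q i using that by (auto simp: X_def xpt_def)
  have Dpos: "D q q' > 0" if "q \<in> X" "q' \<in> X" and ne: "q \<noteq> q'" for q q'
  proof -
    obtain i where i: "q i \<noteq> q' i" using ne by (auto simp: fun_eq_iff)
    hence "i \<in> I" using Xext[OF that(1)] Xext[OF that(2)] by (cases "i \<in> I") auto
    have "0 < \<bar>q i - q' i\<bar>" using i by simp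
    also have "... \<le> D q q'" unfolding D_def by (rule member_le_sum[OF \<open>i \<in> I\<close>]) auto
    finally show ?thesis .
  qed
  have sep: "sep > 0" unfolding sep_def using fin Dpos by (subst Min_gr_iff) auto
  have sepD: "sep \<le> D q q'" if "q \<in> X" "q' \<in> X" "q \<noteq> q'" for q q'
    unfolding sep_def using fin that by (intro Min_le) force+
  define c where "c = real (card I)"
  \<comment> \<open>A competitor at least as close as \<open>q\<close> differs from \<open>q\<close>
    by at most \<open>(l + 1) * \<rho>\<close> in each free entry, hence in total by less than the
    separation.\<close>
  define \<rho> where "\<rho> = sep / ((c + 1) * (real l + 1))"
  have c: "c \<ge> 0" by (simp add: c_def)
  have \<rho>: "\<rho> > 0" using sep c by (simp add: \<rho>_def)
  have sepr: "sep = (c + 1) * ((real l + 1) * \<rho>)"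
  proof -
    have "(c + 1) * (real l + 1) \<noteq> 0" using c by auto
    from nonzero_mult_div_cancel_left[OF this, of sep] show ?thesis
      unfolding \<rho>_def mult.assoc[symmetric] by (simp only: times_divide_eq_right)
  qed
  have "mstar (fill l x) = fill l q"
    if q: "q \<in> X" and x: "\<forall>i\<in>I. \<bar>x i - q i\<bar> < \<rho>" for q x
  proof -
    let ?x = "fill l x" and ?s = "fill l"
    have xs: "?x \<in> space (Rn_borel l)" by (simp add: space_Rn fill_constraint_def)
    obtain q' where q': "q' \<in> X" "mstar ?x = ?s q'" using mstar_limit_point[OF xs] by blast
    have fillI: "?s y i = y i" if "i \<in> I" for y i using that by (auto simp: fill_constraint_def I_iff domIff)
    have "is_arg_min (\<lambda>s. L2_set (\<lambda>j. ?x j - s j) {1..l}) (\<lambda>s. s \<in> ?s ` X) (mstar ?x)"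
      using rule xs unfolding closest_point_rule_def limit_points_eq by blast
    hence "\<not> L2_set (\<lambda>j. ?x j - ?s q j) {1..l} < L2_set (\<lambda>j. ?x j - ?s q' j) {1..l}"
      unfolding q'(2) is_arg_min_def using q by blast
    moreover have "L2_set (\<lambda>j. ?x j - ?s q j) {1..l} \<le> real l * \<rho>"
    proof -
      have "\<bar>?x j - ?s q j\<bar> \<le> \<rho>" if j: "j \<in> {1..l}" for j
      proof (cases "j \<in> I")
        case True
        thus ?thesis using x fillI by (simp add: less_imp_le)
      next
        case False
        hence "?x j = ?s q j" using j by (auto simp: fill_constraint_def I_iff domIff)
        thus ?thesis using \<rho> by simp
      qed
      hence "(\<Sum>j\<in>{1..l}. \<bar>?x j - ?s q j\<bar>) \<le> real l * \<rho>"
        using sum_bounded_above[of "{1..l}" "\<lambda>j. \<bar>?x j - ?s q j\<bar>" \<rho>] by simp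
      thus ?thesis using L2_set_le_sum_abs[of "\<lambda>j. ?x j - ?s q j" "{1..l}"] by linarith
    qed
    ultimately have far: "L2_set (\<lambda>j. ?x j - ?s q' j) {1..l} \<le> real l * \<rho>" by linarith
    have "\<bar>q i - q' i\<bar> \<le> (real l + 1) * \<rho>" if i: "i \<in> I" for i
    proof -
      have "i \<in> {1..l}" using i by (auto simp: I_iff)
      hence "\<bar>?x i - ?s q' i\<bar> \<le> L2_set (\<lambda>j. \<bar>?x j - ?s q' j\<bar>) {1..l}" by (intro member_le_L2_set) auto
      also have "... = L2_set (\<lambda>j. ?x j - ?s q' j) {1..l}" by (simp add: L2_set_def)
      finally have "\<bar>x i - q' i\<bar> \<le> real l * \<rho>" using far i fillI by simp
      moreover have "\<bar>x i - q i\<bar> < \<rho>" using x i by blast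
      ultimately show ?thesis by (simp add: algebra_simps)
    qed
    hence "D q q' \<le> c * ((real l + 1) * \<rho>)"
      unfolding D_def c_def using sum_bounded_above[of I "\<lambda>i. \<bar>q i - q' i\<bar>" "(real l + 1) * \<rho>"] by simp
    also have "... < (c + 1) * ((real l + 1) * \<rho>)" using \<rho> by (intro mult_strict_right_mono mult_pos_pos) auto
    also have "... = sep" by (rule sepr[symmetric])
    finally have "\<not> sep \<le> D q q'" by simp
    hence "q = q'" using sepD[OF q q'(1)] by blast
    thus ?thesis using q' by simp
  qed
  thus ?thesis using \<rho> by blast
qed

text \<open>Once the selected limit point is fixed, the deviation is exactly linear in
  \<open>x - q\<close>. Constrained entries vanish since \<open>insert_zeros\<close> leaves zero
  rows there.\<close>

lemma T_near:
  "\<exists>\<rho>>0. \<forall>q\<in>X. \<forall>x. (\<forall>i\<in>I. \<bar>x i - q i\<bar> < \<rho>) \<longrightarrow> (\<forall>n. \<forall>i\<in>{1..l}. T n (fill l x) i =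
     (if i \<in> dom C then 0 else a n * (\<Sum>j\<in>I. Sg q i j * (x j - q j))))"
proof -
  obtain \<rho> where \<rho>: "\<rho> > 0" "\<And>q x. q \<in> X \<Longrightarrow> \<forall>i\<in>I. \<bar>x i - q i\<bar> < \<rho> \<Longrightarrow> mstar (fill l x) = fill l q"
    using near_selects by blast
  have "T n (fill l x) i = (if i \<in> dom C then 0 else a n * (\<Sum>j\<in>I. Sg q i j * (x j - q j)))"
    if q: "q \<in> X" and x: "\<forall>i\<in>I. \<bar>x i - q i\<bar> < \<rho>" and i: "i \<in> {1..l}" for q x n i
  proof -
    let ?s = "fill l"
    have r: "restrict (?s x) {1..l} = ?s x" by (simp add: fill_constraint_def)
    have T: "T n (?s x) i = a n * (\<Sum>j=1..l. Sg q i j * (?s x j - ?s q j))"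
      unfolding rescaled_deviation_def r \<rho>(2)[OF q x] mat_apply_def Sg_def using i by (simp add: Let_def)
    have "(\<Sum>j=1..l. Sg q i j * (?s x j - ?s q j)) = (\<Sum>j\<in>I. Sg q i j * (?s x j - ?s q j))"
      by (intro sum.mono_neutral_right) (auto simp: fill_constraint_def free_indices_def)
    also have "... = (\<Sum>j\<in>I. Sg q i j * (x j - q j))"
      by (intro sum.cong refl) (auto simp: fill_constraint_def I_iff domIff)
    finally have 1: "T n (?s x) i = a n * (\<Sum>j\<in>I. Sg q i j * (x j - q j))" using T by simp
    have "Sg q i j = 0" if "i \<in> dom C" "j \<in> I" for j
    proof -
      have "i - 1 < l" "j - 1 < l" "Suc (i - 1) = i" using i that(2) by (auto simp: I_iff)
      thus ?thesis using that(1) by (simp add: Sg_def Sigma_mat_def insert_zeros_def)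
    qed
    thus ?thesis using 1 by auto
  qed
  thus ?thesis using \<rho>(1) by blast
qed

lemma speed_top: "filterlim (\<lambda>n. real n / (a n)\<^sup>2) at_top sequentially"
  unfolding filterlim_at_top
proof (rule allI)
  fix Z :: real
  define c where "c = 1 / sqrt (\<bar>Z\<bar> + 1)"
  have c: "c > 0" "c\<^sup>2 = 1 / (\<bar>Z\<bar> + 1)" by (auto simp: c_def power_divide)
  have "\<forall>\<^sub>F n in sequentially. norm (a n) \<le> c * norm (sqrt (real n))"
    using landau_o.smallD[OF a_small c(1)] .
  moreover have "\<forall>\<^sub>F n in sequentially. a n \<ge> 1" using a_top by (simp add: filterlim_at_top)
  ultimately show "\<forall>\<^sub>F n in sequentially. Z \<le> real n / (a n)\<^sup>2"
  proof eventually_elim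
    case (elim n)
    have "(a n)\<^sup>2 \<le> (c * sqrt (real n))\<^sup>2" using elim by (intro power_mono) auto
    also have "... = real n / (\<bar>Z\<bar> + 1)" by (simp add: power_mult_distrib c(2))
    finally have "(\<bar>Z\<bar> + 1) * (a n)\<^sup>2 \<le> real n" by (simp add: field_simps)
    moreover have "(a n)\<^sup>2 > 0" using elim(2) by simp
    ultimately have "\<bar>Z\<bar> + 1 \<le> real n / (a n)\<^sup>2" by (simp add: field_simps)
    thus ?case by linarith
  qed
qed

lemma speed: "lap.speed_ok a"
  using a_top speed_top by (simp add: lap.speed_ok_def)

text \<open>Points far from all limit points are dealt with by \<open>prob_upper\<close>, so only
  those elements of \<open>\<Gamma>\<close> matter that \<open>T n\<close> attains near a limit
  point, and these have vanishing constrained entries.\<close>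

lemma law_upper:
  assumes "\<Gamma> \<in> sets (Rn_borel l)" "\<eta> > 0"
    and "\<And>z. z \<in> \<Gamma> \<Longrightarrow> \<forall>i\<in>dom C. z i = 0 \<Longrightarrow> r\<^sup>2 \<le> (\<Sum>i\<in>{1..l}. (z i)\<^sup>2)"
  shows "\<forall>\<^sub>F n in sequentially. emeasure (law n) \<Gamma> \<le> ennreal (exp (- (real n / (a n)\<^sup>2) * (r\<^sup>2 / 2 - \<eta>)))"
proof -
  obtain \<rho> where \<rho>: "\<rho> > 0" "\<And>q x n i. q \<in> X \<Longrightarrow> \<forall>i\<in>I. \<bar>x i - q i\<bar> < \<rho> \<Longrightarrow> i \<in> {1..l} \<Longrightarrow> T n (fill l x) i =
     (if i \<in> dom C then 0 else a n * (\<Sum>j\<in>I. Sg q i j * (x j - q j)))"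
    using T_near by blast
  define A where "A = (\<lambda>n. {x \<in> space (leb l). T n (fill l x) \<in> \<Gamma>})"
  have "\<forall>\<^sub>F n in sequentially. (\<integral>\<^sup>+x. indicator (A n) x * dens n x \<partial>leb l) / lap.mass n
     \<le> ennreal (exp (- (real n / (a n)\<^sup>2) * (r\<^sup>2 / 2 - \<eta>)))"
  proof (rule lap.prob_upper[OF speed assms(2) \<rho>(1)])
    show "x \<in> A n \<Longrightarrow> x \<in> space (leb l)" for n x by (simp add: A_def)
    fix n x q assume x: "x \<in> A n" and q: "q \<in> X" and near: "\<forall>i\<in>I. \<bar>x i - q i\<bar> < \<rho>"
    define z where "z = T n (fill l x)"
    have z: "z i = (if i \<in> dom C then 0 else a n * (\<Sum>j\<in>I. Sg q i j * (x j - q j)))" if "i \<in> {1..l}" for i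
      unfolding z_def by (rule \<rho>(2)[OF q near that])
    have "r\<^sup>2 \<le> (\<Sum>i\<in>{1..l}. (z i)\<^sup>2)"
    proof (rule assms(3))
      show "z \<in> \<Gamma>" using x by (simp add: A_def z_def)
      show "\<forall>i\<in>dom C. z i = 0"
      proof
        fix i assume i: "i \<in> dom C"
        hence "i \<in> {1..l}" using dom_range[OF i] l_ge by simp
        thus "z i = 0" using z i by simp
      qed
    qed
    also have "... = (\<Sum>i\<in>I. (z i)\<^sup>2)"
      using z by (intro sum.mono_neutral_right) (auto simp: free_indices_def)
    also have "... = (\<Sum>i\<in>I. (a n)\<^sup>2 * (\<Sum>j\<in>I. Sg q i j * (x j - q j))\<^sup>2)"
      using z by (intro sum.cong refl) (auto simp: I_iff power_mult_distrib)
    also have "... = (a n)\<^sup>2 * QQ q (\<lambda>i. x i - q i)" by (simp add: QQ_def sum_distrib_left)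
    finally show "r\<^sup>2 \<le> (a n)\<^sup>2 * QQ q (\<lambda>i. x i - q i)" .
  qed
  thus ?thesis using eventually_law
  proof eventually_elim
    case (elim n)
    thus ?case using emeasure_law[of n \<Gamma>] assms(1) by (simp add: A_def)
  qed
qed

text \<open>A single limit point \<open>q\<close> suffices. Solving for \<open>\<zeta>\<close> with
  image \<open>z\<close> under the normalizing matrix turns a box around \<open>z\<close> into a box
  around \<open>\<zeta>\<close> in unnormalized deviations.\<close>

lemma law_lower:
  assumes "\<Gamma> \<in> sets (Rn_borel l)" "\<eta> > 0" "e > 0" and z: "\<forall>i\<in>dom C. z i = 0"
    and box: "\<And>y. y \<in> PiE {1..l} (\<lambda>_. UNIV) \<Longrightarrow> \<forall>i\<in>{1..l}. \<bar>y i - z i\<bar> < e \<Longrightarrow> y \<in> \<Gamma>"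
  shows "\<forall>\<^sub>F n in sequentially. ennreal (exp (- (real n / (a n)\<^sup>2) * ((\<Sum>i\<in>{1..l}. (z i)\<^sup>2) / 2 + \<eta>))) \<le> emeasure (law n) \<Gamma>"
proof -
  obtain \<rho> where \<rho>: "\<rho> > 0" "\<And>q x n i. q \<in> X \<Longrightarrow> \<forall>i\<in>I. \<bar>x i - q i\<bar> < \<rho> \<Longrightarrow> i \<in> {1..l} \<Longrightarrow> T n (fill l x) i =
     (if i \<in> dom C then 0 else a n * (\<Sum>j\<in>I. Sg q i j * (x j - q j)))"
    using T_near by blast
  obtain q where q: "q \<in> X" using X_ne by blast
  obtain \<zeta> where \<zeta>: "\<And>i. i \<in> I \<Longrightarrow> (\<Sum>j\<in>I. Sg q i j * \<zeta> j) = z i" using Sg_surjective[OF q, of z] by blast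
  have Qz: "QQ q \<zeta> = (\<Sum>i\<in>{1..l}. (z i)\<^sup>2)"
  proof -
    have "QQ q \<zeta> = (\<Sum>i\<in>I. (z i)\<^sup>2)" unfolding QQ_def using \<zeta> by (intro sum.cong refl) simp
    also have "... = (\<Sum>i\<in>{1..l}. (z i)\<^sup>2)"
      using z by (intro sum.mono_neutral_left) (auto simp: free_indices_def)
    finally show ?thesis .
  qed
  define A where "A = (\<lambda>n. {x \<in> space (leb l). T n (fill l x) \<in> \<Gamma>})"
  define Bx where "Bx = (\<lambda>\<delta> n. {x\<in>space (leb l). \<forall>i\<in>I. \<bar>a n * (x i - q i) - \<zeta> i\<bar> \<le> \<delta>})"
  obtain \<delta>0 where \<delta>0: "\<delta>0 > 0" "\<And>\<delta>. 0 < \<delta> \<Longrightarrow> \<delta> \<le> \<delta>0 \<Longrightarrow> (\<forall>\<^sub>F n in sequentially.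
    ennreal (exp (- (real n / (a n)\<^sup>2) * (QQ q \<zeta> / 2 + \<eta>)))
     \<le> (\<integral>\<^sup>+x. indicator (Bx \<delta> n) x * dens n x \<partial>leb l) / lap.mass n)"
    using lap.prob_lower[OF speed assms(2) q, of \<zeta>] unfolding Bx_def by blast
  define B where "B = (\<Sum>i\<in>I. \<Sum>j\<in>I. \<bar>Sg q i j\<bar>)"
  have B: "B \<ge> 0" by (auto simp: B_def intro!: sum_nonneg)
  \<comment> \<open>A deviation within \<open>\<delta>\<close> of \<open>\<zeta>\<close> has an
    image within \<open>\<delta> * B < e\<close> of \<open>z\<close>.\<close>
  define \<delta> where "\<delta> = min \<delta>0 (e / (2 * (B + 1)))"
  have \<delta>: "\<delta> > 0" "\<delta> \<le> \<delta>0" using \<delta>0(1) assms(3) B by (auto simp: \<delta>_def)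
  have "\<delta> * B < e"
  proof -
    have "\<delta> * B \<le> e / (2 * (B + 1)) * (B + 1)" using B assms(3) by (intro mult_mono) (auto simp: \<delta>_def)
    also have "... = e / 2"
    proof -
      define R where "R = B + 1"
      have "R > 0" using B by (simp add: R_def)
      thus ?thesis unfolding R_def[symmetric] by simp
    qed
    finally show ?thesis using assms(3) by simp
  qed
  define s where "s = (\<Sum>i\<in>I. \<bar>\<zeta> i\<bar>)"
  have s: "s \<ge> 0" "\<And>i. i \<in> I \<Longrightarrow> \<bar>\<zeta> i\<bar> \<le> s"
    by (auto simp: s_def intro!: sum_nonneg member_le_sum)
  have sub: "Bx \<delta> n \<subseteq> A n" if an: "a n > (s + \<delta>) / \<rho>" "a n > 0" for n
  proof
    fix x assume x: "x \<in> Bx \<delta> n"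
    hence xS: "x \<in> space (leb l)" and xb: "\<And>i. i \<in> I \<Longrightarrow> \<bar>a n * (x i - q i) - \<zeta> i\<bar> \<le> \<delta>" by (auto simp: Bx_def)
    have near: "\<forall>i\<in>I. \<bar>x i - q i\<bar> < \<rho>"
    proof
      fix i assume i: "i \<in> I"
      have "a n * \<bar>x i - q i\<bar> = \<bar>a n * (x i - q i)\<bar>" using an(2) by (simp add: abs_mult)
      also have "... \<le> \<delta> + s" using xb[OF i] s(2)[OF i] by linarith
      also have "... < a n * \<rho>" using an(1) \<rho>(1) by (simp add: field_simps)
      finally show "\<bar>x i - q i\<bar> < \<rho>" using an(2) by simp
    qed
    have "T n (fill l x) \<in> \<Gamma>"
    proof (rule box)
      show "T n (fill l x) \<in> PiE {1..l} (\<lambda>_. UNIV)" by (simp add: rescaled_deviation_def Let_def)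
      show "\<forall>i\<in>{1..l}. \<bar>T n (fill l x) i - z i\<bar> < e"
      proof
        fix i assume i: "i \<in> {1..l}"
        note Ti = \<rho>(2)[OF q near i, of n]
        show "\<bar>T n (fill l x) i - z i\<bar> < e"
        proof (cases "i \<in> dom C")
          case True
          thus ?thesis using Ti z assms(3) by simp
        next
          case False
          hence iI: "i \<in> I" using i by (auto simp: I_iff)
          have "T n (fill l x) i - z i = a n * (\<Sum>j\<in>I. Sg q i j * (x j - q j)) - (\<Sum>j\<in>I. Sg q i j * \<zeta> j)"
            using Ti False \<zeta>[OF iI] by simp
          also have "... = (\<Sum>j\<in>I. a n * (Sg q i j * (x j - q j)) - Sg q i j * \<zeta> j)"
            by (simp only: sum_distrib_left sum_subtractf)
          also have "... = (\<Sum>j\<in>I. Sg q i j * (a n * (x j - q j) - \<zeta> j))"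
            by (intro sum.cong refl) (simp add: algebra_simps)
          also have "\<bar>...\<bar> \<le> (\<Sum>j\<in>I. \<bar>Sg q i j\<bar> * \<delta>)"
            by (rule order_trans[OF sum_abs]) (use xb in "auto simp: abs_mult intro!: sum_mono mult_left_mono")
          also have "... = (\<Sum>j\<in>I. \<bar>Sg q i j\<bar>) * \<delta>" by (simp add: sum_distrib_right)
          also have "... \<le> B * \<delta>"
            unfolding B_def using \<delta>(1) iI
            by (intro mult_right_mono member_le_sum[of i I "\<lambda>i. \<Sum>j\<in>I. \<bar>Sg q i j\<bar>"]) (auto intro: sum_nonneg)
          finally show ?thesis using \<open>\<delta> * B < e\<close> by (simp add: mult.commute)
        qed
      qed
    qed
    thus "x \<in> A n" using xS by (simp add: A_def)
  qed
  have "\<forall>\<^sub>F n in sequentially. a n > (s + \<delta>) / \<rho>" "\<forall>\<^sub>F n in sequentially. a n > 0"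
    using a_top by (auto simp: filterlim_at_top_dense)
  with eventually_law \<delta>0(2)[OF \<delta>] show ?thesis
  proof eventually_elim
    case (elim n)
    have "(\<integral>\<^sup>+x. indicator (Bx \<delta> n) x * dens n x \<partial>leb l) \<le> (\<integral>\<^sup>+x. indicator (A n) x * dens n x \<partial>leb l)"
      using sub elim by (intro nn_integral_mono mult_right_mono) (auto simp: indicator_def)
    hence "(\<integral>\<^sup>+x. indicator (Bx \<delta> n) x * dens n x \<partial>leb l) / lap.mass n
        \<le> (\<integral>\<^sup>+x. indicator (A n) x * dens n x \<partial>leb l) / lap.mass n" by (rule divide_right_mono_ennreal)
    with elim(2) show ?case using emeasure_law[of n \<Gamma>] assms(1) elim(1) unfolding Qz A_def by simp
  qed
qed

section \<open>The two large deviations bounds\<close>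

lemma gaussian_rate_sum:
  "\<forall>i\<in>dom C. z i = 0 \<Longrightarrow> gaussian_rate C l z = ereal ((\<Sum>i\<in>{1..l}. (z i)\<^sup>2) / 2)"
  by (simp add: gaussian_rate_def L2_set_def sum_nonneg)

lemma gaussian_rate_nonneg: "0 \<le> gaussian_rate C l z"
  by (simp add: gaussian_rate_def)

lemma eventually_speed_pos: "\<forall>\<^sub>F n in sequentially. real n / (a n)\<^sup>2 > 0"
  using speed_top by (simp add: filterlim_at_top_dense)

text \<open>If the rate is at least \<open>t\<close> on the closure, every relevant point of
  \<open>\<Gamma>\<close> lies outside the ball of squared radius \<open>2 * t\<close>, and the
  probability of that complement already has the right order; neither closedness nor compactness is
  exploited further.\<close>

lemma ldp_upper:
  assumes "\<Gamma> \<in> sets (Rn_borel l)"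
  shows "limsup (\<lambda>n. ereal (1 / (real n / (a n)\<^sup>2)) * log_prob (law n) \<Gamma>) \<le> - (INF x\<in>Rn_top l closure_of \<Gamma>. gaussian_rate C l x)"
    (is "?ls \<le> - ?S")
proof -
  have S0: "0 \<le> ?S" by (intro INF_greatest gaussian_rate_nonneg)
  have key: "ereal t \<le> - ?ls" if t: "0 \<le> t" "ereal t \<le> ?S" for t
  proof (rule ereal_le_epsilon2)
    fix \<eta> :: real assume \<eta>: "\<eta> > 0"
    define r where "r = sqrt (2 * t)"
    have r: "r\<^sup>2 / 2 = t" using t(1) by (simp add: r_def)
    have "\<forall>\<^sub>F n in sequentially. emeasure (law n) \<Gamma> \<le> ennreal (exp (- (real n / (a n)\<^sup>2) * (r\<^sup>2 / 2 - \<eta>)))"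
    proof (rule law_upper[OF assms \<eta>])
      fix z assume z: "z \<in> \<Gamma>" "\<forall>i\<in>dom C. z i = 0"
      have "\<Gamma> \<subseteq> topspace (Rn_top l)" using sets.sets_into_space[OF assms] by (simp add: space_Rn topspace_Rn_top)
      hence "z \<in> Rn_top l closure_of \<Gamma>" using closure_of_subset z(1) by blast
      hence "?S \<le> gaussian_rate C l z" by (rule INF_lower)
      with t(2) have "ereal t \<le> ereal ((\<Sum>i\<in>{1..l}. (z i)\<^sup>2) / 2)"
        unfolding gaussian_rate_sum[OF z(2)] by (rule order_trans)
      thus "r\<^sup>2 \<le> (\<Sum>i\<in>{1..l}. (z i)\<^sup>2)" using r by simp
    qed
    hence "\<forall>\<^sub>F n in sequentially. ereal (1 / (real n / (a n)\<^sup>2)) * log_prob (law n) \<Gamma> \<le> ereal (\<eta> - t)"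
      using eventually_speed_pos
    proof eventually_elim
      case (elim n)
      define b where "b = real n / (a n)\<^sup>2"
      have b: "b > 0" using elim(2) by (simp add: b_def)
      have "log_prob (law n) \<Gamma> \<le> ereal (- b * (t - \<eta>))" using log_prob_le[OF elim(1)] by (simp add: r b_def)
      hence "ereal (1 / b) * log_prob (law n) \<Gamma> \<le> ereal (1 / b) * ereal (- b * (t - \<eta>))"
        using b by (intro ereal_mult_left_mono) auto
      also have "... = ereal (\<eta> - t)" using b by simp
      finally show ?case unfolding b_def .
    qed
    hence "?ls \<le> ereal (\<eta> - t)" by (rule Limsup_bounded)
    thus "ereal t \<le> - ?ls + ereal \<eta>" by (cases ?ls) auto
  qed
  have "?S \<le> - ?ls"
  \<comment> \<open>The infimum may be infinite, so it is approached by finite values; negative ones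
    are replaced by \<open>0\<close>, because \<open>key\<close> takes a square root.\<close>
  proof (rule dense_le)
    fix x assume x: "x < ?S"
    show "x \<le> - ?ls"
    proof (cases x)
      case (real t)
      have "ereal (max t 0) \<le> ?S" using less_imp_le[OF x] S0 unfolding real by (cases "t \<le> 0") (simp_all add: zero_ereal_def)
      hence "ereal (max t 0) \<le> - ?ls" by (intro key) auto
      thus ?thesis using real by (auto intro: order_trans[of _ "ereal (max t 0)"])
    qed (use x in auto)
  qed
  thus ?thesis using ereal_minus_le_minus[of "- ?ls" ?S] by simp
qed

text \<open>It suffices to treat one interior point at a time. Where a constrained entry is nonzero
  the rate is infinite and nothing is to be shown; otherwise a box around the point lies in
  \<open>\<Gamma>\<close>.\<close>

lemma ldp_lower:
  assumes "\<Gamma> \<in> sets (Rn_borel l)"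
  shows "- (INF x\<in>Rn_top l interior_of \<Gamma>. gaussian_rate C l x) \<le> liminf (\<lambda>n. ereal (1 / (real n / (a n)\<^sup>2)) * log_prob (law n) \<Gamma>)"
    (is "- ?S \<le> ?li")
proof -
  have "- ?li \<le> gaussian_rate C l z" if z: "z \<in> Rn_top l interior_of \<Gamma>" for z
  proof (cases "\<forall>i\<in>dom C. z i = 0")
    case True
    define t where "t = (\<Sum>i\<in>{1..l}. (z i)\<^sup>2) / 2"
    obtain e where e: "e > 0" "\<And>y. y \<in> PiE {1..l} (\<lambda>_. UNIV) \<Longrightarrow> \<forall>i\<in>{1..l}. \<bar>y i - z i\<bar> < e \<Longrightarrow> y \<in> Rn_top l interior_of \<Gamma>"
      using openin_box[OF openin_interior_of z] by blast
    have "- ?li \<le> ereal t"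
    proof (rule ereal_le_epsilon2)
      fix \<eta> :: real assume \<eta>: "\<eta> > 0"
      have "\<forall>\<^sub>F n in sequentially. ennreal (exp (- (real n / (a n)\<^sup>2) * (t + \<eta>))) \<le> emeasure (law n) \<Gamma>"
        unfolding t_def
      proof (rule law_lower[OF assms \<eta> e(1) True])
        fix y assume "y \<in> PiE {1..l} (\<lambda>_. UNIV)" "\<forall>i\<in>{1..l}. \<bar>y i - z i\<bar> < e"
        thus "y \<in> \<Gamma>" using e(2) interior_of_subset[of "Rn_top l" \<Gamma>] by blast
      qed
      hence "\<forall>\<^sub>F n in sequentially. ereal (- (t + \<eta>)) \<le> ereal (1 / (real n / (a n)\<^sup>2)) * log_prob (law n) \<Gamma>"
        using eventually_speed_pos prob_space_law
      proof eventually_elim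
        case (elim n)
        define b where "b = real n / (a n)\<^sup>2"
        have b: "b > 0" using elim(2) by (simp add: b_def)
        have "ereal (- b * (t + \<eta>)) \<le> log_prob (law n) \<Gamma>" using log_prob_ge[OF elim(3,1)] by (simp add: b_def)
        hence "ereal (1 / b) * ereal (- b * (t + \<eta>)) \<le> ereal (1 / b) * log_prob (law n) \<Gamma>"
          using b by (intro ereal_mult_left_mono) auto
        moreover have "ereal (1 / b) * ereal (- b * (t + \<eta>)) = ereal (- (t + \<eta>))" using b by (simp add: field_simps)
        ultimately show ?case unfolding b_def by simp
      qed
      hence "ereal (- (t + \<eta>)) \<le> ?li" by (rule Liminf_bounded)
      thus "- ?li \<le> ereal t + ereal \<eta>" by (cases ?li) auto
    qed
    thus ?thesis using gaussian_rate_sum[OF True] by (simp add: t_def)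
  next
    case False
    hence "gaussian_rate C l z = \<infinity>" unfolding gaussian_rate_def by (rule if_not_P)
    thus ?thesis by simp
  qed
  hence "- ?li \<le> ?S" by (rule INF_greatest)
  thus ?thesis by (simp add: ereal_uminus_le_reorder)
qed

lemma gaussian_rate_closed: "closedin (Rn_top l) {x \<in> topspace (Rn_top l). gaussian_rate C l x \<le> c}"
proof (cases c)
  case (real r)
  have "Hausdorff_space (Rn_top l)" unfolding Rn_top_def by (simp add: Hausdorff_space_product_topology)
  thus ?thesis unfolding real by (rule compactin_imp_closedin[OF _ gaussian_rate_sublevel[OF constr l_ge]])
next
  case MInf
  hence "{x \<in> topspace (Rn_top l). gaussian_rate C l x \<le> c} = {}"
    using gaussian_rate_nonneg by (auto simp: gaussian_rate_def)
  thus ?thesis by (simp only: closedin_empty)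
qed simp

end

theorem theorem3p10:
  fixes E :: interval_kind
    and C :: moment_constraint
    and V :: "nat \<Rightarrow> real \<Rightarrow> real"
    and l :: nat
    and a :: "nat \<Rightarrow> real"
    and mstar :: "(nat \<Rightarrow> real) \<Rightarrow> nat \<Rightarrow> real"
  assumes "admissible E C"
    and "generic E C V"
    and "l \<ge> last_index C" and "l \<ge> 1"
    and "filterlim a at_top sequentially"
    and "a \<in> o(\<lambda>n. sqrt (real n))"
    and "closest_point_rule l (limit_points E C V l) mstar"
  shows "large_deviations (Rn_top l) (Rn_borel l)
           (\<lambda>n. distr (moment_law E C V n) (Rn_borel l) (rescaled_deviation E C V l a mstar n))
           (\<lambda>n. real n / (a n)\<^sup>2) (gaussian_rate C l)
         \<and> good_rate_function (Rn_top l) (gaussian_rate C l)"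
proof -
  interpret deviation_setting E C V l a mstar by unfold_locales (fact assms)+
  show ?thesis
    unfolding large_deviations_def good_rate_function_def
    using prob_space_law speed_top gaussian_rate_nonneg gaussian_rate_closed ldp_lower ldp_upper
      gaussian_rate_sublevel[OF constr l_ge] by simp
qed

end
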